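(* Let $N\ge 1$ be an integer, let $\Omega\subset\mathbb{R}^N$ be an open bounded set with Lipschitz boundary, and let $A:\mathbb{R}^N\to\mathbb{R}^N$ be a measurable, locally bounded vector field with $A\in C^2(\overline{\Omega})$. Then, for every $u\in H^1_A(\Omega)$, $$\lim_{s\nearrow 1}(1-s)\int_{\Omega}\int_{\Omega}\frac{\big|u(x)-e^{\mathrm{i}(x-y)\cdot A\left(\frac{x+y}{2}\right)}u(y)\big|^2}{|x-y|^{N+2s}}\,dx\,dy=K_N\int_{\Omega}|\nabla u-\mathrm{i}A(x)u|^2\,dx,$$ where $$K_N=\frac12\int_{\mathbb{S}^{N-1}}|\omega\cdot\mathbf{e}|^2\,d\mathcal{H}^{N-1}(\omega),$$ $\mathbb{S}^{N-1}$ is the unit sphere of $\mathbb{R}^N$ and $\mathbf{e}$ is any unit vector in $\mathbb{R}^N$.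
   Context: $\mathrm{i}$ is the imaginary unit and $\mathcal{H}^{N-1}$ is the $(N-1)$-dimensional Hausdorff measure. The limit is over $s\in(0,1)$, $s\to1$. $A\in C^2(\overline\Omega)$ means that the restriction of $A$ to $\Omega$ is of class $C^2$ with all derivatives of order at most 2 extending continuously to $\overline\Omega$ (with the extension of $A$ itself agreeing with $A$ on $\overline{\Omega}$). $L^2(\Omega,\mathbb{C})$ is the space of complex-valued square-integrable functions on $\Omega$. Set $[u]_{H^1_A(\Omega)}:=\big(\int_\Omega|\nabla u-\mathrm{i}A(x)u|^2dx\big)^{1/2}$, with $\nabla u$ the weak gradient; $H^1_A(\Omega)$ is the space of $u\in L^2(\Omega,\mathbb{C})$ with $[u]_{H^1_A(\Omega)}<\infty$, endowed with the norm $\|u\|_{H^1_A(\Omega)}:=\big(\|u\|_{L^2(\Omega)}^2+[u]_{H^1_A(\Omega)}^2\big)^{1/2}$. *)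

theory Defs
  imports "HOL-Analysis.Analysis"
begin

section \<open>Hausdorff measure\<close>

text \<open>
  The normalisation by the volume of the unit ball of dimension \<open>d\<close> makes the \<open>d\<close>-dimensional
  Hausdorff measure agree with Lebesgue measure on \<open>d\<close>-dimensional Euclidean space. The empty set
  is treated separately because \<open>0 ^ 0 = 1\<close>; thus for \<open>d = 0\<close> one obtains counting measure.
\<close>

definition hausdorff_weight :: "nat \<Rightarrow> 'a::metric_space set \<Rightarrow> ennreal" where
  "hausdorff_weight d E =
     (if E = {} then 0 else ennreal (unit_ball_vol (real d) * (diameter E / 2) ^ d))"

definition hausdorff_pre :: "nat \<Rightarrow> real \<Rightarrow> 'a::metric_space set \<Rightarrow> ennreal" where
  "hausdorff_pre d \<delta> S =
     (INF C \<in> {C :: nat \<Rightarrow> 'a set. S \<subseteq> (\<Union>i. C i) \<and> (\<forall>i. bounded (C i) \<and> diameter (C i) \<le> \<delta>)}.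
        \<Sum>i. hausdorff_weight d (C i))"

definition hausdorff_outer :: "nat \<Rightarrow> 'a::metric_space set \<Rightarrow> ennreal" where
  "hausdorff_outer d S = (SUP \<delta> \<in> {0<..}. hausdorff_pre d \<delta> S)"

text \<open>
  The outer measure is a metric outer measure, hence countably additive on the Borel sets by
  Caratheodory's criterion; so \<^const>\<open>measure_of\<close> does not fall back to the zero measure here.
\<close>

definition hausdorff_measure :: "nat \<Rightarrow> 'a::metric_space measure" where
  "hausdorff_measure d = measure_of UNIV (sets borel) (hausdorff_outer d)"


section \<open>Regularity of the domain and of the vector field\<close>

text \<open>
  Near each boundary point the set lies strictly on one side of the graph of a Lipschitz function,
  after a rigid change of coordinates: \<open>x \<bullet> \<nu>\<close> is the last coordinate of \<open>x\<close>, and its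
  projection \<open>x - (x \<bullet> \<nu>) *\<^sub>R \<nu>\<close> to the hyperplane orthogonal to \<open>\<nu>\<close> stands for the remaining
  ones.
\<close>

definition lipschitz_boundary :: "'a::euclidean_space set \<Rightarrow> bool" where
  "lipschitz_boundary \<Omega> \<longleftrightarrow>
     (\<forall>p \<in> frontier \<Omega>. \<exists>r > 0. \<exists>\<nu> L \<gamma>.
        norm \<nu> = 1 \<and> L-lipschitz_on {y. y \<bullet> \<nu> = 0} \<gamma> \<and>
        \<Omega> \<inter> ball p r = {x \<in> ball p r. \<gamma> (x - (x \<bullet> \<nu>) *\<^sub>R \<nu>) < x \<bullet> \<nu>})"

definition locally_bounded :: "('a::metric_space \<Rightarrow> 'b::metric_space) \<Rightarrow> bool" where
  "locally_bounded f \<longleftrightarrow> (\<forall>K. compact K \<longrightarrow> bounded (f ` K))"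

text \<open>
  \<open>DA\<close> and \<open>D2A\<close> are the continuous extensions to the closure of the first and second Frechet
  derivatives of \<open>A\<close> on the open set \<open>\<Omega>\<close>.
\<close>

definition C2_closure ::
    "'a::euclidean_space set \<Rightarrow> ('a \<Rightarrow> 'b::euclidean_space) \<Rightarrow> bool" where
  "C2_closure \<Omega> A \<longleftrightarrow>
     continuous_on (closure \<Omega>) A \<and>
     (\<exists>(DA :: 'a \<Rightarrow> 'a \<Rightarrow>\<^sub>L 'b) (D2A :: 'a \<Rightarrow> 'a \<Rightarrow>\<^sub>L ('a \<Rightarrow>\<^sub>L 'b)).
        continuous_on (closure \<Omega>) DA \<and> continuous_on (closure \<Omega>) D2A \<and>
        (\<forall>x \<in> \<Omega>. (A has_derivative blinfun_apply (DA x)) (at x) \<and>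
                 (DA has_derivative blinfun_apply (D2A x)) (at x)))"


section \<open>Weak gradients and the magnetic Sobolev space\<close>

definition partial_deriv :: "'n::finite \<Rightarrow> (real^'n \<Rightarrow> real) \<Rightarrow> real^'n \<Rightarrow> real" where
  "partial_deriv j f x = frechet_derivative f (at x) (axis j 1)"

primrec Ck_fun :: "nat \<Rightarrow> (real^'n::finite \<Rightarrow> real) \<Rightarrow> bool" where
  "Ck_fun 0 f \<longleftrightarrow> continuous_on UNIV f"
| "Ck_fun (Suc k) f \<longleftrightarrow> (\<forall>x. f differentiable (at x)) \<and> (\<forall>j. Ck_fun k (partial_deriv j f))"

definition test_function :: "(real^'n::finite) set \<Rightarrow> (real^'n \<Rightarrow> real) \<Rightarrow> bool" where
  "test_function \<Omega> \<phi> \<longleftrightarrow>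
     (\<forall>k. Ck_fun k \<phi>) \<and> compact (closure {x. \<phi> x \<noteq> 0}) \<and> closure {x. \<phi> x \<noteq> 0} \<subseteq> \<Omega>"

definition locally_integrable ::
    "'a::euclidean_space set \<Rightarrow> ('a \<Rightarrow> 'b::euclidean_space) \<Rightarrow> bool" where
  "locally_integrable \<Omega> f \<longleftrightarrow> (\<forall>K. compact K \<and> K \<subseteq> \<Omega> \<longrightarrow> integrable (lebesgue_on K) f)"

definition has_weak_gradient ::
    "(real^'n::finite) set \<Rightarrow> (real^'n \<Rightarrow> complex) \<Rightarrow> (real^'n \<Rightarrow> complex^'n) \<Rightarrow> bool" where
  "has_weak_gradient \<Omega> u g \<longleftrightarrow>
     locally_integrable \<Omega> u \<and> locally_integrable \<Omega> g \<and>
     (\<forall>\<phi> j. test_function \<Omega> \<phi> \<longrightarrow>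
        (LINT x|lebesgue_on \<Omega>. partial_deriv j \<phi> x *\<^sub>R u x) =
        - (LINT x|lebesgue_on \<Omega>. \<phi> x *\<^sub>R (g x $ j)))"

text \<open>Unique up to null sets when it exists.\<close>

definition weak_gradient ::
    "(real^'n::finite) set \<Rightarrow> (real^'n \<Rightarrow> complex) \<Rightarrow> real^'n \<Rightarrow> complex^'n" where
  "weak_gradient \<Omega> u = (SOME g. has_weak_gradient \<Omega> u g)"

definition magnetic_gradient ::
    "(real^'n::finite) set \<Rightarrow> (real^'n \<Rightarrow> real^'n) \<Rightarrow> (real^'n \<Rightarrow> complex) \<Rightarrow> real^'n \<Rightarrow> complex^'n" where
  "magnetic_gradient \<Omega> A u x =
     weak_gradient \<Omega> u x - (\<chi> j. \<i> * complex_of_real (A x $ j) * u x)"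

text \<open>
  Elements are functions on the whole space, but only their values on \<open>\<Omega>\<close> matter; functions
  equal almost everywhere on \<open>\<Omega>\<close> are not identified.
\<close>

definition H1A ::
    "(real^'n::finite) set \<Rightarrow> (real^'n \<Rightarrow> real^'n) \<Rightarrow> (real^'n \<Rightarrow> complex) set" where
  "H1A \<Omega> A =
     {u. u \<in> borel_measurable (lebesgue_on \<Omega>) \<and>
         integrable (lebesgue_on \<Omega>) (\<lambda>x. (norm (u x))\<^sup>2) \<and>
         (\<exists>g. has_weak_gradient \<Omega> u g) \<and>
         (\<integral>\<^sup>+x. ennreal ((norm (magnetic_gradient \<Omega> A u x))\<^sup>2) \<partial>lebesgue_on \<Omega>) < \<infinity>}"

end

theory Submission
  imports Defs
begin

text \<open>
  Write \<open>D h y = u (y + h) - exp (\<i> h \<bullet> A (y + h / 2)) u y\<close> and let \<open>G h\<close> be the integral of \<open>\<bar>D h\<bar>\<^sup>2\<close> over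
  the points \<open>y\<close> for which \<open>y\<close> and \<open>y + h\<close> lie in \<open>\<Omega>\<close>. Substituting \<open>x = y + h\<close> turns the double
  integral into the integral of \<open>G h / \<bar>h\<bar> powr (N + 2 s)\<close>. Let \<open>Q h\<close> be the integral of the squared
  modulus of \<open>h \<bullet> (\<nabla>u - \<i> A u)\<close> over \<open>\<Omega>\<close>. Up to a factor close to 1, \<open>G h\<close> and \<open>Q h\<close> differ by
  \<open>o(\<bar>h\<bar>\<^sup>2)\<close>: away from the boundary because \<open>u (y + h) - u y\<close> is the integral of the weak gradient
  along a segment and translations are continuous in \<open>L\<^sup>2\<close>; near the boundary because the Lipschitz
  condition joins \<open>y\<close> to \<open>y + h\<close> by three segments inside \<open>\<Omega>\<close> of length comparable to \<open>\<bar>h\<bar>\<close>, so that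
  the contribution of a boundary layer is controlled by the energy in a slightly larger one.

  By rotation invariance, \<open>(1 - s)\<close> times the integral of \<open>Q h / \<bar>h\<bar> powr (N + 2 s)\<close> over a ball of radius
  \<open>\<delta>\<close> is \<open>\<omega> \<delta> powr (2 - 2 s) / 2\<close> times the magnetic energy, \<open>\<omega>\<close> being the volume of the unit ball,
  while the part \<open>\<bar>h\<bar> \<ge> \<delta>\<close> contributes nothing in the limit. The constant is the right one because the
  sphere has Hausdorff measure \<open>N \<omega>\<close>: an isodiametric inequality in cylinders bounds the volume of
  a thin shell over each piece of a cover, which gives the lower bound, and Vitali's covering theorem,
  applied to small caps, gives the upper bound.
\<close>

section \<open>Midpoint sets and an isodiametric inequality\<close>

text \<open>Hausdorff measure charges a set by its diameter, but a set of diameter \<open>d\<close>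
  need not lie in a ball of that diameter. The sharp lower bound for the sphere therefore needs an
  isodiametric inequality. It comes from the symmetrisation \<open>(X - X) / 2\<close>, which does
  not lose volume, by a Brunn-Minkowski inequality for midpoint sets proved first for finite unions
  of boxes. Cylinders fit a thin shell piece: the diameter bounds \<open>N - 1\<close> directions,
  the thickness the remaining one.

  The dimension enters twice and cancels: the sphere has measure \<open>N \<omega>\<close>, and
  averaging the square of one coordinate over rotations divides by \<open>N\<close>. So the sphere
  integral is \<open>\<omega>\<close>, and the constant is half of it.

  Near 0 the kernel has a second moment of order \<open>1 / (1 - s)\<close>, so an error survives
  the limit unless it is small relative to the squared increment. The segment formula for
  \<open>u\<close> is obtained by duality from bumps, for each fixed increment and almost every
  starting point. Near the frontier no convergence is shown: there the difference and its
  linearisation are separately dominated by the energy in a thin layer.\<close>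

definition box_union :: "nat \<Rightarrow> 'a::euclidean_space set \<Rightarrow> bool" where
  "box_union n S \<longleftrightarrow> (\<exists>\<A>. finite \<A> \<and> card \<A> \<le> n \<and> disjoint \<A> \<and>
     (\<forall>B\<in>\<A>. B \<noteq> {} \<and> (\<exists>a b. B = box a b)) \<and> S = \<Union>\<A>)"

definition midpoints :: "'a::real_vector set \<Rightarrow> 'a set \<Rightarrow> 'a set" where
  "midpoints S T = (\<lambda>(x, y). (1/2) *\<^sub>R (x + y)) ` (S \<times> T)"

lemma midpoints_commute: "midpoints S T = midpoints T S"
  unfolding midpoints_def by (auto simp: image_iff add.commute) (metis add.commute)+

lemma open_midpoints:
  fixes S :: "'a::real_normed_vector set"
  assumes "open S" shows "open (midpoints S T)"
proof -
  have "midpoints S T = (\<Union>y\<in>T. (\<lambda>x. (1/2) *\<^sub>R x) ` ((\<lambda>x. y + x) ` S))"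
    by (force simp: midpoints_def image_iff add.commute)
  then show ?thesis
    using assms by (auto intro!: open_UN open_scaling open_translation)
qed

lemma bounded_midpoints:
  fixes S :: "'a::real_normed_vector set"
  assumes "bounded S" "bounded T" shows "bounded (midpoints S T)"
proof -
  have "bounded ((\<lambda>p. (1/2) *\<^sub>R (fst p + snd p)) ` (S \<times> T))"
    by (intro bounded_scaleR_comp bounded_plus_comp)
      (use bounded_fst[OF bounded_Times[OF assms]] bounded_snd[OF bounded_Times[OF assms]] in auto)
  then show ?thesis by (simp add: midpoints_def case_prod_beta)
qed

lemma box_unionD:
  assumes "box_union n S" shows "open S" "bounded S"
proof -
  obtain \<A> where \<A>: "finite \<A>" "\<And>B. B\<in>\<A> \<Longrightarrow> \<exists>a b. B = box a b" "S = \<Union>\<A>"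
    using assms(1) unfolding box_union_def by blast
  have "open B" "bounded B" if "B \<in> \<A>" for B
    using \<A>(2)[OF that] bounded_box by auto
  then show "open S" "bounded S" using \<A>(1,3) by auto
qed

lemma box_Int_less:
  fixes a b :: "'a::euclidean_space"
  assumes i: "i \<in> Basis"
  shows "box a b \<inter> {x. x \<bullet> i < c} = box a (b + (min (b \<bullet> i) c - b \<bullet> i) *\<^sub>R i)"
    and "box a b \<inter> {x. c < x \<bullet> i} = box (a + (max (a \<bullet> i) c - a \<bullet> i) *\<^sub>R i) b"
  using i by (auto simp: mem_box inner_add_left inner_Basis split: if_splits)

text \<open>Some boxes may become empty, so a cut can lower the number of boxes but never raise it.
  This is why \<open>box_union n\<close> bounds the number instead of fixing it.\<close>

lemma box_union_cut:
  assumes "box_union n S" "\<And>B a b. B = box a b \<Longrightarrow> \<exists>c d. B \<inter> H = box c d"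
  shows "box_union n (S \<inter> H)"
proof -
  obtain \<A> where \<A>: "finite \<A>" "card \<A> \<le> n" "disjoint \<A>"
     "\<And>B. B\<in>\<A> \<Longrightarrow> B \<noteq> {} \<and> (\<exists>a b. B = box a b)" "S = \<Union>\<A>"
    using assms(1) unfolding box_union_def by blast
  define \<B> where "\<B> = (\<lambda>B. B \<inter> H) ` \<A> - {{}}"
  have "card \<B> \<le> card ((\<lambda>B. B \<inter> H) ` \<A>)"
    unfolding \<B>_def using \<A>(1) by (intro card_mono) auto
  also have "\<dots> \<le> card \<A>" by (rule card_image_le[OF \<A>(1)])
  finally have "card \<B> \<le> n" using \<A>(2) by simp
  moreover have "disjoint \<B>"
    using \<A>(3) unfolding \<B>_def disjoint_def by blast
  moreover have "B \<noteq> {} \<and> (\<exists>a b. B = box a b)" if "B \<in> \<B>" for B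
    using that \<A>(4) assms(2) unfolding \<B>_def by blast
  moreover have "S \<inter> H = \<Union>\<B>" unfolding \<B>_def \<A>(5) by blast
  moreover have "finite \<B>" unfolding \<B>_def using \<A>(1) by simp
  ultimately show ?thesis unfolding box_union_def by blast
qed

text \<open>Two disjoint nonempty boxes are separated by a hyperplane
  \<open>x \<bullet> i = c\<close>. Each open side misses one of them completely, so both parts of
  \<open>S\<close> need fewer boxes; this drives the induction in
  \<open>measure_midpoints_box_union\<close>.\<close>

lemma box_union_split:
  fixes S :: "'a::euclidean_space set"
  assumes "box_union n S"
  obtains "S = {}" | a b where "S = box a b"
  | i c m where "i \<in> Basis" "n = Suc m" "box_union m (S \<inter> {x. x \<bullet> i < c})" "box_union m (S \<inter> {x. c < x \<bullet> i})"
      "S \<inter> {x. x \<bullet> i < c} \<noteq> {}" "S \<inter> {x. c < x \<bullet> i} \<noteq> {}"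
proof -
  obtain \<A> where \<A>: "finite \<A>" "card \<A> \<le> n" "disjoint \<A>"
     "\<And>B. B\<in>\<A> \<Longrightarrow> B \<noteq> {} \<and> (\<exists>a b. B = box a b)" "S = \<Union>\<A>"
    using assms(1) unfolding box_union_def by blast
  show thesis
  proof (cases "\<exists>B1\<in>\<A>. \<exists>B2\<in>\<A>. B1 \<noteq> B2")
    case False
    then have "\<A> = {} \<or> (\<exists>B. \<A> = {B})" by blast
    then show thesis
      using \<A>(4,5) that(1,2) by (metis Sup_empty cSup_singleton insertI1)
  next
    case True
    then obtain B1 B2 where B: "B1 \<in> \<A>" "B2 \<in> \<A>" "B1 \<noteq> B2" by blast
    then obtain a b c d where ab: "B1 = box a b" "B2 = box c d" using \<A>(4) by meson
    have ne: "box a b \<noteq> {}" "box c d \<noteq> {}" using \<A>(4) B ab by auto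
    have "box a b \<inter> box c d = {}" using \<A>(3) B ab unfolding disjoint_def by blast
    then obtain i where i: "i \<in> Basis" and
       "b \<bullet> i \<le> a \<bullet> i \<or> d \<bullet> i \<le> c \<bullet> i \<or> b \<bullet> i \<le> c \<bullet> i \<or> d \<bullet> i \<le> a \<bullet> i"
      unfolding disjoint_interval by blast
    then have "b \<bullet> i \<le> c \<bullet> i \<or> d \<bullet> i \<le> a \<bullet> i"
      using ne i unfolding box_ne_empty by force
    then obtain L U t where LU: "L \<in> \<A>" "U \<in> \<A>" "L \<subseteq> {x. x \<bullet> i < t}" "U \<subseteq> {x. t < x \<bullet> i}"
    proof
      assume "b \<bullet> i \<le> c \<bullet> i" then show thesis
        using that[of B1 B2 "c \<bullet> i"] B ab i by (force simp: mem_box)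
    next
      assume "d \<bullet> i \<le> a \<bullet> i" then show thesis
        using that[of B2 B1 "a \<bullet> i"] B ab i by (force simp: mem_box)
    qed
    have ne': "L \<noteq> {}" "U \<noteq> {}" using LU \<A>(4) by auto
    have "n \<noteq> 0" using \<A>(1,2) LU(1) by (metis card_0_eq empty_iff le_zero_eq)
    then obtain m where m: "n = Suc m" using not0_implies_Suc by blast
    \<comment> \<open>A box missed by \<open>H\<close> is discarded before the cut, which saves one
      in the count.\<close>
    have aux: "box_union m (S \<inter> H)" if "B \<in> \<A>" "B \<inter> H = {}"
       "\<And>B a b. B = box a b \<Longrightarrow> \<exists>c d. B \<inter> H = box c d" for B H
    proof -
      have "box_union m (\<Union>(\<A> - {B}))"
        unfolding box_union_def
        using \<A> that(1) m by (intro exI[of _ "\<A> - {B}"]) (auto simp: pairwise_def disjoint_def)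
      then have "box_union m (\<Union>(\<A> - {B}) \<inter> H)"
        by (rule box_union_cut) (use that in auto)
      moreover have "\<Union>(\<A> - {B}) \<inter> H = S \<inter> H" using \<A>(5) that by blast
      ultimately show ?thesis by simp
    qed
    have "box_union m (S \<inter> {x. x \<bullet> i < t})"
      by (rule aux[OF LU(2)]) (use LU(4) box_Int_less(1)[OF i] in \<open>auto intro!: exI\<close>)
    moreover have "box_union m (S \<inter> {x. t < x \<bullet> i})"
      by (rule aux[OF LU(1)]) (use LU(3) box_Int_less(2)[OF i] in \<open>auto intro!: exI\<close>)
    moreover have "S \<inter> {x. x \<bullet> i < t} \<noteq> {}" "S \<inter> {x. t < x \<bullet> i} \<noteq> {}"
      using LU ne' \<A>(5) by blast+
    ultimately show thesis using that(3) i m by blast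
  qed
qed

text \<open>Pairs of points with the same relative coordinates in both boxes have midpoints that
  fill the box with averaged corners. Its side lengths are arithmetic means, so the claim is the
  inequality between arithmetic and geometric mean in each coordinate.\<close>

lemma measure_midpoints_box:
  fixes a b c d :: "'a::euclidean_space"
  assumes "box a b \<noteq> {}" "box c d \<noteq> {}"
  shows "measure lborel (box a b) * measure lborel (box c d)
          \<le> (measure lborel (midpoints (box a b) (box c d)))\<^sup>2"
proof -
  have ab: "\<And>i. i \<in> Basis \<Longrightarrow> a \<bullet> i < b \<bullet> i" and cd: "\<And>i. i \<in> Basis \<Longrightarrow> c \<bullet> i < d \<bullet> i"
    using assms by (auto simp: box_ne_empty)
  define p q where "p = (1/2) *\<^sub>R (a + c)" and "q = (1/2) *\<^sub>R (b + d)"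
  have sub: "box p q \<subseteq> midpoints (box a b) (box c d)"
  proof
    fix z assume z: "z \<in> box p q"
    define t where "t i = (z \<bullet> i - p \<bullet> i) / (q \<bullet> i - p \<bullet> i)" for i
    define x where "x = (\<Sum>i\<in>Basis. (a \<bullet> i + t i * (b \<bullet> i - a \<bullet> i)) *\<^sub>R i)"
    define y where "y = (\<Sum>i\<in>Basis. (c \<bullet> i + t i * (d \<bullet> i - c \<bullet> i)) *\<^sub>R i)"
    have t: "0 < t i \<and> t i < 1" if "i \<in> Basis" for i
      using z that by (auto simp: t_def mem_box divide_simps)
    have conv: "l < l + s * (r - l)" "l + s * (r - l) < r" if "l < r" "0 < s" "s < 1" for l r s :: real
    proof -
      show "l < l + s * (r - l)" using that by simp
      have "s * (r - l) < 1 * (r - l)" using that by (intro mult_strict_right_mono) auto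
      then show "l + s * (r - l) < r" by simp
    qed
    have "x \<in> box a b" "y \<in> box c d"
      using t ab cd conv unfolding mem_box x_def y_def by simp_all
    moreover have "z = (1/2) *\<^sub>R (x + y)"
    proof (rule euclidean_eqI)
      fix i :: 'a assume i: "i \<in> Basis"
      have "q \<bullet> i - p \<bullet> i \<noteq> 0" using ab[OF i] cd[OF i] by (simp add: p_def q_def inner_add_left)
      then have "t i * (q \<bullet> i - p \<bullet> i) = z \<bullet> i - p \<bullet> i" by (simp add: t_def)
      moreover have "x \<bullet> i = a \<bullet> i + t i * (b \<bullet> i - a \<bullet> i)" "y \<bullet> i = c \<bullet> i + t i * (d \<bullet> i - c \<bullet> i)"
        using i by (simp_all add: x_def y_def)
      ultimately show "z \<bullet> i = ((1/2) *\<^sub>R (x + y)) \<bullet> i"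
        by (simp add: inner_add_left p_def q_def algebra_simps)
    qed
    ultimately show "z \<in> midpoints (box a b) (box c d)" by (force simp: midpoints_def)
  qed
  have "measure lborel (box a b) * measure lborel (box c d) =
      (\<Prod>i\<in>Basis. ((b - a) \<bullet> i) * ((d - c) \<bullet> i))"
    using ab cd by (simp add: prod.distrib less_imp_le)
  also have "\<dots> \<le> (\<Prod>i\<in>Basis. ((q - p) \<bullet> i)\<^sup>2)"
  proof (rule prod_mono)
    fix i :: 'a assume i: "i \<in> Basis"
    show "0 \<le> (b - a) \<bullet> i * ((d - c) \<bullet> i) \<and> (b - a) \<bullet> i * ((d - c) \<bullet> i) \<le> ((q - p) \<bullet> i)\<^sup>2"
    proof -
      have am: "x * y \<le> ((x + y) / 2)\<^sup>2" for x y :: real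
        using zero_le_power2[of "x - y"] by (simp add: power2_eq_square field_simps)
      have "(q - p) \<bullet> i = ((b - a) \<bullet> i + (d - c) \<bullet> i) / 2"
        by (simp add: p_def q_def inner_diff_left inner_add_left field_simps)
      moreover have "0 \<le> (b - a) \<bullet> i" "0 \<le> (d - c) \<bullet> i"
        using ab[OF i] cd[OF i] by (auto simp: inner_diff_left)
      ultimately show ?thesis
        using am[of "(b - a) \<bullet> i" "(d - c) \<bullet> i"] by (metis mult_nonneg_nonneg)
    qed
  qed
  also have "\<dots> = (measure lborel (box p q))\<^sup>2"
    using ab cd by (subst measure_lborel_box)
      (auto simp: prod_power_distrib p_def q_def inner_add_left less_imp_le add_mono)
  also have "\<dots> \<le> (measure lborel (midpoints (box a b) (box c d)))\<^sup>2"
    by (intro power_mono measure_mono_fmeasurable sub)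
      (auto intro!: fmeasurableI borel_open open_midpoints emeasure_bounded_finite bounded_midpoints)
  finally show ?thesis .
qed

section \<open>Cutting sets by parallel hyperplanes\<close>

lemma measure_halfspace_cut:
  fixes T :: "'a::euclidean_space set"
  assumes T: "T \<in> sets borel" "bounded T" and i: "i \<in> Basis"
  shows "measure lborel (T \<inter> {x. x \<bullet> i < c}) + measure lborel (T \<inter> {x. c < x \<bullet> i}) = measure lborel T"
proof -

  have "{x. x \<bullet> i = c} \<in> null_sets lborel"
    using negligible_standard_hyperplane[OF i, of c]
    by (simp add: negligible_iff_null_sets null_sets_completion_iff)
  then have "T \<inter> {x. x \<bullet> i = c} \<in> null_sets lborel"
    using T by (auto intro: null_set_Int1)
  then have "measure lborel (T \<inter> {x. x \<bullet> i < c} \<union> T \<inter> {x. c < x \<bullet> i}) = measure lborel T"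
  proof -
    have *: "T = (T \<inter> {x. x \<bullet> i < c} \<union> T \<inter> {x. c < x \<bullet> i}) \<union> T \<inter> {x. x \<bullet> i = c}" by auto
    show ?thesis
      by (subst (3) *, subst measure_Un_null_set[OF _ \<open>T \<inter> {x. x \<bullet> i = c} \<in> null_sets lborel\<close>])
        (use T in auto)
  qed
  moreover have "measure lborel (T \<inter> {x. x \<bullet> i < c} \<union> T \<inter> {x. c < x \<bullet> i}) =
     measure lborel (T \<inter> {x. x \<bullet> i < c}) + measure lborel (T \<inter> {x. c < x \<bullet> i})"
    using T emeasure_bounded_finite[OF bounded_subset[OF T(2)]]
    by (intro measure_Union) (auto simp: less_top[symmetric])
  ultimately show ?thesis by simp
qed

text \<open>Provides the Lipschitz constant of the volume below a moving hyperplane, uniformly in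
  its position.\<close>

lemma measure_slab_le:
  fixes T :: "'a::euclidean_space set"
  assumes T: "T \<in> sets borel" "T \<subseteq> cbox l u" and i: "i \<in> Basis" and "c \<le> d"
  shows "measure lborel (T \<inter> {x. c \<le> x \<bullet> i \<and> x \<bullet> i < d})
      \<le> (d - c) * (\<Prod>k\<in>Basis - {i}. \<bar>(u - l) \<bullet> k\<bar>)"
proof (cases "cbox l u = {}")
  case True then show ?thesis using T \<open>c \<le> d\<close> by (auto intro!: mult_nonneg_nonneg prod_nonneg)
next
  case False
  then have lu: "\<And>k. k \<in> Basis \<Longrightarrow> l \<bullet> k \<le> u \<bullet> k" by (auto simp: box_ne_empty)
  define l' u' where "l' = l + (c - l \<bullet> i) *\<^sub>R i" and "u' = u + (d - u \<bullet> i) *\<^sub>R i"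
  have k: "k \<in> Basis \<Longrightarrow> l' \<bullet> k = (if k = i then c else l \<bullet> k)"
     "k \<in> Basis \<Longrightarrow> u' \<bullet> k = (if k = i then d else u \<bullet> k)" for k
    using i by (auto simp: l'_def u'_def inner_add_left inner_Basis)
  have "T \<inter> {x. c \<le> x \<bullet> i \<and> x \<bullet> i < d} \<subseteq> cbox l' u'"
    using T(2) k by (fastforce simp: mem_box)
  moreover have "T \<inter> {x. c \<le> x \<bullet> i \<and> x \<bullet> i < d} \<in> sets borel"
    using T(1) by measurable
  ultimately have "measure lborel (T \<inter> {x. c \<le> x \<bullet> i \<and> x \<bullet> i < d}) \<le> measure lborel (cbox l' u')"
    by (intro measure_mono_fmeasurable) auto
  also have "\<dots> = (\<Prod>k\<in>Basis. (u' - l') \<bullet> k)"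
    using k lu \<open>c \<le> d\<close> by (subst measure_lborel_cbox) auto
  also have "\<dots> = (d - c) * (\<Prod>k\<in>Basis - {i}. (u' - l') \<bullet> k)"
    using i k by (subst prod.remove[of _ i]) (auto simp: inner_diff_left)
  also have "(\<Prod>k\<in>Basis - {i}. (u' - l') \<bullet> k) = (\<Prod>k\<in>Basis - {i}. \<bar>(u - l) \<bullet> k\<bar>)"
    using k lu by (intro prod.cong) (auto simp: inner_diff_left)
  finally show ?thesis .
qed

text \<open>The volume of \<open>T\<close> below the hyperplane at height \<open>c\<close> is
  Lipschitz in \<open>c\<close> and runs from 0 to the volume of \<open>T\<close>, so every
  intermediate value is taken.\<close>

lemma exists_halfspace_cut:
  fixes T :: "'a::euclidean_space set"
  assumes T: "T \<in> sets borel" "bounded T" and i: "i \<in> Basis" and p: "0 \<le> p" "p \<le> 1"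
  obtains c where "measure lborel (T \<inter> {x. x \<bullet> i < c}) = p * measure lborel T"
proof -
  obtain a where a: "T \<subseteq> box (-a) a" using bounded_subset_box_symmetric[OF T(2)] by blast
  then have a': "T \<subseteq> cbox (-a) a" using box_subset_cbox by blast
  define f where "f c = measure lborel (T \<inter> {x. x \<bullet> i < c})" for c
  define L where "L = (\<Prod>k\<in>Basis - {i}. \<bar>(a - (-a)) \<bullet> k\<bar>)"
  have L: "0 \<le> L" unfolding L_def by (intro prod_nonneg) auto
  have step: "f d - f c \<le> L * (d - c) \<and> f c \<le> f d" if "c \<le> d" for c d
  proof -
    have eq: "T \<inter> {x. x \<bullet> i < d} = T \<inter> {x. x \<bullet> i < c} \<union> T \<inter> {x. c \<le> x \<bullet> i \<and> x \<bullet> i < d}"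
      using that by auto
    have "f d = f c + measure lborel (T \<inter> {x. c \<le> x \<bullet> i \<and> x \<bullet> i < d})"
      unfolding f_def eq
      using T emeasure_bounded_finite[OF bounded_subset[OF T(2)]]
      by (intro measure_Union) (auto simp: less_top[symmetric])
    then show ?thesis using measure_slab_le[OF T(1) a' i that] by (simp add: L_def mult.commute)
  qed
  have "L-lipschitz_on UNIV f"
  proof (rule lipschitz_onI[OF _ L])
    fix x y :: real
    show "dist (f x) (f y) \<le> L * dist x y"
      using step[of x y] step[of y x] by (cases "x \<le> y") (auto simp: dist_real_def abs_if)
  qed
  then have cont: "continuous_on UNIV f" by (rule lipschitz_on_continuous_on)
  have f0: "f ((-a) \<bullet> i) = 0"
  proof -
    have "T \<inter> {x. x \<bullet> i < (-a) \<bullet> i} = {}" using a' i by (force simp: mem_box)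
    then show ?thesis by (simp add: f_def)
  qed
  have f1: "f (a \<bullet> i) = measure lborel T"
  proof -
    have "T \<inter> {x. x \<bullet> i < a \<bullet> i} = T" using a i by (force simp: mem_box)
    then show ?thesis by (simp add: f_def)
  qed
  show thesis
  proof (cases "T = {}")
    case True then show thesis using that[of 0] by simp
  next
    case False
    then have "(-a) \<bullet> i \<le> a \<bullet> i" using a i by (force simp: mem_box)
    moreover have "f ((-a) \<bullet> i) \<le> p * measure lborel T" "p * measure lborel T \<le> f (a \<bullet> i)"
      using f0 f1 p by (auto intro: mult_left_le_one_le)
    ultimately obtain c where "f c = p * measure lborel T"
      using IVT'[of f "(-a) \<bullet> i" "p * measure lborel T" "a \<bullet> i"] continuous_on_subset[OF cont]
      by (metis subset_UNIV)
    then show thesis using that by (simp add: f_def)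
  qed
qed

text \<open>Hadwiger and Ohmann: cut both sets by parallel hyperplanes in the same ratio; the midpoint
  sets of the two pairs of halves are separated by the midpoint hyperplane.\<close>

lemma measure_midpoints_step:
  fixes S T :: "'a::euclidean_space set"
  assumes S: "open S" "bounded S" and T: "open T" "bounded T" and i: "i \<in> Basis"
    and ne: "S \<inter> {x. x \<bullet> i < c} \<noteq> {}" "S \<inter> {x. c < x \<bullet> i} \<noteq> {}"
    and lower: "\<And>d. measure lborel (S \<inter> {x. x \<bullet> i < c}) * measure lborel (T \<inter> {x. x \<bullet> i < d})
        \<le> (measure lborel (midpoints (S \<inter> {x. x \<bullet> i < c}) (T \<inter> {x. x \<bullet> i < d})))\<^sup>2"
    and upper: "\<And>d. measure lborel (S \<inter> {x. c < x \<bullet> i}) * measure lborel (T \<inter> {x. d < x \<bullet> i})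
        \<le> (measure lborel (midpoints (S \<inter> {x. c < x \<bullet> i}) (T \<inter> {x. d < x \<bullet> i})))\<^sup>2"
  shows "measure lborel S * measure lborel T \<le> (measure lborel (midpoints S T))\<^sup>2"
proof -
  let ?m = "measure lborel"
  let ?L = "\<lambda>c. {x. x \<bullet> i < c}" and ?U = "\<lambda>c. {x. c < x \<bullet> i}"
  have fin: "B \<in> fmeasurable lborel" if "open B" "bounded B" for B :: "'a set"
    using that emeasure_bounded_finite[OF that(2)] by (auto intro!: fmeasurableI)
  have op: "open (B \<inter> ?L d)" "open (B \<inter> ?U d)" if "open B" for B d
    using that by (auto intro!: open_Int open_halfspace_component_lt open_halfspace_component_gt)
  have S0: "?m S = ?m (S \<inter> ?L c) + ?m (S \<inter> ?U c)"
    using measure_halfspace_cut[OF _ S(2) i, of c] S(1) by simp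
  define p where "p = ?m (S \<inter> ?L c) / ?m S"
  have pos: "0 < ?m S"
  proof -
    have "S \<noteq> {}" using ne by auto
    then have "\<not> negligible S" using S(1) open_not_negligible by blast
    then have "emeasure lborel S > 0" using S(1)
      by (simp add: negligible_iff_null_sets null_sets_completion_iff null_sets_def zero_less_iff_neq_zero)
    then show ?thesis using S emeasure_bounded_finite[OF S(2)]
      by (simp add: measure_def enn2real_positive_iff)
  qed
  have p: "0 \<le> p" "p \<le> 1" "?m (S \<inter> ?L c) = p * ?m S" "?m (S \<inter> ?U c) = (1 - p) * ?m S"
    using pos S0 by (auto simp: p_def field_simps)
  obtain d where d: "?m (T \<inter> ?L d) = p * ?m T"
    using exists_halfspace_cut[OF _ T(2) i p(1,2)] T(1) by auto
  have d': "?m (T \<inter> ?U d) = (1 - p) * ?m T"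
    using measure_halfspace_cut[OF _ T(2) i, of d] T(1) d by (simp add: algebra_simps)
  define M1 M2 where "M1 = midpoints (S \<inter> ?L c) (T \<inter> ?L d)" and "M2 = midpoints (S \<inter> ?U c) (T \<inter> ?U d)"
  have M: "open M1" "open M2" "bounded M1" "bounded M2"
    unfolding M1_def M2_def using S T by (auto intro!: open_midpoints op bounded_midpoints bounded_Int)
  \<comment> \<open>In terms of the geometric mean \<open>r\<close> of the two volumes the
    inequality becomes additive: the halves contribute \<open>p r\<close> and
    \<open>(1 - p) r\<close>.\<close>
  define r where "r = sqrt (?m S * ?m T)"
  have r: "r\<^sup>2 = ?m S * ?m T" "0 \<le> r" by (simp_all add: r_def)
  have "(p * r)\<^sup>2 \<le> (?m M1)\<^sup>2" "((1 - p) * r)\<^sup>2 \<le> (?m M2)\<^sup>2"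
    using lower[of d] upper[of d]
    by (simp_all add: M1_def M2_def p d d' power_mult_distrib r(1)) (simp_all add: power2_eq_square mult_ac)
  then have "p * r \<le> ?m M1" "(1 - p) * r \<le> ?m M2"
    by (auto intro: power2_le_imp_le)
  then have "r \<le> ?m M1 + ?m M2" by (simp add: algebra_simps)
  also have "\<dots> = ?m (M1 \<union> M2)"
  proof (rule measure_Union[symmetric])
    show "M1 \<inter> M2 = {}"
    proof -
      have "z \<bullet> i < (c + d) / 2" if "z \<in> M1" for z
        using that unfolding M1_def midpoints_def by (auto simp: inner_add_left)
      moreover have "(c + d) / 2 < z \<bullet> i" if "z \<in> M2" for z
        using that unfolding M2_def midpoints_def by (auto simp: inner_add_left)
      ultimately show ?thesis by (meson disjoint_iff less_asym)
    qed
  qed (use M emeasure_bounded_finite in \<open>auto simp: less_top[symmetric]\<close>)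
  also have "\<dots> \<le> ?m (midpoints S T)"
    using M S T by (intro measure_mono_fmeasurable fin open_midpoints bounded_midpoints)
      (auto simp: M1_def M2_def midpoints_def)
  finally show ?thesis using r by (metis power_mono)
qed

text \<open>Induction on the total number of boxes. Cutting one set along a separating hyperplane
  reduces its count on both sides, while the parallel cut of the other set does not raise its count.
  Empty sets and pairs of single boxes are the base.\<close>

theorem measure_midpoints_box_union:
  fixes S T :: "'a::euclidean_space set"
  assumes "box_union k S" "box_union l T"
  shows "measure lborel S * measure lborel T \<le> (measure lborel (midpoints S T))\<^sup>2"
  using assms
proof (induction "k + l" arbitrary: k l S T rule: less_induct)
  case less
  note S = box_unionD[OF less.prems(1)] and T = box_unionD[OF less.prems(2)]
  have cut: "box_union n (B \<inter> {x. x \<bullet> i < d})" "box_union n (B \<inter> {x. d < x \<bullet> i})"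
    if "box_union n B" "i \<in> Basis" for n d i and B :: "'a set"
    by (rule box_union_cut[OF that(1)]; use box_Int_less[OF that(2)] in \<open>auto intro!: exI\<close>)+
  consider "S = {} \<or> T = {}" | a b c d where "S = box a b" "T = box c d" "S \<noteq> {}" "T \<noteq> {}"
    | i c m where "i \<in> Basis" "k = Suc m" "box_union m (S \<inter> {x. x \<bullet> i < c})" "box_union m (S \<inter> {x. c < x \<bullet> i})"
      "S \<inter> {x. x \<bullet> i < c} \<noteq> {}" "S \<inter> {x. c < x \<bullet> i} \<noteq> {}"
    | i c m where "i \<in> Basis" "l = Suc m" "box_union m (T \<inter> {x. x \<bullet> i < c})" "box_union m (T \<inter> {x. c < x \<bullet> i})"
      "T \<inter> {x. x \<bullet> i < c} \<noteq> {}" "T \<inter> {x. c < x \<bullet> i} \<noteq> {}"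
    using box_union_split[OF less.prems(1)] box_union_split[OF less.prems(2)] by metis
  then show ?case
  proof cases
    case 1 then show ?thesis by auto
  next
    case 2 then show ?thesis using measure_midpoints_box by metis
  next
    case 3
    show ?thesis
      by (rule measure_midpoints_step[OF S T \<open>i \<in> Basis\<close> 3(5,6)])
        (rule less.hyps[OF _ _ cut(1)[OF less.prems(2)]] less.hyps[OF _ _ cut(2)[OF less.prems(2)]]; use 3 in simp)+
  next
    case 4
    have "measure lborel T * measure lborel S \<le> (measure lborel (midpoints T S))\<^sup>2"
      by (rule measure_midpoints_step[OF T S \<open>i \<in> Basis\<close> 4(5,6)]; subst midpoints_commute; subst mult.commute)
        (rule less.hyps[OF _ cut(1)[OF less.prems(1)]] less.hyps[OF _ cut(2)[OF less.prems(1)]]; use 4 in simp)+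
    then show ?thesis by (simp add: mult.commute midpoints_commute)
  qed
qed

lemma lborel_distr_reflect: "distr lborel borel uminus = (lborel :: 'a::euclidean_space measure)"
  using lborel_affine[of "-1" "0::'a"] by (simp add: density_1 one_ennreal_def[symmetric])

text \<open>The case \<open>T = - S\<close> of the midpoint inequality: reflection preserves volume,
  and the midpoint set is then \<open>(V - V) / 2\<close>.\<close>

lemma midpoints_bound_box_union:
  fixes V :: "'a::euclidean_space set"
  assumes "box_union n V"
  shows "measure lborel V \<le> measure lborel (midpoints V (uminus ` V))"
proof -
  obtain \<A> where \<A>: "finite \<A>" "card \<A> \<le> n" "disjoint \<A>"
     "\<And>B. B\<in>\<A> \<Longrightarrow> B \<noteq> {} \<and> (\<exists>a b. B = box a b)" "V = \<Union>\<A>"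
    using assms(1) unfolding box_union_def by blast
  have neg: "uminus ` box a b = box (-b) (-a)" for a b :: 'a
  proof -
    have "x \<in> uminus ` box a b \<longleftrightarrow> x \<in> box (-b) (-a)" for x
    proof -
      have "x \<in> uminus ` box a b \<longleftrightarrow> - x \<in> box a b" by force
      then show ?thesis by (auto simp: mem_box)
    qed
    then show ?thesis by blast
  qed
  have "box_union n (uminus ` V)"
    unfolding box_union_def
  proof (intro exI[of _ "(`) uminus ` \<A>"] conjI ballI)
    show "card ((`) uminus ` \<A>) \<le> n"
      using card_image_le[OF \<A>(1), of "(`) uminus"] \<A>(2) by simp
    have "inj (uminus :: 'a \<Rightarrow> 'a)" by (auto simp: inj_def)
    then show "disjoint ((`) uminus ` \<A>)"
      using \<A>(3) unfolding disjoint_def by (auto simp: image_Int[symmetric])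
    fix B assume "B \<in> (`) uminus ` \<A>"
    then obtain C where C: "C \<in> \<A>" "B = uminus ` C" by blast
    then show "B \<noteq> {}" using \<A>(4) by auto
    show "\<exists>a b. B = box a b" using C \<A>(4)[OF C(1)] neg by metis
  qed (use \<A> in auto)
  then have "measure lborel V * measure lborel (uminus ` V) \<le> (measure lborel (midpoints V (uminus ` V)))\<^sup>2"
    by (rule measure_midpoints_box_union[OF assms])
  moreover have "measure lborel (uminus ` V) = measure lborel V"
  proof -
    have V: "V \<in> sets borel" using box_unionD[OF assms] by auto
    have "uminus ` V = uminus -` V" by force
    then have "measure lborel (uminus ` V) = measure (distr lborel borel uminus) V"
      using V by (subst measure_distr) auto
    then show ?thesis by (simp only: lborel_distr_reflect)
  qed
  ultimately show ?thesis by (metis power2_eq_square power2_le_imp_le measure_nonneg)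
qed

text \<open>The measure of the pairs with \<open>x\<close> in \<open>A\<close> and
  \<open>x + y\<close> in \<open>B\<close> is evaluated in both orders. It is the
  \<open>M\<close>-measure of \<open>A\<close> times the volume of \<open>B\<close>, and also the
  volume of \<open>A\<close> times the \<open>M\<close>-measure of \<open>B\<close>; agreement on
  one set of positive finite volume thus forces agreement everywhere.\<close>

lemma translation_invariant_lborel_unique:
  fixes M :: "'a::euclidean_space measure"
  assumes sets: "sets M = sets borel" and "sigma_finite_measure M"
    and trans: "\<And>a. distr M borel (\<lambda>x. a + x) = M"
    and B: "B \<in> sets borel" "emeasure M B = emeasure lborel B" "emeasure lborel B \<noteq> 0" "emeasure lborel B < \<infinity>"
  shows "M = lborel"
proof (rule measure_eqI)
  interpret M: sigma_finite_measure M by fact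
  interpret P: pair_sigma_finite M "lborel :: 'a measure" ..
  note [measurable_cong] = sets
  fix A assume "A \<in> sets M"
  then have [measurable]: "A \<in> sets borel" "B \<in> sets borel" using sets B by auto
  have "emeasure M A * emeasure lborel B = (\<integral>\<^sup>+x. indicator A x * (\<integral>\<^sup>+y. indicator B y \<partial>lborel) \<partial>M)"
    by (simp add: nn_integral_multc sets)
  also have "\<dots> = (\<integral>\<^sup>+x. indicator A x * (\<integral>\<^sup>+y. indicator B (x + y) \<partial>lborel) \<partial>M)"
  proof -
    have "(\<integral>\<^sup>+y. indicator B y \<partial>lborel) = (\<integral>\<^sup>+y. indicator B (x + y) \<partial>lborel :: ennreal)" for x
    proof -
    have "(\<integral>\<^sup>+y. indicator B y \<partial>lborel) = (\<integral>\<^sup>+y. indicator B y \<partial>distr lborel borel (\<lambda>y. x + y))"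
      by (simp add: lborel_distr_plus)
    also have "\<dots> = (\<integral>\<^sup>+y. indicator B (x + y) \<partial>lborel)" by (subst nn_integral_distr) auto
    finally show ?thesis .
    qed
    then show ?thesis by presburger
  qed
  also have "\<dots> = (\<integral>\<^sup>+x. (\<integral>\<^sup>+y. indicator A x * indicator B (x + y) \<partial>lborel) \<partial>M)"
    by (intro nn_integral_cong nn_integral_cmult[symmetric]) auto
  also have "\<dots> = (\<integral>\<^sup>+y. (\<integral>\<^sup>+x. indicator A x * indicator B (x + y) \<partial>M) \<partial>lborel)"
    by (rule P.Fubini'[symmetric]) measurable
  also have "\<dots> = (\<integral>\<^sup>+y. (\<integral>\<^sup>+x. indicator A (x - y) * indicator B x \<partial>M) \<partial>lborel)"
  proof (rule nn_integral_cong)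
    fix y :: 'a
    have "(\<integral>\<^sup>+x. indicator A (x - y) * indicator B x \<partial>M) =
       (\<integral>\<^sup>+x. indicator A (x - y) * indicator B x \<partial>distr M borel (\<lambda>x. y + x))"
      by (simp add: trans)
    also have "\<dots> = (\<integral>\<^sup>+x. indicator A x * indicator B (x + y) \<partial>M)"
      by (subst nn_integral_distr) (auto simp: add.commute)
    finally show "(\<integral>\<^sup>+x. indicator A x * indicator B (x + y) \<partial>M) = (\<integral>\<^sup>+x. indicator A (x - y) * indicator B x \<partial>M :: ennreal)" by simp
  qed
  also have "\<dots> = (\<integral>\<^sup>+x. (\<integral>\<^sup>+y. indicator A (x - y) * indicator B x \<partial>lborel) \<partial>M)"
    by (rule P.Fubini') measurable
  also have "\<dots> = (\<integral>\<^sup>+x. emeasure lborel A * indicator B x \<partial>M)"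
  proof (rule nn_integral_cong)
    fix x :: 'a
    have "(\<integral>\<^sup>+y. indicator A (x - y) \<partial>lborel) = (\<integral>\<^sup>+y. indicator A (x + y) \<partial>distr lborel borel uminus)"
      by (subst nn_integral_distr) auto
    also have "\<dots> = (\<integral>\<^sup>+y. indicator A y \<partial>distr lborel borel (\<lambda>y. x + y))"
      unfolding lborel_distr_reflect by (subst nn_integral_distr) auto
    also have "\<dots> = emeasure lborel A" by (simp add: lborel_distr_plus)
    finally show "(\<integral>\<^sup>+y. indicator A (x - y) * indicator B x \<partial>lborel) = emeasure lborel A * indicator B x"
      by (subst nn_integral_multc) auto
  qed
  also have "\<dots> = emeasure lborel A * emeasure M B"
    by (subst nn_integral_cmult) (auto simp: sets)
  finally have eq: "emeasure M A * emeasure lborel B = emeasure lborel A * emeasure lborel B" using B by simp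
  then show "emeasure M A = emeasure lborel A"
    using B(3,4) by (metis mult_divide_eq_ennreal infinity_ennreal_def less_irrefl)
qed (simp add: sets)

text \<open>Writing \<open>a\<close> as \<open>f b\<close> turns translation by \<open>a\<close>
  after \<open>f\<close> into translation by \<open>b\<close> before it, so the image measure is
  translation invariant. The unit ball, which \<open>f\<close> preserves, fixes the
  normalisation.\<close>

lemma lborel_distr_orthogonal:
  fixes f :: "'a::euclidean_space \<Rightarrow> 'a"
  assumes "orthogonal_transformation f"
  shows "distr lborel borel f = lborel"
proof (rule translation_invariant_lborel_unique[where B="cball 0 1"])
  have lin: "linear f" and nrm: "\<And>x. norm (f x) = norm x" and "bij f"
    using assms by (auto simp: orthogonal_transformation orthogonal_transformation_bij)
  have [measurable]: "f \<in> borel_measurable borel"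
    using lin by (simp add: borel_measurable_continuous_onI linear_continuous_on linear_conv_bounded_linear)
  have ball: "f -` cball 0 r = cball 0 r" for r using nrm by (auto simp: dist_norm)
  show "emeasure (distr lborel borel f) (cball 0 1) = emeasure lborel (cball 0 1 :: 'a set)"
    by (subst emeasure_distr) (auto simp: ball)
  show "sigma_finite_measure (distr lborel borel f)"
  proof (rule sigma_finite_measure.intro, intro exI[of _ "range (\<lambda>n::nat. cball 0 (real n))"] conjI ballI)
    show "\<Union>(range (\<lambda>n::nat. cball 0 (real n))) = space (distr lborel borel f)"
      by (auto simp: dist_norm real_arch_simple)
    fix a assume "a \<in> range (\<lambda>n::nat. cball (0::'a) (real n))"
    then show "emeasure (distr lborel borel f) a \<noteq> \<infinity>"
      by (auto simp: emeasure_distr ball emeasure_cball)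
  qed auto
  fix a
  obtain b where b: "f b = a" using \<open>bij f\<close> by (metis bij_pointE)
  have "distr (distr lborel borel f) borel (\<lambda>x. a + x) = distr lborel borel (\<lambda>x. f (b + x))"
    by (subst distr_distr) (auto simp: comp_def b linear_add[OF lin])
  also have "\<dots> = distr (distr lborel borel (\<lambda>x. b + x)) borel f"
    by (subst distr_distr) (auto simp: comp_def)
  finally show "distr (distr lborel borel f) borel (\<lambda>x. a + x) = distr lborel borel f"
    by (simp add: lborel_distr_plus)
qed (auto simp: emeasure_cball unit_ball_vol_pos[THEN less_imp_neq, symmetric] simp del: nn_integral_const)

section \<open>Volumes of cylinders and the isodiametric inequality\<close>

definition cylinder :: "'a::real_inner \<Rightarrow> real \<Rightarrow> real \<Rightarrow> real \<Rightarrow> 'a set" where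
  "cylinder p r \<alpha> \<beta> = {z. norm (z - (z \<bullet> p) *\<^sub>R p) \<le> r \<and> \<alpha> \<le> z \<bullet> p \<and> z \<bullet> p \<le> \<beta>}"

lemma closed_cylinder: "closed (cylinder p r \<alpha> \<beta>)"
  unfolding cylinder_def by (intro closed_Collect_conj closed_Collect_le continuous_intros)

text \<open>Fubini splits off the coordinate along \<open>p\<close>; the other coordinates run
  through a ball of one dimension less, whose volume is given by
  \<open>emeasure_cball_aux\<close>.\<close>

lemma emeasure_cylinder_Basis:
  fixes p :: "'a::euclidean_space"
  assumes p: "p \<in> Basis" and r: "r > 0" and "\<alpha> \<le> \<beta>"
  shows "emeasure lborel (cylinder p r \<alpha> \<beta>) = ennreal (unit_ball_vol (real (DIM('a) - 1)) * r ^ (DIM('a) - 1) * (\<beta> - \<alpha>))"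
proof -
  interpret product_sigma_finite "\<lambda>_. lborel :: real measure" by standard
  let ?A = "Basis - {p}" and ?s = "\<lambda>f. \<Sum>b\<in>Basis. f b *\<^sub>R (b::'a)"
  have B: "Basis = insert p ?A" using p by auto
  have sp: "?s f \<bullet> p = f p" for f using p by simp
  have nrm: "norm (?s f - (?s f \<bullet> p) *\<^sub>R p) = sqrt (\<Sum>i\<in>?A. (f i)\<^sup>2)" for f
  proof -
    have "norm (?s f - (?s f \<bullet> p) *\<^sub>R p) = L2_set (\<lambda>i. (?s f - (?s f \<bullet> p) *\<^sub>R p) \<bullet> i) Basis"
      using euclidean_dist_l2[of "?s f - (?s f \<bullet> p) *\<^sub>R p" 0] by (simp add: L2_set_def)
    also have "\<dots> = sqrt (\<Sum>i\<in>Basis. (if i = p then 0 else f i)\<^sup>2)"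
      unfolding L2_set_def using p by (intro arg_cong[where f=sqrt] sum.cong) (auto simp: inner_diff_left inner_Basis)
    also have "(\<Sum>i\<in>Basis. (if i = p then 0 else f i)\<^sup>2) = (\<Sum>i\<in>?A. (f i)\<^sup>2)"
      by (subst sum.remove[OF _ p]) (auto intro!: sum.cong)
    finally show ?thesis .
  qed
  have meas[measurable]: "cylinder p r \<alpha> \<beta> \<in> sets borel" by (rule borel_closed[OF closed_cylinder])
  let ?C = "{f. sqrt (\<Sum>i\<in>?A. (f i)\<^sup>2) \<le> r} \<inter> space (Pi\<^sub>M ?A (\<lambda>_. lborel))"
  have "emeasure lborel (cylinder p r \<alpha> \<beta>) = (\<integral>\<^sup>+z. indicator (cylinder p r \<alpha> \<beta>) z \<partial>lborel)"
    using meas by simp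
  also have "\<dots> = (\<integral>\<^sup>+f. indicator (cylinder p r \<alpha> \<beta>) (?s f) \<partial>Pi\<^sub>M Basis (\<lambda>_. lborel))"
    by (subst lborel_eq, subst nn_integral_distr) auto
  also have "\<dots> = (\<integral>\<^sup>+f. indicator {f. sqrt (\<Sum>i\<in>?A. (f i)\<^sup>2) \<le> r} f * indicator {\<alpha>..\<beta>} (f p) \<partial>Pi\<^sub>M (insert p ?A) (\<lambda>_. lborel))"
    unfolding B[symmetric]
    by (intro nn_integral_cong) (auto simp: indicator_def cylinder_def nrm[unfolded sp] sp)
  also have "\<dots> = (\<integral>\<^sup>+y. \<integral>\<^sup>+f. indicator {f. sqrt (\<Sum>i\<in>?A. (f i)\<^sup>2) \<le> r} (f(p := y)) * indicator {\<alpha>..\<beta>} ((f(p := y)) p)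
       \<partial>Pi\<^sub>M ?A (\<lambda>_. lborel) \<partial>lborel)"
    by (subst product_nn_integral_insert_rev) auto
  also have "\<dots> = (\<integral>\<^sup>+y. \<integral>\<^sup>+f. indicator ?C f * indicator {\<alpha>..\<beta>} y \<partial>Pi\<^sub>M ?A (\<lambda>_. lborel) \<partial>lborel)"
    by (intro nn_integral_cong) (auto simp: indicator_def)
  also have "\<dots> = (\<integral>\<^sup>+y. emeasure (Pi\<^sub>M ?A (\<lambda>_. lborel)) ?C * indicator {\<alpha>..\<beta>} y \<partial>lborel)"
    by (intro nn_integral_cong, subst nn_integral_multc) (auto intro!: arg_cong2[where f="(*)"] nn_integral_indicator)
  also have "\<dots> = emeasure (Pi\<^sub>M ?A (\<lambda>_. lborel)) ?C * ennreal (\<beta> - \<alpha>)"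
    using \<open>\<alpha> \<le> \<beta>\<close> by (subst nn_integral_cmult) auto
  also have "emeasure (Pi\<^sub>M ?A (\<lambda>_. lborel)) ?C = ennreal (unit_ball_vol (real (card ?A)) * r ^ card ?A)"
    by (rule emeasure_cball_aux) (use r in auto)
  finally show ?thesis using p \<open>\<alpha> \<le> \<beta>\<close> r by (simp add: ennreal_mult' card_Diff_singleton)
qed

text \<open>An orthogonal map taking \<open>p\<close> to a basis vector takes one cylinder to the
  other and preserves volume.\<close>

lemma emeasure_cylinder:
  fixes p :: "real^'n"
  assumes p: "norm p = 1" and r: "r > 0" and "\<alpha> \<le> \<beta>"
  shows "emeasure lborel (cylinder p r \<alpha> \<beta>) = ennreal (unit_ball_vol (real (CARD('n) - 1)) * r ^ (CARD('n) - 1) * (\<beta> - \<alpha>))"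
proof -
  fix k :: 'n
  define q where "q = (axis k 1 :: real^'n)"
  have q: "q \<in> Basis" "norm q = 1" by (auto simp: q_def axis_in_Basis_iff)
  obtain f where f: "orthogonal_transformation f" "f p = q"
    using orthogonal_transformation_exists_1[OF p q(2)] by blast
  then have lin: "linear f" and nrm: "\<And>x. norm (f x) = norm x" and inn: "\<And>x y. f x \<bullet> f y = x \<bullet> y"
    unfolding orthogonal_transformation_def by (simp_all add: norm_eq_sqrt_inner)
  have [measurable]: "f \<in> borel_measurable borel"
    using lin by (simp add: borel_measurable_continuous_onI linear_continuous_on linear_conv_bounded_linear)
  have "f z \<in> cylinder q r \<alpha> \<beta> \<longleftrightarrow> z \<in> cylinder p r \<alpha> \<beta>" for z
  proof -
    have "f z \<bullet> q = z \<bullet> p" using inn[of z p] f(2) by simp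
    moreover have "f z - (z \<bullet> p) *\<^sub>R q = f (z - (z \<bullet> p) *\<^sub>R p)"
      using f(2) lin by (simp add: linear_diff linear_scale)
    ultimately show ?thesis by (simp add: cylinder_def nrm)
  qed
  then have "emeasure (distr lborel borel f) (cylinder q r \<alpha> \<beta>) = emeasure lborel (cylinder p r \<alpha> \<beta>)"
    by (subst emeasure_distr) (auto simp: vimage_def borel_closed[OF closed_cylinder])
  then show ?thesis
    using emeasure_cylinder_Basis[OF q(1) r \<open>\<alpha> \<le> \<beta>\<close>] by (simp add: lborel_distr_orthogonal[OF f(1)])
qed

text \<open>The symmetrised set \<open>(X - X) / 2\<close> has at least the volume of \<open>X\<close> and lies in a cylinder.\<close>

theorem isodiametric_cylinder:
  fixes X :: "(real^'n) set"
  assumes p: "norm p = 1" and X: "bounded X" "X \<noteq> {}"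
    and slab: "\<And>x. x \<in> X \<Longrightarrow> \<alpha> \<le> x \<bullet> p \<and> x \<bullet> p \<le> \<beta>"
    and diam: "\<And>x y. x \<in> X \<Longrightarrow> y \<in> X \<Longrightarrow> norm ((x - y) - ((x - y) \<bullet> p) *\<^sub>R p) \<le> D"
  shows "emeasure lborel (closure X) \<le> ennreal (unit_ball_vol (real (CARD('n) - 1)) * (D / 2) ^ (CARD('n) - 1) * (\<beta> - \<alpha>))"
proof -
  obtain x0 where x0: "x0 \<in> X" using X by blast
  have D: "0 \<le> D" using diam[OF x0 x0] by simp
  have ab: "\<alpha> \<le> \<beta>" using slab[OF x0] by simp
  define P where "P x = x - (x \<bullet> p) *\<^sub>R p" for x
  have Pn: "norm (P x) \<le> norm x" for x
  proof -
    have "(norm (P x))\<^sup>2 = (norm x)\<^sup>2 - (x \<bullet> p)\<^sup>2"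
      using p unfolding P_def power2_norm_eq_inner
      by (simp add: inner_diff_left inner_diff_right power2_eq_square norm_eq_1 inner_commute)
    then show ?thesis by (auto intro!: power2_le_imp_le[of "norm (P x)" "norm x"])
  qed
  have Plin: "P (x + y) = P x + P y" "P (x - y) = P x - P y" "P (c *\<^sub>R x) = c *\<^sub>R P x" for x y c
    by (simp_all add: P_def algebra_simps inner_add_left inner_diff_left)
  \<comment> \<open>The midpoint inequality is known only for unions of boxes, so
    \<open>closure X\<close> is replaced by a box union \<open>V\<close> inside its neighbourhood of
    radius \<open>2 * e\<close>. Passing from \<open>x - y\<close> to \<open>v - w\<close> costs at
    most \<open>4 * e\<close>, which the midpoint halves.\<close>
  have le: "emeasure lborel (closure X) \<le> ennreal (unit_ball_vol (real (CARD('n) - 1)) * (D / 2 + 2 * e) ^ (CARD('n) - 1) * (\<beta> - \<alpha> + 4 * e))"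
    if "e > 0" for e
  proof -
    define U where "U = (\<Union>x\<in>X. ball x (2 * e))"
    have cU: "closure X \<subseteq> U"
    proof
      fix x assume "x \<in> closure X"
      then obtain y where "y \<in> X" "dist y x < e" using \<open>e > 0\<close> by (meson closure_approachable)
      then show "x \<in> U" using \<open>e > 0\<close> unfolding U_def by force
    qed
    have "open U" by (auto simp: U_def)
    then have "\<forall>x\<in>closure X. \<exists>a b. cbox a b \<subseteq> U \<and> x \<in> box a b"
      using cU open_contains_cbox by (metis subsetD)
    then obtain a b where ab': "\<And>x. x \<in> closure X \<Longrightarrow> cbox (a x) (b x) \<subseteq> U \<and> x \<in> box (a x) (b x)"
      by metis
    have "compact (closure X)" using X by simp
    then obtain K where K: "K \<subseteq> closure X" "finite K" "closure X \<subseteq> (\<Union>x\<in>K. box (a x) (b x))"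
      by (rule compactE_image[where C="closure X" and f="\<lambda>x. box (a x) (b x)"]) (use ab' in auto)
    obtain d where d: "d division_of (\<Union>((\<lambda>x. cbox (a x) (b x)) ` K))"
      using elementary_unions_intervals[of "(\<lambda>x. cbox (a x) (b x)) ` K"] K(2) by blast
    \<comment> \<open>The pieces of a division have disjoint interiors, as \<open>box_union\<close>
      demands; passing to interiors loses only a null set.\<close>
    define \<A> where "\<A> = interior ` d - {{}}"
    define V where "V = \<Union>\<A>"
    have fin: "finite d" using d by auto
    have bu: "box_union (card d) V"
      unfolding box_union_def
    proof (intro exI[of _ \<A>] conjI ballI)
      have "card \<A> \<le> card (interior ` d)" unfolding \<A>_def using fin by (intro card_mono) auto
      then show "card \<A> \<le> card d" using card_image_le[OF fin] le_trans by blast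
      show "disjoint \<A>" unfolding disjoint_def \<A>_def using division_ofD(5)[OF d] by auto
      fix B assume "B \<in> \<A>"
      then obtain k where "k \<in> d" "B = interior k" by (auto simp: \<A>_def)
      then show "\<exists>a b. B = box a b" using division_ofD(4)[OF d] by (metis interior_cbox)
    qed (auto simp: \<A>_def V_def fin)
    have VU: "V \<subseteq> U"
    proof -
      have "V \<subseteq> \<Union>d" unfolding V_def \<A>_def using interior_subset by blast
      also have "\<Union>d \<subseteq> U" using division_ofD(6)[OF d] K(1) ab' by blast
      finally show ?thesis .
    qed
    have "negligible (k - interior k)" if "k \<in> d" for k
    proof -
      obtain l u where "k = cbox l u" using division_ofD(4)[OF d \<open>k \<in> d\<close>] by blast
      then show ?thesis using negligible_frontier_interval[of l u] by simp
    qed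
    then have neg: "negligible (\<Union>k\<in>d. k - interior k)" using fin by (auto intro!: negligible_Union)
    have "closure X \<subseteq> \<Union>d" using K(3) division_ofD(6)[OF d] box_subset_cbox by blast
    also have "\<Union>d \<subseteq> V \<union> (\<Union>k\<in>d. k - interior k)" unfolding V_def \<A>_def by auto
    finally have "emeasure lebesgue (closure X) \<le> emeasure lebesgue (V \<union> (\<Union>k\<in>d. k - interior k))"
      using box_unionD(1)[OF bu] neg by (intro emeasure_mono) (auto simp: negligible_iff_null_sets null_sets_def)
    also have "\<dots> = emeasure lebesgue V"
      using box_unionD(1)[OF bu] neg by (intro emeasure_Un_null_set) (auto simp: negligible_iff_null_sets)
    finally have "emeasure lborel (closure X) \<le> emeasure lborel V"
      using box_unionD(1)[OF bu] by simp
    also have "\<dots> = ennreal (measure lborel V)"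
      using emeasure_bounded_finite[OF box_unionD(2)[OF bu]] by (intro emeasure_eq_ennreal_measure) auto
    also have "\<dots> \<le> ennreal (measure lborel (midpoints V (uminus ` V)))"
      using midpoints_bound_box_union[OF bu] by (rule ennreal_leI)
    also have "\<dots> = emeasure lborel (midpoints V (uminus ` V))"
      using emeasure_bounded_finite[OF bounded_midpoints[OF box_unionD(2)[OF bu]]] box_unionD(2)[OF bu]
      by (intro emeasure_eq_ennreal_measure[symmetric]) (auto simp: less_top[symmetric])
    also have "\<dots> \<le> emeasure lborel (cylinder p (D / 2 + 2 * e) (- ((\<beta> - \<alpha>) / 2 + 2 * e)) ((\<beta> - \<alpha>) / 2 + 2 * e))"
    proof (rule emeasure_mono)
      show "midpoints V (uminus ` V) \<subseteq> cylinder p (D / 2 + 2 * e) (- ((\<beta> - \<alpha>) / 2 + 2 * e)) ((\<beta> - \<alpha>) / 2 + 2 * e)"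
      proof
        fix z assume "z \<in> midpoints V (uminus ` V)"
        then obtain v w where vw: "v \<in> V" "w \<in> V" "z = (1/2) *\<^sub>R (v - w)" by (auto simp: midpoints_def)
        then obtain x y where xy: "x \<in> X" "y \<in> X" "norm (v - x) < 2 * e" "norm (w - y) < 2 * e"
          using VU unfolding U_def subset_iff UN_iff mem_ball dist_norm by (metis norm_minus_commute)
        have z: "z = (1/2) *\<^sub>R ((x - y) + (v - x) - (w - y))" using vw by simp
        have "norm (P z) = (1/2) * norm (P (x - y) + P (v - x) - P (w - y))"
          unfolding z Plin(3) by (simp add: Plin(1,2))
        also have "\<dots> \<le> (1/2) * (norm (P (x - y)) + norm (P (v - x)) + norm (P (w - y)))"
              using norm_triangle_ineq4[of "P (x - y) + P (v - x)" "P (w - y)"] norm_triangle_ineq[of "P (x - y)" "P (v - x)"]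
          by simp
        also have "\<dots> \<le> (1/2) * (D + 2 * e + 2 * e)"
          using diam[OF xy(1,2)] xy(3,4) Pn[of "v - x"] Pn[of "w - y"]
          unfolding P_def[symmetric] by (intro mult_left_mono) auto
        finally have 1: "norm (P z) \<le> D / 2 + 2 * e" by simp
        have "\<bar>(v - x) \<bullet> p\<bar> \<le> 2 * e" "\<bar>(w - y) \<bullet> p\<bar> \<le> 2 * e"
          using Cauchy_Schwarz_ineq2[of "v - x" p] Cauchy_Schwarz_ineq2[of "w - y" p] p xy by auto
        moreover have "\<bar>(x - y) \<bullet> p\<bar> \<le> \<beta> - \<alpha>"
          using slab[OF xy(1)] slab[OF xy(2)] by (auto simp: inner_diff_left)
        moreover have "z \<bullet> p = (1/2) * ((x - y) \<bullet> p + (v - x) \<bullet> p - (w - y) \<bullet> p)"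
          unfolding z by (simp add: inner_diff_left inner_add_left)
        ultimately have "\<bar>z \<bullet> p\<bar> \<le> (\<beta> - \<alpha>) / 2 + 2 * e" unfolding abs_le_iff by argo
        then show "z \<in> cylinder p (D / 2 + 2 * e) (- ((\<beta> - \<alpha>) / 2 + 2 * e)) ((\<beta> - \<alpha>) / 2 + 2 * e)"
          using 1 unfolding cylinder_def P_def by auto
      qed
    qed (simp add: borel_closed[OF closed_cylinder])
    also have "\<dots> = ennreal (unit_ball_vol (real (CARD('n) - 1)) * (D / 2 + 2 * e) ^ (CARD('n) - 1) * (\<beta> - \<alpha> + 4 * e))"
      using D ab \<open>e > 0\<close> by (subst emeasure_cylinder[OF p]) (auto simp: algebra_simps)
    finally show ?thesis .
  qed
  have "((\<lambda>e. ennreal (unit_ball_vol (real (CARD('n) - 1)) * (D / 2 + 2 * e) ^ (CARD('n) - 1) * (\<beta> - \<alpha> + 4 * e)))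
      \<longlongrightarrow> ennreal (unit_ball_vol (real (CARD('n) - 1)) * (D / 2 + 2 * 0) ^ (CARD('n) - 1) * (\<beta> - \<alpha> + 4 * 0))) (at_right 0)"
    by (intro tendsto_ennrealI tendsto_intros)
  then have "((\<lambda>e. ennreal (unit_ball_vol (real (CARD('n) - 1)) * (D / 2 + 2 * e) ^ (CARD('n) - 1) * (\<beta> - \<alpha> + 4 * e)))
      \<longlongrightarrow> ennreal (unit_ball_vol (real (CARD('n) - 1)) * (D / 2) ^ (CARD('n) - 1) * (\<beta> - \<alpha>))) (at_right 0)"
    unfolding mult_zero_right add_0_right .
  moreover have "\<forall>\<^sub>F e in at_right (0::real). emeasure lborel (closure X) \<le>
      ennreal (unit_ball_vol (real (CARD('n) - 1)) * (D / 2 + 2 * e) ^ (CARD('n) - 1) * (\<beta> - \<alpha> + 4 * e))"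
    by (rule eventually_mono[OF eventually_at_right_less le])
  ultimately show ?thesis
    by (rule tendsto_lowerbound) simp
qed

section \<open>Hausdorff measure of the unit sphere\<close>

lemma suminf_tail_ennreal:
  fixes f :: "nat \<Rightarrow> ennreal"
  assumes "(\<Sum>i. f i) < top" "0 < e"
  obtains n where "(\<Sum>i. f (i + n)) < ennreal e"
proof -
  have fin: "f i < top" for i
    using ennreal_suminf_lessD[OF assms(1)] by auto
  define r where "r i = enn2real (f i)" for i
  have f: "f i = ennreal (r i)" for i using fin by (simp add: r_def)
  have r: "0 \<le> r i" for i by (simp add: r_def)
  have "summable r"
    using assms(1) r by (intro summable_suminf_not_top) (auto simp: f)
  then obtain n where n: "norm (\<Sum>i. r (i + n)) < e"
    using suminf_exist_split[OF \<open>0 < e\<close>] by blast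
  have "(\<Sum>i. f (i + n)) = ennreal (\<Sum>i. r (i + n))"
    unfolding f using r \<open>summable r\<close> by (intro suminf_ennreal2) (auto simp: summable_iff_shift)
  moreover have "(\<Sum>i. r (i + n)) < e" using n by simp
  ultimately have "(\<Sum>i. f (i + n)) < ennreal e" using ennreal_lessI[OF \<open>0 < e\<close>] by simp
  then show thesis by (rule that)
qed

text \<open>\<open>X - F\<close> is exhausted by the sets \<open>A n\<close> of points at distance
  at least \<open>1 / (n + 1)\<close> from \<open>F\<close>, and each of these is separated from
  \<open>X \<inter> F\<close>. What \<open>A n\<close> misses lies in the shells \<open>R k\<close>;
  their outer measures are summable, so the missing part becomes arbitrarily small.\<close>

theorem metric_outer_measure_closed:
  fixes m :: "'a::metric_space set \<Rightarrow> ennreal"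
  assumes empty: "m {} = 0"
    and mono: "\<And>S T. S \<subseteq> T \<Longrightarrow> m S \<le> m T"
    and subadd: "\<And>A :: nat \<Rightarrow> 'a set. m (\<Union>i. A i) \<le> (\<Sum>i. m (A i))"
    and metric: "\<And>S T e. 0 < e \<Longrightarrow> (\<And>x y. x \<in> S \<Longrightarrow> y \<in> T \<Longrightarrow> e \<le> dist x y) \<Longrightarrow> m S + m T \<le> m (S \<union> T)"
    and F: "closed F"
  shows "m (X \<inter> F) + m (X - F) \<le> m X"
proof (cases "m X = top \<or> F = {}")
  case True then show ?thesis using empty by auto
next
  case False
  then have fin: "m X < top" and ne: "F \<noteq> {}" by (auto simp: less_top)
  define A where "A n = {x \<in> X. 1 / real (Suc n) \<le> infdist x F}" for n
  define R where "R n = A (Suc n) - A n" for n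
  have AX: "A n \<subseteq> X - F" for n
    unfolding A_def by (auto simp: infdist_zero)
  have Amono: "A n \<subseteq> A (Suc n)" for n
    unfolding A_def by (auto intro: order_trans[rotated] simp: frac_le)
  have Amono': "n \<le> k \<Longrightarrow> A n \<subseteq> A k" for n k using Amono by (rule lift_Suc_mono_le)
  have lip: "infdist x F - infdist y F \<le> dist x y" for x y
    using infdist_triangle[of x F y] by simp
  have sepA: "m (A n) + m (R (Suc n)) \<le> m (A (Suc (Suc n)))" for n
  proof -
    have "m (A n) + m (R (Suc n)) \<le> m (A n \<union> R (Suc n))"
    proof (rule metric)
      have "1 / real (Suc (Suc n)) < 1 / real (Suc n)" by (intro divide_strict_left_mono) auto
      then show "0 < 1 / real (Suc n) - 1 / real (Suc (Suc n))" by simp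
      fix x y assume "x \<in> A n" "y \<in> R (Suc n)"
      then have "1 / real (Suc n) \<le> infdist x F" "infdist y F < 1 / real (Suc (Suc n))"
        by (auto simp: A_def R_def)
      then show "1 / real (Suc n) - 1 / real (Suc (Suc n)) \<le> dist x y" using lip[of x y] by linarith
    qed
    also have "\<dots> \<le> m (A (Suc (Suc n)))"
      by (intro mono) (use Amono'[of n "Suc (Suc n)"] in \<open>auto simp: R_def\<close>)
    finally show ?thesis .
  qed
  \<comment> \<open>Consecutive shells may touch, but shells two apart are separated. The two
    summands on the right carry the shells of either parity, and each induction step updates one of
    them.\<close>
  have part: "(\<Sum>k<n. m (R (Suc k))) \<le> m (A n) + m (A (Suc n))" for n
  proof (induction n)
    case (Suc n)
    have "(\<Sum>k<Suc n. m (R (Suc k))) \<le> (m (A n) + m (R (Suc n))) + m (A (Suc n))"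
      using Suc by (simp add: add_right_mono add.commute add.left_commute)
    also have "\<dots> \<le> m (A (Suc (Suc n))) + m (A (Suc n))" by (intro add_right_mono sepA)
    finally show ?case by (simp add: add.commute)
  qed simp
  have "(\<Sum>k. m (R (Suc k))) \<le> m X + m X"
  proof (rule suminf_le_const[OF summableI])
    fix n
    show "(\<Sum>k<n. m (R (Suc k))) \<le> m X + m X"
      by (rule order_trans[OF part]) (intro add_mono mono; use AX in blast)
  qed
  also have "\<dots> < top" using fin by (simp add: ennreal_add_less_top)
  finally have sfin: "(\<Sum>k. m (R (Suc k))) < top" .
  have sepF: "m (X \<inter> F) + m (A n) \<le> m X" for n
  proof -
    have "m (X \<inter> F) + m (A n) \<le> m (X \<inter> F \<union> A n)"
    proof (rule metric)
      show "0 < 1 / real (Suc n)" by simp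
      fix x y assume "x \<in> X \<inter> F" "y \<in> A n"
      then show "1 / real (Suc n) \<le> dist x y"
        using infdist_le[of x F y] by (auto simp: A_def dist_commute)
    qed
    also have "\<dots> \<le> m X" by (intro mono) (use AX in auto)
    finally show ?thesis .
  qed
  have AR: "X - F \<subseteq> A (Suc n) \<union> (\<Union>k. R (Suc (k + n)))" for n
  proof
    fix x assume x: "x \<in> X - F"
    then have "0 < infdist x F" using F ne by (metis DiffD2 in_closed_iff_infdist_zero infdist_nonneg less_eq_real_def)
    then obtain k where "1 / real (Suc k) < infdist x F" using nat_approx_posE by metis
    then have "x \<in> A k" using x by (auto simp: A_def)
    then have ex: "\<exists>k. x \<in> A k" by blast
    define k0 where "k0 = (LEAST k. x \<in> A k)"
    have k0: "x \<in> A k0" "\<And>j. j < k0 \<Longrightarrow> x \<notin> A j"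
      unfolding k0_def using LeastI_ex[OF ex] not_less_Least by auto
    show "x \<in> A (Suc n) \<union> (\<Union>k. R (Suc (k + n)))"
    proof (cases "k0 \<le> Suc n")
      case True then show ?thesis using Amono'[OF True] k0 by auto
    next
      case False
      then obtain j where "k0 = Suc (Suc (j + n))" by (metis add.commute add_Suc_right less_iff_Suc_add not_le)
      then have "x \<in> R (Suc (j + n))" using k0 by (auto simp: R_def)
      then show ?thesis by blast
    qed
  qed
  have un: "m (S \<union> T) \<le> m S + m T" for S T
  proof -
    have "m (\<Union>i::nat. (if i = 0 then S else if i = 1 then T else {} :: 'a set)) \<le>
       (\<Sum>i::nat. m (if i = 0 then S else if i = 1 then T else {}))" by (rule subadd)
    also have "\<dots> = (\<Sum>i\<in>{0,1::nat}. m (if i = 0 then S else if i = 1 then T else {}))"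
      using suminf_finite[of "{0,1}" "\<lambda>i. m (if i = 0 then S else if i = 1 then T else {})"] by (auto simp: empty)
    also have "(\<Union>i::nat. (if i = 0 then S else if i = 1 then T else {} :: 'a set)) = S \<union> T"
    proof
      show "S \<union> T \<subseteq> (\<Union>i::nat. (if i = 0 then S else if i = 1 then T else {}))"
      proof
        fix x assume "x \<in> S \<union> T"
        then have "x \<in> (if (0::nat) = 0 then S else if 0 = (1::nat) then T else {}) \<or>
            x \<in> (if (1::nat) = 0 then S else if 1 = (1::nat) then T else {})" by auto
        then show "x \<in> (\<Union>i::nat. (if i = 0 then S else if i = 1 then T else {}))" by blast
      qed
    qed (auto split: if_splits)
    finally show ?thesis by simp
  qed
  show ?thesis
  proof (rule ennreal_le_epsilon)
    fix e :: real assume e: "0 < e"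
    obtain n where n: "(\<Sum>k. m (R (Suc (k + n)))) < ennreal e"
      using suminf_tail_ennreal[OF sfin e] by auto
    have "m (X \<inter> F) + m (X - F) \<le> m (X \<inter> F) + (m (A (Suc n)) + m (\<Union>k. R (Suc (k + n))))"
      by (intro add_left_mono order_trans[OF mono[OF AR] un])
    also have "\<dots> \<le> m (X \<inter> F) + (m (A (Suc n)) + (\<Sum>k. m (R (Suc (k + n)))))"
      by (intro add_left_mono subadd)
    also have "\<dots> \<le> m X + ennreal e"
      unfolding add.assoc[symmetric] using n by (intro add_mono sepF) auto
    finally show "m (X \<inter> F) + m (X - F) \<le> m X + ennreal e" .
  qed
qed

section \<open>Hausdorff outer measure and the Borel sets\<close>

lemma hausdorff_pre_le_cover:
  assumes "S \<subseteq> (\<Union>i. C i)" "\<And>i. bounded (C i)" "\<And>i. diameter (C i) \<le> \<delta>"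
  shows "hausdorff_pre d \<delta> S \<le> (\<Sum>i. hausdorff_weight d (C i))"
  unfolding hausdorff_pre_def using assms by (intro INF_lower) auto

lemma hausdorff_pre_mono: "S \<subseteq> T \<Longrightarrow> hausdorff_pre d \<delta> S \<le> hausdorff_pre d \<delta> T"
  unfolding hausdorff_pre_def by (intro INF_superset_mono) auto

lemma hausdorff_pre_antimono: "\<delta> \<le> \<delta>' \<Longrightarrow> hausdorff_pre d \<delta>' S \<le> hausdorff_pre d \<delta> S"
  unfolding hausdorff_pre_def by (intro INF_superset_mono order_refl) (auto intro: order_trans)

lemma hausdorff_pre_empty: "0 < \<delta> \<Longrightarrow> hausdorff_pre d \<delta> {} = 0"
  using hausdorff_pre_le_cover[of "{}" "\<lambda>_. {}" \<delta> d] by (auto simp: hausdorff_weight_def)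

text \<open>Covers of the sets \<open>A n\<close>, each optimal up to
  \<open>e / 2 ^ (n + 1)\<close>, are merged into a single sequence by an enumeration of
  pairs.\<close>

lemma hausdorff_pre_UN_le:
  fixes A :: "nat \<Rightarrow> 'a::metric_space set"
  shows "hausdorff_pre d \<delta> (\<Union>i. A i) \<le> (\<Sum>i. hausdorff_pre d \<delta> (A i))"
proof (rule ennreal_le_epsilon)
  fix e :: real assume "0 < e" and fin: "(\<Sum>i. hausdorff_pre d \<delta> (A i)) < top"
  have e2: "0 < e * (1/2) ^ Suc n" for n using \<open>0 < e\<close> by simp
  have "\<exists>C. A n \<subseteq> (\<Union>i. C i) \<and> (\<forall>i. bounded (C i) \<and> diameter (C i) \<le> \<delta>) \<and>
      (\<Sum>i. hausdorff_weight d (C i)) \<le> hausdorff_pre d \<delta> (A n) + ennreal (e * (1/2) ^ Suc n)" for n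
  proof -
    have "hausdorff_pre d \<delta> (A n) < top" using ennreal_suminf_lessD[OF fin] by auto
    then have "hausdorff_pre d \<delta> (A n) < hausdorff_pre d \<delta> (A n) + ennreal (e * (1/2) ^ Suc n)"
      using e2[of n] by (cases "hausdorff_pre d \<delta> (A n)") (auto simp: ennreal_plus[symmetric] ennreal_less_iff simp del: ennreal_plus)
    then show ?thesis unfolding hausdorff_pre_def INF_less_iff by (auto intro: less_imp_le)
  qed
  then obtain C where C: "\<And>n. A n \<subseteq> (\<Union>i. C n i)" "\<And>n i. bounded (C n i)" "\<And>n i. diameter (C n i) \<le> \<delta>"
    "\<And>n. (\<Sum>i. hausdorff_weight d (C n i)) \<le> hausdorff_pre d \<delta> (A n) + ennreal (e * (1/2) ^ Suc n)" by metis
  define E where "E k = (case prod_decode k of (n, i) \<Rightarrow> C n i)" for k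
  have "(\<Union>i. A i) \<subseteq> (\<Union>k. E k)"
  proof
    fix x assume "x \<in> (\<Union>i. A i)"
    then obtain n i where "x \<in> C n i" using C(1) by blast
    then have "x \<in> E (prod_encode (n, i))" by (simp add: E_def)
    then show "x \<in> (\<Union>k. E k)" by blast
  qed
  then have "hausdorff_pre d \<delta> (\<Union>i. A i) \<le> (\<Sum>k. hausdorff_weight d (E k))"
    by (rule hausdorff_pre_le_cover) (auto simp: E_def C split: prod.split)
  also have "\<dots> = (\<Sum>n. \<Sum>i. hausdorff_weight d (C n i))"
    using suminf_ennreal_2dimen[of "\<lambda>n. \<Sum>i. hausdorff_weight d (C n i)" "\<lambda>(n, i). hausdorff_weight d (C n i)"]
    by (simp add: E_def case_prod_beta)
  also have "\<dots> \<le> (\<Sum>n. hausdorff_pre d \<delta> (A n) + ennreal (e * (1/2) ^ Suc n))"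
    by (intro suminf_le C) auto
  also have "\<dots> = (\<Sum>n. hausdorff_pre d \<delta> (A n)) + (\<Sum>n. ennreal (e * (1/2) ^ Suc n))"
    by (intro suminf_add[symmetric]) auto
  also have "(\<Sum>n. ennreal (e * (1/2) ^ Suc n)) = ennreal e"
    using sums_mult[OF power_half_series, of e] \<open>0 < e\<close> by (intro suminf_ennreal_eq) auto
  finally show "hausdorff_pre d \<delta> (\<Union>i. A i) \<le> (\<Sum>i. hausdorff_pre d \<delta> (A i)) + ennreal e" .
qed

lemma hausdorff_pre_le_outer: "0 < \<delta> \<Longrightarrow> hausdorff_pre d \<delta> S \<le> hausdorff_outer d S"
  unfolding hausdorff_outer_def by (intro SUP_upper) auto

lemma hausdorff_outer_UN_le:
  fixes A :: "nat \<Rightarrow> 'a::metric_space set"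
  shows "hausdorff_outer d (\<Union>i. A i) \<le> (\<Sum>i. hausdorff_outer d (A i))"
  unfolding hausdorff_outer_def[of d "\<Union>i. A i"]
  by (intro SUP_least order_trans[OF hausdorff_pre_UN_le] suminf_le hausdorff_pre_le_outer) auto

lemma hausdorff_outer_mono: "S \<subseteq> T \<Longrightarrow> hausdorff_outer d S \<le> hausdorff_outer d T"
  unfolding hausdorff_outer_def by (intro SUP_mono) (auto intro: hausdorff_pre_mono)

lemma hausdorff_outer_empty: "hausdorff_outer d {} = 0"
  unfolding hausdorff_outer_def by (simp add: hausdorff_pre_empty cong: SUP_cong_simp)

text \<open>A cover by sets of diameter below \<open>e\<close> has no member meeting both
  \<open>S\<close> and \<open>T\<close>, so it splits into a cover of \<open>S\<close> and a cover
  of \<open>T\<close>.\<close>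

lemma hausdorff_outer_separated:
  fixes S T :: "'a::metric_space set"
  assumes e: "0 < e" and sep: "\<And>x y. x \<in> S \<Longrightarrow> y \<in> T \<Longrightarrow> e \<le> dist x y"
  shows "hausdorff_outer d S + hausdorff_outer d T \<le> hausdorff_outer d (S \<union> T)"
proof -
  have small: "hausdorff_pre d \<delta> S + hausdorff_pre d \<delta> T \<le> hausdorff_pre d \<delta> (S \<union> T)" if "\<delta> < e" "0 < \<delta>" for \<delta>
    unfolding hausdorff_pre_def[of d \<delta> "S \<union> T"]
  proof (rule INF_greatest)
    fix C :: "nat \<Rightarrow> 'a set"
    assume "C \<in> {C. S \<union> T \<subseteq> (\<Union>i. C i) \<and> (\<forall>i. bounded (C i) \<and> diameter (C i) \<le> \<delta>)}"
    then have C: "S \<union> T \<subseteq> (\<Union>i. C i)" "\<And>i. bounded (C i)" "\<And>i. diameter (C i) \<le> \<delta>" by auto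
    define CS where "CS U i = (if C i \<inter> U = {} then {} else C i)" for U i
    have pre: "hausdorff_pre d \<delta> U \<le> (\<Sum>i. hausdorff_weight d (CS U i))" if "U \<subseteq> S \<union> T" for U
    proof (rule hausdorff_pre_le_cover)
      show "U \<subseteq> (\<Union>i. CS U i)" using that C(1) unfolding CS_def by fastforce
    qed (use C \<open>0 < \<delta>\<close> in \<open>auto simp: CS_def\<close>)
    have disj: "CS S i = {} \<or> CS T i = {}" for i
    proof (rule ccontr)
      assume "\<not> ?thesis"
      then obtain x y where "x \<in> C i \<inter> S" "y \<in> C i \<inter> T" unfolding CS_def by (auto split: if_splits)
      then have "e \<le> \<delta>" using sep[of x y] diameter_bounded_bound[OF C(2), of x i y] C(3)[of i] by auto
      then show False using that by simp
    qed
    have "hausdorff_pre d \<delta> S + hausdorff_pre d \<delta> T \<le>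
       (\<Sum>i. hausdorff_weight d (CS S i)) + (\<Sum>i. hausdorff_weight d (CS T i))"
      by (intro add_mono pre) auto
    also have "\<dots> = (\<Sum>i. hausdorff_weight d (CS S i) + hausdorff_weight d (CS T i))"
      by (intro suminf_add) auto
    also have "\<dots> \<le> (\<Sum>i. hausdorff_weight d (C i))"
    proof (intro suminf_le)
      fix i
      show "hausdorff_weight d (CS S i) + hausdorff_weight d (CS T i) \<le> hausdorff_weight d (C i)"
      proof -
        have "hausdorff_weight d ({} :: 'a set) = 0" "hausdorff_weight d (CS U i) \<le> hausdorff_weight d (C i)" for U
          by (auto simp: hausdorff_weight_def CS_def)
        then show ?thesis using disj[of i] by auto
      qed
    qed auto
    finally show "hausdorff_pre d \<delta> S + hausdorff_pre d \<delta> T \<le> (\<Sum>i. hausdorff_weight d (C i))" .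
  qed
  have le: "hausdorff_pre d a S + hausdorff_pre d b T \<le> hausdorff_outer d (S \<union> T)" if "0 < a" "0 < b" for a b
  proof -
    define \<delta> where "\<delta> = min (min a b) (e / 2)"
    have \<delta>: "0 < \<delta>" "\<delta> < e" "\<delta> \<le> a" "\<delta> \<le> b" using that e by (auto simp: \<delta>_def)
    have "hausdorff_pre d a S + hausdorff_pre d b T \<le> hausdorff_pre d \<delta> S + hausdorff_pre d \<delta> T"
      by (intro add_mono hausdorff_pre_antimono \<delta>)
    also have "\<dots> \<le> hausdorff_outer d (S \<union> T)"
      using small[OF \<delta>(2,1)] hausdorff_pre_le_outer[OF \<delta>(1)] by (rule order_trans)
    finally show ?thesis .
  qed
  have "hausdorff_outer d S + hausdorff_pre d b T \<le> hausdorff_outer d (S \<union> T)" if "0 < b" for b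
    unfolding hausdorff_outer_def[of d S] using le that
    by (subst ennreal_SUP_add_left[symmetric]) (auto intro!: SUP_least)
  then show ?thesis
    unfolding hausdorff_outer_def[of d T]
    by (subst add.commute, subst ennreal_SUP_add_left[symmetric]) (auto intro!: SUP_least simp: add.commute)
qed

text \<open>The sets that split every set additively form a sigma-algebra by Caratheodory's lemma.
  It contains the closed sets because \<open>hausdorff_outer\<close> adds up on separated sets,
  hence it contains all Borel sets.\<close>

theorem emeasure_hausdorff:
  fixes S :: "'a::metric_space set"
  assumes "S \<in> sets borel"
  shows "emeasure (hausdorff_measure d) S = hausdorff_outer d S"
proof -
  interpret sigma_algebra "UNIV :: 'a set" UNIV by (rule sigma_algebra_Pow[of UNIV, simplified])
  let ?m = "hausdorff_outer d :: 'a set \<Rightarrow> ennreal"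
  have oms: "outer_measure_space UNIV ?m"
    by (auto simp: outer_measure_space_def positive_def increasing_def countably_subadditive_def
       hausdorff_outer_empty hausdorff_outer_mono hausdorff_outer_UN_le)
  let ?L = "lambda_system UNIV UNIV ?m"
  have ms: "measure_space UNIV ?L ?m" by (rule caratheodory_lemma[OF oms])
  then interpret L: sigma_algebra UNIV ?L by (simp add: measure_space_def)
  have "F \<in> ?L" if "closed F" for F
  proof -
    have "?m (F \<inter> X) + ?m (- F \<inter> X) = ?m X" for X
    proof (rule antisym)
      show "?m (F \<inter> X) + ?m (- F \<inter> X) \<le> ?m X"
        using metric_outer_measure_closed[where m="?m" and X=X and F=F, OF hausdorff_outer_empty hausdorff_outer_mono
            hausdorff_outer_UN_le hausdorff_outer_separated that]
        by (simp add: Int_commute Diff_eq)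
      have "?m X = ?m ((F \<inter> X) \<union> (- F \<inter> X))" by (rule arg_cong[where f="?m"]) auto
      also have "\<dots> \<le> ?m (F \<inter> X) + ?m (- F \<inter> X)"
        using oms countably_subadditive_subadditive[of ?m] unfolding outer_measure_space_def
        by (intro subadditiveD[where M=UNIV and f="?m"]) auto
      finally show "?m X \<le> ?m (F \<inter> X) + ?m (- F \<inter> X)" .
    qed
    then show ?thesis by (auto simp: lambda_system_def Compl_eq_Diff_UNIV)
  qed
  then have "sigma_sets UNIV (Collect closed) \<subseteq> ?L"
    by (intro L.sigma_sets_subset) auto
  then have sub: "sets borel \<subseteq> ?L" by (simp add: borel_eq_closed)
  have *: "measure_space UNIV (sets borel) ?m"
    using measure_down[OF ms _ sub] sets.sigma_algebra_axioms[of "borel :: 'a measure"] by simp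
  have sets: "sigma_sets UNIV (sets (borel :: 'a measure)) = sets borel"
    using sets.sigma_sets_eq[of "borel :: 'a measure"] by simp
  show ?thesis
    unfolding hausdorff_measure_def
  proof (rule emeasure_measure_of[where \<Omega>=UNIV and A="sets borel" and \<mu>="?m"])
    show "S \<in> sets (measure_of UNIV (sets borel) ?m)" using assms by (simp add: sets)
  qed (use * in \<open>auto simp: measure_space_def sets\<close>)
qed

lemma sets_hausdorff [simp, measurable_cong]: "sets (hausdorff_measure d) = sets borel"
  using sets.sigma_sets_eq[of "borel :: 'a measure"] by (simp add: hausdorff_measure_def)

text \<open>The piece is thickened radially to the heights between 1 and \<open>1 + \<eta>\<close>.
  Unit vectors within \<open>\<eta>\<close> of \<open>p\<close> have inner product at least
  \<open>1 - \<eta>\<^sup>2\<close> with it, so the extent along \<open>p\<close> is at most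
  \<open>\<eta> + \<eta>\<^sup>2\<close>. Orthogonally to \<open>p\<close> the diameter grows at
  most by the factor \<open>1 + 2 * \<eta>\<close>, and \<open>isodiametric_cylinder\<close>
  applies.\<close>

lemma sphere_shell_piece:
  fixes C :: "(real^'n) set"
  assumes \<eta>: "0 < \<eta>" "\<eta> \<le> 1" and C: "bounded C" "diameter C \<le> \<eta>" "C \<inter> sphere 0 1 \<noteq> {}"
  shows "emeasure lborel (closure ((\<lambda>(t, x). t *\<^sub>R x) ` ({1..1 + \<eta>} \<times> (C \<inter> sphere 0 1))))
     \<le> ennreal ((1 + 2 * \<eta>) ^ (CARD('n) - 1) * (\<eta> + \<eta>\<^sup>2)) * hausdorff_weight (CARD('n) - 1) C"
proof -
  let ?S = "C \<inter> sphere (0::real^'n) 1" and ?d = "diameter C"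
  let ?X = "(\<lambda>(t, x). t *\<^sub>R x) ` ({1..1 + \<eta>} \<times> ?S)"
  obtain p where p: "p \<in> C" "norm p = 1" using C(3) by auto
  have close: "norm (x - y) \<le> ?d" if "x \<in> C" "y \<in> C" for x y
    using diameter_bounded_bound[OF C(1) that] by (simp add: dist_norm)
  define P where "P x = x - (x \<bullet> p) *\<^sub>R p" for x
  have pp: "p \<bullet> p = 1" using p by (simp add: norm_eq_1)
  have Pn: "norm (P x) \<le> norm x" for x
  proof -
    have "(norm (P x))\<^sup>2 = (norm x)\<^sup>2 - (x \<bullet> p)\<^sup>2"
      using pp unfolding P_def power2_norm_eq_inner
      by (simp add: inner_diff_left inner_diff_right power2_eq_square inner_commute)
    then show ?thesis by (auto intro!: power2_le_imp_le[of "norm (P x)" "norm x"])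
  qed
  have Plin: "P (x + y) = P x + P y" "P (x - y) = P x - P y" "P (c *\<^sub>R x) = c *\<^sub>R P x" for x y c
    by (simp_all add: P_def algebra_simps inner_add_left inner_diff_left)
  have Pp: "P p = 0" by (simp add: P_def pp)
  have "emeasure lborel (closure ?X) \<le>
     ennreal (unit_ball_vol (real (CARD('n) - 1)) * ((1 + 2 * \<eta>) * ?d / 2) ^ (CARD('n) - 1) * ((1 + \<eta>) - (1 - \<eta>\<^sup>2)))"
  proof (rule isodiametric_cylinder[OF p(2)])
    have "bounded ((\<lambda>q. fst q *\<^sub>R snd q) ` ({1..1 + \<eta>} \<times> ?S))"
    proof (rule boundedI[of _ "1 + \<eta>"])
      fix z assume "z \<in> (\<lambda>q. fst q *\<^sub>R snd q) ` ({1..1 + \<eta>} \<times> ?S)"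
      then show "norm z \<le> 1 + \<eta>" by auto
    qed
    then show "bounded ?X" by (simp add: case_prod_beta)
    show "?X \<noteq> {}" using C(3) \<eta> by auto
  next
    fix z assume "z \<in> ?X"
    then obtain t x where tx: "z = t *\<^sub>R x" "1 \<le> t" "t \<le> 1 + \<eta>" "x \<in> C" "norm x = 1" by auto
    have "(norm (x - p))\<^sup>2 = 2 - 2 * (x \<bullet> p)"
      using tx p pp unfolding power2_norm_eq_inner
      by (simp add: inner_diff_left inner_diff_right inner_commute norm_eq_1)
    moreover have "(norm (x - p))\<^sup>2 \<le> \<eta>\<^sup>2"
      using close[OF tx(4) p(1)] C(2) by (intro power_mono) auto
    moreover have e1: "\<eta>\<^sup>2 \<le> 1" "0 \<le> \<eta>\<^sup>2" using \<eta> by (auto simp: power_le_one)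
    ultimately have xp: "1 - \<eta>\<^sup>2 \<le> x \<bullet> p" "0 \<le> x \<bullet> p" by argo+
    have "x \<bullet> p \<le> 1" using norm_cauchy_schwarz[of x p] tx p by simp
    then have "t * (x \<bullet> p) \<le> (1 + \<eta>) * 1" using tx xp \<eta> by (intro mult_mono) auto
    moreover have "1 * (x \<bullet> p) \<le> t * (x \<bullet> p)" using tx xp by (intro mult_right_mono) auto
    ultimately show "1 - \<eta>\<^sup>2 \<le> z \<bullet> p \<and> z \<bullet> p \<le> 1 + \<eta>" using xp tx by simp
  next
    fix z z' assume "z \<in> ?X" "z' \<in> ?X"
    then obtain t x t' x' where tx: "z = t *\<^sub>R x" "1 \<le> t" "t \<le> 1 + \<eta>" "x \<in> C"
       "z' = t' *\<^sub>R x'" "1 \<le> t'" "t' \<le> 1 + \<eta>" "x' \<in> C" by auto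
    \<comment> \<open>Since \<open>P\<close> kills \<open>p\<close>, it sees the radial displacement
      only through \<open>x' - p\<close>. This gives the second summand, \<open>\<eta>\<close> times
      the diameter.\<close>
    have "z - z' = t *\<^sub>R (x - x') + (t - t') *\<^sub>R x'" using tx by (simp add: algebra_simps)
    moreover have "P x' = P (x' - p)" by (simp add: Plin Pp)
    ultimately have "P (z - z') = t *\<^sub>R P (x - x') + (t - t') *\<^sub>R P (x' - p)" by (simp add: Plin)
    then have "norm (P (z - z')) \<le> \<bar>t\<bar> * norm (P (x - x')) + \<bar>t - t'\<bar> * norm (P (x' - p))"
      by (metis norm_triangle_ineq norm_scaleR)
    also have "\<dots> \<le> (1 + \<eta>) * ?d + \<eta> * ?d"
      using tx \<eta> close[OF tx(4,8)] close[OF tx(8) p(1)] Pn[of "x - x'"] Pn[of "x' - p"]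
      by (intro add_mono mult_mono) auto
    finally show "norm ((z - z') - ((z - z') \<bullet> p) *\<^sub>R p) \<le> (1 + 2 * \<eta>) * ?d"
      unfolding P_def by (simp add: algebra_simps)
  qed
  also have "\<dots> = ennreal ((1 + 2 * \<eta>) ^ (CARD('n) - 1) * (\<eta> + \<eta>\<^sup>2)) * hausdorff_weight (CARD('n) - 1) C"
  proof -
    have "C \<noteq> {}" using p by auto
    moreover have "0 \<le> (1 + 2 * \<eta>) ^ (CARD('n) - 1) * (\<eta> + \<eta>\<^sup>2)" using \<eta> by (intro mult_nonneg_nonneg) auto
    moreover have "unit_ball_vol (real (CARD('n) - 1)) * ((1 + 2 * \<eta>) * ?d / 2) ^ (CARD('n) - 1) * ((1 + \<eta>) - (1 - \<eta>\<^sup>2))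
       = ((1 + 2 * \<eta>) ^ (CARD('n) - 1) * (\<eta> + \<eta>\<^sup>2)) * (unit_ball_vol (real (CARD('n) - 1)) * (?d / 2) ^ (CARD('n) - 1))"
    proof -
      have "(1 + 2 * \<eta>) * ?d / 2 = (1 + 2 * \<eta>) * (?d / 2)" by simp
      then show ?thesis by (simp only: power_mult_distrib) (simp add: mult_ac)
    qed
    ultimately show ?thesis
      by (simp only: hausdorff_weight_def if_False ennreal_mult'[symmetric])
  qed
  finally show ?thesis .
qed

lemma emeasure_shell:
  assumes "1 \<le> R"
  shows "emeasure lborel (cball 0 R - ball 0 1 :: (real^'n) set) = ennreal (unit_ball_vol (real CARD('n)) * (R ^ CARD('n) - 1))"
proof -
  have "emeasure lborel (cball 0 R - ball 0 1 :: (real^'n) set) = emeasure lborel (cball 0 R :: (real^'n) set) - emeasure lborel (ball 0 1 :: (real^'n) set)"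
    using assms by (intro emeasure_Diff) (auto simp: emeasure_ball intro: order_trans)
  also have "\<dots> = ennreal (unit_ball_vol (real CARD('n)) * (R ^ CARD('n) - 1))"
    using assms by (simp add: emeasure_cball emeasure_ball ennreal_minus[symmetric] algebra_simps)
  finally show ?thesis .
qed

text \<open>The radial thickenings of the pieces of any cover fill the shell between the radii 1 and
  \<open>1 + \<eta>\<close>, so their volumes add up to at least that of the shell. The scale of the
  cover and the thickness of the shell are the same \<open>\<eta>\<close>.\<close>

lemma hausdorff_pre_sphere_ge:
  assumes \<eta>: "0 < \<eta>" "\<eta> \<le> 1"
  shows "ennreal (unit_ball_vol (real CARD('n)) * ((1 + \<eta>) ^ CARD('n) - 1))
    \<le> ennreal ((1 + 2 * \<eta>) ^ (CARD('n) - 1) * (\<eta> + \<eta>\<^sup>2)) * hausdorff_pre (CARD('n) - 1) \<eta> (sphere 0 1 :: (real^'n) set)"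
proof -
  let ?c = "(1 + 2 * \<eta>) ^ (CARD('n) - 1) * (\<eta> + \<eta>\<^sup>2)"
  let ?v = "unit_ball_vol (real CARD('n)) * ((1 + \<eta>) ^ CARD('n) - 1)"
  have c: "0 < ?c" using \<eta> by (intro mult_pos_pos) (auto intro: add_pos_pos)
  have "ennreal (?v / ?c) \<le> hausdorff_pre (CARD('n) - 1) \<eta> (sphere 0 1 :: (real^'n) set)"
    unfolding hausdorff_pre_def
  proof (rule INF_greatest)
    fix C :: "nat \<Rightarrow> (real^'n) set"
    assume "C \<in> {C. sphere 0 1 \<subseteq> (\<Union>i. C i) \<and> (\<forall>i. bounded (C i) \<and> diameter (C i) \<le> \<eta>)}"
    then have C: "sphere 0 1 \<subseteq> (\<Union>i. C i)" "\<And>i. bounded (C i)" "\<And>i. diameter (C i) \<le> \<eta>" by auto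
    let ?X = "\<lambda>i. (\<lambda>(t, x). t *\<^sub>R x) ` ({1..1 + \<eta>} \<times> (C i \<inter> sphere 0 1))"
    have "cball 0 (1 + \<eta>) - ball 0 1 \<subseteq> (\<Union>i. closure (?X i))"
    proof
      fix z :: "real^'n" assume "z \<in> cball 0 (1 + \<eta>) - ball 0 1"
      then have z: "1 \<le> norm z" "norm z \<le> 1 + \<eta>" by auto
      define x where "x = (1 / norm z) *\<^sub>R z"
      have x: "norm x = 1" "z = norm z *\<^sub>R x" using z by (auto simp: x_def)
      then obtain i where "x \<in> C i" using C(1) by auto
      then have "z \<in> ?X i" using x z by (intro image_eqI[of _ _ "(norm z, x)"]) auto
      then have "z \<in> closure (?X i)" by (rule subsetD[OF closure_subset])
      then show "z \<in> (\<Union>i. closure (?X i))" by (rule UN_I[OF UNIV_I])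
    qed
    then have "emeasure lborel (cball 0 (1 + \<eta>) - ball 0 1 :: (real^'n) set) \<le> emeasure lborel (\<Union>i. closure (?X i))"
      by (intro emeasure_mono) auto
    also have "\<dots> \<le> (\<Sum>i. emeasure lborel (closure (?X i)))"
      by (intro emeasure_subadditive_countably) auto
    also have "\<dots> \<le> (\<Sum>i. ennreal ?c * hausdorff_weight (CARD('n) - 1) (C i))"
    proof (intro suminf_le)
      fix i
      show "emeasure lborel (closure (?X i)) \<le> ennreal ?c * hausdorff_weight (CARD('n) - 1) (C i)"
        using sphere_shell_piece[OF \<eta> C(2,3)] by (cases "C i \<inter> sphere 0 1 = {}") auto
    qed auto
    finally have "ennreal ?v \<le> ennreal ?c * (\<Sum>i. hausdorff_weight (CARD('n) - 1) (C i))"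
      using \<eta> by (simp add: emeasure_shell)
    then have "ennreal ?v / ennreal ?c \<le> (\<Sum>i. hausdorff_weight (CARD('n) - 1) (C i))"
      using c by (intro divide_le_posI_ennreal) (simp only: ennreal_less_zero_iff)
    moreover have "0 \<le> ?v" using \<eta> by (intro mult_nonneg_nonneg) auto
    ultimately show "ennreal (?v / ?c) \<le> (\<Sum>i. hausdorff_weight (CARD('n) - 1) (C i))"
      using c by (subst divide_ennreal[symmetric])
  qed
  then have "ennreal ?c * ennreal (?v / ?c) \<le> ennreal ?c * hausdorff_pre (CARD('n) - 1) \<eta> (sphere 0 1 :: (real^'n) set)"
    by (rule mult_left_mono) simp
  moreover have "ennreal ?c * ennreal (?v / ?c) = ennreal ?v"
  proof -
    have "?c * (?v / ?c) = ?v"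
    proof -
      have "a * (b / a) = b" if "0 < a" for a b :: real using that by simp
      then show ?thesis using c .
    qed
    then show ?thesis
      by (simp only: ennreal_mult'[symmetric, OF less_imp_le[OF c]])
  qed
  ultimately show ?thesis by simp
qed

lemma tendsto_shell_quotient:
  shows "((\<lambda>\<eta>::real. ((1 + \<eta>) ^ n - 1) / \<eta>) \<longlongrightarrow> real n) (at_right 0)"
proof -
  have "((\<lambda>x. (1 + x) ^ n) has_real_derivative real n) (at (0::real))"
    by (auto intro!: derivative_eq_intros)
  then have "((\<lambda>\<eta>::real. ((1 + \<eta>) ^ n - 1) / \<eta>) \<longlongrightarrow> real n) (at 0)"
    by (simp add: has_field_derivative_iff)
  then show ?thesis by (rule tendsto_mono[rotated]) (simp add: at_le)
qed

text \<open>By rotation invariance all unit directions have the same second moment, and those of the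
  coordinate directions add up to that of the norm. Serves for the Hausdorff measure on the sphere
  as well as for Lebesgue measure with a radial weight.\<close>

lemma nn_integral_inner_sq:
  fixes M :: "(real^'n) measure" and k :: "real^'n \<Rightarrow> ennreal"
  assumes sets [measurable_cong]: "sets M = sets borel"
    and inv: "\<And>f. orthogonal_transformation f \<Longrightarrow> distr M borel f = M"
    and k [measurable]: "k \<in> borel_measurable borel"
    and kinv: "\<And>f x. orthogonal_transformation f \<Longrightarrow> k (f x) = k x"
    and e: "norm e = 1"
  shows "of_nat CARD('n) * (\<integral>\<^sup>+x. ennreal ((x \<bullet> e)\<^sup>2) * k x \<partial>M) = (\<integral>\<^sup>+x. ennreal ((norm x)\<^sup>2) * k x \<partial>M)"
proof -
  have ax: "(\<integral>\<^sup>+x. ennreal ((x $ j)\<^sup>2) * k x \<partial>M) = (\<integral>\<^sup>+x. ennreal ((x \<bullet> e)\<^sup>2) * k x \<partial>M)" for j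
  proof -
    have "norm (axis j 1 :: real^'n) = 1" by simp
    have "\<exists>f. orthogonal_transformation f \<and> f e = (axis j 1 :: real^'n)"
    proof (rule orthogonal_transformation_exists_1[OF e \<open>norm (axis j 1 :: real^'n) = 1\<close>])
      fix f assume "orthogonal_transformation f" "f e = (axis j 1 :: real^'n)"
      then show ?thesis by (intro exI[of _ f] conjI)
    qed
    then obtain f where f: "orthogonal_transformation f" "f e = (axis j 1 :: real^'n)" by (elim exE conjE)
    have "linear f" using f(1) by (simp add: orthogonal_transformation_def)
    then have [measurable]: "f \<in> borel_measurable borel"
      by (simp add: borel_measurable_continuous_onI linear_continuous_on linear_conv_bounded_linear)
    have "(\<integral>\<^sup>+x. ennreal ((x $ j)\<^sup>2) * k x \<partial>M) = (\<integral>\<^sup>+x. ennreal ((x \<bullet> axis j 1)\<^sup>2) * k x \<partial>distr M borel f)"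
      by (simp add: inv[OF f(1)] inner_axis)
    also have "\<dots> = (\<integral>\<^sup>+x. ennreal ((f x \<bullet> axis j 1)\<^sup>2) * k (f x) \<partial>M)"
      by (subst nn_integral_distr) auto
    also have "\<dots> = (\<integral>\<^sup>+x. ennreal ((x \<bullet> e)\<^sup>2) * k x \<partial>M)"
    proof -
      have "f x \<bullet> axis j 1 = x \<bullet> e" for x
        using f(1) unfolding f(2)[symmetric] orthogonal_transformation_def by blast
      then show ?thesis by (simp add: kinv[OF f(1)])
    qed
    finally show ?thesis .
  qed
  have "(\<integral>\<^sup>+x. ennreal ((norm x)\<^sup>2) * k x \<partial>M) = (\<integral>\<^sup>+x. (\<Sum>j\<in>UNIV. ennreal ((x $ j)\<^sup>2) * k x) \<partial>M)"
  proof (rule nn_integral_cong)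
    fix x :: "real^'n"
    have "(norm x)\<^sup>2 = (\<Sum>j\<in>UNIV. (x $ j)\<^sup>2)"
      unfolding power2_norm_eq_inner by (simp add: inner_vec_def power2_eq_square)
    then have "ennreal ((norm x)\<^sup>2) = (\<Sum>j\<in>UNIV. ennreal ((x $ j)\<^sup>2))" by simp
    then show "ennreal ((norm x)\<^sup>2) * k x = (\<Sum>j\<in>UNIV. ennreal ((x $ j)\<^sup>2) * k x)"
      by (simp only: sum_distrib_right)
  qed
  also have "\<dots> = (\<Sum>j\<in>UNIV. (\<integral>\<^sup>+x. ennreal ((x $ j)\<^sup>2) * k x \<partial>M))"
    by (rule nn_integral_sum) measurable
  also have "\<dots> = of_nat CARD('n) * (\<integral>\<^sup>+x. ennreal ((x \<bullet> e)\<^sup>2) * k x \<partial>M)" by (simp add: ax)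
  finally show ?thesis by simp
qed

section \<open>Hausdorff measure under isometries\<close>

lemma hausdorff_pre_isometry:
  fixes f :: "'a::metric_space \<Rightarrow> 'b::metric_space"
  assumes f: "\<And>x y. dist (f x) (f y) = dist x y"
  shows "hausdorff_pre d \<delta> (f ` S) \<le> hausdorff_pre d \<delta> S"
  unfolding hausdorff_pre_def[of d \<delta> S]
proof (rule INF_greatest)
  fix C :: "nat \<Rightarrow> 'a set"
  assume "C \<in> {C. S \<subseteq> (\<Union>i. C i) \<and> (\<forall>i. bounded (C i) \<and> diameter (C i) \<le> \<delta>)}"
  then have C: "S \<subseteq> (\<Union>i. C i)" "\<And>i. bounded (C i)" "\<And>i. diameter (C i) \<le> \<delta>" by auto
  have diam: "diameter (f ` E) = diameter E" for E
  proof -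
    have "(\<lambda>(x, y). dist x y) ` (f ` E \<times> f ` E) = (\<lambda>(x, y). dist x y) ` (E \<times> E)"
      by (force simp: f image_iff)
    then show ?thesis by (simp add: diameter_def)
  qed
  have "hausdorff_pre d \<delta> (f ` S) \<le> (\<Sum>i. hausdorff_weight d (f ` C i))"
  proof (rule hausdorff_pre_le_cover)
    show "f ` S \<subseteq> (\<Union>i. f ` C i)" using C(1) by blast
    show "bounded (f ` C i)" for i
      using C(2)[of i] unfolding bounded_def by (metis f imageE)
  qed (simp add: diam C)
  also have "\<dots> = (\<Sum>i. hausdorff_weight d (C i))" by (simp add: hausdorff_weight_def diam cong: if_cong)
  finally show "hausdorff_pre d \<delta> (f ` S) \<le> (\<Sum>i. hausdorff_weight d (C i))" .
qed

lemma hausdorff_distr_orthogonal: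
  fixes f :: "'a::euclidean_space \<Rightarrow> 'a"
  assumes f: "orthogonal_transformation f"
  shows "distr (hausdorff_measure d) borel f = hausdorff_measure d"
proof (rule measure_eqI)
  have "linear f" using f by (simp add: orthogonal_transformation_def)
  then have m [measurable]: "f \<in> borel_measurable borel"
    by (simp add: borel_measurable_continuous_onI linear_continuous_on linear_conv_bounded_linear)
  have iso: "dist (f x) (f y) = dist x y" for x y
    using f unfolding orthogonal_transformation_isometry by simp
  have "bij f" by (rule orthogonal_transformation_bij[OF f])
  then have inv: "f (inv f x) = x" "inv f (f x) = x" for x
    by (auto simp: bij_is_surj surj_f_inv_f bij_is_inj)
  have iso': "dist (inv f x) (inv f y) = dist x y" for x y using iso[of "inv f x" "inv f y"] by (simp add: inv)
  fix A assume "A \<in> sets (distr (hausdorff_measure d) borel f)"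
  then have A: "A \<in> sets borel" by simp
  then have fA: "f -` A \<in> sets borel" using measurable_sets[OF m A] by simp
  have img: "f ` (f -` A) = A" "inv f ` A = f -` A"
    using inv by (auto simp: image_iff) metis+
  have "hausdorff_outer d (f -` A) = hausdorff_outer d A"
  proof (rule antisym)
    show "hausdorff_outer d (f -` A) \<le> hausdorff_outer d A"
      unfolding hausdorff_outer_def img(2)[symmetric]
      by (rule SUP_mono, rule bexI, rule hausdorff_pre_isometry, rule iso', assumption)
    have "hausdorff_outer d (f ` (f -` A)) \<le> hausdorff_outer d (f -` A)"
      unfolding hausdorff_outer_def
      by (rule SUP_mono, rule bexI, rule hausdorff_pre_isometry, rule iso, assumption)
    then show "hausdorff_outer d A \<le> hausdorff_outer d (f -` A)" by (simp only: img)
  qed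
  then show "emeasure (distr (hausdorff_measure d) borel f) A = emeasure (hausdorff_measure d) A"
    using A fA by (simp add: emeasure_distr emeasure_hausdorff)
qed simp

text \<open>The radial projection of a cylinder standing on a cap falls back into the ball that cuts
  out the cap. Hence disjoint balls carry disjoint cylinders, which is how
  \<open>sum_disjoint_caps_le\<close> compares volumes.\<close>

lemma cylinder_imp_radial:
  fixes p :: "'a::real_inner"
  assumes p: "norm p = 1" and z: "z \<in> cylinder p r 1 (1 + \<eta>)"
  shows "1 \<le> norm z" "norm z \<le> 1 + \<eta> + r" "(1 / norm z) *\<^sub>R z \<in> cball p r"
proof -
  define t where "t = z \<bullet> p"
  define w where "w = z - t *\<^sub>R p"
  have pp: "p \<bullet> p = 1" using p by (simp add: norm_eq_1)
  have t: "1 \<le> t" "t \<le> 1 + \<eta>" and w: "norm w \<le> r"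
    using z by (auto simp: cylinder_def t_def w_def)
  have w2: "(norm w)\<^sup>2 = (norm z)\<^sup>2 - t\<^sup>2"
    using pp unfolding w_def t_def power2_norm_eq_inner
    by (simp add: inner_diff_left inner_diff_right power2_eq_square inner_commute)
  have tz: "t \<le> norm z" using norm_cauchy_schwarz[of z p] p by (simp add: t_def)
  then show z1: "1 \<le> norm z" using t by simp
  have "norm z = norm (w + t *\<^sub>R p)" by (simp add: w_def)
  also have "\<dots> \<le> norm w + norm (t *\<^sub>R p)" by (rule norm_triangle_ineq)
  also have "\<dots> \<le> r + (1 + \<eta>)" using t w p by (intro add_mono) auto
  finally show "norm z \<le> 1 + \<eta> + r" by simp
  have "(norm (p - (1 / norm z) *\<^sub>R z))\<^sup>2 = 2 - 2 * (t / norm z)"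
  proof -
    have "((1 / norm z) *\<^sub>R z) \<bullet> ((1 / norm z) *\<^sub>R z) = 1"
    proof -
      have "norm z \<noteq> 0" using z1 by linarith
      then have "z \<noteq> 0" by simp
      then show ?thesis by (simp add: power2_norm_eq_inner[symmetric] power2_eq_square)
    qed
    then show ?thesis using pp unfolding power2_norm_eq_inner
      by (simp add: inner_diff_left inner_diff_right inner_commute t_def)
  qed
  also have "\<dots> = 2 / norm z * (norm z - t)"
  proof -
    have "norm z \<noteq> 0" using z1 by linarith
    then show ?thesis by (simp add: field_simps del: norm_eq_zero)
  qed
  \<comment> \<open>\<open>2 / norm z\<close> is at most 2, while both \<open>norm z\<close> and
    \<open>t\<close> are at least 1. The product on the right is the squared distance of
    \<open>z\<close> from the axis.\<close>
  also have "\<dots> \<le> (norm z + t) * (norm z - t)"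
  proof (rule mult_right_mono)
    have "2 / norm z \<le> 2 / 1" using z1 by (intro divide_left_mono) auto
    then show "2 / norm z \<le> norm z + t" using z1 t by linarith
  qed (use tz in simp)
  also have "\<dots> = (norm w)\<^sup>2" unfolding w2 by (simp add: power2_eq_square algebra_simps)
  finally have "norm (p - (1 / norm z) *\<^sub>R z) \<le> norm w" by (auto dest: power2_le_imp_le)
  then show "(1 / norm z) *\<^sub>R z \<in> cball p r" using w by (simp add: dist_norm)
qed

text \<open>Cylinders of height \<open>\<eta>\<close> erected on disjoint caps are disjoint and stay
  in the shell up to radius \<open>1 + \<eta> + \<rho>\<close>, whose volume bounds the sum of
  theirs.\<close>

lemma sum_disjoint_caps_le:
  fixes a :: "'i \<Rightarrow> real^'n"
  assumes F: "finite F" and a: "\<And>i. i \<in> F \<Longrightarrow> norm (a i) = 1" and r: "\<And>i. i \<in> F \<Longrightarrow> 0 < r i \<and> r i \<le> \<rho>"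
    and disj: "pairwise (\<lambda>i j. disjnt (cball (a i) (r i)) (cball (a j) (r j))) F"
    and \<eta>: "0 < \<eta>" and \<rho>: "0 < \<rho>"
  shows "\<eta> * (\<Sum>i\<in>F. unit_ball_vol (real (CARD('n) - 1)) * r i ^ (CARD('n) - 1))
    \<le> unit_ball_vol (real CARD('n)) * ((1 + \<eta> + \<rho>) ^ CARD('n) - 1)"
proof -
  let ?Z = "\<lambda>i. cylinder (a i) (r i) 1 (1 + \<eta>)" and ?w = "unit_ball_vol (real (CARD('n) - 1))"
  have Z: "emeasure lborel (?Z i) = ennreal (?w * r i ^ (CARD('n) - 1) * \<eta>)" if "i \<in> F" for i
    using emeasure_cylinder[OF a, of i "r i" 1 "1 + \<eta>"] that r \<eta> by simp
  have "ennreal (\<eta> * (\<Sum>i\<in>F. ?w * r i ^ (CARD('n) - 1))) = (\<Sum>i\<in>F. ennreal (?w * r i ^ (CARD('n) - 1) * \<eta>))"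
    using r \<eta> by (subst sum_ennreal) (auto simp: sum_distrib_left mult_ac intro!: mult_nonneg_nonneg zero_le_power less_imp_le)
  also have "\<dots> = (\<Sum>i\<in>F. emeasure lborel (?Z i))" by (simp add: Z)
  also have "\<dots> = emeasure lborel (\<Union>i\<in>F. ?Z i)"
  proof (rule sum_emeasure)
    show "disjoint_family_on ?Z F"
      unfolding disjoint_family_on_def
    proof (intro ballI impI)
      fix i j assume ij: "i \<in> F" "j \<in> F" "i \<noteq> j"
      then have "disjnt (cball (a i) (r i)) (cball (a j) (r j))" using disj by (auto simp: pairwise_def)
      then show "?Z i \<inter> ?Z j = {}"
        using cylinder_imp_radial(3)[OF a[OF ij(1)]] cylinder_imp_radial(3)[OF a[OF ij(2)]]
        unfolding disjnt_iff by (meson disjoint_iff)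
    qed
  qed (auto simp: F borel_closed closed_cylinder)
  also have "\<dots> \<le> emeasure lborel (cball 0 (1 + \<eta> + \<rho>) - ball 0 1 :: (real^'n) set)"
  proof (rule emeasure_mono)
    show "(\<Union>i\<in>F. ?Z i) \<subseteq> cball 0 (1 + \<eta> + \<rho>) - ball 0 1"
    proof
      fix z assume "z \<in> (\<Union>i\<in>F. ?Z i)"
      then obtain i where i: "i \<in> F" "z \<in> ?Z i" by blast
      show "z \<in> cball 0 (1 + \<eta> + \<rho>) - ball 0 1"
        using cylinder_imp_radial(1,2)[OF a[OF i(1)] i(2)] r[OF i(1)] by auto
    qed
  qed auto
  also have "\<dots> = ennreal (unit_ball_vol (real CARD('n)) * ((1 + \<eta> + \<rho>) ^ CARD('n) - 1))"
    using \<eta> \<rho> by (intro emeasure_shell) auto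
  finally show ?thesis
    using \<eta> \<rho> by (subst (asm) ennreal_le_iff) auto
qed

section \<open>Upper bound for the sphere by Vitali covers\<close>

lemma hausdorff_weight_cball_le:
  "0 < r \<Longrightarrow> hausdorff_weight d (cball p r) \<le> ennreal (unit_ball_vol (real d) * r ^ d)"
  for p :: "'a::euclidean_space"
  by (simp add: hausdorff_weight_def)

lemma hausdorff_pre_le_weight:
  assumes "bounded S" "diameter S \<le> \<delta>" "0 < \<delta>"
  shows "hausdorff_pre d \<delta> S \<le> hausdorff_weight d S"
proof -
  have "hausdorff_pre d \<delta> S \<le> (\<Sum>i::nat. hausdorff_weight d (if i = 0 then S else {}))"
    by (rule hausdorff_pre_le_cover) (use assms in \<open>auto split: if_splits\<close>)
  also have "\<dots> = (\<Sum>i\<in>{0::nat}. hausdorff_weight d (if i = 0 then S else {}))"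
    by (rule suminf_finite) (auto simp: hausdorff_weight_def)
  finally show ?thesis by simp
qed

lemma hausdorff_pre_Un_le: "0 < \<delta> \<Longrightarrow> hausdorff_pre d \<delta> (S \<union> T) \<le> hausdorff_pre d \<delta> S + hausdorff_pre d \<delta> T"
proof -
  assume \<delta>: "0 < \<delta>"
  let ?A = "\<lambda>i::nat. if i = 0 then S else if i = 1 then T else {}"
  have "S \<union> T \<subseteq> (\<Union>i. ?A i)"
  proof
    fix x assume "x \<in> S \<union> T"
    then have "x \<in> ?A 0 \<or> x \<in> ?A 1" by auto
    then show "x \<in> (\<Union>i. ?A i)" by blast
  qed
  then have "hausdorff_pre d \<delta> (S \<union> T) \<le> (\<Sum>i. hausdorff_pre d \<delta> (?A i))"
    by (rule order_trans[OF hausdorff_pre_mono hausdorff_pre_UN_le])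
  also have "\<dots> = (\<Sum>i\<in>{0,1}. hausdorff_pre d \<delta> (?A i))"
    by (rule suminf_finite) (auto simp: hausdorff_pre_empty[OF \<delta>])
  finally show ?thesis by simp
qed

lemma hausdorff_pre_finite_UN_le:
  assumes "0 < \<delta>" "finite F"
  shows "hausdorff_pre d \<delta> (\<Union>i\<in>F. A i) \<le> (\<Sum>i\<in>F. hausdorff_pre d \<delta> (A i))"
  using assms(2)
proof (induction F rule: finite_induct)
  case empty then show ?case using assms by (simp add: hausdorff_pre_empty)
next
  case (insert i F)
  then show ?case using hausdorff_pre_Un_le[OF assms(1), of d "A i" "\<Union>i\<in>F. A i"]
    by simp (meson add_left_mono order_trans)
qed

lemma hausdorff_pre_countable_UN_le:
  assumes \<delta>: "0 < \<delta>" and D: "countable D" and bd: "\<And>i. i \<in> D \<Longrightarrow> bounded (A i) \<and> diameter (A i) \<le> \<delta>"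
    and le: "\<And>F. finite F \<Longrightarrow> F \<subseteq> D \<Longrightarrow> (\<Sum>i\<in>F. hausdorff_weight d (A i)) \<le> B"
  shows "hausdorff_pre d \<delta> (\<Union>i\<in>D. A i) \<le> B"
proof -
  define f where "f = to_nat_on D"
  have inj: "inj_on f D" using inj_on_to_nat_on[OF D] by (simp add: f_def)
  define E where "E n = (if n \<in> f ` D then A (inv_into D f n) else {})" for n
  have "hausdorff_pre d \<delta> (\<Union>i\<in>D. A i) \<le> (\<Sum>n. hausdorff_weight d (E n))"
  proof (rule hausdorff_pre_le_cover)
    show "(\<Union>i\<in>D. A i) \<subseteq> (\<Union>n. E n)"
    proof
      fix x assume "x \<in> (\<Union>i\<in>D. A i)"
      then obtain i where "i \<in> D" "x \<in> A i" by blast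
      then have "x \<in> E (f i)" by (simp add: E_def inv_into_f_f[OF inj])
      then show "x \<in> (\<Union>n. E n)" by blast
    qed
    show "bounded (E n)" "diameter (E n) \<le> \<delta>" for n
      using bd \<delta> by (auto simp: E_def inv_into_f_f[OF inj])
  qed
  also have "\<dots> \<le> B"
  proof (rule suminf_le_const[OF summableI])
    fix n
    define F where "F = {i \<in> D. f i < n}"
    have "f ` F \<subseteq> {..<n}" by (auto simp: F_def)
    then have "finite (f ` F)" by (rule finite_subset) simp
    moreover have injF: "inj_on f F" using inj by (rule inj_on_subset) (auto simp: F_def)
    ultimately have fin: "finite F" by (simp add: finite_image_iff)
    have "(\<Sum>k<n. hausdorff_weight d (E k)) = (\<Sum>k\<in>f ` F. hausdorff_weight d (E k))"
      by (intro sum.mono_neutral_right) (auto simp: F_def E_def hausdorff_weight_def)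
    also have "\<dots> = (\<Sum>i\<in>F. hausdorff_weight d (E (f i)))" by (simp add: sum.reindex[OF injF])
    also have "\<dots> = (\<Sum>i\<in>F. hausdorff_weight d (A i))"
      by (intro sum.cong) (auto simp: E_def F_def inv_into_f_f[OF inj])
    also have "\<dots> \<le> B" by (rule le[OF fin]) (auto simp: F_def)
    finally show "(\<Sum>k<n. hausdorff_weight d (E k)) \<le> B" .
  qed
  finally show ?thesis .
qed

text \<open>Vitali: finitely many of the disjoint caps carry almost the full sum, and the five-fold
  enlargements of the others cover the rest of the sphere.\<close>

lemma hausdorff_pre_sphere_le:
  assumes \<eta>: "0 < \<eta>" and \<delta>: "0 < \<delta>" and \<rho>: "0 < \<rho>" "10 * \<rho> \<le> \<delta>"
  shows "hausdorff_pre (CARD('n) - 1) \<delta> (sphere 0 1 :: (real^'n) set)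
     \<le> ennreal (unit_ball_vol (real CARD('n)) * ((1 + \<eta> + \<rho>) ^ CARD('n) - 1) / \<eta>)"
proof (rule ennreal_le_epsilon)
  fix e :: real assume e: "0 < e"
  let ?d = "CARD('n) - 1" and ?S = "sphere 0 1 :: (real^'n) set"
  define w where "w = (\<lambda>i::(real^'n) \<times> real. unit_ball_vol (real ?d) * snd i ^ ?d)"
  define B where "B = unit_ball_vol (real CARD('n)) * ((1 + \<eta> + \<rho>) ^ CARD('n) - 1) / \<eta>"
  define K where "K = ?S \<times> {0<..\<rho>}"
  obtain C where C: "countable C" "C \<subseteq> K"
     "pairwise (\<lambda>i j. disjnt (cball (fst i) (snd i)) (cball (fst j) (snd j))) C"
     "\<And>i. i \<in> K \<Longrightarrow> \<exists>j. j \<in> C \<and> \<not> disjnt (cball (fst i) (snd i)) (cball (fst j) (snd j)) \<and>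
                        cball (fst i) (snd i) \<subseteq> ball (fst j) (5 * snd j)"
  proof -
    have K: "\<And>i. i \<in> K \<Longrightarrow> 0 < snd i \<and> snd i \<le> \<rho>" by (auto simp: K_def)
    show thesis
      by (rule Vitali_covering_lemma_cballs_balls[of K snd \<rho> fst, OF K], assumption)
        (rule that; (assumption | blast))
  qed
  have Cr: "norm (fst i) = 1" "0 < snd i" "snd i \<le> \<rho>" if "i \<in> C" for i
    using C(2) that by (auto simp: K_def)
  have w0: "0 \<le> w i" if "i \<in> C" for i using Cr[OF that] by (auto simp: w_def)
  have wB: "sum w F \<le> B" if F: "finite F" "F \<subseteq> C" for F
  proof -
    have "\<eta> * (\<Sum>i\<in>F. unit_ball_vol (real ?d) * snd i ^ ?d) \<le> unit_ball_vol (real CARD('n)) * ((1 + \<eta> + \<rho>) ^ CARD('n) - 1)"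
      by (rule sum_disjoint_caps_le[OF F(1), where a=fst])
        (use Cr F \<eta> \<rho> pairwise_subset[OF C(3) F(2)] in auto)
    then show ?thesis using \<eta> by (simp add: B_def w_def field_simps)
  qed
  \<comment> \<open>\<open>F\<close> exhausts the supremum up to \<open>e / 5 ^ ?d\<close>, so every
    finite family of further caps has at most this weight. Fivefold enlargement multiplies the
    weights by \<open>5 ^ ?d\<close> and leaves at most \<open>e\<close>.\<close>
  define \<Sigma> where "\<Sigma> = Sup (sum w ` {F. finite F \<and> F \<subseteq> C})"
  have bdd: "bdd_above (sum w ` {F. finite F \<and> F \<subseteq> C})" using wB by (auto intro!: bdd_aboveI)
  have "\<Sigma> - e / 5 ^ ?d < \<Sigma>" using e by simp
  then obtain F where F: "finite F" "F \<subseteq> C" "\<Sigma> - e / 5 ^ ?d < sum w F"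
    unfolding \<Sigma>_def by (subst (asm) less_cSup_iff[OF _ bdd]) auto
  have tail: "sum w G \<le> e / 5 ^ ?d" if G: "finite G" "G \<subseteq> C - F" for G
  proof -
    have "sum w F + sum w G = sum w (F \<union> G)" using F G by (subst sum.union_disjoint) auto
    also have "\<dots> \<le> \<Sigma>" unfolding \<Sigma>_def using F G by (intro cSup_upper bdd) auto
    finally show ?thesis using F(3) by simp
  qed
  let ?b = "\<lambda>i. cball (fst i) (snd i)" and ?c = "\<lambda>i. cball (fst i) (5 * snd i)"
  have cover: "?S \<subseteq> (\<Union>i\<in>F. ?b i) \<union> (\<Union>i\<in>C - F. ?c i)"
  proof
    fix x assume x: "x \<in> ?S"
    show "x \<in> (\<Union>i\<in>F. ?b i) \<union> (\<Union>i\<in>C - F. ?c i)"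
    proof (cases "x \<in> (\<Union>i\<in>F. ?b i)")
      case False
      have "open (- (\<Union>i\<in>F. ?b i))" using F(1) by (intro open_Compl closed_UN) auto
      then obtain s where s: "0 < s" "cball x s \<subseteq> - (\<Union>i\<in>F. ?b i)"
        using False unfolding open_contains_cball by blast
      \<comment> \<open>The ball around \<open>x\<close> avoids the closed set covered by
        \<open>F\<close>. Its partner in the Vitali family meets it, hence is not in
        \<open>F\<close>, and the enlarged partner contains \<open>x\<close>.\<close>
      define s' where "s' = min s \<rho>"
      have "(x, s') \<in> K" using x s(1) \<rho> by (auto simp: K_def s'_def)
      from C(4)[OF this] obtain j where j: "j \<in> C" "\<not> disjnt (cball x s') (?b j)"
          "cball x s' \<subseteq> ball (fst j) (5 * snd j)" by auto
      have "cball x s' \<subseteq> cball x s" by (rule subset_cball) (simp add: s'_def)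
      then have "cball x s' \<inter> ?b i = {}" if "i \<in> F" for i using s(2) that by blast
      then have "j \<notin> F" using j(2) unfolding disjnt_def by metis
      moreover have "x \<in> cball x s'" using s(1) \<rho> by (simp add: s'_def)
      then have "x \<in> ball (fst j) (5 * snd j)" using j(3) by (rule subsetD[rotated])
      ultimately show ?thesis using j(1) by (auto intro!: bexI[of _ j])
    qed auto
  qed
  have "hausdorff_pre ?d \<delta> ?S \<le> hausdorff_pre ?d \<delta> (\<Union>i\<in>F. ?b i) + hausdorff_pre ?d \<delta> (\<Union>i\<in>C - F. ?c i)"
    by (rule order_trans[OF hausdorff_pre_mono[OF cover] hausdorff_pre_Un_le[OF \<delta>]])
  also have "hausdorff_pre ?d \<delta> (\<Union>i\<in>F. ?b i) \<le> ennreal B"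
  proof -
    have "hausdorff_pre ?d \<delta> (\<Union>i\<in>F. ?b i) \<le> (\<Sum>i\<in>F. hausdorff_pre ?d \<delta> (?b i))"
      by (rule hausdorff_pre_finite_UN_le[OF \<delta> F(1)])
    also have "\<dots> \<le> (\<Sum>i\<in>F. ennreal (w i))"
    proof (rule sum_mono)
      fix i assume "i \<in> F"
      then have "i \<in> C" using F(2) by blast
      then have i: "0 < snd i" "snd i \<le> \<rho>" using Cr by blast+
      have "hausdorff_pre ?d \<delta> (?b i) \<le> hausdorff_weight ?d (?b i)"
        by (rule hausdorff_pre_le_weight) (use i \<rho> \<delta> in auto)
      also have "\<dots> \<le> ennreal (w i)" unfolding w_def by (rule hausdorff_weight_cball_le[OF i(1)])
      finally show "hausdorff_pre ?d \<delta> (?b i) \<le> ennreal (w i)" .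
    qed
    also have "\<dots> = ennreal (sum w F)" using w0 F(2) by (intro sum_ennreal) auto
    also have "\<dots> \<le> ennreal B" by (intro ennreal_leI wB F)
    finally show ?thesis .
  qed
  also have "hausdorff_pre ?d \<delta> (\<Union>i\<in>C - F. ?c i) \<le> ennreal e"
  proof (rule hausdorff_pre_countable_UN_le[OF \<delta>])
    show "countable (C - F)" using C(1) by auto
    \<comment> \<open>The enlarged balls have diameter at most \<open>10 * \<rho>\<close>, which is
      why \<open>\<delta>\<close> is assumed to dominate it.\<close>
    show "bounded (?c i) \<and> diameter (?c i) \<le> \<delta>" if "i \<in> C - F" for i
      using Cr[of i] that \<rho> by auto
    fix G assume G: "finite G" "G \<subseteq> C - F"
    have "(\<Sum>i\<in>G. hausdorff_weight ?d (?c i)) \<le> (\<Sum>i\<in>G. ennreal (5 ^ ?d * w i))"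
    proof (rule sum_mono)
      fix i assume "i \<in> G"
      then have "i \<in> C" using G(2) by blast
      then have "0 < snd i" using Cr by blast
      then show "hausdorff_weight ?d (?c i) \<le> ennreal (5 ^ ?d * w i)"
        using hausdorff_weight_cball_le[of "5 * snd i" ?d "fst i"]
        by (simp add: w_def power_mult_distrib mult_ac)
    qed
    also have "\<dots> = ennreal (5 ^ ?d * sum w G)"
      using w0 G(2) by (subst sum_ennreal) (auto simp: sum_distrib_left intro!: mult_nonneg_nonneg)
    also have "\<dots> \<le> ennreal e"
      using tail[OF G] by (intro ennreal_leI) (simp add: field_simps)
    finally show "(\<Sum>i\<in>G. hausdorff_weight ?d (?c i)) \<le> ennreal e" .
  qed
  finally show "hausdorff_pre ?d \<delta> ?S \<le> ennreal (unit_ball_vol (real CARD('n)) * ((1 + \<eta> + \<rho>) ^ CARD('n) - 1) / \<eta>) + ennreal e"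
    unfolding B_def by (simp add: add_mono)
qed

text \<open>In the upper bound the cap radius \<open>\<rho>\<close> tends to 0 before the height
  \<open>\<eta>\<close>; in the lower bound the scale of the cover and the thickness tend to 0
  together. Both leave the derivative of \<open>R ^ N\<close> at 1, which is
  \<open>N\<close>.\<close>

theorem hausdorff_outer_sphere:
  "hausdorff_outer (CARD('n) - 1) (sphere 0 1 :: (real^'n) set) = ennreal (real CARD('n) * unit_ball_vol (real CARD('n)))"
proof -
  let ?S = "sphere 0 1 :: (real^'n) set" and ?d = "CARD('n) - 1" and ?N = "CARD('n)"
  let ?v = "unit_ball_vol (real CARD('n))"
  have upper: "hausdorff_outer ?d ?S \<le> ennreal (real ?N * ?v)"
    unfolding hausdorff_outer_def
  proof (rule SUP_least)
    fix \<delta> :: real assume "\<delta> \<in> {0<..}"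
    then have \<delta>: "0 < \<delta>" by simp
    have inner: "hausdorff_pre ?d \<delta> ?S \<le> ennreal (?v * ((1 + \<eta>) ^ ?N - 1) / \<eta>)" if "0 < \<eta>" for \<eta>
    proof (rule tendsto_lowerbound)
      have "((\<lambda>\<rho>. ennreal (?v * ((1 + \<eta> + \<rho>) ^ ?N - 1) / \<eta>)) \<longlongrightarrow> ennreal (?v * ((1 + \<eta> + 0) ^ ?N - 1) / \<eta>)) (at_right 0)"
        using that by (intro tendsto_ennrealI tendsto_intros) auto
      then show "((\<lambda>\<rho>. ennreal (?v * ((1 + \<eta> + \<rho>) ^ ?N - 1) / \<eta>)) \<longlongrightarrow> ennreal (?v * ((1 + \<eta>) ^ ?N - 1) / \<eta>)) (at_right 0)"
        by simp
      have "\<forall>\<^sub>F \<rho> in at_right (0::real). 0 < \<rho> \<and> \<rho> < \<delta> / 10"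
        using \<delta> by (auto simp: eventually_at_right_field intro!: exI[of _ "\<delta> / 10"])
      then show "\<forall>\<^sub>F \<rho> in at_right 0. hausdorff_pre ?d \<delta> ?S \<le> ennreal (?v * ((1 + \<eta> + \<rho>) ^ ?N - 1) / \<eta>)"
        by eventually_elim (use hausdorff_pre_sphere_le[where 'n='n, OF that \<delta>] in auto)
    qed simp
    show "hausdorff_pre ?d \<delta> ?S \<le> ennreal (real ?N * ?v)"
    proof (rule tendsto_lowerbound)
      show "((\<lambda>\<eta>. ennreal (?v * (((1 + \<eta>) ^ ?N - 1) / \<eta>))) \<longlongrightarrow> ennreal (real ?N * ?v)) (at_right 0)"
        unfolding mult.commute[of "real ?N"]
        by (intro tendsto_ennrealI tendsto_intros tendsto_shell_quotient)
      show "\<forall>\<^sub>F \<eta> in at_right 0. hausdorff_pre ?d \<delta> ?S \<le> ennreal (?v * (((1 + \<eta>) ^ ?N - 1) / \<eta>))"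
        by (rule eventually_mono[OF eventually_at_right_less[of 0]]) (use inner in auto)
    qed simp
  qed
  obtain h where h: "hausdorff_outer ?d ?S = ennreal h" "0 \<le> h"
  proof (cases "hausdorff_outer ?d ?S" rule: ennreal_cases)
    case top then show thesis using upper by (simp add: top_unique)
  qed (rule that)
  have "real ?N * ?v \<le> h"
  proof (rule tendsto_le[OF trivial_limit_at_right_real])
    show "((\<lambda>\<eta>. ?v * (((1 + \<eta>) ^ ?N - 1) / \<eta>)) \<longlongrightarrow> real ?N * ?v) (at_right 0)"
      unfolding mult.commute[of "real ?N"] by (intro tendsto_intros tendsto_shell_quotient)
    have "((\<lambda>\<eta>. (1 + 2 * \<eta>) ^ ?d * (1 + \<eta>) * h) \<longlongrightarrow> (1 + 2 * 0) ^ ?d * (1 + 0) * h) (at_right (0::real))"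
      by (intro tendsto_intros)
    then show "((\<lambda>\<eta>. (1 + 2 * \<eta>) ^ ?d * (1 + \<eta>) * h) \<longlongrightarrow> h) (at_right (0::real))" by simp
    have "\<forall>\<^sub>F \<eta> in at_right (0::real). 0 < \<eta> \<and> \<eta> < 1"
      by (auto simp: eventually_at_right_field intro!: exI[of _ 1])
    then show "\<forall>\<^sub>F \<eta> in at_right (0::real). ?v * (((1 + \<eta>) ^ ?N - 1) / \<eta>) \<le> (1 + 2 * \<eta>) ^ ?d * (1 + \<eta>) * h"
    proof eventually_elim
      case (elim \<eta>)
      let ?c = "(1 + 2 * \<eta>) ^ ?d * (\<eta> + \<eta>\<^sup>2)"
      have c: "0 \<le> ?c" using elim by (intro mult_nonneg_nonneg) auto
      have "ennreal (?v * ((1 + \<eta>) ^ ?N - 1)) \<le> ennreal ?c * hausdorff_pre ?d \<eta> ?S"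
        using elim by (intro hausdorff_pre_sphere_ge) auto
      also have "\<dots> \<le> ennreal ?c * ennreal h"
        unfolding h(1)[symmetric] using elim by (intro mult_left_mono hausdorff_pre_le_outer) auto
      finally have "?v * ((1 + \<eta>) ^ ?N - 1) \<le> ?c * h"
        using c h(2) by (simp add: ennreal_mult'[symmetric] ennreal_le_iff)
      also have "?c * h = \<eta> * ((1 + 2 * \<eta>) ^ ?d * (1 + \<eta>) * h)"
        by (simp add: power2_eq_square algebra_simps)
      finally show ?case using elim by (simp add: field_simps)
    qed
  qed
  then show ?thesis using upper h by (simp add: antisym ennreal_leI)
qed

text \<open>On the sphere the second moments of the \<open>N\<close> coordinates add up to the total
  measure, which is \<open>N\<close> times the volume of the unit ball; so each of them equals that
  volume.\<close>

theorem nn_integral_sphere_inner_sq: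
  fixes e :: "real^'n"
  assumes e: "norm e = 1"
  shows "(\<integral>\<^sup>+\<omega>\<in>sphere 0 1. ennreal (\<bar>\<omega> \<bullet> e\<bar>\<^sup>2) \<partial>hausdorff_measure (CARD('n) - 1))
     = ennreal (unit_ball_vol (real CARD('n)))"
proof -
  let ?H = "hausdorff_measure (CARD('n) - 1) :: (real^'n) measure"
  let ?k = "indicator (sphere 0 1) :: real^'n \<Rightarrow> ennreal"
  have "of_nat CARD('n) * (\<integral>\<^sup>+x. ennreal ((x \<bullet> e)\<^sup>2) * ?k x \<partial>?H) = (\<integral>\<^sup>+x. ennreal ((norm x)\<^sup>2) * ?k x \<partial>?H)"
  proof (rule nn_integral_inner_sq[OF _ hausdorff_distr_orthogonal _ _ e])
    show "?k (f x) = ?k x" if "orthogonal_transformation f" for f x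
      using that by (simp add: indicator_def orthogonal_transformation)
    show "?k \<in> borel_measurable borel" by (rule borel_measurable_indicator) auto
  qed auto
  also have "\<dots> = (\<integral>\<^sup>+x. ?k x \<partial>?H)"
    by (intro nn_integral_cong) (auto simp: indicator_def)
  also have "\<dots> = ennreal (real CARD('n) * unit_ball_vol (real CARD('n)))"
    using hausdorff_outer_sphere[where 'n='n] by (simp add: emeasure_hausdorff)
  also have "\<dots> = of_nat CARD('n) * ennreal (unit_ball_vol (real CARD('n)))"
    by (simp add: ennreal_mult' ennreal_of_nat_eq_real_of_nat)
  finally show ?thesis by (simp add: ennreal_mult_cancel_left)
qed

section \<open>Smooth bumps\<close>

text \<open>The polynomial factor and the power \<open>k\<close> make the class closed under differentiation.\<close>

definition bump_class :: "real \<Rightarrow> real \<Rightarrow> (real \<Rightarrow> real) set" where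
  "bump_class a b = {f. \<exists>q k c. 0 < c \<and> (\<forall>t. f t = (if a < t \<and> t < b
     then poly q t * (exp (- (c / ((t - a) * (b - t)))) / ((t - a) * (b - t)) ^ k) else 0))}"

text \<open>One term of the exponential series, of degree \<open>k + 2\<close>, beats the power in
  the denominator and leaves \<open>w\<^sup>2\<close> to spare. This makes the bumps flat at the end
  points.\<close>

lemma exp_neg_inverse_div_power_le:
  fixes w c :: real
  assumes "0 < w" "0 < c"
  shows "exp (- (c / w)) / w ^ k \<le> fact (k + 2) / c ^ (k + 2) * w\<^sup>2"
proof -
  let ?x = "c / w" and ?m = "k + 2"
  have "summable (\<lambda>n. ?x ^ n /\<^sub>R fact n)" by (rule summable_exp_generic)
  from sum_le_suminf[OF this, of "{?m}"] have "?x ^ ?m / fact ?m \<le> exp ?x"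
    using assms by (simp add: exp_def divide_inverse mult.commute)
  then have "exp (- ?x) \<le> fact ?m / ?x ^ ?m"
  proof -
    assume *: "?x ^ ?m / fact ?m \<le> exp ?x"
    have "0 < ?x ^ ?m" using assms by simp
    have inv: "1 / e \<le> F / Y" if "Y / F \<le> e" "0 < Y" "0 < F" "0 < e" for e F Y :: real
      using that by (simp add: field_simps)
    show ?thesis
      unfolding exp_minus inverse_eq_divide by (rule inv[OF * \<open>0 < ?x ^ ?m\<close>]) auto
  qed
  then have "exp (- ?x) / w ^ k \<le> fact ?m / ?x ^ ?m / w ^ k"
    using assms by (intro divide_right_mono) auto
  also have "\<dots> = fact ?m / c ^ ?m * w\<^sup>2"
    using assms by (simp add: power_divide power_add field_simps power2_eq_square)
  finally show ?thesis .
qed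

lemma has_derivative_zero_if_quadratic:
  fixes f :: "real \<Rightarrow> real"
  assumes "f a = 0" "\<And>t. \<bar>f t\<bar> \<le> K * (t - a)\<^sup>2"
  shows "(f has_real_derivative 0) (at a)"
proof -
  have "((\<lambda>h. f (a + h) / h) \<longlongrightarrow> 0) (at 0)"
  proof (rule Lim_null_comparison)
    show "\<forall>\<^sub>F h in at 0. norm (f (a + h) / h) \<le> K * \<bar>h\<bar>"
    proof (rule eventually_at_filter[THEN iffD2], rule always_eventually, intro allI impI)
      fix h :: real assume "h \<noteq> 0"
      then show "norm (f (a + h) / h) \<le> K * \<bar>h\<bar>"
        using assms(2)[of "a + h"] by (simp add: abs_divide field_simps power2_eq_square)
    qed
    have "((\<lambda>h::real. K * \<bar>h\<bar>) \<longlongrightarrow> K * \<bar>0\<bar>) (at 0)" by (intro tendsto_intros)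
    then show "((\<lambda>h::real. K * \<bar>h\<bar>) \<longlongrightarrow> 0) (at 0)" by simp
  qed
  then show ?thesis using assms(1) by (simp add: DERIV_def)
qed

text \<open>Inside the interval the quotient rule stays in the class, with \<open>k + 2\<close> in
  place of \<open>k\<close>. At the end points the function is bounded by a multiple of the squared
  distance, so its derivative vanishes there.\<close>

lemma bump_class_derivative:
  assumes f: "f \<in> bump_class a b"
  obtains g where "g \<in> bump_class a b" "\<And>t. (f has_real_derivative g t) (at t)"
proof -
  obtain q k c where c: "0 < c" and f: "\<And>t. f t = (if a < t \<and> t < b
     then poly q t * (exp (- (c / ((t - a) * (b - t)))) / ((t - a) * (b - t)) ^ k) else 0)"
    using f unfolding bump_class_def by auto
  define W where "W = [:- (a * b), a + b, - 1:]"
  have W: "poly W t = (t - a) * (b - t)" for t by (simp add: W_def algebra_simps)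
  \<comment> \<open>Numerator of the derivative over \<open>W ^ (k + 2)\<close>: the three terms
    come from differentiating \<open>q\<close>, the power of \<open>W\<close> and the
    exponential.\<close>
  define p where "p = pderiv q * W ^ 2 - smult (of_nat k) (q * pderiv W * W) + smult c (q * pderiv W)"
  define g where "g t = (if a < t \<and> t < b
     then poly p t * (exp (- (c / ((t - a) * (b - t)))) / ((t - a) * (b - t)) ^ (k + 2)) else 0)" for t
  have "g \<in> bump_class a b" unfolding bump_class_def using c g_def by blast
  moreover have "(f has_real_derivative g t) (at t)" for t
  proof -
    consider "a < t \<and> t < b" | "t < a \<or> b < t" | "t = a \<or> t = b" by linarith
    then show ?thesis
    proof cases
      case 1
      let ?w = "poly W t"
      have w: "?w > 0" using 1 by (simp add: W)
      have "((\<lambda>t. poly q t * (exp (- (c / poly W t)) / poly W t ^ k)) has_real_derivative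
         (poly (pderiv q) t * (exp (- (c / ?w)) / ?w ^ k) + poly q t *
           ((exp (- (c / ?w)) * (c * poly (pderiv W) t / ?w\<^sup>2) * ?w ^ k - exp (- (c / ?w)) * (of_nat k * poly (pderiv W) t * ?w ^ (k - 1))) / (?w ^ k)\<^sup>2))) (at t)"
      proof -
        have h1: "((\<lambda>t. exp (- (c / poly W t))) has_real_derivative (exp (- (c / ?w)) * (c * poly (pderiv W) t / ?w\<^sup>2))) (at t)"
          using w by (auto intro!: derivative_eq_intros simp: power2_eq_square)
        have h2: "((\<lambda>t. poly W t ^ k) has_real_derivative (of_nat k * poly (pderiv W) t * ?w ^ (k - 1))) (at t)"
          by (auto intro!: derivative_eq_intros)
        have nz: "?w ^ k \<noteq> 0" using w by simp
        show ?thesis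
          by (rule DERIV_cong[OF DERIV_mult[OF poly_DERIV DERIV_divide[OF h1 h2 nz]]])
            (simp add: power2_eq_square mult.commute)
      qed
      also have "(poly (pderiv q) t * (exp (- (c / ?w)) / ?w ^ k) + poly q t *
           ((exp (- (c / ?w)) * (c * poly (pderiv W) t / ?w\<^sup>2) * ?w ^ k - exp (- (c / ?w)) * (of_nat k * poly (pderiv W) t * ?w ^ (k - 1))) / (?w ^ k)\<^sup>2)) = g t"
      proof -
        have "of_nat k * ?w ^ (k - 1) = of_nat k * ?w ^ k / ?w" using w by (cases k) auto
        moreover have "exp (- (c / ?w)) * (of_nat k * poly (pderiv W) t * ?w ^ (k - 1)) = exp (- (c / ?w)) * poly (pderiv W) t * (of_nat k * ?w ^ (k - 1))"
          by (simp only: mult_ac)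
        ultimately have "exp (- (c / ?w)) * (of_nat k * poly (pderiv W) t * ?w ^ (k - 1)) = exp (- (c / ?w)) * poly (pderiv W) t * (of_nat k * ?w ^ k / ?w)"
          by (simp only:)
        then show ?thesis
          using w 1 unfolding g_def W[symmetric] p_def
          by (auto simp add: field_simps power_add power2_eq_square)
      qed
      finally have "((\<lambda>t. poly q t * (exp (- (c / poly W t)) / poly W t ^ k)) has_real_derivative g t) (at t)" .
      then show ?thesis
        by (rule has_field_derivative_transform_within_open[where S="{a<..<b}"]) (use 1 in \<open>auto simp: f W\<close>)
    next
      case 2
      have "((\<lambda>_. 0) has_real_derivative 0) (at t)" by simp
      then have "(f has_real_derivative 0) (at t)"
        by (rule has_field_derivative_transform_within_open[where S="{..<a} \<union> {b<..}"]) (use 2 in \<open>auto simp: f\<close>)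
      then show ?thesis using 2 by (auto simp: g_def)
    next
      case 3
      obtain M where M: "\<And>s. s \<in> {a..b} \<Longrightarrow> \<bar>poly q s\<bar> \<le> M" "0 < M"
      proof -
        have "bounded (poly q ` {a..b})"
          by (intro compact_imp_bounded compact_continuous_image continuous_intros) auto
        then obtain M where "0 < M" "\<And>s. s \<in> {a..b} \<Longrightarrow> norm (poly q s) \<le> M" unfolding bounded_pos by blast
        then show thesis using that[of M] by auto
      qed
      \<comment> \<open>The product \<open>(s - a) * (b - s)\<close> is at most \<open>b - a\<close>
        times the distance from \<open>s\<close> to the end point \<open>t\<close>; inserting this
        square into the exponential bound gives \<open>K\<close>.\<close>
      define K where "K = M * (fact (k + 2) / c ^ (k + 2) * (b - a)\<^sup>2)"
      have K: "0 \<le> K" unfolding K_def using c M by auto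
      have bound: "\<bar>f s\<bar> \<le> K * (s - t)\<^sup>2" for s
      proof (cases "a < s \<and> s < b")
        case True
        let ?w = "(s - a) * (b - s)"
        have w: "0 < ?w" using True by simp
        have "?w \<le> (b - a) * \<bar>s - t\<bar>"
          using 3
        proof
          assume "t = a"
          then show ?thesis using True mult_right_mono[of "b - s" "b - a" "s - a"] by (simp add: mult.commute)
        next
          assume "t = b"
          then show ?thesis using True mult_right_mono[of "s - a" "b - a" "b - s"] by simp
        qed
        then have w2: "?w\<^sup>2 \<le> ((b - a) * \<bar>s - t\<bar>)\<^sup>2" using w by (intro power_mono) auto
        have "\<bar>f s\<bar> = \<bar>poly q s\<bar> * (exp (- (c / ?w)) / ?w ^ k)"
          using True w unfolding f by (simp add: abs_mult)
        also have "\<dots> \<le> M * (fact (k + 2) / c ^ (k + 2) * ?w\<^sup>2)"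
          using True w M c by (intro mult_mono exp_neg_inverse_div_power_le) auto
        also have "\<dots> \<le> M * (fact (k + 2) / c ^ (k + 2) * ((b - a) * \<bar>s - t\<bar>)\<^sup>2)"
          using M c by (intro mult_left_mono w2) auto
        finally show ?thesis by (simp add: K_def power_mult_distrib mult_ac)
      qed (use K in \<open>auto simp: f\<close>)
      have "(f has_real_derivative 0) (at t)"
        by (rule has_derivative_zero_if_quadratic[OF _ bound]) (use 3 in \<open>auto simp: f\<close>)
      then show ?thesis using 3 by (auto simp: g_def)
    qed
  qed
  ultimately show thesis by (rule that)
qed

lemma bump_class_shift: "f \<in> bump_class a b \<Longrightarrow> (\<lambda>t. f (t - h)) \<in> bump_class (a + h) (b + h)"
proof -
  assume "f \<in> bump_class a b"
  then obtain q k c where c: "0 < c" and f: "\<And>t. f t = (if a < t \<and> t < b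
     then poly q t * (exp (- (c / ((t - a) * (b - t)))) / ((t - a) * (b - t)) ^ k) else 0)"
    unfolding bump_class_def by auto
  have "f (t - h) = (if a + h < t \<and> t < b + h then poly (q \<circ>\<^sub>p [:- h, 1:]) t *
      (exp (- (c / ((t - (a + h)) * (b + h - t)))) / ((t - (a + h)) * (b + h - t)) ^ k) else 0)" for t
    unfolding f poly_pcompose by (simp add: algebra_simps less_diff_eq diff_less_eq)
  then show "(\<lambda>t. f (t - h)) \<in> bump_class (a + h) (b + h)"
    unfolding bump_class_def using c by blast
qed

text \<open>Products of one-variable bumps: a partial derivative changes one factor and stays in the
  class, so smoothness of all orders is a simple induction. They also approximate indicators of
  boxes.\<close>

definition bump_fun :: "real^'n \<Rightarrow> real^'n \<Rightarrow> (real^'n \<Rightarrow> real) set" where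
  "bump_fun a b = {\<phi>. \<exists>\<theta>. (\<forall>i. \<theta> i \<in> bump_class (a $ i) (b $ i)) \<and> (\<forall>x. \<phi> x = (\<Prod>i\<in>UNIV. \<theta> i (x $ i)))}"

text \<open>In the product rule for direction \<open>j\<close> only the summand that differentiates
  the factor \<open>\<theta> j\<close> survives.\<close>

lemma bump_fun_derivative:
  fixes a b :: "real^'n::finite"
  assumes "\<phi> \<in> bump_fun a b"
  shows "\<phi> differentiable at x" and "partial_deriv j \<phi> \<in> bump_fun a b"
    and "(\<phi> has_derivative (\<lambda>h. \<Sum>j\<in>UNIV. h $ j * partial_deriv j \<phi> x)) (at x)"
proof -
  obtain \<theta> where \<theta>: "\<And>i. \<theta> i \<in> bump_class (a $ i) (b $ i)" and \<phi>: "\<And>x. \<phi> x = (\<Prod>i\<in>UNIV. \<theta> i (x $ i))"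
    using assms unfolding bump_fun_def by blast
  have "\<exists>g. g \<in> bump_class (a $ i) (b $ i) \<and> (\<forall>t. (\<theta> i has_real_derivative g t) (at t))" for i
    using bump_class_derivative[OF \<theta>[of i]] by metis
  then obtain \<theta>' where \<theta>': "\<And>i. \<theta>' i \<in> bump_class (a $ i) (b $ i)" "\<And>i t. (\<theta> i has_real_derivative \<theta>' i t) (at t)"
    by metis
  have der1: "((\<lambda>x. \<theta> i (x $ i)) has_derivative (\<lambda>h. h $ i * \<theta>' i (x $ i))) (at x)" for i x
  proof -
    have "((\<lambda>x. x $ i) has_derivative (\<lambda>h. h $ i)) (at x)"
      by (rule bounded_linear.has_derivative[OF bounded_linear_vec_nth has_derivative_ident])
    from has_derivative_compose[OF this \<theta>'(2)[of i "x $ i", unfolded has_field_derivative_def]]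
    show ?thesis by (simp add: mult.commute)
  qed
  have der: "(\<phi> has_derivative (\<lambda>h. \<Sum>i\<in>UNIV. h $ i * \<theta>' i (x $ i) * (\<Prod>j\<in>UNIV - {i}. \<theta> j (x $ j)))) (at x)" for x
    unfolding \<phi>[abs_def] by (rule has_derivative_prod) (rule der1)
  then show "\<phi> differentiable at x" unfolding differentiable_def by blast
  have pd: "partial_deriv j \<phi> x = (\<Prod>i\<in>UNIV. (if i = j then \<theta>' j else \<theta> i) (x $ i))" for j x
  proof -
    have "partial_deriv j \<phi> x = (\<Sum>i\<in>UNIV. axis j 1 $ i * \<theta>' i (x $ i) * (\<Prod>j\<in>UNIV - {i}. \<theta> j (x $ j)))"
      unfolding partial_deriv_def frechet_derivative_at[OF der[of x], symmetric] ..
    also have "\<dots> = \<theta>' j (x $ j) * (\<Prod>i\<in>UNIV - {j}. \<theta> i (x $ i))"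
      by (subst sum.remove[of _ j]) (auto simp: axis_def intro!: sum.neutral)
    also have "\<dots> = (\<Prod>i\<in>UNIV. (if i = j then \<theta>' j else \<theta> i) (x $ i))"
      by (subst (2) prod.remove[of _ j]) (auto intro!: prod.cong)
    finally show ?thesis .
  qed
  show "partial_deriv j \<phi> \<in> bump_fun a b"
    unfolding bump_fun_def mem_Collect_eq
    by (rule exI[of _ "\<lambda>i. if i = j then \<theta>' j else \<theta> i"]) (use pd \<theta> \<theta>' in auto)
  have "h $ i * \<theta>' i (x $ i) * (\<Prod>j\<in>UNIV - {i}. \<theta> j (x $ j)) = h $ i * partial_deriv i \<phi> x" for h i
    unfolding pd by (subst prod.remove[of _ i]) (auto intro!: prod.cong)
  then show "(\<phi> has_derivative (\<lambda>h. \<Sum>j\<in>UNIV. h $ j * partial_deriv j \<phi> x)) (at x)"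
    using der[of x] by (simp only:)
qed

lemma bump_fun_continuous: "\<phi> \<in> bump_fun a b \<Longrightarrow> continuous_on UNIV \<phi>"
  by (rule differentiable_imp_continuous_on) (simp add: differentiable_on_def bump_fun_derivative)

lemma bump_fun_Ck: "\<phi> \<in> bump_fun a b \<Longrightarrow> Ck_fun k \<phi>"
  by (induction k arbitrary: \<phi>) (auto intro: bump_fun_continuous bump_fun_derivative)

lemma bump_fun_zero:
  assumes "\<phi> \<in> bump_fun a b" "x \<notin> box a b"
  shows "\<phi> x = 0"
proof -
  obtain \<theta> where \<theta>: "\<And>i. \<theta> i \<in> bump_class (a $ i) (b $ i)" and \<phi>: "\<And>x. \<phi> x = (\<Prod>i\<in>UNIV. \<theta> i (x $ i))"
    using assms unfolding bump_fun_def by blast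
  obtain i where "\<not> (a $ i < x $ i \<and> x $ i < b $ i)" using assms(2) by (auto simp: mem_box_cart)
  then have "\<theta> i (x $ i) = 0" using \<theta>[of i] unfolding bump_class_def by auto
  then show ?thesis unfolding \<phi> by (auto intro!: prod_zero)
qed

lemma bump_fun_test_function:
  assumes "\<phi> \<in> bump_fun a b" "cbox a b \<subseteq> \<Omega>"
  shows "test_function \<Omega> \<phi>"
proof -
  have "{x. \<phi> x \<noteq> 0} \<subseteq> cbox a b" using bump_fun_zero[OF assms(1)] box_subset_cbox by blast
  then have sub: "closure {x. \<phi> x \<noteq> 0} \<subseteq> cbox a b" by (rule closure_minimal) (rule closed_cbox)
  then have "compact (closure {x. \<phi> x \<noteq> 0})"
    using bounded_subset[OF bounded_cbox sub] by (simp add: compact_eq_bounded_closed)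
  then show ?thesis
    using sub assms bump_fun_Ck[OF assms(1)] unfolding test_function_def by auto
qed

lemma bump_fun_shift: "\<phi> \<in> bump_fun a b \<Longrightarrow> (\<lambda>x. \<phi> (x - h)) \<in> bump_fun (a + h) (b + h)"
proof -
  assume "\<phi> \<in> bump_fun a b"
  then obtain \<theta> where \<theta>: "\<And>i. \<theta> i \<in> bump_class (a $ i) (b $ i)" and \<phi>: "\<And>x. \<phi> x = (\<Prod>i\<in>UNIV. \<theta> i (x $ i))"
    unfolding bump_fun_def by blast
  show ?thesis
    unfolding bump_fun_def mem_Collect_eq
    by (rule exI[of _ "\<lambda>i t. \<theta> i (t - h $ i)"]) (use \<phi> bump_class_shift[OF \<theta>] in auto)
qed

lemma bump_fun_partial_shift:
  fixes \<phi> :: "real^'n::finite \<Rightarrow> real"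
  assumes "\<phi> \<in> bump_fun a b"
  shows "partial_deriv j (\<lambda>x. \<phi> (x - h)) x = partial_deriv j \<phi> (x - h)"
proof -
  have "((\<lambda>x. x - h) has_derivative (\<lambda>v. v)) (at x)" by (auto intro!: derivative_eq_intros)
  from has_derivative_compose[OF this bump_fun_derivative(3)[OF assms, of "x - h"]]
  have "((\<lambda>x. \<phi> (x - h)) has_derivative (\<lambda>v. \<Sum>j\<in>UNIV. v $ j * partial_deriv j \<phi> (x - h))) (at x)" .
  from frechet_derivative_at[OF this, symmetric] show ?thesis
    unfolding partial_deriv_def[of j "\<lambda>x. \<phi> (x - h)"]
    by (simp add: axis_def if_distrib[where f="\<lambda>c. c * _"] cong: if_cong)
qed

lemma bump_fun_bounded:
  assumes "\<phi> \<in> bump_fun a b"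
  obtains M where "0 \<le> M" "\<And>x. \<bar>\<phi> x\<bar> \<le> M"
proof -
  have "bounded (\<phi> ` cbox a b)"
    using bump_fun_continuous[OF assms]
    by (intro compact_imp_bounded compact_continuous_image) (auto intro: continuous_on_subset)
  then obtain M where M: "0 < M" "\<And>x. x \<in> cbox a b \<Longrightarrow> norm (\<phi> x) \<le> M" unfolding bounded_pos by blast
  have "\<bar>\<phi> x\<bar> \<le> M" for x
    using M bump_fun_zero[OF assms, of x] box_subset_cbox[of a b] by (cases "x \<in> box a b") auto
  then show thesis using that[of M] M by simp
qed

text \<open>The constant in the exponent is \<open>1 / (n + 1)\<close>. As it tends to 0, each
  factor increases to 1 inside its interval, and it is 0 outside for all \<open>n\<close>.\<close>

lemma bump_fun_approx_box:
  fixes a b :: "real^'n::finite"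
  obtains \<phi> where "\<And>n. \<phi> n \<in> bump_fun a b" "\<And>n x. 0 \<le> \<phi> n x \<and> \<phi> n x \<le> 1"
    "\<And>x. (\<lambda>n. \<phi> n x) \<longlonglongrightarrow> indicator (box a b) x"
proof -
  define \<theta> where "\<theta> n i t = (if a $ i < t \<and> t < b $ i then exp (- (1 / real (Suc n) / ((t - a $ i) * (b $ i - t)))) else 0)" for n i t
  define \<phi> where "\<phi> n x = (\<Prod>i\<in>UNIV. \<theta> n i (x $ i))" for n and x :: "real^'n"
  have "\<theta> n i \<in> bump_class (a $ i) (b $ i)" for n i
    unfolding bump_class_def mem_Collect_eq
    by (rule exI[of _ 1], rule exI[of _ 0], rule exI[of _ "1 / real (Suc n)"]) (simp add: \<theta>_def)
  then have 1: "\<phi> n \<in> bump_fun a b" for n unfolding bump_fun_def \<phi>_def by blast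
  have "0 \<le> \<theta> n i t \<and> \<theta> n i t \<le> 1" for n i t by (auto simp: \<theta>_def)
  then have 2: "0 \<le> \<phi> n x \<and> \<phi> n x \<le> 1" for n x unfolding \<phi>_def by (auto intro!: prod_nonneg prod_le_1)
  have 3: "(\<lambda>n. \<phi> n x) \<longlonglongrightarrow> indicator (box a b) x" for x
  proof (cases "x \<in> box a b")
    case False
    then show ?thesis using bump_fun_zero[OF 1 False] by simp
  next
    case True
    have "(\<lambda>n. \<theta> n i (x $ i)) \<longlonglongrightarrow> 1" for i
    proof -
      have "(\<lambda>n. exp (- (1 / real (Suc n) / ((x $ i - a $ i) * (b $ i - x $ i))))) \<longlonglongrightarrow> exp (- (0 / ((x $ i - a $ i) * (b $ i - x $ i))))"
        by (intro tendsto_intros LIMSEQ_Suc[OF lim_1_over_n]) (use True[unfolded mem_box_cart, rule_format, of i] in auto)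
      then show ?thesis using True by (simp add: \<theta>_def mem_box_cart)
    qed
    then have "(\<lambda>n. \<phi> n x) \<longlonglongrightarrow> (\<Prod>i\<in>(UNIV::'n set). 1)"
      unfolding \<phi>_def by (intro tendsto_prod)
    then show ?thesis using True by simp
  qed
  from 1 2 3 show thesis by (rule that)
qed

section \<open>Weak gradients along segments\<close>

text \<open>Lebesgue differentiation: for almost every \<open>x\<close> the averages of
  \<open>w\<close> over small cubes with corner \<open>x\<close> converge to \<open>w x\<close>. If
  \<open>x\<close> lies in the open set \<open>U\<close>, so do these cubes, and the averages
  vanish.\<close>

lemma AE_zero_if_box_integrals_zero:
  fixes w :: "'a::euclidean_space \<Rightarrow> 'b::euclidean_space"
  assumes w: "integrable lborel w" and U: "open U"
    and zero: "\<And>a b. cbox a b \<subseteq> U \<Longrightarrow> (\<integral>x. indicator (box a b) x *\<^sub>R w x \<partial>lborel) = 0"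
  shows "AE x in lborel. x \<in> U \<longrightarrow> w x = 0"
proof -
  have abs: "set_integrable lborel S w" if "S \<in> sets borel" for S
    unfolding set_integrable_def by (rule integrable_mult_indicator) (use w that in auto)
  have hk: "(w has_integral (\<integral>x. indicator (cbox a b) x *\<^sub>R w x \<partial>lborel)) (cbox a b)" for a b
    using set_borel_integral_eq_integral[OF abs[of "cbox a b"]]
    by (simp add: set_lebesgue_integral_def has_integral_integral)
  then have "w integrable_on cbox a b" for a b by blast
  from integrable_ccontinuous_explicit[OF this]
  obtain N where N: "negligible N" "\<And>x e. x \<notin> N \<Longrightarrow> 0 < e \<Longrightarrow> \<exists>d>0. \<forall>h. 0 < h \<and> h < d \<longrightarrow>
         norm (integral (cbox x (x + h *\<^sub>R One)) w /\<^sub>R h ^ DIM('a) - w x) < e" by metis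
  have int0: "integral (cbox a b) w = 0" if "cbox a b \<subseteq> U" for a b
  proof -
    have "AE x in lborel. x \<notin> cbox a b - box a b"
      by (rule AE_not_in) (rule null_sets_cbox_Diff_box)
    then have "(\<integral>x. indicator (cbox a b) x *\<^sub>R w x \<partial>lborel) = (\<integral>x. indicator (box a b) x *\<^sub>R w x \<partial>lborel)"
      using w box_subset_cbox[of a b] by (intro integral_cong_AE) (auto simp: indicator_def)
    then show ?thesis using zero[OF that] hk[of a b] by (simp add: integral_unique)
  qed
  have "w x = 0" if xN: "x \<notin> N" and xU: "x \<in> U" for x
  proof (rule ccontr)
    assume "w x \<noteq> 0"
    then obtain d where d: "0 < d" "\<And>h. 0 < h \<and> h < d \<Longrightarrow>
         norm (integral (cbox x (x + h *\<^sub>R One)) w /\<^sub>R h ^ DIM('a) - w x) < norm (w x)"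
      using N(2)[OF xN, of "norm (w x)"] by auto
    obtain r where r: "0 < r" "ball x r \<subseteq> U" using U xU by (meson open_contains_ball)
    \<comment> \<open>Points of the cube of side \<open>h\<close> at \<open>x\<close> differ from
      \<open>x\<close> by at most \<open>h\<close> in each coordinate, hence by at most
      \<open>DIM('a)\<close> times \<open>h\<close> in norm; this is kept below
      \<open>r\<close>.\<close>
    define h where "h = min (d / 2) (r / (2 * real DIM('a)))"
    have h: "0 < h" "h < d" "real DIM('a) * h < r"
      using d r DIM_positive[where 'a='a] by (auto simp: h_def min_def field_simps)
    have "cbox x (x + h *\<^sub>R One) \<subseteq> ball x r"
    proof
      fix y assume y: "y \<in> cbox x (x + h *\<^sub>R One)"
      have "norm (y - x) \<le> (\<Sum>i\<in>Basis. \<bar>(y - x) \<bullet> i\<bar>)" by (rule norm_le_l1)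
      also have "\<dots> \<le> (\<Sum>i\<in>(Basis::'a set). h)"
        using y by (intro sum_mono) (auto simp: mem_box inner_diff_left inner_add_left)
      also have "\<dots> < r" using h by simp
      finally show "y \<in> ball x r" by (simp add: dist_norm norm_minus_commute)
    qed
    then have "integral (cbox x (x + h *\<^sub>R One)) w = 0" using r by (intro int0) auto
    then show False using d(2)[of h] h by simp
  qed
  then have "{x. \<not> (x \<in> U \<longrightarrow> w x = 0)} \<subseteq> N" by blast
  then have "negligible {x. \<not> (x \<in> U \<longrightarrow> w x = 0)}" using N(1) negligible_subset by blast
  then have "AE x in lebesgue. x \<in> U \<longrightarrow> w x = 0"
    by (auto simp: negligible_iff_null_sets intro!: AE_I'[where N="{x. \<not> (x \<in> U \<longrightarrow> w x = 0)}"])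
  then show ?thesis by (simp add: AE_completion_iff)
qed

section \<open>Translations under the integral\<close>

lemma lborel_distr_plus_right: "distr lborel borel (\<lambda>x. x + c) = (lborel :: 'a::euclidean_space measure)"
proof -
  have "(\<lambda>x. x + c) = (+) c" by (auto simp: add.commute)
  then show ?thesis by (simp add: lborel_distr_plus)
qed

lemma integral_translate:
  fixes f :: "'a::euclidean_space \<Rightarrow> 'b::{banach,second_countable_topology}"
  assumes [measurable]: "f \<in> borel_measurable borel"
  shows "(\<integral>x. f (x + c) \<partial>lborel) = (\<integral>x. f x \<partial>lborel)"
  using integral_distr[of "\<lambda>x. x + c" lborel borel f] by (simp add: lborel_distr_plus_right)

lemma nn_integral_translate:
  fixes f :: "'a::euclidean_space \<Rightarrow> ennreal"
  assumes [measurable]: "f \<in> borel_measurable borel"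
  shows "(\<integral>\<^sup>+x. f (x + c) \<partial>lborel) = (\<integral>\<^sup>+x. f x \<partial>lborel)"
  using nn_integral_distr[of "\<lambda>x. x + c" lborel borel f] by (simp add: lborel_distr_plus_right)

lemma integrable_translate:
  fixes f :: "'a::euclidean_space \<Rightarrow> 'b::{banach,second_countable_topology}"
  assumes "integrable lborel f"
  shows "integrable lborel (\<lambda>x. f (x + c))"
proof -
  have [measurable]: "f \<in> borel_measurable borel" using assms by auto
  show ?thesis
    using assms integrable_distr_eq[of "\<lambda>x. x + c" lborel borel f] by (simp add: lborel_distr_plus_right)
qed

text \<open>For fixed \<open>t\<close> the integrand is dominated by \<open>M\<close> times a
  translate of \<open>f\<close>, whose norm has the same integral for all \<open>t\<close>. This
  licenses the uses of Fubini's theorem in \<open>bump_segment_identity\<close>.\<close>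

lemma integrable_segment:
  fixes f :: "'a::euclidean_space \<Rightarrow> 'b::{banach,second_countable_topology}"
  assumes f: "integrable lborel f" and \<psi>: "continuous_on UNIV \<psi>" "\<And>y. \<bar>\<psi> y :: real\<bar> \<le> M"
  shows "integrable (lborel \<Otimes>\<^sub>M lborel) (\<lambda>(y::'a, t::real). (indicator {0..1} t * \<psi> (y + t *\<^sub>R l)) *\<^sub>R f (y + t *\<^sub>R k))"
proof (rule integrableI_bounded)
  have [measurable]: "f \<in> borel_measurable borel" "\<psi> \<in> borel_measurable borel"
    using f \<psi> by (auto intro: borel_measurable_continuous_onI)
  show "(\<lambda>(y::'a, t::real). (indicator {0..1} t * \<psi> (y + t *\<^sub>R l)) *\<^sub>R f (y + t *\<^sub>R k)) \<in> borel_measurable (lborel \<Otimes>\<^sub>M lborel)"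
    by measurable
  have M: "0 \<le> M" using \<psi>(2)[of 0] by linarith
  have "(\<integral>\<^sup>+z. norm (case z of (y::'a, t::real) \<Rightarrow> (indicator {0..1} t * \<psi> (y + t *\<^sub>R l)) *\<^sub>R f (y + t *\<^sub>R k)) \<partial>(lborel \<Otimes>\<^sub>M lborel))
     \<le> (\<integral>\<^sup>+z. (case z of (y::'a, t::real) \<Rightarrow> ennreal M * (indicator {0..1} t * ennreal (norm (f (y + t *\<^sub>R k))))) \<partial>(lborel \<Otimes>\<^sub>M lborel))"
  proof (rule nn_integral_mono, clarify)
    fix y :: 'a and t :: real
    have "indicator {0..1} t * \<bar>\<psi> (y + t *\<^sub>R l)\<bar> * norm (f (y + t *\<^sub>R k)) \<le> M * (indicator {0..1} t * norm (f (y + t *\<^sub>R k)))"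
      using \<psi>(2)[of "y + t *\<^sub>R l"] by (auto simp: indicator_def intro!: mult_right_mono)
    then show "ennreal (norm ((indicator {0..1} t * \<psi> (y + t *\<^sub>R l)) *\<^sub>R f (y + t *\<^sub>R k))) \<le> ennreal M * (indicator {0..1} t * ennreal (norm (f (y + t *\<^sub>R k))))"
      using M by (auto simp: abs_mult ennreal_mult'[symmetric] indicator_def intro!: ennreal_leI)
  qed
  also have "\<dots> = (\<integral>\<^sup>+t. \<integral>\<^sup>+y. ennreal M * (indicator {0..1} t * ennreal (norm (f (y + t *\<^sub>R k)))) \<partial>lborel \<partial>(lborel :: real measure))"
    by (subst lborel_pair.nn_integral_snd[symmetric]) simp_all
  also have "\<dots> = (\<integral>\<^sup>+t. ennreal M * (indicator {0..1} t * (\<integral>\<^sup>+y. ennreal (norm (f y)) \<partial>lborel)) \<partial>(lborel :: real measure))"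
  proof (rule nn_integral_cong)
    fix t :: real
    have "(\<integral>\<^sup>+y. ennreal M * (indicator {0..1} t * ennreal (norm (f (y + t *\<^sub>R k)))) \<partial>lborel)
       = ennreal M * (indicator {0..1} t * (\<integral>\<^sup>+y. ennreal (norm (f (y + t *\<^sub>R k))) \<partial>lborel))"
      by (simp add: nn_integral_cmult)
    also have "(\<integral>\<^sup>+y. ennreal (norm (f (y + t *\<^sub>R k))) \<partial>lborel) = (\<integral>\<^sup>+y. ennreal (norm (f y)) \<partial>lborel)"
      by (rule nn_integral_translate) measurable
    finally show "(\<integral>\<^sup>+y. ennreal M * (indicator {0..1} t * ennreal (norm (f (y + t *\<^sub>R k)))) \<partial>lborel)
       = ennreal M * (indicator {0..1} t * (\<integral>\<^sup>+y. ennreal (norm (f y)) \<partial>lborel))" .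
  qed
  also have "\<dots> = ennreal M * (\<integral>\<^sup>+y. ennreal (norm (f y)) \<partial>lborel)"
    by (simp add: nn_integral_cmult nn_integral_multc)
  also have "\<dots> < \<infinity>"
    using f by (simp add: integrable_iff_bounded ennreal_mult_less_top)
  finally show "(\<integral>\<^sup>+z. norm (case z of (y::'a, t::real) \<Rightarrow> (indicator {0..1} t * \<psi> (y + t *\<^sub>R l)) *\<^sub>R f (y + t *\<^sub>R k)) \<partial>(lborel \<Otimes>\<^sub>M lborel)) < \<infinity>" .
qed

definition dir_deriv :: "(real^'n::finite \<Rightarrow> complex^'n) \<Rightarrow> real^'n \<Rightarrow> real^'n \<Rightarrow> complex" where
  "dir_deriv g k x = (\<Sum>j\<in>UNIV. (k $ j) *\<^sub>R (g x $ j))"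

text \<open>The weak gradient identity tested on bumps only and written with integrals over the
  whole space, where the bump confines them to its box.\<close>

definition weak_gradient_on_bumps ::
    "(real^'n::finite) set \<Rightarrow> (real^'n \<Rightarrow> complex) \<Rightarrow> (real^'n \<Rightarrow> complex^'n) \<Rightarrow> bool" where
  "weak_gradient_on_bumps \<Omega> u g \<longleftrightarrow> (\<forall>a b \<phi> j. cbox a b \<subseteq> \<Omega> \<longrightarrow> \<phi> \<in> bump_fun a b \<longrightarrow>
     (\<integral>x. partial_deriv j \<phi> x *\<^sub>R u x \<partial>lborel) = - (\<integral>x. \<phi> x *\<^sub>R (g x $ j) \<partial>lborel))"

text \<open>The translates of \<open>\<phi>\<close> by \<open>- t k\<close> are test functions as well; integrating the weak gradient identity
  for them over \<open>t\<close> makes the fundamental theorem of calculus for \<open>\<phi>\<close> one for \<open>u\<close>.\<close>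

lemma bump_segment_identity:
  fixes u :: "real^'n::finite \<Rightarrow> complex" and g :: "real^'n \<Rightarrow> complex^'n"
  assumes u: "integrable lborel u" and g: "integrable lborel g"
    and weak: "weak_gradient_on_bumps \<Omega> u g"
    and \<phi>: "\<phi> \<in> bump_fun a b" and seg: "\<And>t. t \<in> {0..1} \<Longrightarrow> cbox (a + t *\<^sub>R k) (b + t *\<^sub>R k) \<subseteq> \<Omega>"
  shows "(\<integral>y. \<phi> y *\<^sub>R (u (y + k) - u y - (\<integral>t. indicator {0..1} t *\<^sub>R dir_deriv g k (y + t *\<^sub>R k) \<partial>lborel)) \<partial>lborel) = 0"
proof -
  have [measurable]: "u \<in> borel_measurable borel" "g \<in> borel_measurable borel" using u g by auto
  have gk: "integrable lborel (dir_deriv g k)"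
    unfolding dir_deriv_def[abs_def]
    by (intro Bochner_Integration.integrable_sum integrable_scaleR_right
        integrable_bounded_linear[OF bounded_linear_vec_nth g])
  have [measurable]: "dir_deriv g k \<in> borel_measurable borel" using gk by auto
  obtain M where M: "0 \<le> M" "\<And>x. \<bar>\<phi> x\<bar> \<le> M" using bump_fun_bounded[OF \<phi>] by blast
  have c\<phi>: "continuous_on UNIV \<phi>" by (rule bump_fun_continuous[OF \<phi>])
  have [measurable]: "\<phi> \<in> borel_measurable borel" using c\<phi> by (rule borel_measurable_continuous_onI)
  define D where "D x = (\<Sum>j\<in>UNIV. k $ j * partial_deriv j \<phi> x)" for x
  have cpd: "continuous_on UNIV (partial_deriv j \<phi>)" for j
    by (rule bump_fun_continuous[OF bump_fun_derivative(2)[OF \<phi>]])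
  have cD: "continuous_on UNIV D" unfolding D_def by (intro continuous_intros cpd)
  have "\<forall>j. \<exists>M. 0 \<le> M \<and> (\<forall>x. \<bar>partial_deriv j \<phi> x\<bar> \<le> M)"
    using bump_fun_bounded[OF bump_fun_derivative(2)[OF \<phi>]] by metis
  then obtain MM where MM: "\<And>j. 0 \<le> MM j" "\<And>j x. \<bar>partial_deriv j \<phi> x\<bar> \<le> MM j" by metis
  have bD: "\<bar>D x\<bar> \<le> (\<Sum>j\<in>UNIV. \<bar>k $ j\<bar> * MM j)" for x
    unfolding D_def by (rule order_trans[OF sum_abs]) (auto simp: abs_mult intro!: sum_mono mult_left_mono MM)
  have [measurable]: "D \<in> borel_measurable borel" using cD by (rule borel_measurable_continuous_onI)
  have int_bdd: "integrable lborel (\<lambda>y. \<psi> y *\<^sub>R f y)" if "integrable lborel f" "continuous_on UNIV \<psi>" "\<And>y. \<bar>\<psi> y\<bar> \<le> K"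
    for f :: "real^'n \<Rightarrow> complex" and \<psi> K
  proof -
    have [measurable]: "f \<in> borel_measurable borel" "\<psi> \<in> borel_measurable borel"
      using that by (auto intro: borel_measurable_continuous_onI)
    have "integrable lborel (\<lambda>y. K *\<^sub>R norm (f y))" using that by auto
    then show ?thesis
    proof (rule Bochner_Integration.integrable_bound)
      have "norm (\<psi> y *\<^sub>R f y) \<le> norm (K *\<^sub>R norm (f y))" for y
        using that(3)[of y] by (auto intro!: mult_right_mono simp: abs_mult)
      then show "AE y in lborel. norm (\<psi> y *\<^sub>R f y) \<le> norm (K *\<^sub>R norm (f y))" by simp
    qed measurable
  qed
  \<comment> \<open>The fundamental theorem is applied to \<open>\<phi>\<close> along the reversed
    segment. After a translation of the integral this difference of \<open>\<phi>\<close> is dual to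
    \<open>u (y + k) - u y\<close>.\<close>
  have ftc: "(\<integral>t. indicator {0..1} t *\<^sub>R (- D (y - t *\<^sub>R k)) \<partial>lborel) = \<phi> (y - k) - \<phi> y" for y
  proof -
    have "(\<integral>t. indicator {0..1} t *\<^sub>R (- D (y - t *\<^sub>R k)) \<partial>lborel) = \<phi> (y - 1 *\<^sub>R k) - \<phi> (y - 0 *\<^sub>R k)"
    proof (rule integral_FTC_Icc)
      show "continuous_on {0..1} (\<lambda>t. - D (y - t *\<^sub>R k))"
        by (intro continuous_intros continuous_on_compose2[OF cD]) auto
      fix t :: real
      have "((\<lambda>t. y - t *\<^sub>R k) has_derivative (\<lambda>s. - (s *\<^sub>R k))) (at t within {0..1})"
        by (auto intro!: derivative_eq_intros)
      from has_derivative_compose[OF this bump_fun_derivative(3)[OF \<phi>]]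
      have "((\<lambda>t. \<phi> (y - t *\<^sub>R k)) has_derivative (\<lambda>s. \<Sum>j\<in>UNIV. (- (s *\<^sub>R k)) $ j * partial_deriv j \<phi> (y - t *\<^sub>R k))) (at t within {0..1})" .
      moreover have "(\<lambda>s. \<Sum>j\<in>UNIV. (- (s *\<^sub>R k)) $ j * partial_deriv j \<phi> (y - t *\<^sub>R k)) = (\<lambda>s. s *\<^sub>R (- D (y - t *\<^sub>R k)))"
        by (simp add: D_def sum_distrib_left sum_negf mult.assoc)
      ultimately show "((\<lambda>t. \<phi> (y - t *\<^sub>R k)) has_vector_derivative - D (y - t *\<^sub>R k)) (at t within {0..1})"
        by (simp add: has_vector_derivative_def)
    qed simp
    then show ?thesis by simp
  qed
  \<comment> \<open>\<open>I1\<close> and \<open>I2\<close> justify the two changes of the order of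
    integration, \<open>I3\<close> the final splitting of the integral.\<close>
  have I1: "integrable (lborel \<Otimes>\<^sub>M lborel) (\<lambda>(y, t). (indicator {0..1} t * (- D (y + t *\<^sub>R (- k)))) *\<^sub>R u (y + t *\<^sub>R 0))"
    using bD by (intro integrable_segment[OF u, of "\<lambda>x. - D x"]) (auto intro: continuous_intros cD)
  have I2: "integrable (lborel \<Otimes>\<^sub>M lborel) (\<lambda>(y, t). (indicator {0..1} t * \<phi> (y + t *\<^sub>R 0)) *\<^sub>R dir_deriv g k (y + t *\<^sub>R k))"
    using M by (intro integrable_segment[OF gk c\<phi>]) auto
  have I3: "integrable lborel (\<lambda>y. \<integral>t. (indicator {0..1} t * \<phi> y) *\<^sub>R dir_deriv g k (y + t *\<^sub>R k) \<partial>lborel)"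
    using lborel_pair.integrable_fst'[OF I2] by simp
  have "(\<integral>y. \<phi> y *\<^sub>R (u (y + k) - u y) \<partial>lborel) = (\<integral>y. \<phi> y *\<^sub>R u (y + k) \<partial>lborel) - (\<integral>y. \<phi> y *\<^sub>R u y \<partial>lborel)"
    unfolding scaleR_diff_right
    by (intro Bochner_Integration.integral_diff int_bdd[OF _ c\<phi> M(2)] u integrable_translate)
  also have "(\<integral>y. \<phi> y *\<^sub>R u (y + k) \<partial>lborel) = (\<integral>y. \<phi> (y - k) *\<^sub>R u y \<partial>lborel)"
    using integral_translate[of "\<lambda>y. \<phi> (y - k) *\<^sub>R u y" k] by simp
  also have "(\<integral>y. \<phi> (y - k) *\<^sub>R u y \<partial>lborel) - (\<integral>y. \<phi> y *\<^sub>R u y \<partial>lborel) = (\<integral>y. (\<phi> (y - k) - \<phi> y) *\<^sub>R u y \<partial>lborel)"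
  proof -
    have "continuous_on UNIV (\<lambda>y. \<phi> (y - k))"
      by (intro continuous_on_compose2[OF c\<phi>] continuous_intros) auto
    then have "integrable lborel (\<lambda>y. \<phi> (y - k) *\<^sub>R u y)" by (rule int_bdd[OF u]) (rule M(2))
    then show ?thesis
      unfolding scaleR_diff_left by (intro Bochner_Integration.integral_diff[symmetric] int_bdd[OF u c\<phi> M(2)])
  qed
  also have "\<dots> = (\<integral>y. (\<integral>t. (indicator {0..1} t * (- D (y + t *\<^sub>R (- k)))) *\<^sub>R u (y + t *\<^sub>R 0) \<partial>lborel) \<partial>lborel)"
  proof (rule Bochner_Integration.integral_cong[OF refl])
    fix y
    have "integrable lborel (\<lambda>t. indicator {0..1} t *\<^sub>R (- D (y - t *\<^sub>R k)))"
      by (intro borel_integrable_compact continuous_intros continuous_on_compose2[OF cD]) auto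
    then show "(\<phi> (y - k) - \<phi> y) *\<^sub>R u y = (\<integral>t. (indicator {0..1} t * (- D (y + t *\<^sub>R (- k)))) *\<^sub>R u (y + t *\<^sub>R 0) \<partial>lborel)"
      unfolding ftc[symmetric] by (subst integral_scaleR_left[symmetric]) simp_all
  qed
  also have "\<dots> = (\<integral>t. (\<integral>y. (indicator {0..1} t * (- D (y + t *\<^sub>R (- k)))) *\<^sub>R u (y + t *\<^sub>R 0) \<partial>lborel) \<partial>lborel)"
    by (rule lborel_pair.Fubini_integral[OF I1, symmetric])
  also have "\<dots> = (\<integral>t. (\<integral>y. (indicator {0..1} t * \<phi> (y + t *\<^sub>R 0)) *\<^sub>R dir_deriv g k (y + t *\<^sub>R k) \<partial>lborel) \<partial>lborel)"
  proof (rule Bochner_Integration.integral_cong[OF refl])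
    fix t :: real
    show "(\<integral>y. (indicator {0..1} t * (- D (y + t *\<^sub>R (- k)))) *\<^sub>R u (y + t *\<^sub>R 0) \<partial>lborel) =
       (\<integral>y. (indicator {0..1} t * \<phi> (y + t *\<^sub>R 0)) *\<^sub>R dir_deriv g k (y + t *\<^sub>R k) \<partial>lborel)"
    proof (cases "t \<in> {0..1}")
      case True
      let ?\<psi> = "\<lambda>y. \<phi> (y - t *\<^sub>R k)"
      have \<psi>: "?\<psi> \<in> bump_fun (a + t *\<^sub>R k) (b + t *\<^sub>R k)" by (rule bump_fun_shift[OF \<phi>])
      have c\<psi>: "continuous_on UNIV ?\<psi>" by (rule bump_fun_continuous[OF \<psi>])
      have pd: "partial_deriv j \<phi> (y - t *\<^sub>R k) = partial_deriv j ?\<psi> y" for j y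
        by (rule bump_fun_partial_shift[OF \<phi>, symmetric])
      have ipd: "integrable lborel (\<lambda>y. partial_deriv j ?\<psi> y *\<^sub>R u y)" for j
        using bump_fun_continuous[OF bump_fun_derivative(2)[OF \<psi>]] MM(2)
        by (intro int_bdd[OF u, where K="MM j"]) (auto simp: pd[symmetric])
      have ig: "integrable lborel (\<lambda>y. ?\<psi> y *\<^sub>R (g y $ j))" for j
        by (rule int_bdd[OF integrable_bounded_linear[OF bounded_linear_vec_nth g] c\<psi> M(2)])
      have "(\<integral>y. - D (y - t *\<^sub>R k) *\<^sub>R u y \<partial>lborel) = - (\<integral>y. (\<Sum>j\<in>UNIV. k $ j *\<^sub>R (partial_deriv j ?\<psi> y *\<^sub>R u y)) \<partial>lborel)"
        unfolding D_def pd by (simp add: scaleR_sum_left)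
      also have "\<dots> = - (\<Sum>j\<in>UNIV. k $ j *\<^sub>R (\<integral>y. partial_deriv j ?\<psi> y *\<^sub>R u y \<partial>lborel))"
        using ipd by (subst Bochner_Integration.integral_sum) (auto simp del: scaleR_scaleR)
      also have "\<dots> = (\<Sum>j\<in>UNIV. k $ j *\<^sub>R (\<integral>y. ?\<psi> y *\<^sub>R (g y $ j) \<partial>lborel))"
        using weak seg[OF True] \<psi> by (simp add: weak_gradient_on_bumps_def sum_negf)
      also have "\<dots> = (\<integral>y. (\<Sum>j\<in>UNIV. k $ j *\<^sub>R (?\<psi> y *\<^sub>R (g y $ j))) \<partial>lborel)"
        using ig by (subst Bochner_Integration.integral_sum) (auto simp del: scaleR_scaleR)
      also have "\<dots> = (\<integral>y. ?\<psi> y *\<^sub>R dir_deriv g k y \<partial>lborel)"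
        unfolding dir_deriv_def by (simp add: scaleR_sum_right mult.commute)
      also have "\<dots> = (\<integral>y. \<phi> y *\<^sub>R dir_deriv g k (y + t *\<^sub>R k) \<partial>lborel)"
        using integral_translate[of "\<lambda>y. ?\<psi> y *\<^sub>R dir_deriv g k y" "t *\<^sub>R k"] by simp
      finally show ?thesis using True by simp
    qed simp
  qed
  also have "\<dots> = (\<integral>y. (\<integral>t. (indicator {0..1} t * \<phi> (y + t *\<^sub>R 0)) *\<^sub>R dir_deriv g k (y + t *\<^sub>R k) \<partial>lborel) \<partial>lborel)"
    by (rule lborel_pair.Fubini_integral[OF I2])
  finally have eq: "(\<integral>y. \<phi> y *\<^sub>R (u (y + k) - u y) \<partial>lborel) = (\<integral>y. (\<integral>t. (indicator {0..1} t * \<phi> y) *\<^sub>R dir_deriv g k (y + t *\<^sub>R k) \<partial>lborel) \<partial>lborel)"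
    by simp
  have "\<phi> y *\<^sub>R (\<integral>t. indicator {0..1} t *\<^sub>R dir_deriv g k (y + t *\<^sub>R k) \<partial>lborel) = (\<integral>t. (indicator {0..1} t * \<phi> y) *\<^sub>R dir_deriv g k (y + t *\<^sub>R k) \<partial>lborel)" for y
    by (subst integral_scaleR_right[symmetric]) (simp add: mult.commute)
  then have "(\<integral>y. \<phi> y *\<^sub>R (u (y + k) - u y - (\<integral>t. indicator {0..1} t *\<^sub>R dir_deriv g k (y + t *\<^sub>R k) \<partial>lborel)) \<partial>lborel) =
    (\<integral>y. \<phi> y *\<^sub>R (u (y + k) - u y) - (\<integral>t. (indicator {0..1} t * \<phi> y) *\<^sub>R dir_deriv g k (y + t *\<^sub>R k) \<partial>lborel) \<partial>lborel)"
    by (simp add: scaleR_diff_right)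
  also have "\<dots> = 0"
    using eq I3 by (subst Bochner_Integration.integral_diff)
      (auto intro!: int_bdd[OF _ c\<phi> M(2)] Bochner_Integration.integrable_diff u integrable_translate)
  finally show ?thesis .
qed

text \<open>The complement is the sum of the closed set \<open>- \<Omega>\<close> and a compact
  segment, hence closed.\<close>

lemma open_segment_domain:
  fixes \<Omega> :: "'a::real_normed_vector set"
  assumes "open \<Omega>"
  shows "open {y. \<forall>t\<in>{0..1}. y + t *\<^sub>R k \<in> \<Omega>}"
proof -
  have "compact ((\<lambda>t. - (t *\<^sub>R k)) ` {0..1::real})"
    by (intro compact_continuous_image continuous_intros) auto
  then have "closed (\<Union>x\<in>- \<Omega>. \<Union>z\<in>(\<lambda>t. - (t *\<^sub>R k)) ` {0..1::real}. {x + z})"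
    using assms by (intro closed_compact_sums) auto
  moreover have "- {y. \<forall>t\<in>{0..1}. y + t *\<^sub>R k \<in> \<Omega>} = (\<Union>x\<in>- \<Omega>. \<Union>z\<in>(\<lambda>t. - (t *\<^sub>R k)) ` {0..1::real}. {x + z})"
  proof (intro set_eqI iffI)
    fix y assume "y \<in> - {y. \<forall>t\<in>{0..1}. y + t *\<^sub>R k \<in> \<Omega>}"
    then obtain t where "t \<in> {0..1}" "y + t *\<^sub>R k \<in> - \<Omega>" by auto
    moreover have "y = (y + t *\<^sub>R k) + - (t *\<^sub>R k)" by simp
    ultimately show "y \<in> (\<Union>x\<in>- \<Omega>. \<Union>z\<in>(\<lambda>t. - (t *\<^sub>R k)) ` {0..1::real}. {x + z})" by blast
  next
    fix y assume "y \<in> (\<Union>x\<in>- \<Omega>. \<Union>z\<in>(\<lambda>t. - (t *\<^sub>R k)) ` {0..1::real}. {x + z})"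
    then obtain x t where "x \<in> - \<Omega>" "t \<in> {0..1}" "y = x + - (t *\<^sub>R k)" by blast
    then show "y \<in> - {y. \<forall>t\<in>{0..1}. y + t *\<^sub>R k \<in> \<Omega>}" by (auto intro!: bexI[of _ t])
  qed
  ultimately show ?thesis by (simp only: open_closed)
qed

lemma integrable_dir_deriv: "integrable lborel g \<Longrightarrow> integrable lborel (dir_deriv g k)"
  unfolding dir_deriv_def[abs_def]
  by (intro Bochner_Integration.integrable_sum integrable_scaleR_right integrable_bounded_linear[OF bounded_linear_vec_nth])

lemma norm_dir_deriv_le: "norm (dir_deriv g k x) \<le> norm k * norm (g x)"
proof -
  have "norm (dir_deriv g k x) \<le> (\<Sum>j\<in>UNIV. \<bar>k $ j\<bar> * \<bar>norm (g x $ j)\<bar>)"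
    unfolding dir_deriv_def by (rule order_trans[OF norm_sum]) simp
  also have "\<dots> \<le> L2_set (\<lambda>j. k $ j) UNIV * L2_set (\<lambda>j. norm (g x $ j)) UNIV"
    by (rule L2_set_mult_ineq)
  also have "\<dots> = norm k * norm (g x)" by (simp add: norm_vec_def L2_set_def)
  finally show ?thesis .
qed

lemma dir_deriv_diff: "dir_deriv g k x - dir_deriv g k y = dir_deriv (\<lambda>x. g x - g y) k x"
  by (simp add: dir_deriv_def sum_subtractf scaleR_diff_right)

lemma borel_measurable_dir_deriv [measurable (raw)]:
  assumes [measurable]: "g \<in> borel_measurable borel" "f \<in> borel_measurable M"
  shows "(\<lambda>x. dir_deriv g k (f x)) \<in> borel_measurable M"
proof -
  have "(\<lambda>x. g x $ j) \<in> borel_measurable borel" for j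
    by (rule measurable_compose[OF assms(1)]) (simp add: borel_measurable_continuous_onI continuous_on_component)
  then have "dir_deriv g k \<in> borel_measurable borel"
    unfolding dir_deriv_def[abs_def] by (intro borel_measurable_sum borel_measurable_scaleR) auto
  then show ?thesis by (rule measurable_compose[rotated]) fact
qed

text \<open>Bumps with values in the unit interval that tend to the indicator of a box upgrade the
  tested identity to vanishing box integrals over the open set of admissible starting points. The
  exceptional null set depends on \<open>k\<close>, so the estimates below fix the
  increment.\<close>

lemma AE_segment_identity:
  fixes u :: "real^'n::finite \<Rightarrow> complex" and g :: "real^'n \<Rightarrow> complex^'n"
  assumes \<Omega>: "open \<Omega>" and u: "integrable lborel u" and g: "integrable lborel g"
    and weak: "weak_gradient_on_bumps \<Omega> u g"
  shows "AE y in lborel. integrable lborel (\<lambda>t. indicator {0..1} t *\<^sub>R dir_deriv g k (y + t *\<^sub>R k)) \<and>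
     ((\<forall>t\<in>{0..1}. y + t *\<^sub>R k \<in> \<Omega>) \<longrightarrow> u (y + k) - u y = (\<integral>t. indicator {0..1} t *\<^sub>R dir_deriv g k (y + t *\<^sub>R k) \<partial>lborel))"
proof -
  have "integrable (lborel \<Otimes>\<^sub>M lborel) (\<lambda>(y, t). (indicator {0..1} t * 1) *\<^sub>R dir_deriv g k (y + t *\<^sub>R k))"
    by (rule integrable_segment[OF integrable_dir_deriv[OF g], of "\<lambda>_. 1" 1]) auto
  then have seg: "integrable (lborel \<Otimes>\<^sub>M lborel) (\<lambda>(y, t). indicator {0..1} t *\<^sub>R dir_deriv g k (y + t *\<^sub>R k))"
    by simp
  have AEi: "AE y in lborel. integrable lborel (\<lambda>t. indicator {0..1} t *\<^sub>R dir_deriv g k (y + t *\<^sub>R k))"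
    using lborel_pair.AE_integrable_fst'[OF seg] by simp
  let ?w = "\<lambda>y. u (y + k) - u y - (\<integral>t. indicator {0..1} t *\<^sub>R dir_deriv g k (y + t *\<^sub>R k) \<partial>lborel)"
  let ?U = "{y. \<forall>t\<in>{0..1}. y + t *\<^sub>R k \<in> \<Omega>}"
  have w: "integrable lborel ?w"
    using lborel_pair.integrable_fst'[OF seg]
    by (intro Bochner_Integration.integrable_diff integrable_translate u) simp
  have "AE y in lborel. y \<in> ?U \<longrightarrow> ?w y = 0"
  proof (rule AE_zero_if_box_integrals_zero[OF w open_segment_domain[OF \<Omega>]])
    fix a b assume ab: "cbox a b \<subseteq> ?U"
    obtain \<phi> where \<phi>: "\<And>n. \<phi> n \<in> bump_fun a b" "\<And>n x. 0 \<le> \<phi> n x \<and> \<phi> n x \<le> 1"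
      "\<And>x. (\<lambda>n. \<phi> n x) \<longlonglongrightarrow> indicator (box a b) x" by (rule bump_fun_approx_box[of a b]) (rule that; (assumption | blast))
    have [measurable]: "\<phi> n \<in> borel_measurable borel" for n
      using bump_fun_continuous[OF \<phi>(1)] by (rule borel_measurable_continuous_onI)
    have [measurable]: "?w \<in> borel_measurable borel" using w by auto
    have seg: "cbox (a + t *\<^sub>R k) (b + t *\<^sub>R k) \<subseteq> \<Omega>" if "t \<in> {0..1}" for t
    proof
      fix x assume "x \<in> cbox (a + t *\<^sub>R k) (b + t *\<^sub>R k)"
      then have "x - t *\<^sub>R k \<in> cbox a b" by (auto simp: mem_box inner_diff_left inner_add_left algebra_simps)
      then have "(x - t *\<^sub>R k) + t *\<^sub>R k \<in> \<Omega>" using ab that by blast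
      then show "x \<in> \<Omega>" by simp
    qed
    have zero: "(\<integral>y. \<phi> n y *\<^sub>R ?w y \<partial>lborel) = 0" for n
      by (rule bump_segment_identity[OF u g weak \<phi>(1) seg])
    have "(\<lambda>n. \<integral>y. \<phi> n y *\<^sub>R ?w y \<partial>lborel) \<longlonglongrightarrow> (\<integral>y. indicator (box a b) y *\<^sub>R ?w y \<partial>lborel)"
    proof (rule integral_dominated_convergence[where w="\<lambda>y. norm (?w y)"])
      show "AE x in lborel. (\<lambda>n. \<phi> n x *\<^sub>R ?w x) \<longlonglongrightarrow> indicator (box a b) x *\<^sub>R ?w x"
        by (intro AE_I2 tendsto_intros \<phi>(3))
      show "AE x in lborel. norm (\<phi> n x *\<^sub>R ?w x) \<le> norm (?w x)" for n
        using \<phi>(2) by (intro AE_I2) (simp add: mult_left_le_one_le)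
    qed (use w in auto)
    then show "(\<integral>y. indicator (box a b) y *\<^sub>R ?w y \<partial>lborel) = 0"
      unfolding zero by (simp add: LIMSEQ_const_iff)
  qed
  with AEi show ?thesis by eventually_elim auto
qed

text \<open>Cauchy-Schwarz on an interval of length 1. If the function is not integrable, its
  Bochner integral has the default value 0 and the bound is trivial.\<close>

lemma norm_integral_unit_interval_sq_le:
  fixes f :: "real \<Rightarrow> 'b::{banach,second_countable_topology}"
  assumes [measurable]: "f \<in> borel_measurable borel"
  shows "ennreal ((norm (\<integral>t. indicator {0..1} t *\<^sub>R f t \<partial>lborel))\<^sup>2) \<le> (\<integral>\<^sup>+t. indicator {0..1} t * ennreal ((norm (f t))\<^sup>2) \<partial>lborel)"
proof (cases "integrable lborel (\<lambda>t. indicator {0..1} t *\<^sub>R f t)")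
  case True
  have "ennreal (norm (\<integral>t. indicator {0..1} t *\<^sub>R f t \<partial>lborel)) \<le> (\<integral>\<^sup>+t. norm (indicator {0..1} t *\<^sub>R f t) \<partial>lborel)"
    by (rule integral_norm_bound_ennreal[OF True])
  also have "\<dots> = (\<integral>\<^sup>+t. indicator {0..1} t * (indicator {0..1} t * ennreal (norm (f t))) \<partial>lborel)"
    by (intro nn_integral_cong) (simp add: indicator_def)
  finally have "(ennreal (norm (\<integral>t. indicator {0..1} t *\<^sub>R f t \<partial>lborel)))\<^sup>2 \<le>
     (\<integral>\<^sup>+t. indicator {0..1} t * (indicator {0..1} t * ennreal (norm (f t))) \<partial>lborel)\<^sup>2"
    by (intro power_mono) auto
  also have "\<dots> \<le> nn_integral lborel (\<lambda>t::real. (indicator {0..1} t)\<^sup>2) * (\<integral>\<^sup>+t. (indicator {0..1} t * ennreal (norm (f t)))\<^sup>2 \<partial>lborel)"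
    by (rule Cauchy_Schwarz_nn_integral) auto
  also have "nn_integral lborel (\<lambda>t::real. (indicator {0..1} t)\<^sup>2) = (\<integral>\<^sup>+t. indicator {0..1::real} t \<partial>lborel)"
    by (intro nn_integral_cong) (simp add: indicator_def)
  also have "\<dots> = 1" by simp
  also have "(\<integral>\<^sup>+t. (indicator {0..1} t * ennreal (norm (f t)))\<^sup>2 \<partial>lborel) = (\<integral>\<^sup>+t. indicator {0..1} t * ennreal ((norm (f t))\<^sup>2) \<partial>lborel)"
    by (intro nn_integral_cong) (simp add: indicator_def ennreal_power)
  finally show ?thesis by (simp add: ennreal_power)
qed (simp add: not_integrable_integral_eq)

text \<open>After Cauchy-Schwarz in \<open>t\<close> the order of integration is exchanged. For each
  \<open>t\<close> the map from \<open>y\<close> to \<open>y + t *\<^sub>R k\<close> is a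
  translation taking \<open>V\<close> into \<open>W\<close>, so only the energy in \<open>W\<close>
  counts.\<close>

lemma segment_L2_estimate:
  fixes u :: "real^'n::finite \<Rightarrow> complex" and g :: "real^'n \<Rightarrow> complex^'n"
  assumes \<Omega>: "open \<Omega>" and u: "integrable lborel u" and g: "integrable lborel g"
    and weak: "weak_gradient_on_bumps \<Omega> u g"
    and V [measurable]: "V \<in> sets borel" and W [measurable]: "W \<in> sets borel"
    and seg: "\<And>y t. y \<in> V \<Longrightarrow> t \<in> {0..1} \<Longrightarrow> y + t *\<^sub>R k \<in> \<Omega> \<inter> W"
  shows "(\<integral>\<^sup>+y. indicator V y * ennreal ((norm (u (y + k) - u y))\<^sup>2) \<partial>lborel)
     \<le> ennreal ((norm k)\<^sup>2) * (\<integral>\<^sup>+x. indicator W x * ennreal ((norm (g x))\<^sup>2) \<partial>lborel)"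
proof -
  have [measurable]: "u \<in> borel_measurable borel" "g \<in> borel_measurable borel" using u g by auto
  have "(\<integral>\<^sup>+y. indicator V y * ennreal ((norm (u (y + k) - u y))\<^sup>2) \<partial>lborel)
    \<le> (\<integral>\<^sup>+y. (\<integral>\<^sup>+t. indicator {0..1::real} t * (ennreal ((norm k)\<^sup>2) * (indicator W (y + t *\<^sub>R k) * ennreal ((norm (g (y + t *\<^sub>R k)))\<^sup>2))) \<partial>lborel) \<partial>lborel)"
  proof (rule nn_integral_mono_AE)
    show "AE y in lborel. indicator V y * ennreal ((norm (u (y + k) - u y))\<^sup>2) \<le>
       (\<integral>\<^sup>+t. indicator {0..1::real} t * (ennreal ((norm k)\<^sup>2) * (indicator W (y + t *\<^sub>R k) * ennreal ((norm (g (y + t *\<^sub>R k)))\<^sup>2))) \<partial>lborel)"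
      using AE_segment_identity[OF \<Omega> u g weak, where k=k]
    proof eventually_elim
      case (elim y)
      show ?case
      proof (cases "y \<in> V")
        case True
        then have "u (y + k) - u y = (\<integral>t. indicator {0..1} t *\<^sub>R dir_deriv g k (y + t *\<^sub>R k) \<partial>lborel)"
          using elim seg by blast
        then have "ennreal ((norm (u (y + k) - u y))\<^sup>2) \<le> (\<integral>\<^sup>+t. indicator {0..1} t * ennreal ((norm (dir_deriv g k (y + t *\<^sub>R k)))\<^sup>2) \<partial>lborel)"
          by (simp add: norm_integral_unit_interval_sq_le)
        also have "\<dots> \<le> (\<integral>\<^sup>+t. indicator {0..1::real} t * (ennreal ((norm k)\<^sup>2) * (indicator W (y + t *\<^sub>R k) * ennreal ((norm (g (y + t *\<^sub>R k)))\<^sup>2))) \<partial>lborel)"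
        proof (rule nn_integral_mono)
          fix t :: real
          have "ennreal ((norm (dir_deriv g k (y + t *\<^sub>R k)))\<^sup>2) \<le> ennreal ((norm k)\<^sup>2) * ennreal ((norm (g (y + t *\<^sub>R k)))\<^sup>2)"
            using norm_dir_deriv_le[of g k "y + t *\<^sub>R k"]
            by (subst ennreal_mult'[symmetric]) (auto simp: power_mult_distrib[symmetric] intro!: ennreal_leI power_mono)
          then show "indicator {0..1} t * ennreal ((norm (dir_deriv g k (y + t *\<^sub>R k)))\<^sup>2) \<le>
             indicator {0..1::real} t * (ennreal ((norm k)\<^sup>2) * (indicator W (y + t *\<^sub>R k) * ennreal ((norm (g (y + t *\<^sub>R k)))\<^sup>2)))"
            using seg[OF True, of t] by (auto simp: indicator_def)
        qed
        finally show ?thesis using True by simp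
      qed simp
    qed
  qed
  also have "\<dots> = (\<integral>\<^sup>+t. (\<integral>\<^sup>+y. indicator {0..1::real} t * (ennreal ((norm k)\<^sup>2) * (indicator W (y + t *\<^sub>R k) * ennreal ((norm (g (y + t *\<^sub>R k)))\<^sup>2))) \<partial>lborel) \<partial>lborel)"
    by (rule lborel_pair.Fubini'[symmetric]) measurable
  also have "\<dots> = (\<integral>\<^sup>+t. indicator {0..1::real} t * (ennreal ((norm k)\<^sup>2) * (\<integral>\<^sup>+x. indicator W x * ennreal ((norm (g x))\<^sup>2) \<partial>lborel)) \<partial>lborel)"
  proof (rule nn_integral_cong)
    fix t :: real
    have "(\<integral>\<^sup>+y. indicator W (y + t *\<^sub>R k) * ennreal ((norm (g (y + t *\<^sub>R k)))\<^sup>2) \<partial>lborel) = (\<integral>\<^sup>+x. indicator W x * ennreal ((norm (g x))\<^sup>2) \<partial>lborel)"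
      by (rule nn_integral_translate[where f="\<lambda>x. indicator W x * ennreal ((norm (g x))\<^sup>2)"]) measurable
    then show "(\<integral>\<^sup>+y. indicator {0..1::real} t * (ennreal ((norm k)\<^sup>2) * (indicator W (y + t *\<^sub>R k) * ennreal ((norm (g (y + t *\<^sub>R k)))\<^sup>2))) \<partial>lborel)
       = indicator {0..1::real} t * (ennreal ((norm k)\<^sup>2) * (\<integral>\<^sup>+x. indicator W x * ennreal ((norm (g x))\<^sup>2) \<partial>lborel))"
      by (simp add: nn_integral_cmult)
  qed
  also have "\<dots> = ennreal ((norm k)\<^sup>2) * (\<integral>\<^sup>+x. indicator W x * ennreal ((norm (g x))\<^sup>2) \<partial>lborel)"
    by (simp add: nn_integral_multc)
  finally show ?thesis .
qed

text \<open>The constant \<open>dir_deriv g k y\<close> is its own integral over the unit interval,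
  so the error is the integral of the variation of \<open>g\<close> along the segment; in L2 this is
  controlled by translations of \<open>g\<close>.\<close>

lemma segment_L2_linearization:
  fixes u :: "real^'n::finite \<Rightarrow> complex" and g :: "real^'n \<Rightarrow> complex^'n"
  assumes \<Omega>: "open \<Omega>" and u: "integrable lborel u" and g: "integrable lborel g"
    and weak: "weak_gradient_on_bumps \<Omega> u g"
    and V [measurable]: "V \<in> sets borel"
    and seg: "\<And>y t. y \<in> V \<Longrightarrow> t \<in> {0..1} \<Longrightarrow> y + t *\<^sub>R k \<in> \<Omega>"
    and trans: "\<And>t. t \<in> {0..1} \<Longrightarrow> (\<integral>\<^sup>+x. ennreal ((norm (g (x + t *\<^sub>R k) - g x))\<^sup>2) \<partial>lborel) \<le> \<epsilon>"
  shows "(\<integral>\<^sup>+y. indicator V y * ennreal ((norm (u (y + k) - u y - dir_deriv g k y))\<^sup>2) \<partial>lborel) \<le> ennreal ((norm k)\<^sup>2) * \<epsilon>"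
proof -
  have [measurable]: "u \<in> borel_measurable borel" "g \<in> borel_measurable borel" using u g by auto
  have "(\<integral>\<^sup>+y. indicator V y * ennreal ((norm (u (y + k) - u y - dir_deriv g k y))\<^sup>2) \<partial>lborel)
    \<le> (\<integral>\<^sup>+y. (\<integral>\<^sup>+t. indicator {0..1::real} t * (ennreal ((norm k)\<^sup>2) * ennreal ((norm (g (y + t *\<^sub>R k) - g y))\<^sup>2)) \<partial>lborel) \<partial>lborel)"
  proof (rule nn_integral_mono_AE)
    show "AE y in lborel. indicator V y * ennreal ((norm (u (y + k) - u y - dir_deriv g k y))\<^sup>2) \<le>
       (\<integral>\<^sup>+t. indicator {0..1::real} t * (ennreal ((norm k)\<^sup>2) * ennreal ((norm (g (y + t *\<^sub>R k) - g y))\<^sup>2)) \<partial>lborel)"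
      using AE_segment_identity[OF \<Omega> u g weak, where k=k]
    proof eventually_elim
      case (elim y)
      show ?case
      proof (cases "y \<in> V")
        case True
        have c: "(\<integral>t. indicator {0..1::real} t *\<^sub>R dir_deriv g k y \<partial>lborel) = dir_deriv g k y"
          by simp
        have "u (y + k) - u y - dir_deriv g k y = (\<integral>t. indicator {0..1} t *\<^sub>R dir_deriv g k (y + t *\<^sub>R k) \<partial>lborel) - (\<integral>t. indicator {0..1::real} t *\<^sub>R dir_deriv g k y \<partial>lborel)"
          using elim seg[OF True] unfolding c by simp
        also have "\<dots> = (\<integral>t. indicator {0..1} t *\<^sub>R dir_deriv g k (y + t *\<^sub>R k) - indicator {0..1::real} t *\<^sub>R dir_deriv g k y \<partial>lborel)"
          using elim by (intro Bochner_Integration.integral_diff[symmetric]) auto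
        also have "\<dots> = (\<integral>t. indicator {0..1} t *\<^sub>R (dir_deriv g k (y + t *\<^sub>R k) - dir_deriv g k y) \<partial>lborel)"
          by (simp add: scaleR_diff_right)
        finally have "ennreal ((norm (u (y + k) - u y - dir_deriv g k y))\<^sup>2) \<le> (\<integral>\<^sup>+t. indicator {0..1} t * ennreal ((norm (dir_deriv g k (y + t *\<^sub>R k) - dir_deriv g k y))\<^sup>2) \<partial>lborel)"
          by (simp add: norm_integral_unit_interval_sq_le)
        also have "\<dots> \<le> (\<integral>\<^sup>+t. indicator {0..1::real} t * (ennreal ((norm k)\<^sup>2) * ennreal ((norm (g (y + t *\<^sub>R k) - g y))\<^sup>2)) \<partial>lborel)"
        proof (intro nn_integral_mono mult_left_mono)
          fix t :: real
          show "ennreal ((norm (dir_deriv g k (y + t *\<^sub>R k) - dir_deriv g k y))\<^sup>2) \<le> ennreal ((norm k)\<^sup>2) * ennreal ((norm (g (y + t *\<^sub>R k) - g y))\<^sup>2)"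
            using norm_dir_deriv_le[of "\<lambda>x. g x - g y" k "y + t *\<^sub>R k"]
            by (subst ennreal_mult'[symmetric]) (auto simp: dir_deriv_diff power_mult_distrib[symmetric] intro!: ennreal_leI power_mono)
        qed simp
        finally show ?thesis using True by simp
      qed simp
    qed
  qed
  also have "\<dots> = (\<integral>\<^sup>+t. (\<integral>\<^sup>+y. indicator {0..1::real} t * (ennreal ((norm k)\<^sup>2) * ennreal ((norm (g (y + t *\<^sub>R k) - g y))\<^sup>2)) \<partial>lborel) \<partial>lborel)"
    by (rule lborel_pair.Fubini'[symmetric]) measurable
  also have "\<dots> \<le> (\<integral>\<^sup>+t. indicator {0..1::real} t * (ennreal ((norm k)\<^sup>2) * \<epsilon>) \<partial>lborel)"
  proof (rule nn_integral_mono)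
    fix t :: real
    show "(\<integral>\<^sup>+y. indicator {0..1::real} t * (ennreal ((norm k)\<^sup>2) * ennreal ((norm (g (y + t *\<^sub>R k) - g y))\<^sup>2)) \<partial>lborel)
       \<le> indicator {0..1::real} t * (ennreal ((norm k)\<^sup>2) * \<epsilon>)"
      using trans[of t] by (auto simp: nn_integral_cmult indicator_def intro!: mult_left_mono)
  qed
  also have "\<dots> = ennreal ((norm k)\<^sup>2) * \<epsilon>" by (simp add: nn_integral_multc)
  finally show ?thesis .
qed

section \<open>Continuity of translations in mean\<close>

lemma tendsto_at_0_sequentiallyI:
  fixes f :: "'a::first_countable_topology \<Rightarrow> 'b::topological_space"
  assumes "\<And>X. (\<forall>n. X n \<noteq> a) \<Longrightarrow> X \<longlonglongrightarrow> a \<Longrightarrow> (\<lambda>n. f (X n)) \<longlonglongrightarrow> l"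
  shows "(f \<longlongrightarrow> l) (at a)"
  using assms by (auto simp: tendsto_at_iff_sequentially comp_def)

definition L1_shift :: "('a::euclidean_space \<Rightarrow> 'b::euclidean_space) \<Rightarrow> 'a \<Rightarrow> real" where
  "L1_shift f k = (\<integral>y. norm (f (y + k) - f y) \<partial>lborel)"

lemma integrable_shift_diff:
  fixes f :: "'a::euclidean_space \<Rightarrow> 'b::euclidean_space"
  assumes "integrable lborel f"
  shows "integrable lborel (\<lambda>y. f (y + k) - f y)"
  by (intro Bochner_Integration.integrable_diff integrable_translate assms)

text \<open>Replacing \<open>f\<close> by \<open>h\<close> costs their distance twice, once for the
  translate and once for the function itself.\<close>

lemma L1_shift_perturb:
  fixes f h :: "'a::euclidean_space \<Rightarrow> 'b::euclidean_space"
  assumes f: "integrable lborel f" and h: "integrable lborel h"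
  shows "L1_shift f k \<le> L1_shift h k + 2 * (\<integral>y. norm (f y - h y) \<partial>lborel)"
proof -
  have fh: "integrable lborel (\<lambda>y. f y - h y)" by (intro Bochner_Integration.integrable_diff f h)
  have "L1_shift f k \<le> (\<integral>y. norm (h (y + k) - h y) + (norm (f (y + k) - h (y + k)) + norm (f y - h y)) \<partial>lborel)"
    unfolding L1_shift_def
  proof (rule integral_mono)
    fix y
    have "norm (f (y + k) - f y) = norm ((h (y + k) - h y) + ((f (y + k) - h (y + k)) - (f y - h y)))" by simp
    also have "\<dots> \<le> norm (h (y + k) - h y) + norm ((f (y + k) - h (y + k)) - (f y - h y))" by (rule norm_triangle_ineq)
    also have "\<dots> \<le> norm (h (y + k) - h y) + (norm (f (y + k) - h (y + k)) + norm (f y - h y))"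
      by (intro add_left_mono norm_triangle_ineq4)
    finally show "norm (f (y + k) - f y) \<le> norm (h (y + k) - h y) + (norm (f (y + k) - h (y + k)) + norm (f y - h y))" .
  qed (auto intro!: integrable_norm integrable_shift_diff f h fh integrable_translate[OF fh] Bochner_Integration.integrable_add)
  also have "\<dots> = L1_shift h k + ((\<integral>y. norm (f (y + k) - h (y + k)) \<partial>lborel) + (\<integral>y. norm (f y - h y) \<partial>lborel))"
    unfolding L1_shift_def
    by (subst Bochner_Integration.integral_add, (auto intro!: integrable_norm integrable_shift_diff f h fh integrable_translate[OF fh] Bochner_Integration.integrable_add)[2],
        subst Bochner_Integration.integral_add) (auto intro!: integrable_norm fh integrable_translate[OF fh])
  also have "(\<integral>y. norm (f (y + k) - h (y + k)) \<partial>lborel) = (\<integral>y. norm (f y - h y) \<partial>lborel)"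
    using f h by (intro integral_translate[where f="\<lambda>y. norm (f y - h y)"]) auto
  finally show ?thesis by simp
qed

lemma L1_shift_nonneg: "0 \<le> L1_shift f k"
  by (simp add: L1_shift_def)

lemma L1_shift_tendsto_approx:
  fixes f :: "'a::euclidean_space \<Rightarrow> 'b::euclidean_space"
  assumes f: "integrable lborel f"
    and approx: "\<And>e. 0 < e \<Longrightarrow> \<exists>h. integrable lborel h \<and> (L1_shift h \<longlongrightarrow> 0) (at 0) \<and> (\<integral>y. norm (f y - h y) \<partial>lborel) \<le> e"
  shows "(L1_shift f \<longlongrightarrow> 0) (at 0)"
proof (rule tendstoI)
  fix e :: real assume e: "0 < e"
  obtain h where h: "integrable lborel h" "(L1_shift h \<longlongrightarrow> 0) (at 0)" "(\<integral>y. norm (f y - h y) \<partial>lborel) \<le> e / 4"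
    using approx[of "e / 4"] e by auto
  have "\<forall>\<^sub>F k in at 0. dist (L1_shift h k) 0 < e / 2" using tendstoD[OF h(2), of "e / 2"] e by simp
  then show "\<forall>\<^sub>F k in at 0. dist (L1_shift f k) 0 < e"
  proof eventually_elim
    case (elim k)
    then show ?case using L1_shift_perturb[OF f h(1), of k] h(3) L1_shift_nonneg[of f k] L1_shift_nonneg[of h k] by simp
  qed
qed

text \<open>Points of \<open>U\<close> stay in \<open>U\<close> under small shifts, which makes
  \<open>d\<close> tend to 0 pointwise. The points that enter \<open>U\<close> are, up to
  translation, those that leave it under the opposite shift. So the frontier, where pointwise
  convergence can fail, is never examined.\<close>

lemma L1_shift_open:
  fixes U :: "'a::euclidean_space set" and c :: "'b::euclidean_space"
  assumes U: "open U" "emeasure lborel U < \<infinity>"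
  shows "(L1_shift (\<lambda>x. indicator U x *\<^sub>R c) \<longlongrightarrow> 0) (at 0)"
proof (rule tendsto_at_0_sequentiallyI)
  fix X :: "nat \<Rightarrow> 'a" assume X: "X \<longlonglongrightarrow> 0"
  have [measurable]: "U \<in> sets borel" using U by auto
  have iU: "integrable lborel (indicator U :: 'a \<Rightarrow> real)" using U by (simp add: integrable_indicator_iff)
  define d where "d k y = (indicator U y * (1 - indicator U (y + k)) :: real)" for k y
  have [measurable]: "d k \<in> borel_measurable borel" for k unfolding d_def by measurable
  have id: "integrable lborel (d k)" for k
    by (rule Bochner_Integration.integrable_bound[OF iU]) (auto simp: d_def indicator_def)
  have lim: "(\<lambda>n. \<integral>y. d (Y n) y \<partial>lborel) \<longlonglongrightarrow> integral\<^sup>L (lborel :: 'a measure) (\<lambda>_. 0)" if Y: "Y \<longlonglongrightarrow> 0" for Y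
  proof (rule integral_dominated_convergence[where w="indicator U"])
    show "AE y in lborel. (\<lambda>n. d (Y n) y) \<longlonglongrightarrow> 0"
    proof (rule AE_I2)
      fix y
      show "(\<lambda>n. d (Y n) y) \<longlonglongrightarrow> 0"
      proof (cases "y \<in> U")
        case True
        have "(\<lambda>n. y + Y n) \<longlonglongrightarrow> y + 0" by (intro tendsto_intros Y)
        then have "\<forall>\<^sub>F n in sequentially. y + Y n \<in> U" using U(1) True by (auto dest: topological_tendstoD)
        then have "\<forall>\<^sub>F n in sequentially. d (Y n) y = 0" by eventually_elim (simp add: d_def)
        then show ?thesis by (rule tendsto_eventually)
      qed (simp add: d_def)
    qed
    show "AE y in lborel. norm (d (Y n) y) \<le> indicator U y" for n by (auto simp: d_def indicator_def)
  qed (use iU id in auto)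
  have "L1_shift (\<lambda>x. indicator U x *\<^sub>R c) k = ((\<integral>y. d k y \<partial>lborel) + (\<integral>y. d (- k) y \<partial>lborel)) * norm c" for k
  proof -
    have "L1_shift (\<lambda>x. indicator U x *\<^sub>R c) k = (\<integral>y. (d k y + d (- k) (y + k)) * norm c \<partial>lborel)"
      unfolding L1_shift_def by (intro Bochner_Integration.integral_cong) (auto simp: d_def indicator_def)
    also have "\<dots> = ((\<integral>y. d k y \<partial>lborel) + (\<integral>y. d (- k) (y + k) \<partial>lborel)) * norm c"
      using id integrable_translate[OF id] by simp
    also have "(\<integral>y. d (- k) (y + k) \<partial>lborel) = (\<integral>y. d (- k) y \<partial>lborel)"
      using id by (intro integral_translate) auto
    finally show ?thesis .
  qed
  moreover have "(\<lambda>n. ((\<integral>y. d (X n) y \<partial>lborel) + (\<integral>y. d (- X n) y \<partial>lborel)) * norm c) \<longlonglongrightarrow> (0 + 0) * norm c"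
    using lim[OF X] lim[of "\<lambda>n. - X n"] tendsto_minus[OF X] by (intro tendsto_intros) auto
  ultimately show "(\<lambda>n. L1_shift (\<lambda>x. indicator U x *\<^sub>R c) (X n)) \<longlonglongrightarrow> 0" by simp
qed

text \<open>Indicators of Borel sets are approximated by those of open sets through outer
  regularity; sums follow from the triangle inequality, and dominated limits from
  \<open>L1_shift_tendsto_approx\<close>.\<close>

theorem L1_shift_tendsto_0:
  fixes f :: "'a::euclidean_space \<Rightarrow> 'b::euclidean_space"
  assumes "integrable lborel f"
  shows "(L1_shift f \<longlongrightarrow> 0) (at 0)"
  using assms
proof (induction rule: integrable_induct)
  case (base A c)
  then have A: "A \<in> sets borel" "emeasure lborel A < \<infinity>" by auto
  have iA: "integrable lborel (\<lambda>x. indicator A x *\<^sub>R c)" using A by (intro integrable_scaleR_left) (simp add: integrable_indicator_iff)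
  show ?case
  proof (rule L1_shift_tendsto_approx[OF iA])
    fix e :: real assume e: "0 < e"
    obtain U where U: "open U" "A \<subseteq> U" "emeasure lborel (U - A) < ennreal (e / (1 + norm c))"
      using outer_regular_lborel[OF A(1), of "e / (1 + norm c)"] e by (auto simp: add_pos_nonneg)
    have UA: "emeasure lborel U = emeasure lborel A + emeasure lborel (U - A)"
      using U(1,2) A(1) by (subst plus_emeasure) (auto simp: Un_absorb1)
    have fin: "emeasure lborel U < \<infinity>"
      unfolding UA using A(2) U(3) by (auto simp: ennreal_add_less_top less_top[symmetric] top_unique dest: less_trans[OF _ ennreal_less_top])
    have iU: "integrable lborel (\<lambda>x. indicator U x *\<^sub>R c)" using U(1) fin by (intro integrable_scaleR_left) (simp add: integrable_indicator_iff)
    have "(\<integral>y. norm (indicator A y *\<^sub>R c - indicator U y *\<^sub>R c) \<partial>lborel) = (\<integral>y. indicator (U - A) y * norm c \<partial>lborel)"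
      using U(2) by (intro Bochner_Integration.integral_cong) (auto simp: indicator_def)
    also have "\<dots> = measure lborel (U - A) * norm c" using U(1) A(1) by simp
    also have "\<dots> \<le> e / (1 + norm c) * norm c"
    proof (rule mult_right_mono)
      show "measure lborel (U - A) \<le> e / (1 + norm c)"
        using U(3) e unfolding measure_def by (intro enn2real_leI) (auto simp: less_imp_le add_pos_nonneg)
    qed simp
    also have "\<dots> \<le> e" using e by (simp add: field_simps add_pos_nonneg)
    finally show "\<exists>h. integrable lborel h \<and> (L1_shift h \<longlongrightarrow> 0) (at 0) \<and> (\<integral>y. norm (indicator A y *\<^sub>R c - h y) \<partial>lborel) \<le> e"
      using iU L1_shift_open[OF U(1) fin] by blast
  qed
next
  case (add f g)
  have le: "L1_shift (\<lambda>x. f x + g x) k \<le> L1_shift f k + L1_shift g k" for k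
  proof -
    have "L1_shift (\<lambda>x. f x + g x) k \<le> (\<integral>y. norm (f (y + k) - f y) + norm (g (y + k) - g y) \<partial>lborel)"
      unfolding L1_shift_def
    proof (rule integral_mono)
      fix y
      show "norm (f (y + k) + g (y + k) - (f y + g y)) \<le> norm (f (y + k) - f y) + norm (g (y + k) - g y)"
        by (simp add: add_diff_add norm_triangle_ineq)
    qed (auto intro!: integrable_norm integrable_shift_diff[of "\<lambda>x. f x + g x"] integrable_shift_diff add Bochner_Integration.integrable_add)
    also have "\<dots> = L1_shift f k + L1_shift g k"
      unfolding L1_shift_def by (intro Bochner_Integration.integral_add integrable_norm integrable_shift_diff add)
    finally show ?thesis .
  qed
  have "((\<lambda>k. L1_shift f k + L1_shift g k) \<longlongrightarrow> 0 + 0) (at 0)" by (intro tendsto_intros add)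
  then have "((\<lambda>k. L1_shift f k + L1_shift g k) \<longlongrightarrow> 0) (at 0)" by simp
  then show ?case
    by (rule tendsto_sandwich[rotated 3, where f="\<lambda>_. 0"]) (auto simp: L1_shift_nonneg le)
next
  case (lim f s)
  have "(\<lambda>i. \<integral>y. norm (f y - s i y) \<partial>lborel) \<longlonglongrightarrow> integral\<^sup>L (lborel :: 'a measure) (\<lambda>_. 0)"
  \<comment> \<open>The approximants are bounded by \<open>2 * norm (f y)\<close>, whence the factor
    3.\<close>
  proof (rule integral_dominated_convergence[where w="\<lambda>y. 3 * norm (f y)"])
    show "AE y in lborel. (\<lambda>i. norm (f y - s i y)) \<longlonglongrightarrow> 0"
    proof (rule AE_I2)
      fix y
      have "(\<lambda>i. norm (f y - s i y)) \<longlonglongrightarrow> norm (f y - f y)" by (intro tendsto_intros lim) simp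
      then show "(\<lambda>i. norm (f y - s i y)) \<longlonglongrightarrow> 0" by simp
    qed
    show "AE y in lborel. norm (norm (f y - s i y)) \<le> 3 * norm (f y)" for i
    proof (rule AE_I2)
      fix y
      show "norm (norm (f y - s i y)) \<le> 3 * norm (f y)"
        using norm_triangle_ineq4[of "f y" "s i y"] lim.hyps(3)[of y i] by simp
    qed
  qed (use lim in auto)
  then have conv: "(\<lambda>i. \<integral>y. norm (f y - s i y) \<partial>lborel) \<longlonglongrightarrow> 0" by simp
  show ?case
  proof (rule L1_shift_tendsto_approx[OF lim.hyps(4)])
    fix e :: real assume "0 < e"
    then obtain i where "(\<integral>y. norm (f y - s i y) \<partial>lborel) < e"
      using order_tendstoD(2)[OF conv] by (auto simp: eventually_sequentially)
    then show "\<exists>h. integrable lborel h \<and> (L1_shift h \<longlongrightarrow> 0) (at 0) \<and> (\<integral>y. norm (f y - h y) \<partial>lborel) \<le> e"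
      using lim.hyps(1) lim.IH by (intro exI[of _ "s i"]) auto
  qed
qed

text \<open>For the truncation \<open>T n\<close> at height \<open>n\<close> the square of a
  difference is at most \<open>2 * n\<close> times its norm, which reduces the claim to continuity
  in L1. The discarded part is small in L2, and so are all its translates.\<close>

theorem L2_shift_small:
  fixes f :: "'a::euclidean_space \<Rightarrow> 'b::euclidean_space"
  assumes f1: "integrable lborel f" and f2: "integrable lborel (\<lambda>y. (norm (f y))\<^sup>2)" and e: "0 < e"
  shows "\<exists>\<delta>>0. \<forall>k. norm k < \<delta> \<longrightarrow> (\<integral>\<^sup>+y. ennreal ((norm (f (y + k) - f y))\<^sup>2) \<partial>lborel) \<le> ennreal e"
proof -
  have [measurable]: "f \<in> borel_measurable borel" using f1 by auto
  define T where "T n y = (if norm (f y) \<le> real n then f y else 0)" for n y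
  have [measurable]: "T n \<in> borel_measurable borel" for n unfolding T_def by measurable
  have "(\<lambda>n. \<integral>y. (norm (f y - T n y))\<^sup>2 \<partial>lborel) \<longlonglongrightarrow> integral\<^sup>L (lborel :: 'a measure) (\<lambda>_. 0)"
  proof (rule integral_dominated_convergence[where w="\<lambda>y. (norm (f y))\<^sup>2"])
    show "AE y in lborel. (\<lambda>n. (norm (f y - T n y))\<^sup>2) \<longlonglongrightarrow> 0"
    proof (rule AE_I2)
      fix y
      have "\<forall>\<^sub>F n in sequentially. norm (f y) \<le> real n"
      proof -
        obtain m where "norm (f y) \<le> real m" using real_arch_simple by blast
        then have "\<forall>n\<ge>m. norm (f y) \<le> real n" by (meson of_nat_le_iff order_trans)
        then show ?thesis unfolding eventually_sequentially by blast
      qed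
      then have "\<forall>\<^sub>F n in sequentially. (norm (f y - T n y))\<^sup>2 = 0" by eventually_elim (simp add: T_def)
      then show "(\<lambda>n. (norm (f y - T n y))\<^sup>2) \<longlonglongrightarrow> 0" by (rule tendsto_eventually)
    qed
  qed (use f2 in \<open>auto simp: T_def\<close>)
  then have "(\<lambda>n. \<integral>y. (norm (f y - T n y))\<^sup>2 \<partial>lborel) \<longlonglongrightarrow> 0" by simp
  then obtain n where n: "(\<integral>y. (norm (f y - T n y))\<^sup>2 \<partial>lborel) < e / 12"
    using order_tendstoD(2)[of _ 0 sequentially "e / 12"] e by (auto simp: eventually_sequentially)
  let ?F = "T n"
  have F1: "integrable lborel ?F"
    by (rule Bochner_Integration.integrable_bound[OF f1]) (auto simp: T_def)
  have F2: "integrable lborel (\<lambda>y. (norm (f y - ?F y))\<^sup>2)"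
    by (rule Bochner_Integration.integrable_bound[OF f2]) (auto simp: T_def)
  have "\<forall>\<^sub>F k in at 0. dist (L1_shift ?F k) 0 < e / (12 * (real n + 1))"
    using tendstoD[OF L1_shift_tendsto_0[OF F1], of "e / (12 * (real n + 1))"] e by simp
  then obtain \<delta> where \<delta>: "0 < \<delta>" "\<And>k. k \<noteq> 0 \<Longrightarrow> norm k < \<delta> \<Longrightarrow> L1_shift ?F k < e / (12 * (real n + 1))"
    unfolding eventually_at by (auto simp: L1_shift_nonneg)
  show ?thesis
  proof (intro exI[of _ \<delta>] conjI allI impI)
    fix k :: 'a assume k: "norm k < \<delta>"
    \<comment> \<open>The budget is 3 times the sum of \<open>e / 6\<close>, \<open>e / 12\<close>
      and \<open>e / 12\<close>; the 3 comes from squaring a sum of three terms.\<close>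
    have Tk: "2 * real n * L1_shift ?F k \<le> e / 6"
    proof (cases "k = 0")
      case True then show ?thesis using e by (simp add: L1_shift_def)
    next
      case False
      have "2 * real n * L1_shift ?F k \<le> 2 * (real n + 1) * (e / (12 * (real n + 1)))"
        using \<delta>(2)[OF False k] L1_shift_nonneg[of ?F k] by (intro mult_mono) auto
      also have "\<dots> = e / 6"
      proof -
        have q: "2 * x * (e / (12 * x)) = e / 6" if "0 < x" for x :: real using that by simp
        show ?thesis by (rule q) simp
      qed
      finally show ?thesis .
    qed
    let ?r = "\<lambda>y. (norm (f y - ?F y))\<^sup>2"
    have pw: "(norm (f (y + k) - f y))\<^sup>2 \<le> 3 * (2 * real n * norm (?F (y + k) - ?F y) + (?r (y + k) + ?r y))" for y
    proof -
      let ?a = "norm (?F (y + k) - ?F y)" and ?b = "norm (f (y + k) - ?F (y + k))" and ?c = "norm (f y - ?F y)"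
      have "norm (f (y + k) - f y) = norm ((?F (y + k) - ?F y) + ((f (y + k) - ?F (y + k)) - (f y - ?F y)))" by simp
      also have "\<dots> \<le> ?a + norm ((f (y + k) - ?F (y + k)) - (f y - ?F y))" by (rule norm_triangle_ineq)
      also have "\<dots> \<le> ?a + (?b + ?c)" by (intro add_left_mono norm_triangle_ineq4)
      finally have "norm (f (y + k) - f y) \<le> ?a + (?b + ?c)" .
      then have "(norm (f (y + k) - f y))\<^sup>2 \<le> (?a + (?b + ?c))\<^sup>2" by (intro power_mono) auto
      also have "\<dots> \<le> 3 * (?a\<^sup>2 + (?b\<^sup>2 + ?c\<^sup>2))"
        using zero_le_power2[of "?a - ?b"] zero_le_power2[of "?a - ?c"] zero_le_power2[of "?b - ?c"]
        by (simp add: power2_eq_square algebra_simps)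
      also have "?a\<^sup>2 \<le> 2 * real n * ?a"
      proof -
        have "norm (?F z) \<le> real n" for z by (auto simp: T_def)
        then have "?a \<le> 2 * real n" using norm_triangle_ineq4[of "?F (y + k)" "?F y"] by (smt (verit))
        then show ?thesis unfolding power2_eq_square by (rule mult_right_mono) simp
      qed
      finally show ?thesis by simp
    qed
    have int: "integrable lborel (\<lambda>y. 3 * (2 * real n * norm (?F (y + k) - ?F y) + (?r (y + k) + ?r y)))"
      by (intro integrable_mult_right Bochner_Integration.integrable_add integrable_norm integrable_shift_diff F1 F2 integrable_translate[OF F2])
    have "(\<integral>\<^sup>+y. ennreal ((norm (f (y + k) - f y))\<^sup>2) \<partial>lborel) \<le>
        (\<integral>\<^sup>+y. ennreal (3 * (2 * real n * norm (?F (y + k) - ?F y) + (?r (y + k) + ?r y))) \<partial>lborel)"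
      by (intro nn_integral_mono ennreal_leI pw)
    also have "\<dots> = ennreal (\<integral>y. 3 * (2 * real n * norm (?F (y + k) - ?F y) + (?r (y + k) + ?r y)) \<partial>lborel)"
      by (intro nn_integral_eq_integral int) auto
    also have "(\<integral>y. 3 * (2 * real n * norm (?F (y + k) - ?F y) + (?r (y + k) + ?r y)) \<partial>lborel)
      = 3 * (2 * real n * L1_shift ?F k + ((\<integral>y. ?r (y + k) \<partial>lborel) + (\<integral>y. ?r y \<partial>lborel)))"
      unfolding L1_shift_def using F2 integrable_translate[OF F2] integrable_norm[OF integrable_shift_diff[OF F1]]
      by simp
    also have "(\<integral>y. ?r (y + k) \<partial>lborel) = (\<integral>y. ?r y \<partial>lborel)"
      by (rule integral_translate) measurable
    also have "ennreal (3 * (2 * real n * L1_shift ?F k + ((\<integral>y. ?r y \<partial>lborel) + (\<integral>y. ?r y \<partial>lborel)))) \<le> ennreal e"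
      using Tk n by (intro ennreal_leI) simp
    finally show "(\<integral>\<^sup>+y. ennreal ((norm (f (y + k) - f y))\<^sup>2) \<partial>lborel) \<le> ennreal e" .
  qed (use \<delta> in simp)
qed

section \<open>Difference quotients near the boundary\<close>

definition boundary_layer :: "'a::metric_space set \<Rightarrow> real \<Rightarrow> 'a set" where
  "boundary_layer \<Omega> \<delta> = \<Omega> \<inter> (\<Union>p\<in>frontier \<Omega>. ball p \<delta>)"

lemma open_boundary_layer: "open \<Omega> \<Longrightarrow> open (boundary_layer \<Omega> \<delta>)"
  by (auto simp: boundary_layer_def)

lemma boundary_layer_mono: "\<delta> \<le> \<delta>' \<Longrightarrow> boundary_layer \<Omega> \<delta> \<subseteq> boundary_layer \<Omega> \<delta>'"
  unfolding boundary_layer_def by force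

text \<open>A ball is connected: if the ball around \<open>y\<close> met both
  \<open>\<Omega>\<close> and its complement, it would meet the frontier, and \<open>y\<close> would
  belong to the layer.\<close>

lemma not_in_boundary_layer:
  fixes \<Omega> :: "'a::real_normed_vector set"
  assumes "y \<in> \<Omega>" "y \<notin> boundary_layer \<Omega> \<delta>" "norm k < \<delta>"
  shows "y + k \<in> \<Omega>"
proof (rule ccontr)
  assume "y + k \<notin> \<Omega>"
  moreover have "y + k \<in> ball y \<delta>" "y \<in> ball y \<delta>"
    using assms(3) norm_ge_zero[of k] by (auto simp: dist_norm simp del: norm_ge_zero)
  ultimately have "ball y \<delta> \<inter> \<Omega> \<noteq> {}" "ball y \<delta> - \<Omega> \<noteq> {}" using assms(1) by blast+
  then have "ball y \<delta> \<inter> frontier \<Omega> \<noteq> {}" by (rule connected_Int_frontier[OF connected_ball])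
  then obtain p where "p \<in> frontier \<Omega>" "dist y p < \<delta>" by auto
  then show False using assms(1,2) by (auto simp: boundary_layer_def dist_commute)
qed

text \<open>Every point of the open set has positive distance from the frontier, so the layers
  shrink to the empty set and dominated convergence applies.\<close>

lemma boundary_layer_nn_integral_small:
  fixes f :: "'a::euclidean_space \<Rightarrow> ennreal"
  assumes \<Omega>: "open \<Omega>" and [measurable]: "f \<in> borel_measurable borel"
    and fin: "(\<integral>\<^sup>+y. indicator \<Omega> y * f y \<partial>lborel) < \<infinity>" and e: "0 < e"
  shows "\<exists>\<delta>>0. (\<integral>\<^sup>+y. indicator (boundary_layer \<Omega> \<delta>) y * f y \<partial>lborel) \<le> ennreal e"
proof -
  have [measurable]: "\<Omega> \<in> sets borel" "boundary_layer \<Omega> \<delta> \<in> sets borel" for \<delta>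
    using \<Omega> open_boundary_layer[OF \<Omega>] by auto
  let ?s = "\<lambda>n y. indicator (boundary_layer \<Omega> (1 / real (Suc n))) y * f y"
  have "(\<lambda>n. \<integral>\<^sup>+y. ?s n y \<partial>lborel) \<longlonglongrightarrow> (\<integral>\<^sup>+y. 0 \<partial>(lborel :: 'a measure))"
  proof (rule nn_integral_dominated_convergence[where w="\<lambda>y. indicator \<Omega> y * f y"])
    show "AE y in lborel. (\<lambda>n. ?s n y) \<longlonglongrightarrow> 0"
    proof (rule AE_I2)
      fix y
      show "(\<lambda>n. ?s n y) \<longlonglongrightarrow> 0"
      proof (cases "y \<in> \<Omega>")
        case True
        then obtain r where r: "0 < r" "ball y r \<subseteq> \<Omega>" using \<Omega> by (meson open_contains_ball)
        have "frontier \<Omega> \<inter> \<Omega> = {}" using \<Omega> by (simp add: frontier_disjoint_eq)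
        then have far: "r \<le> dist y p" if "p \<in> frontier \<Omega>" for p
          using that r(2) by (metis disjoint_iff mem_ball not_le subsetD)
        obtain n0 where n0: "1 / real (Suc n0) < r" using nat_approx_posE[OF r(1)] .
        have "\<forall>\<^sub>F n in sequentially. ?s n y = 0"
          unfolding eventually_sequentially
        proof (intro exI[of _ n0] allI impI)
          fix n assume "n0 \<le> n"
          then have "1 / real (Suc n) \<le> 1 / real (Suc n0)" by (simp add: frac_le)
          then have "y \<notin> boundary_layer \<Omega> (1 / real (Suc n))"
            using far n0 unfolding boundary_layer_def by (force simp: dist_commute)
          then show "?s n y = 0" by simp
        qed
        then show ?thesis by (rule tendsto_eventually)
      qed (simp add: boundary_layer_def)
    qed
    show "AE y in lborel. ?s n y \<le> indicator \<Omega> y * f y" for n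
      by (rule AE_I2) (auto simp: indicator_def boundary_layer_def)
  qed (use fin in auto)
  then have "(\<lambda>n. \<integral>\<^sup>+y. ?s n y \<partial>lborel) \<longlonglongrightarrow> 0" by simp
  then have "\<forall>\<^sub>F n in sequentially. (\<integral>\<^sup>+y. ?s n y \<partial>lborel) < ennreal e"
    using e by (intro order_tendstoD(2)) auto
  then obtain n where "(\<integral>\<^sup>+y. ?s n y \<partial>lborel) < ennreal e" by (auto simp: eventually_sequentially)
  then show ?thesis by (intro exI[of _ "1 / real (Suc n)"]) auto
qed

lemma norm_add3_sq_le:
  fixes a b c :: "'a::real_normed_vector"
  shows "(norm (a + b + c))\<^sup>2 \<le> 3 * ((norm a)\<^sup>2 + (norm b)\<^sup>2 + (norm c)\<^sup>2)"
proof -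
  have "norm (a + b + c) \<le> norm a + norm b + norm c"
    by (intro order_trans[OF norm_triangle_ineq] add_right_mono norm_triangle_ineq)
  then have "(norm (a + b + c))\<^sup>2 \<le> (norm a + norm b + norm c)\<^sup>2" by (intro power_mono) auto
  also have "\<dots> \<le> 3 * ((norm a)\<^sup>2 + (norm b)\<^sup>2 + (norm c)\<^sup>2)"
    using zero_le_power2[of "norm a - norm b"] zero_le_power2[of "norm a - norm c"] zero_le_power2[of "norm b - norm c"]
    by (simp add: power2_eq_square algebra_simps)
  finally show ?thesis .
qed

text \<open>Near a boundary point, two points \<open>y\<close> and \<open>y + h\<close> of the domain are joined inside the domain by
  moving both of them a distance comparable to \<open>norm h\<close> in the direction \<open>\<nu>\<close>.\<close>

lemma chart_L2_estimate:
  fixes u :: "real^'n::finite \<Rightarrow> complex" and g :: "real^'n \<Rightarrow> complex^'n"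
  assumes \<Omega>: "open \<Omega>" and u: "integrable lborel u" and g: "integrable lborel g"
    and weak: "weak_gradient_on_bumps \<Omega> u g"
    and \<nu>: "norm \<nu> = 1" and lip: "L-lipschitz_on {y. y \<bullet> \<nu> = 0} \<gamma>"
    and chart: "\<Omega> \<inter> ball p r = {x \<in> ball p r. \<gamma> (x - (x \<bullet> \<nu>) *\<^sub>R \<nu>) < x \<bullet> \<nu>}"
    and V [measurable]: "V \<in> sets borel" and W [measurable]: "W \<in> sets borel"
    and Vp: "\<And>y. y \<in> V \<Longrightarrow> y \<in> \<Omega> \<and> y + h \<in> \<Omega> \<and> y \<in> ball p (r / 2)"
    and small: "(L + 2) * norm h < r / 2"
    and VW: "\<And>y z. y \<in> V \<Longrightarrow> z \<in> \<Omega> \<Longrightarrow> dist y z \<le> (L + 2) * norm h \<Longrightarrow> z \<in> W"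
  shows "(\<integral>\<^sup>+y. indicator V y * ennreal ((norm (u (y + h) - u y))\<^sup>2) \<partial>lborel)
     \<le> ennreal (3 * (2 * (L + 1)\<^sup>2 + 1) * (norm h)\<^sup>2) * (\<integral>\<^sup>+x. indicator W x * ennreal ((norm (g x))\<^sup>2) \<partial>lborel)"
proof -
  have [measurable]: "u \<in> borel_measurable borel" "g \<in> borel_measurable borel" using u g by auto
  have L: "0 \<le> L" using lip by (rule lipschitz_on_nonneg)
  have \<nu>\<nu>: "\<nu> \<bullet> \<nu> = 1" using \<nu> by (simp add: norm_eq_1)
  define P where "P x = x - (x \<bullet> \<nu>) *\<^sub>R \<nu>" for x
  have Plin: "P (x + y) = P x + P y" "P (c *\<^sub>R x) = c *\<^sub>R P x" for x y c
    by (simp_all add: P_def algebra_simps inner_add_left)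
  have P\<nu>: "P \<nu> = 0" by (simp add: P_def \<nu>\<nu>)
  have P0: "P x \<bullet> \<nu> = 0" for x by (simp add: P_def inner_diff_left \<nu>\<nu>)
  have Pn: "norm (P x) \<le> norm x" for x
  proof -
    have "(norm (P x))\<^sup>2 = (norm x)\<^sup>2 - (x \<bullet> \<nu>)\<^sup>2"
      using \<nu>\<nu> unfolding P_def power2_norm_eq_inner
      by (simp add: inner_diff_left inner_diff_right power2_eq_square inner_commute)
    then show ?thesis by (auto intro!: power2_le_imp_le[of "norm (P x)" "norm x"])
  qed
  \<comment> \<open>Along the move by \<open>h\<close> the graph rises by at most
    \<open>L * norm h\<close> and the path sinks by at most \<open>norm h\<close>; the lift
    \<open>\<tau>\<close> compensates both.\<close>
  define \<tau> where "\<tau> = (L + 1) * norm h"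
  define l where "l = \<tau> *\<^sub>R \<nu>"
  have \<tau>: "0 \<le> \<tau>" using L by (simp add: \<tau>_def)
  have nl: "norm l = \<tau>" using \<nu> \<tau> by (simp add: l_def)
  have tot: "\<tau> + norm h = (L + 2) * norm h" by (simp add: \<tau>_def algebra_simps)
  have in\<Omega>: "x \<in> \<Omega>" if "dist p x < r" "\<gamma> (P x) < x \<bullet> \<nu>" for x
  proof -
    have "x \<in> {x \<in> ball p r. \<gamma> (x - (x \<bullet> \<nu>) *\<^sub>R \<nu>) < x \<bullet> \<nu>}" using that by (simp add: P_def)
    then show ?thesis unfolding chart[symmetric] by blast
  qed
  have \<Omega>D: "\<gamma> (P x) < x \<bullet> \<nu>" if "dist p x < r" "x \<in> \<Omega>" for x
  proof -
    have "x \<in> \<Omega> \<inter> ball p r" using that by simp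
    then show ?thesis unfolding chart by (simp add: P_def)
  qed
  have inball: "dist p z < r" if "y \<in> V" "dist y z \<le> (L + 2) * norm h" for y z
    using Vp[OF that(1)] that(2) small dist_triangle[of p z y] by simp
  \<comment> \<open>Moving along \<open>\<nu>\<close> keeps the projection and raises the height, so
    a point above the graph stays above it.\<close>
  have up: "x + t *\<^sub>R l \<in> \<Omega> \<inter> W" if "y \<in> V" "x \<in> \<Omega>" "dist y x \<le> norm h" "t \<in> {0..1}" for x y t
  proof -
    have "norm (t *\<^sub>R l) \<le> \<tau>" using that(4) nl \<tau> by (simp add: mult_left_le_one_le)
    then have d: "dist y (x + t *\<^sub>R l) \<le> (L + 2) * norm h"
      using that(3) dist_triangle[of y "x + t *\<^sub>R l" x] tot by (simp add: dist_norm)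
    have "dist y x \<le> (L + 2) * norm h" using that(3) tot \<tau> by linarith
    then have "\<gamma> (P x) < x \<bullet> \<nu>" using inball[OF that(1)] that(2) by (intro \<Omega>D) auto
    moreover have "P (x + t *\<^sub>R l) = P x" by (simp add: Plin l_def P\<nu>)
    moreover have "x \<bullet> \<nu> \<le> (x + t *\<^sub>R l) \<bullet> \<nu>" using that(4) \<tau> by (simp add: inner_add_left l_def \<nu>\<nu>)
    ultimately have "x + t *\<^sub>R l \<in> \<Omega>" using inball[OF that(1) d] by (intro in\<Omega>) auto
    then show ?thesis using VW[OF that(1) _ d] by simp
  qed
  have across: "(y + l) + t *\<^sub>R h \<in> \<Omega> \<inter> W" if "y \<in> V" "t \<in> {0..1}" for y t
  proof -
    let ?x = "(y + l) + t *\<^sub>R h"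
    have th: "norm (t *\<^sub>R h) \<le> norm h" using that(2) by (simp add: mult_left_le_one_le)
    have "y - ?x = - (l + t *\<^sub>R h)" by simp
    then have "dist y ?x = norm (l + t *\<^sub>R h)" by (simp only: dist_norm norm_minus_cancel)
    also have "\<dots> \<le> (L + 2) * norm h" using norm_triangle_ineq[of l "t *\<^sub>R h"] th nl tot by simp
    finally have d: "dist y ?x \<le> (L + 2) * norm h" .
    have "dist (\<gamma> (P ?x)) (\<gamma> (P y)) \<le> L * dist (P ?x) (P y)"
      by (rule lipschitz_onD[OF lip]) (auto simp: P0)
    also have "\<dots> = L * norm (P (t *\<^sub>R h))" by (simp add: dist_norm Plin l_def P\<nu>)
    also have "\<dots> \<le> L * norm h" using L Pn[of "t *\<^sub>R h"] th by (intro mult_left_mono) auto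
    finally have "\<gamma> (P ?x) \<le> \<gamma> (P y) + L * norm h" by (simp add: dist_real_def)
    also have "\<gamma> (P y) < y \<bullet> \<nu>"
      using Vp[OF that(1)] inball[OF that(1), of y] L by (intro \<Omega>D) auto
    finally have "\<gamma> (P ?x) < y \<bullet> \<nu> + L * norm h" by simp
    moreover have "?x \<bullet> \<nu> = y \<bullet> \<nu> + \<tau> + (t *\<^sub>R h) \<bullet> \<nu>" by (simp add: inner_add_left l_def \<nu>\<nu>)
    moreover have "\<bar>(t *\<^sub>R h) \<bullet> \<nu>\<bar> \<le> norm h"
      using Cauchy_Schwarz_ineq2[of "t *\<^sub>R h" \<nu>] \<nu> th by simp
    moreover have "\<tau> = L * norm h + norm h" by (simp add: \<tau>_def algebra_simps)
    ultimately have "\<gamma> (P ?x) < ?x \<bullet> \<nu>" by linarith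
    then have "?x \<in> \<Omega>" using inball[OF that(1) d] by (intro in\<Omega>)
    then show ?thesis using VW[OF that(1) _ d] by simp
  qed
  let ?I = "\<integral>\<^sup>+x. indicator W x * ennreal ((norm (g x))\<^sup>2) \<partial>lborel"
  let ?D = "\<lambda>k y. ennreal ((norm (u (y + k) - u y))\<^sup>2)"
  \<comment> \<open>The segment estimate with the starting points displaced by \<open>c\<close>;
    translating the integral moves the displacement into the set of starting points.\<close>
  have shift: "(\<integral>\<^sup>+y. indicator V y * ?D k (y + c) \<partial>lborel) \<le> ennreal ((norm k)\<^sup>2) * ?I"
    if s: "\<And>y t. y \<in> V \<Longrightarrow> t \<in> {0..1} \<Longrightarrow> (y + c) + t *\<^sub>R k \<in> \<Omega> \<inter> W" for k c
  proof -
    let ?V = "{z. z - c \<in> V}"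
    have V' [measurable]: "?V \<in> sets borel" by measurable
    have "(\<integral>\<^sup>+y. indicator V y * ?D k (y + c) \<partial>lborel) = (\<integral>\<^sup>+y. indicator ?V (y + c) * ?D k (y + c) \<partial>lborel)"
      by (intro nn_integral_cong) (simp add: indicator_def)
    also have "\<dots> = (\<integral>\<^sup>+y. indicator ?V y * ?D k y \<partial>lborel)"
      by (rule nn_integral_translate[where f="\<lambda>y. indicator ?V y * ?D k y"]) measurable
    also have "\<dots> \<le> ennreal ((norm k)\<^sup>2) * ?I"
      by (rule segment_L2_estimate[OF \<Omega> u g weak V' W]) (use s[of "_ - c"] in auto)
    finally show ?thesis .
  qed
  have 1: "(\<integral>\<^sup>+y. indicator V y * ?D l (y + h) \<partial>lborel) \<le> ennreal ((norm l)\<^sup>2) * ?I"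
    by (rule shift, rule up) (use Vp in \<open>auto simp: dist_norm\<close>)
  have 2: "(\<integral>\<^sup>+y. indicator V y * ?D h (y + l) \<partial>lborel) \<le> ennreal ((norm h)\<^sup>2) * ?I"
    by (rule shift, rule across)
  have 3: "(\<integral>\<^sup>+y. indicator V y * ?D l (y + 0) \<partial>lborel) \<le> ennreal ((norm l)\<^sup>2) * ?I"
    by (rule shift, rule up) (use Vp in auto)
  \<comment> \<open>The way from \<open>y\<close> to \<open>y + h\<close> leads over
    \<open>y + l\<close> and \<open>y + h + l\<close>. Squaring the sum of three increments costs
    the factor 3. The two legs along \<open>\<nu>\<close> contribute
    \<open>2 * (L + 1)\<^sup>2\<close> to the constant, the leg along \<open>h\<close> contributes
    1.\<close>
  have pw: "?D h y \<le> 3 * (?D l (y + h) + ?D h (y + l) + ?D l (y + 0))" for y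
  proof -
    have "u (y + h) - u y = - (u (y + h + l) - u (y + h)) + (u (y + l + h) - u (y + l)) + (u (y + l) - u y)"
      by (simp add: algebra_simps)
    then have "(norm (u (y + h) - u y))\<^sup>2 \<le> 3 * ((norm (u (y + h + l) - u (y + h)))\<^sup>2 + (norm (u (y + l + h) - u (y + l)))\<^sup>2 + (norm (u (y + l) - u y))\<^sup>2)"
      by (metis norm_add3_sq_le norm_minus_cancel)
    then have "?D h y \<le> ennreal (3 * ((norm (u (y + h + l) - u (y + h)))\<^sup>2 + (norm (u (y + l + h) - u (y + l)))\<^sup>2 + (norm (u (y + l) - u y))\<^sup>2))"
      by (rule ennreal_leI)
    then show ?thesis by (simp add: ennreal_mult' ennreal_plus)
  qed
  have "(\<integral>\<^sup>+y. indicator V y * ?D h y \<partial>lborel) \<le>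
      (\<integral>\<^sup>+y. 3 * (indicator V y * ?D l (y + h) + indicator V y * ?D h (y + l) + indicator V y * ?D l (y + 0)) \<partial>lborel)"
    using pw by (intro nn_integral_mono) (auto simp: indicator_def)
  also have "\<dots> = 3 * ((\<integral>\<^sup>+y. indicator V y * ?D l (y + h) \<partial>lborel) + (\<integral>\<^sup>+y. indicator V y * ?D h (y + l) \<partial>lborel) + (\<integral>\<^sup>+y. indicator V y * ?D l (y + 0) \<partial>lborel))"
    by (subst nn_integral_cmult, measurable, subst nn_integral_add, measurable, subst nn_integral_add, measurable)
  also have "\<dots> \<le> 3 * (ennreal ((norm l)\<^sup>2) * ?I + ennreal ((norm h)\<^sup>2) * ?I + ennreal ((norm l)\<^sup>2) * ?I)"
    by (intro mult_left_mono add_mono 1 2 3) simp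
  also have "\<dots> = ennreal (3 * ((norm l)\<^sup>2 + (norm h)\<^sup>2 + (norm l)\<^sup>2)) * ?I"
  proof -
    have e: "ennreal (3 * ((norm l)\<^sup>2 + (norm h)\<^sup>2 + (norm l)\<^sup>2)) = 3 * (ennreal ((norm l)\<^sup>2) + ennreal ((norm h)\<^sup>2) + ennreal ((norm l)\<^sup>2))"
    proof -
      have "ennreal (3 * (a + b + a)) = 3 * (ennreal a + ennreal b + ennreal a)" if "0 \<le> a" "0 \<le> b" for a b :: real
        using that ennreal_mult[of 3 "a + b + a"] by (simp only: ennreal_plus[symmetric] add_nonneg_nonneg ennreal_numeral zero_le_numeral)
      then show ?thesis by simp
    qed
    show ?thesis unfolding e by (simp only: distrib_right mult.assoc)
  qed
  also have "3 * ((norm l)\<^sup>2 + (norm h)\<^sup>2 + (norm l)\<^sup>2) = 3 * (2 * (L + 1)\<^sup>2 + 1) * (norm h)\<^sup>2"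
    unfolding nl \<tau>_def power_mult_distrib by (simp add: distrib_right mult.assoc)
  finally show ?thesis .
qed

text \<open>Compactness of the frontier leaves finitely many charts, whose constants are added up.
  The doubled layer on the right leaves room for the paths of
  \<open>chart_L2_estimate\<close>.\<close>

theorem boundary_layer_L2_estimate:
  fixes u :: "real^'n::finite \<Rightarrow> complex" and g :: "real^'n \<Rightarrow> complex^'n"
  assumes \<Omega>: "open \<Omega>" "bounded \<Omega>" "lipschitz_boundary \<Omega>"
    and u: "integrable lborel u" and g: "integrable lborel g"
    and weak: "weak_gradient_on_bumps \<Omega> u g"
  obtains C \<delta>0 where "0 \<le> C" "0 < \<delta>0"
    "\<And>\<delta>. 0 < \<delta> \<Longrightarrow> \<delta> \<le> \<delta>0 \<Longrightarrow> \<exists>\<rho>>0. \<forall>h. norm h < \<rho> \<longrightarrow>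
       (\<integral>\<^sup>+y. indicator (boundary_layer \<Omega> \<delta> \<inter> {y. y + h \<in> \<Omega>}) y * ennreal ((norm (u (y + h) - u y))\<^sup>2) \<partial>lborel)
       \<le> ennreal (C * (norm h)\<^sup>2) * (\<integral>\<^sup>+x. indicator (boundary_layer \<Omega> (2 * \<delta>)) x * ennreal ((norm (g x))\<^sup>2) \<partial>lborel)"
proof -
  have [measurable]: "u \<in> borel_measurable borel" using u by auto
  define Ch where "Ch p r \<nu> L \<gamma> \<longleftrightarrow> 0 < r \<and> norm \<nu> = 1 \<and> L-lipschitz_on {y. y \<bullet> \<nu> = 0} \<gamma> \<and>
        \<Omega> \<inter> ball p r = {x \<in> ball p r. \<gamma> (x - (x \<bullet> \<nu>) *\<^sub>R \<nu>) < x \<bullet> \<nu>}" for p r \<nu> L \<gamma>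
  have "\<forall>p\<in>frontier \<Omega>. \<exists>r \<nu> L \<gamma>. Ch p r \<nu> L \<gamma>"
    using \<Omega>(3) unfolding lipschitz_boundary_def Ch_def by blast
  then obtain r \<nu> L \<gamma> where "\<And>p. p \<in> frontier \<Omega> \<Longrightarrow> Ch p (r p) (\<nu> p) (L p) (\<gamma> p)" by metis
  then have ch: "\<And>p. p \<in> frontier \<Omega> \<Longrightarrow> 0 < r p" "\<And>p. p \<in> frontier \<Omega> \<Longrightarrow> norm (\<nu> p) = 1"
     "\<And>p. p \<in> frontier \<Omega> \<Longrightarrow> (L p)-lipschitz_on {y. y \<bullet> \<nu> p = 0} (\<gamma> p)"
     "\<And>p. p \<in> frontier \<Omega> \<Longrightarrow> \<Omega> \<inter> ball p (r p) = {x \<in> ball p (r p). \<gamma> p (x - (x \<bullet> \<nu> p) *\<^sub>R \<nu> p) < x \<bullet> \<nu> p}"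
    unfolding Ch_def by blast+
  have "compact (frontier \<Omega>)" using \<Omega>(2) by (simp add: compact_frontier_bounded)
  then obtain F where F: "F \<subseteq> frontier \<Omega>" "finite F" "frontier \<Omega> \<subseteq> (\<Union>p\<in>F. ball p (r p / 4))"
    by (rule compactE_image[where C="frontier \<Omega>" and f="\<lambda>p. ball p (r p / 4)"]) (use ch(1) in force)+
  define C where "C = (\<Sum>p\<in>F. 3 * (2 * (L p + 1)\<^sup>2 + 1))"
  \<comment> \<open>A point of the layer is within \<open>\<delta>\<close> of a frontier point,
    which is within \<open>r p / 4\<close> of some chart centre \<open>p\<close>. With
    \<open>\<delta>\<close> at most \<open>r p / 4\<close> the point lies in the ball of radius
    \<open>r p / 2\<close> on which the chart estimate works.\<close>
  define \<delta>0 where "\<delta>0 = Min (insert 1 ((\<lambda>p. r p / 4) ` F))"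
  have \<delta>0: "0 < \<delta>0" "\<And>p. p \<in> F \<Longrightarrow> \<delta>0 \<le> r p / 4"
  proof -
    show "0 < \<delta>0" using F ch(1) by (auto simp: \<delta>0_def)
    show "\<delta>0 \<le> r p / 4" if "p \<in> F" for p unfolding \<delta>0_def by (rule Min_le) (use F that in auto)
  qed
  have C: "0 \<le> C" unfolding C_def by (intro sum_nonneg) auto
  have L: "0 \<le> L p" if "p \<in> F" for p using ch(3) F(1) that by (meson lipschitz_on_nonneg subsetD)
  show thesis
  proof (rule that[OF C \<delta>0(1)])
    fix \<delta> :: real assume \<delta>: "0 < \<delta>" "\<delta> \<le> \<delta>0"
    \<comment> \<open>Keeps the paths, which reach as far as \<open>(L p + 2) * norm h\<close>,
      within \<open>\<delta>\<close> of their starting points.\<close>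
    define \<rho> where "\<rho> = Min (insert 1 ((\<lambda>p. \<delta> / (L p + 2)) ` F))"
    have \<rho>: "0 < \<rho>" "\<And>p. p \<in> F \<Longrightarrow> \<rho> \<le> \<delta> / (L p + 2)"
    proof -
      show "0 < \<rho>" using F \<delta> L by (auto simp: \<rho>_def add_nonneg_pos)
      show "\<rho> \<le> \<delta> / (L p + 2)" if "p \<in> F" for p unfolding \<rho>_def by (rule Min_le) (use F that in auto)
    qed
    show "\<exists>\<rho>>0. \<forall>h. norm h < \<rho> \<longrightarrow>
       (\<integral>\<^sup>+y. indicator (boundary_layer \<Omega> \<delta> \<inter> {y. y + h \<in> \<Omega>}) y * ennreal ((norm (u (y + h) - u y))\<^sup>2) \<partial>lborel)
       \<le> ennreal (C * (norm h)\<^sup>2) * (\<integral>\<^sup>+x. indicator (boundary_layer \<Omega> (2 * \<delta>)) x * ennreal ((norm (g x))\<^sup>2) \<partial>lborel)"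
    proof (intro exI[of _ \<rho>] conjI allI impI \<rho>(1))
      fix h :: "real^'n" assume h: "norm h < \<rho>"
      let ?I = "\<integral>\<^sup>+x. indicator (boundary_layer \<Omega> (2 * \<delta>)) x * ennreal ((norm (g x))\<^sup>2) \<partial>lborel"
      let ?D = "\<lambda>y. ennreal ((norm (u (y + h) - u y))\<^sup>2)"
      define V where "V p = boundary_layer \<Omega> \<delta> \<inter> {y. y + h \<in> \<Omega>} \<inter> ball p (r p / 2)" for p
      have oV: "open (V p)" for p
      proof -
        have "open {y. y + h \<in> \<Omega>}"
          using open_vimage[OF \<Omega>(1), of "\<lambda>y. y + h"] by (simp add: vimage_def continuous_intros)
        then show ?thesis unfolding V_def by (intro open_Int open_boundary_layer \<Omega>(1)) auto
      qed
      then have [measurable]: "V p \<in> sets borel" for p by auto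
      have hs: "(L p + 2) * norm h < \<delta>" if "p \<in> F" for p
      proof -
        have "norm h < \<delta> / (L p + 2)" using h \<rho>(2)[OF that] by simp
        then show ?thesis using L[OF that] by (simp add: pos_less_divide_eq mult.commute)
      qed
      have cov: "boundary_layer \<Omega> \<delta> \<inter> {y. y + h \<in> \<Omega>} \<subseteq> (\<Union>p\<in>F. V p)"
      proof
        fix y assume y: "y \<in> boundary_layer \<Omega> \<delta> \<inter> {y. y + h \<in> \<Omega>}"
        then obtain q where q: "q \<in> frontier \<Omega>" "dist q y < \<delta>" by (auto simp: boundary_layer_def)
        then obtain p where p: "p \<in> F" "dist p q < r p / 4" using F(3) by auto
        have "dist p y < r p / 2" using dist_triangle[of p y q] q(2) p(2) \<delta>(2) \<delta>0(2)[OF p(1)] by simp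
        then show "y \<in> (\<Union>p\<in>F. V p)" using y p(1) by (auto simp: V_def)
      qed
      have "(\<integral>\<^sup>+y. indicator (boundary_layer \<Omega> \<delta> \<inter> {y. y + h \<in> \<Omega>}) y * ?D y \<partial>lborel) \<le> (\<integral>\<^sup>+y. (\<Sum>p\<in>F. indicator (V p) y * ?D y) \<partial>lborel)"
      proof (rule nn_integral_mono)
        fix y
        show "indicator (boundary_layer \<Omega> \<delta> \<inter> {y. y + h \<in> \<Omega>}) y * ?D y \<le> (\<Sum>p\<in>F. indicator (V p) y * ?D y)"
        proof (cases "y \<in> boundary_layer \<Omega> \<delta> \<inter> {y. y + h \<in> \<Omega>}")
          case True
          then obtain p where p: "p \<in> F" "y \<in> V p" using cov by blast
          have "indicator (V p) y * ?D y \<le> (\<Sum>p\<in>F. indicator (V p) y * ?D y)"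
            by (rule member_le_sum[OF p(1)]) (use F(2) in auto)
          then show ?thesis using True p(2) by simp
        qed simp
      qed
      also have "\<dots> = (\<Sum>p\<in>F. \<integral>\<^sup>+y. indicator (V p) y * ?D y \<partial>lborel)"
        by (rule nn_integral_sum) measurable
      also have "\<dots> \<le> (\<Sum>p\<in>F. ennreal (3 * (2 * (L p + 1)\<^sup>2 + 1) * (norm h)\<^sup>2) * ?I)"
      proof (rule sum_mono)
        fix p assume p: "p \<in> F"
        then have pf: "p \<in> frontier \<Omega>" using F(1) by blast
        show "(\<integral>\<^sup>+y. indicator (V p) y * ?D y \<partial>lborel) \<le> ennreal (3 * (2 * (L p + 1)\<^sup>2 + 1) * (norm h)\<^sup>2) * ?I"
        proof (rule chart_L2_estimate[OF \<Omega>(1) u g weak ch(2,3,4)[OF pf]])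
          show "boundary_layer \<Omega> (2 * \<delta>) \<in> sets borel" using open_boundary_layer[OF \<Omega>(1)] by auto
          show "y \<in> \<Omega> \<and> y + h \<in> \<Omega> \<and> y \<in> ball p (r p / 2)" if "y \<in> V p" for y
            using that by (auto simp: V_def boundary_layer_def)
          show "(L p + 2) * norm h < r p / 2"
            using hs[OF p] \<delta>(2) \<delta>0(2)[OF p] ch(1)[OF pf] by linarith
          fix y z assume yz: "y \<in> V p" "z \<in> \<Omega>" "dist y z \<le> (L p + 2) * norm h"
          then obtain q where q: "q \<in> frontier \<Omega>" "dist q y < \<delta>" by (auto simp: V_def boundary_layer_def)
          have "dist q z < 2 * \<delta>" using dist_triangle[of q z y] q(2) yz(3) hs[OF p] by simp
          then show "z \<in> boundary_layer \<Omega> (2 * \<delta>)" using q(1) yz(2) by (auto simp: boundary_layer_def)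
        qed measurable
      qed
      also have "\<dots> = (\<Sum>p\<in>F. ennreal (3 * (2 * (L p + 1)\<^sup>2 + 1) * (norm h)\<^sup>2)) * ?I"
        by (rule sum_distrib_right[symmetric])
      also have "(\<Sum>p\<in>F. ennreal (3 * (2 * (L p + 1)\<^sup>2 + 1) * (norm h)\<^sup>2)) = ennreal (C * (norm h)\<^sup>2)"
        unfolding C_def by (subst sum_ennreal) (auto simp: sum_distrib_right)
      finally show "(\<integral>\<^sup>+y. indicator (boundary_layer \<Omega> \<delta> \<inter> {y. y + h \<in> \<Omega>}) y * ?D y \<partial>lborel) \<le> ennreal (C * (norm h)\<^sup>2) * ?I" .
    qed
  qed
qed

section \<open>Magnetic differences\<close>

lemma norm_vec_phase:
  fixes a :: "real^'n::finite"
  shows "norm (\<chi> j. \<i> * complex_of_real (a $ j) * z) = norm a * norm z"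
proof -
  have "norm (\<chi> j. \<i> * complex_of_real (a $ j) * z) = L2_set (\<lambda>j. norm z * \<bar>a $ j\<bar>) UNIV"
    by (simp add: norm_vec_def norm_mult mult.commute)
  also have "\<dots> = norm z * L2_set (\<lambda>j. \<bar>a $ j\<bar>) UNIV" by (rule L2_set_right_distrib[symmetric]) simp
  finally show ?thesis by (simp add: norm_vec_def mult.commute)
qed

lemma borel_measurable_vec_phase:
  fixes a :: "'b \<Rightarrow> real^'n::finite"
  assumes [measurable]: "a \<in> borel_measurable N" "z \<in> borel_measurable N"
  shows "(\<lambda>x. \<chi> j. \<i> * complex_of_real (a x $ j) * z x) \<in> borel_measurable N"
proof (subst borel_measurable_euclidean_space, rule ballI)
  have [measurable]: "(\<lambda>x. a x $ j) \<in> borel_measurable N" for j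
    by (rule measurable_compose[OF assms(1)]) (simp add: borel_measurable_continuous_onI continuous_on_component)
  fix b :: "complex^'n" assume "b \<in> Basis"
  then obtain i c where "b = axis i c" "c \<in> Basis" by (auto simp: Basis_vec_def)
  then show "(\<lambda>x. (\<chi> j. \<i> * complex_of_real (a x $ j) * z x) \<bullet> b) \<in> borel_measurable N"
    by (simp add: inner_axis)
qed

text \<open>Everything is Borel on the whole space, \<open>u\<close> and \<open>g\<close> vanish
  outside the domain and \<open>A\<close> is globally bounded, so all integrals can be taken against
  \<open>lborel\<close>. The data of the theorem are brought to this form by choosing
  representatives.\<close>

locale magnetic_data =
  fixes \<Omega> :: "(real^'n::finite) set" and u :: "real^'n \<Rightarrow> complex" and g :: "real^'n \<Rightarrow> complex^'n"
    and A :: "real^'n \<Rightarrow> real^'n" and M :: real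
  assumes \<Omega>: "open \<Omega>" "bounded \<Omega>" "lipschitz_boundary \<Omega>"
    and u_borel [measurable]: "u \<in> borel_measurable borel"
    and g_borel [measurable]: "g \<in> borel_measurable borel"
    and A_borel [measurable]: "A \<in> borel_measurable borel"
    and u_outside: "\<And>x. x \<notin> \<Omega> \<Longrightarrow> u x = 0" and g_outside: "\<And>x. x \<notin> \<Omega> \<Longrightarrow> g x = 0"
    and integrable_u_sq: "integrable lborel (\<lambda>x. (norm (u x))\<^sup>2)" and integrable_g_sq: "integrable lborel (\<lambda>x. (norm (g x))\<^sup>2)"
    and weak: "weak_gradient_on_bumps \<Omega> u g"
    and A_bound: "\<And>x. norm (A x) \<le> M" and A_unif: "uniformly_continuous_on \<Omega> A"
begin

lemma \<Omega>_borel [measurable]: "\<Omega> \<in> sets borel"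
  using \<Omega> by auto

lemma layer_borel [measurable]: "boundary_layer \<Omega> \<delta> \<in> sets borel"
  using open_boundary_layer[OF \<Omega>(1)] by auto

lemma M_nonneg: "0 \<le> M"
  using A_bound[of 0] norm_ge_zero order_trans by blast

lemma integrable_if_L2:
  fixes f :: "real^'n \<Rightarrow> 'c::euclidean_space"
  assumes [measurable]: "f \<in> borel_measurable borel" and f0: "\<And>x. x \<notin> \<Omega> \<Longrightarrow> f x = 0"
    and f2: "integrable lborel (\<lambda>x. (norm (f x))\<^sup>2)"
  shows "integrable lborel f"
proof -
  have "integrable lborel (\<lambda>x. indicator \<Omega> x + (norm (f x))\<^sup>2 :: real)"
    using f2 emeasure_bounded_finite[OF \<Omega>(2)]
    by (intro Bochner_Integration.integrable_add) (auto simp: integrable_indicator_iff)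
  then show ?thesis
  proof (rule Bochner_Integration.integrable_bound)
    have "norm (f x) \<le> norm (indicator \<Omega> x + (norm (f x))\<^sup>2 :: real)" for x
    proof -
      have "t \<le> 1 + t\<^sup>2" for t :: real
      proof (cases "0 \<le> t")
        case True then show ?thesis
          using zero_le_power2[of "t - 1"] by (simp add: power2_eq_square algebra_simps)
      next
        case False then show ?thesis using zero_le_power2[of t] by linarith
      qed
      then show ?thesis using f0[of x] by (auto simp: indicator_def)
    qed
    then show "AE x in lborel. norm (f x) \<le> norm (indicator \<Omega> x + (norm (f x))\<^sup>2 :: real)" by simp
  qed measurable
qed

lemma integrable_u: "integrable lborel u"
  by (rule integrable_if_L2) (use u_outside integrable_u_sq in auto)

lemma integrable_g: "integrable lborel g"
  by (rule integrable_if_L2) (use g_outside integrable_g_sq in auto)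

lemma nn_integral_sq_finite:
  fixes f :: "real^'n \<Rightarrow> 'c::euclidean_space"
  assumes f2: "integrable lborel (\<lambda>x. (norm (f x))\<^sup>2)"
  shows "(\<integral>\<^sup>+x. ennreal ((norm (f x))\<^sup>2) \<partial>lborel) < \<infinity>" "(\<integral>\<^sup>+x. indicator S x * ennreal ((norm (f x))\<^sup>2) \<partial>lborel) < \<infinity>"
proof -
  show 1: "(\<integral>\<^sup>+x. ennreal ((norm (f x))\<^sup>2) \<partial>lborel) < \<infinity>"
    using f2 by (simp add: integrable_iff_bounded)
  have "(\<integral>\<^sup>+x. indicator S x * ennreal ((norm (f x))\<^sup>2) \<partial>lborel) \<le> (\<integral>\<^sup>+x. ennreal ((norm (f x))\<^sup>2) \<partial>lborel)"
    by (intro nn_integral_mono) (simp add: indicator_def)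
  then show "(\<integral>\<^sup>+x. indicator S x * ennreal ((norm (f x))\<^sup>2) \<partial>lborel) < \<infinity>" using 1 by (rule le_less_trans)
qed

definition m :: "real^'n \<Rightarrow> complex^'n" where
  "m x = g x - (\<chi> j. \<i> * complex_of_real (A x $ j) * u x)"

definition D :: "real^'n \<Rightarrow> real^'n \<Rightarrow> complex" where
  "D h y = u (y + h) - exp (\<i> * complex_of_real (h \<bullet> A (y + (1/2) *\<^sub>R h))) * u y"

definition G :: "real^'n \<Rightarrow> ennreal" where
  "G h = (\<integral>\<^sup>+y. indicator (\<Omega> \<inter> {y. y + h \<in> \<Omega>}) y * ennreal ((norm (D h y))\<^sup>2) \<partial>lborel)"

definition Q :: "real^'n \<Rightarrow> ennreal" where
  "Q h = (\<integral>\<^sup>+y. ennreal ((norm (dir_deriv m h y))\<^sup>2) \<partial>lborel)"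

lemma dir_deriv_m: "dir_deriv m h y = dir_deriv g h y - \<i> * complex_of_real (h \<bullet> A y) * u y"
proof -
  have "(\<Sum>j\<in>UNIV. h $ j *\<^sub>R (\<i> * complex_of_real (A y $ j) * u y)) = \<i> * complex_of_real (h \<bullet> A y) * u y"
    by (simp add: inner_vec_def scaleR_conv_of_real sum_distrib_left sum_distrib_right mult_ac)
  then show ?thesis by (simp add: dir_deriv_def m_def scaleR_diff_right sum_subtractf)
qed

lemma m_borel [measurable]: "m \<in> borel_measurable borel"
  unfolding m_def[abs_def] by (intro borel_measurable_diff g_borel borel_measurable_vec_phase A_borel u_borel)

lemma D_borel [measurable]: "D h \<in> borel_measurable borel"
  unfolding D_def[abs_def] by measurable

lemma m_outside: "x \<notin> \<Omega> \<Longrightarrow> m x = 0"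
  by (simp add: m_def u_outside g_outside vec_eq_iff)

lemma integrable_m_sq: "integrable lborel (\<lambda>x. (norm (m x))\<^sup>2)"
proof -
  have "integrable lborel (\<lambda>x. 2 * (norm (g x))\<^sup>2 + 2 * M\<^sup>2 * (norm (u x))\<^sup>2)"
    by (intro Bochner_Integration.integrable_add integrable_mult_right integrable_u_sq integrable_g_sq)
  then show ?thesis
  proof (rule Bochner_Integration.integrable_bound)
    have "(norm (m x))\<^sup>2 \<le> 2 * (norm (g x))\<^sup>2 + 2 * M\<^sup>2 * (norm (u x))\<^sup>2" for x
    proof -
      have "norm (A x) * norm (u x) \<le> M * norm (u x)" by (intro mult_right_mono A_bound) simp
      then have "norm (m x) \<le> norm (g x) + M * norm (u x)"
        unfolding m_def by (intro order_trans[OF norm_triangle_ineq4] add_left_mono) (simp add: norm_vec_phase)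
      then have "(norm (m x))\<^sup>2 \<le> (norm (g x) + M * norm (u x))\<^sup>2" by (intro power_mono) auto
      also have "\<dots> \<le> 2 * (norm (g x))\<^sup>2 + 2 * M\<^sup>2 * (norm (u x))\<^sup>2"
        using zero_le_power2[of "norm (g x) - M * norm (u x)"] by (simp add: power2_eq_square algebra_simps)
      finally show ?thesis .
    qed
    then show "AE x in lborel. norm ((norm (m x))\<^sup>2) \<le> norm (2 * (norm (g x))\<^sup>2 + 2 * M\<^sup>2 * (norm (u x))\<^sup>2)"
      by (auto intro!: AE_I2 order_trans[OF _ abs_ge_self])
  qed measurable
qed

text \<open>Young's inequality with weight \<open>e\<close>. The factor \<open>1 + e\<close> in
  place of 2 keeps the leading term sharp, and the large factor \<open>1 + 1 / e\<close> falls on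
  the remainder.\<close>

lemma norm_add_sq_le:
  fixes a b :: "'c::real_normed_vector"
  assumes "0 < e"
  shows "(norm a)\<^sup>2 \<le> (1 + e) * (norm b)\<^sup>2 + (1 + 1 / e) * (norm (a - b))\<^sup>2"
proof -
  have "norm a \<le> norm b + norm (a - b)" using norm_triangle_ineq[of b "a - b"] by simp
  then have "(norm a)\<^sup>2 \<le> (norm b + norm (a - b))\<^sup>2" by (intro power_mono) auto
  also have "\<dots> \<le> (1 + e) * (norm b)\<^sup>2 + (1 + 1 / e) * (norm (a - b))\<^sup>2"
  proof -
    have "0 \<le> (e * norm b - norm (a - b))\<^sup>2 / e" using assms by simp
    also have "\<dots> = e * (norm b)\<^sup>2 - 2 * norm b * norm (a - b) + (norm (a - b))\<^sup>2 / e"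
      using assms by (simp add: power2_eq_square field_simps)
    finally show ?thesis by (simp add: power2_eq_square algebra_simps)
  qed
  finally show ?thesis .
qed

text \<open>Away from the frontier the whole segment lies in \<open>\<Omega>\<close> and the
  linearisation applies. In the layer the two terms are estimated separately: the difference by the
  energy of the doubled layer and the derivative by that of the layer, both small.\<close>

lemma difference_quotient_small:
  assumes e: "0 < e"
  shows "\<exists>\<rho>>0. \<forall>h. norm h < \<rho> \<longrightarrow>
    (\<integral>\<^sup>+y. indicator (\<Omega> \<inter> {y. y + h \<in> \<Omega>}) y * ennreal ((norm (u (y + h) - u y - dir_deriv g h y))\<^sup>2) \<partial>lborel)
      \<le> ennreal (e * (norm h)\<^sup>2)"
proof -
  let ?R = "\<lambda>h y. ennreal ((norm (u (y + h) - u y - dir_deriv g h y))\<^sup>2)"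
  obtain C \<delta>0 where C: "0 \<le> C" "0 < \<delta>0"
    "\<And>\<delta>. 0 < \<delta> \<Longrightarrow> \<delta> \<le> \<delta>0 \<Longrightarrow> \<exists>\<rho>>0. \<forall>h. norm h < \<rho> \<longrightarrow>
       (\<integral>\<^sup>+y. indicator (boundary_layer \<Omega> \<delta> \<inter> {y. y + h \<in> \<Omega>}) y * ennreal ((norm (u (y + h) - u y))\<^sup>2) \<partial>lborel)
       \<le> ennreal (C * (norm h)\<^sup>2) * (\<integral>\<^sup>+x. indicator (boundary_layer \<Omega> (2 * \<delta>)) x * ennreal ((norm (g x))\<^sup>2) \<partial>lborel)"
    by (rule boundary_layer_L2_estimate[OF \<Omega> integrable_u integrable_g weak]) (rule that; (assumption | blast))
  \<comment> \<open>Chosen so that \<open>(2 * C + 2) * e1\<close> is \<open>e / 2\<close>, the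
    share of the layer.\<close>
  define e1 where "e1 = e / (2 * (2 * C + 2))"
  have e1: "0 < e1" using e C(1) by (simp add: e1_def add_nonneg_pos)
  obtain \<delta>1 where \<delta>1: "0 < \<delta>1" "(\<integral>\<^sup>+y. indicator (boundary_layer \<Omega> \<delta>1) y * ennreal ((norm (g y))\<^sup>2) \<partial>lborel) \<le> ennreal e1"
    using boundary_layer_nn_integral_small[OF \<Omega>(1) _ nn_integral_sq_finite(2)[OF integrable_g_sq] e1] by auto
  define \<delta> where "\<delta> = min \<delta>0 (\<delta>1 / 2)"
  have \<delta>: "0 < \<delta>" "\<delta> \<le> \<delta>0" "2 * \<delta> \<le> \<delta>1" using C(2) \<delta>1(1) by (auto simp: \<delta>_def)
  let ?I = "\<lambda>S. \<integral>\<^sup>+x. indicator S x * ennreal ((norm (g x))\<^sup>2) \<partial>lborel"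
  have I2: "?I (boundary_layer \<Omega> (2 * \<delta>)) \<le> ennreal e1"
    using boundary_layer_mono[OF \<delta>(3), of \<Omega>]
    by (intro order_trans[OF _ \<delta>1(2)] nn_integral_mono) (auto simp: indicator_def)
  have I1: "?I (boundary_layer \<Omega> \<delta>) \<le> ennreal e1"
    using boundary_layer_mono[of \<delta> "2 * \<delta>" \<Omega>] \<delta>(1)
    by (intro order_trans[OF _ I2] nn_integral_mono) (auto simp: indicator_def)
  obtain \<rho>1 where \<rho>1: "0 < \<rho>1" "\<And>h. norm h < \<rho>1 \<Longrightarrow>
       (\<integral>\<^sup>+y. indicator (boundary_layer \<Omega> \<delta> \<inter> {y. y + h \<in> \<Omega>}) y * ennreal ((norm (u (y + h) - u y))\<^sup>2) \<partial>lborel)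
       \<le> ennreal (C * (norm h)\<^sup>2) * ?I (boundary_layer \<Omega> (2 * \<delta>))"
    using C(3)[OF \<delta>(1,2)] by blast
  obtain \<rho>2 where \<rho>2: "0 < \<rho>2" "\<And>k. norm k < \<rho>2 \<Longrightarrow> (\<integral>\<^sup>+y. ennreal ((norm (g (y + k) - g y))\<^sup>2) \<partial>lborel) \<le> ennreal (e / 2)"
    using L2_shift_small[OF integrable_g integrable_g_sq, of "e / 2"] e by auto
  show ?thesis
  proof (intro exI[of _ "min \<delta> (min \<rho>1 \<rho>2)"] conjI allI impI)
    fix h :: "real^'n" assume "norm h < min \<delta> (min \<rho>1 \<rho>2)"
    then have h: "norm h < \<delta>" "norm h < \<rho>1" "norm h < \<rho>2" by auto
    let ?V = "\<Omega> - boundary_layer \<Omega> \<delta>" and ?L = "boundary_layer \<Omega> \<delta> \<inter> {y. y + h \<in> \<Omega>}"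
    have [measurable]: "{y. y + h \<in> \<Omega>} \<in> sets borel" by measurable
    have tn: "norm (t *\<^sub>R h) \<le> norm h" if "t \<in> {0..1}" for t using that by (simp add: mult_left_le_one_le)
    have 1: "(\<integral>\<^sup>+y. indicator ?V y * ?R h y \<partial>lborel) \<le> ennreal ((norm h)\<^sup>2) * ennreal (e / 2)"
    proof (rule segment_L2_linearization[OF \<Omega>(1) integrable_u integrable_g weak])
      show "?V \<in> sets borel" by measurable
      show "y + t *\<^sub>R h \<in> \<Omega>" if "y \<in> ?V" "t \<in> {0..1}" for y t
        using not_in_boundary_layer[of y \<Omega> \<delta> "t *\<^sub>R h"] that tn[OF that(2)] h(1) by auto
      show "(\<integral>\<^sup>+x. ennreal ((norm (g (x + t *\<^sub>R h) - g x))\<^sup>2) \<partial>lborel) \<le> ennreal (e / 2)" if "t \<in> {0..1}" for t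
        by (rule \<rho>2(2)) (use tn[OF that] h(3) in simp)
    qed
    have 2: "(\<integral>\<^sup>+y. indicator ?L y * ?R h y \<partial>lborel) \<le> ennreal ((norm h)\<^sup>2) * ennreal (e / 2)"
    proof -
      have "(\<integral>\<^sup>+y. indicator ?L y * ?R h y \<partial>lborel) \<le>
        (\<integral>\<^sup>+y. 2 * (indicator ?L y * ennreal ((norm (u (y + h) - u y))\<^sup>2)) + 2 * (ennreal ((norm h)\<^sup>2) * (indicator (boundary_layer \<Omega> \<delta>) y * ennreal ((norm (g y))\<^sup>2))) \<partial>lborel)"
      proof (rule nn_integral_mono)
        fix y
        show "indicator ?L y * ?R h y \<le> 2 * (indicator ?L y * ennreal ((norm (u (y + h) - u y))\<^sup>2)) + 2 * (ennreal ((norm h)\<^sup>2) * (indicator (boundary_layer \<Omega> \<delta>) y * ennreal ((norm (g y))\<^sup>2)))"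
        proof (cases "y \<in> ?L")
          case True
          have "(norm (u (y + h) - u y - dir_deriv g h y))\<^sup>2 \<le> (norm (u (y + h) - u y) + norm (dir_deriv g h y))\<^sup>2"
            by (intro power_mono norm_triangle_ineq4) auto
          also have "\<dots> \<le> (norm (u (y + h) - u y) + norm h * norm (g y))\<^sup>2"
            by (intro power_mono add_left_mono norm_dir_deriv_le) auto
          also have "\<dots> \<le> 2 * (norm (u (y + h) - u y))\<^sup>2 + 2 * ((norm h)\<^sup>2 * (norm (g y))\<^sup>2)"
            using zero_le_power2[of "norm (u (y + h) - u y) - norm h * norm (g y)"] by (simp add: power2_eq_square algebra_simps)
          finally have "?R h y \<le> ennreal (2 * (norm (u (y + h) - u y))\<^sup>2 + 2 * ((norm h)\<^sup>2 * (norm (g y))\<^sup>2))" by (rule ennreal_leI)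
          also have "\<dots> = 2 * ennreal ((norm (u (y + h) - u y))\<^sup>2) + 2 * (ennreal ((norm h)\<^sup>2) * ennreal ((norm (g y))\<^sup>2))"
            by (simp add: ennreal_plus ennreal_mult')
          finally show ?thesis using True by simp
        qed simp
      qed
      also have "\<dots> = 2 * (\<integral>\<^sup>+y. indicator ?L y * ennreal ((norm (u (y + h) - u y))\<^sup>2) \<partial>lborel) + 2 * (ennreal ((norm h)\<^sup>2) * ?I (boundary_layer \<Omega> \<delta>))"
        by (subst nn_integral_add, measurable, simp add: nn_integral_cmult)
      also have "\<dots> \<le> 2 * (ennreal (C * (norm h)\<^sup>2) * ennreal e1) + 2 * (ennreal ((norm h)\<^sup>2) * ennreal e1)"
        by (intro add_mono mult_left_mono order_trans[OF \<rho>1(2)[OF h(2)]] I1 I2) auto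
      also have "\<dots> = ennreal ((2 * C + 2) * e1 * (norm h)\<^sup>2)"
      proof -
        have "2 * (ennreal (C * (norm h)\<^sup>2) * ennreal e1) + 2 * (ennreal ((norm h)\<^sup>2) * ennreal e1)
           = ennreal (2 * (C * (norm h)\<^sup>2 * e1) + 2 * ((norm h)\<^sup>2 * e1))"
          using C(1) e1 by (simp add: ennreal_mult' ennreal_plus)
        then show ?thesis by (simp add: algebra_simps)
      qed
      also have "(2 * C + 2) * e1 * (norm h)\<^sup>2 = (norm h)\<^sup>2 * (e / 2)"
      proof -
        have "(2 * C + 2) * e1 = e / 2" unfolding e1_def using C(1) by (simp add: field_simps add_nonneg_pos add_nonneg_eq_0_iff)
        then show ?thesis by simp
      qed
      finally show ?thesis using e by (subst ennreal_mult[symmetric]) auto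
    qed
    have "(\<integral>\<^sup>+y. indicator (\<Omega> \<inter> {y. y + h \<in> \<Omega>}) y * ?R h y \<partial>lborel) \<le> (\<integral>\<^sup>+y. indicator ?V y * ?R h y + indicator ?L y * ?R h y \<partial>lborel)"
      by (intro nn_integral_mono) (auto simp: indicator_def)
    also have "\<dots> = (\<integral>\<^sup>+y. indicator ?V y * ?R h y \<partial>lborel) + (\<integral>\<^sup>+y. indicator ?L y * ?R h y \<partial>lborel)"
      by (rule nn_integral_add) measurable
    also have "\<dots> \<le> ennreal ((norm h)\<^sup>2) * ennreal (e / 2) + ennreal ((norm h)\<^sup>2) * ennreal (e / 2)"
      by (intro add_mono 1 2)
    also have "\<dots> = ennreal (e * (norm h)\<^sup>2)"
    proof -
      have "ennreal ((norm h)\<^sup>2) * ennreal (e / 2) = ennreal ((norm h)\<^sup>2 * (e / 2))"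
        by (rule ennreal_mult[symmetric]) (use e in auto)
      moreover have "ennreal ((norm h)\<^sup>2 * (e / 2)) + ennreal ((norm h)\<^sup>2 * (e / 2)) = ennreal ((norm h)\<^sup>2 * (e / 2) + (norm h)\<^sup>2 * (e / 2))"
        by (rule ennreal_plus[symmetric]) (use e in auto)
      ultimately show ?thesis by (simp only:) (simp add: mult.commute)
    qed
    finally show "(\<integral>\<^sup>+y. indicator (\<Omega> \<inter> {y. y + h \<in> \<Omega>}) y * ?R h y \<partial>lborel) \<le> ennreal (e * (norm h)\<^sup>2)" .
  qed (use \<delta> \<rho>1 \<rho>2 in auto)
qed

text \<open>Here \<open>\<theta>\<close> will be the phase at the midpoint and
  \<open>\<alpha>\<close> the phase at \<open>y\<close>: the first order terms differ by
  \<open>\<theta> - \<alpha>\<close>, and the Taylor remainder of the exponential is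
  quadratic.\<close>

lemma norm_exp_linearization_le:
  fixes \<theta> \<alpha> :: real
  shows "norm (1 + \<i> * complex_of_real \<alpha> - exp (\<i> * complex_of_real \<theta>)) \<le> \<bar>\<theta> - \<alpha>\<bar> + \<theta>\<^sup>2"
proof -
  have "norm (exp (\<i> * complex_of_real \<theta>) - (\<Sum>k\<le>1. (\<i> * complex_of_real \<theta>) ^ k / fact k))
      \<le> exp \<bar>Re (\<i> * complex_of_real \<theta>)\<bar> * norm (\<i> * complex_of_real \<theta>) ^ Suc 1 / fact 1"
    by (rule Taylor_exp)
  then have 1: "norm (exp (\<i> * complex_of_real \<theta>) - (1 + \<i> * complex_of_real \<theta>)) \<le> \<theta>\<^sup>2"
    by (simp add: norm_mult power2_eq_square)
  have "1 + \<i> * complex_of_real \<alpha> - exp (\<i> * complex_of_real \<theta>) =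
      - (\<i> * complex_of_real (\<theta> - \<alpha>)) - (exp (\<i> * complex_of_real \<theta>) - (1 + \<i> * complex_of_real \<theta>))"
    by (simp add: algebra_simps)
  then have "norm (1 + \<i> * complex_of_real \<alpha> - exp (\<i> * complex_of_real \<theta>)) \<le>
      norm (- (\<i> * complex_of_real (\<theta> - \<alpha>))) + norm (exp (\<i> * complex_of_real \<theta>) - (1 + \<i> * complex_of_real \<theta>))"
    by (simp only: norm_triangle_ineq4)
  also have "norm (- (\<i> * complex_of_real (\<theta> - \<alpha>))) = \<bar>\<theta> - \<alpha>\<bar>"
    by (simp only: norm_minus_cancel norm_mult norm_ii norm_of_real mult_1)
  finally show ?thesis using 1 by linarith
qed

text \<open>Uniform continuity of \<open>A\<close> is available on \<open>\<Omega>\<close> only, and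
  near the frontier the midpoint may leave it. There the crude bound by \<open>M\<close> is used,
  paid for by the small mass of \<open>u\<close> in a layer.\<close>

lemma phase_remainder_small:
  assumes e: "0 < e"
  shows "\<exists>\<rho>>0. \<forall>h. norm h < \<rho> \<longrightarrow>
    (\<integral>\<^sup>+y. indicator \<Omega> y * ennreal ((norm ((1 + \<i> * complex_of_real (h \<bullet> A y) - exp (\<i> * complex_of_real (h \<bullet> A (y + (1/2) *\<^sub>R h)))) * u y))\<^sup>2) \<partial>lborel)
      \<le> ennreal (e * (norm h)\<^sup>2)"
proof -
  let ?p = "\<lambda>h y. 1 + \<i> * complex_of_real (h \<bullet> A y) - exp (\<i> * complex_of_real (h \<bullet> A (y + (1/2) *\<^sub>R h)))"
  define U where "U = enn2real (\<integral>\<^sup>+x. ennreal ((norm (u x))\<^sup>2) \<partial>lborel)"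
  have U: "(\<integral>\<^sup>+x. ennreal ((norm (u x))\<^sup>2) \<partial>lborel) = ennreal U" "0 \<le> U"
    using nn_integral_sq_finite(1)[OF integrable_u_sq] by (auto simp: U_def)
  \<comment> \<open>Makes \<open>\<eta>\<^sup>2 * U\<close> at most \<open>e / 2\<close>; the added
    1 covers the case \<open>U = 0\<close>.\<close>
  define \<eta> where "\<eta> = sqrt (e / (2 * (U + 1)))"
  have \<eta>: "0 < \<eta>" "\<eta>\<^sup>2 = e / (2 * (U + 1))" using e U(2) by (auto simp: \<eta>_def)
  \<comment> \<open>For \<open>norm h\<close> below 1 the crude phase error is at most
    \<open>norm h\<close> times \<open>2 * M + M\<^sup>2\<close>. The added 1 keeps \<open>K\<close>
    positive, so that one can divide by it.\<close>
  define K where "K = (2 * M + M\<^sup>2)\<^sup>2 + 1"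
  have K: "0 < K" by (simp add: K_def add_nonneg_pos)
  obtain \<delta> where \<delta>: "0 < \<delta>" "(\<integral>\<^sup>+y. indicator (boundary_layer \<Omega> \<delta>) y * ennreal ((norm (u y))\<^sup>2) \<partial>lborel) \<le> ennreal (e / (2 * K))"
    using boundary_layer_nn_integral_small[OF \<Omega>(1) _ nn_integral_sq_finite(2)[OF integrable_u_sq], of "e / (2 * K)"] e K by auto
  obtain \<rho>1 where \<rho>1: "0 < \<rho>1" "\<And>x y. x \<in> \<Omega> \<Longrightarrow> y \<in> \<Omega> \<Longrightarrow> dist y x < \<rho>1 \<Longrightarrow> dist (A y) (A x) < \<eta> / 2"
    using A_unif \<eta>(1) unfolding uniformly_continuous_on_def by (meson half_gt_zero)
  \<comment> \<open>Brings the quadratic phase error \<open>M\<^sup>2 * (norm h)\<^sup>2\<close>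
    below \<open>norm h\<close> times \<open>\<eta> / 2\<close>.\<close>
  define \<rho>2 where "\<rho>2 = \<eta> / (2 * (M\<^sup>2 + 1))"
  have \<rho>2: "0 < \<rho>2" "M\<^sup>2 * \<rho>2 \<le> \<eta> / 2"
  proof -
    have pos: "0 < M\<^sup>2 + 1" by (simp add: add_nonneg_pos)
    show "0 < \<rho>2" unfolding \<rho>2_def using \<eta>(1) pos by (intro divide_pos_pos) auto
    have "M\<^sup>2 / (M\<^sup>2 + 1) * (\<eta> / 2) \<le> 1 * (\<eta> / 2)"
      using \<eta>(1) pos by (intro mult_right_mono) (auto simp: divide_le_eq_1)
    then show "M\<^sup>2 * \<rho>2 \<le> \<eta> / 2" by (simp add: \<rho>2_def mult.commute)
  qed
  have base: "norm (?p h y) \<le> norm h * norm (A (y + (1/2) *\<^sub>R h) - A y) + (M * norm h)\<^sup>2" for h y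
  proof -
    have "\<bar>h \<bullet> A (y + (1/2) *\<^sub>R h) - h \<bullet> A y\<bar> \<le> norm h * norm (A (y + (1/2) *\<^sub>R h) - A y)"
      unfolding inner_diff_right[symmetric] by (rule Cauchy_Schwarz_ineq2)
    moreover have "(h \<bullet> A (y + (1/2) *\<^sub>R h))\<^sup>2 \<le> (M * norm h)\<^sup>2"
    proof -
      have "\<bar>h \<bullet> A (y + (1/2) *\<^sub>R h)\<bar> \<le> norm h * norm (A (y + (1/2) *\<^sub>R h))" by (rule Cauchy_Schwarz_ineq2)
      also have "\<dots> \<le> norm h * M" by (intro mult_left_mono A_bound) simp
      finally show ?thesis using M_nonneg by (intro abs_le_square_iff[THEN iffD1]) (simp add: mult.commute)
    qed
    ultimately show ?thesis using norm_exp_linearization_le[of "h \<bullet> A y" "h \<bullet> A (y + (1/2) *\<^sub>R h)"] by linarith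
  qed
  show ?thesis
  proof (intro exI[of _ "min 1 (min \<delta> (min \<rho>1 \<rho>2))"] conjI allI impI)
    fix h :: "real^'n" assume "norm h < min 1 (min \<delta> (min \<rho>1 \<rho>2))"
    then have h: "norm h < 1" "norm h < \<delta>" "norm h < \<rho>1" "norm h < \<rho>2" by auto
    have half: "norm ((1/2) *\<^sub>R h) \<le> norm h" by simp
    have inner: "norm (?p h y) \<le> norm h * \<eta>" if y: "y \<in> \<Omega>" "y \<notin> boundary_layer \<Omega> \<delta>" for y
    proof -
      have "y + (1/2) *\<^sub>R h \<in> \<Omega>" using not_in_boundary_layer[OF y] half h(2) by (meson le_less_trans)
      then have "dist (A (y + (1/2) *\<^sub>R h)) (A y) < \<eta> / 2"
        using y(1) half h(3) \<rho>1(1) by (intro \<rho>1(2)) (auto simp: dist_norm)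
      then have a: "norm (A (y + (1/2) *\<^sub>R h) - A y) \<le> \<eta> / 2" by (simp add: dist_norm)
      have b: "M\<^sup>2 * norm h \<le> \<eta> / 2"
        using mult_left_mono[of "norm h" \<rho>2 "M\<^sup>2"] h(4) \<rho>2(2) by simp
      have "norm (?p h y) \<le> norm h * (\<eta> / 2) + norm h * (M\<^sup>2 * norm h)"
        using base[of h y] mult_left_mono[OF a, of "norm h"] by (simp add: power2_eq_square mult_ac)
      also have "\<dots> \<le> norm h * (\<eta> / 2) + norm h * (\<eta> / 2)" by (intro add_left_mono mult_left_mono b) simp
      also have "\<dots> = norm h * \<eta>" by (simp add: field_simps)
      finally show ?thesis .
    qed
    have outer: "norm (?p h y) \<le> norm h * (2 * M + M\<^sup>2)" for y
    proof -
      have a: "norm (A (y + (1/2) *\<^sub>R h) - A y) \<le> 2 * M"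
        using norm_triangle_ineq4[of "A (y + (1/2) *\<^sub>R h)" "A y"] A_bound[of y] A_bound[of "y + (1/2) *\<^sub>R h"] by linarith
      have b: "M\<^sup>2 * norm h \<le> M\<^sup>2" using h(1) by (simp add: mult_left_le)
      have "norm (?p h y) \<le> norm h * (2 * M) + norm h * (M\<^sup>2 * norm h)"
        using base[of h y] mult_left_mono[OF a, of "norm h"] by (simp add: power2_eq_square mult_ac)
      also have "\<dots> \<le> norm h * (2 * M) + norm h * M\<^sup>2" by (intro add_left_mono mult_left_mono b) simp
      finally show ?thesis by (simp add: distrib_left)
    qed
    have "(\<integral>\<^sup>+y. indicator \<Omega> y * ennreal ((norm (?p h y * u y))\<^sup>2) \<partial>lborel) \<le>
      (\<integral>\<^sup>+y. ennreal ((norm h)\<^sup>2 * \<eta>\<^sup>2) * ennreal ((norm (u y))\<^sup>2) + ennreal ((norm h)\<^sup>2 * K) * (indicator (boundary_layer \<Omega> \<delta>) y * ennreal ((norm (u y))\<^sup>2)) \<partial>lborel)"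
    proof (rule nn_integral_mono)
      fix y
      have mono: "ennreal ((norm (?p h y * u y))\<^sup>2) \<le> ennreal (B\<^sup>2) * ennreal ((norm (u y))\<^sup>2)" if "norm (?p h y) \<le> B" for B
      proof -
        have "(norm (?p h y * u y))\<^sup>2 \<le> B\<^sup>2 * (norm (u y))\<^sup>2"
          unfolding norm_mult power_mult_distrib using that by (intro mult_right_mono power_mono) auto
        then show ?thesis by (subst ennreal_mult[symmetric]) (auto intro: ennreal_leI)
      qed
      show "indicator \<Omega> y * ennreal ((norm (?p h y * u y))\<^sup>2) \<le>
        ennreal ((norm h)\<^sup>2 * \<eta>\<^sup>2) * ennreal ((norm (u y))\<^sup>2) + ennreal ((norm h)\<^sup>2 * K) * (indicator (boundary_layer \<Omega> \<delta>) y * ennreal ((norm (u y))\<^sup>2))"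
      proof (cases "y \<in> \<Omega>")
        case y: True
        show ?thesis
        proof (cases "y \<in> boundary_layer \<Omega> \<delta>")
          case True
          have "ennreal ((norm (?p h y * u y))\<^sup>2) \<le> ennreal ((norm h * (2 * M + M\<^sup>2))\<^sup>2) * ennreal ((norm (u y))\<^sup>2)"
            by (rule mono[OF outer])
          also have "\<dots> \<le> ennreal ((norm h)\<^sup>2 * K) * ennreal ((norm (u y))\<^sup>2)"
            by (intro mult_right_mono ennreal_leI) (auto simp: K_def power_mult_distrib mult_left_mono)
          finally show ?thesis using True y by (simp add: add_increasing)
        next
          case False
          then show ?thesis using mono[OF inner[OF y False]] y by (simp add: power_mult_distrib)
        qed
      qed simp
    qed
    also have "\<dots> = ennreal ((norm h)\<^sup>2 * \<eta>\<^sup>2) * ennreal U + ennreal ((norm h)\<^sup>2 * K) * (\<integral>\<^sup>+y. indicator (boundary_layer \<Omega> \<delta>) y * ennreal ((norm (u y))\<^sup>2) \<partial>lborel)"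
      by (subst nn_integral_add, measurable, simp add: nn_integral_cmult U)
    also have "\<dots> \<le> ennreal ((norm h)\<^sup>2 * \<eta>\<^sup>2) * ennreal U + ennreal ((norm h)\<^sup>2 * K) * ennreal (e / (2 * K))"
      by (intro add_left_mono mult_left_mono \<delta>(2)) simp
    also have "\<dots> = ennreal ((norm h)\<^sup>2 * \<eta>\<^sup>2 * U + (norm h)\<^sup>2 * K * (e / (2 * K)))"
    proof -
      have "ennreal (a + b) = ennreal a + ennreal b" if "0 \<le> a" "0 \<le> b" for a b using that by (rule ennreal_plus)
      moreover have "ennreal ((norm h)\<^sup>2 * \<eta>\<^sup>2 * U) = ennreal ((norm h)\<^sup>2 * \<eta>\<^sup>2) * ennreal U"
        by (rule ennreal_mult) (use U(2) in auto)
      moreover have "ennreal ((norm h)\<^sup>2 * K * (e / (2 * K))) = ennreal ((norm h)\<^sup>2 * K) * ennreal (e / (2 * K))"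
        by (rule ennreal_mult) (use K e in auto)
      moreover have "0 \<le> (norm h)\<^sup>2 * \<eta>\<^sup>2 * U" "0 \<le> (norm h)\<^sup>2 * K * (e / (2 * K))"
        using U(2) K e by (auto intro!: mult_nonneg_nonneg)
      ultimately show ?thesis by presburger
    qed
    also have "\<dots> \<le> ennreal (e * (norm h)\<^sup>2)"
    proof (rule ennreal_leI)
      have "\<eta>\<^sup>2 * U \<le> e / 2"
        unfolding \<eta>(2) using U(2) e by (simp add: field_simps)
      then have "(norm h)\<^sup>2 * (\<eta>\<^sup>2 * U) \<le> (norm h)\<^sup>2 * (e / 2)" by (rule mult_left_mono) simp
      moreover have "K * (e / (2 * K)) = e / 2" using K by simp
      ultimately have "(norm h)\<^sup>2 * \<eta>\<^sup>2 * U + (norm h)\<^sup>2 * K * (e / (2 * K)) \<le> (norm h)\<^sup>2 * (e / 2) + (norm h)\<^sup>2 * (e / 2)"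
        by (simp only: mult.assoc add_right_mono)
      also have "\<dots> = e * (norm h)\<^sup>2" by (simp add: field_simps)
      finally show "(norm h)\<^sup>2 * \<eta>\<^sup>2 * U + (norm h)\<^sup>2 * K * (e / (2 * K)) \<le> e * (norm h)\<^sup>2" .
    qed
    finally show "(\<integral>\<^sup>+y. indicator \<Omega> y * ennreal ((norm (?p h y * u y))\<^sup>2) \<partial>lborel) \<le> ennreal (e * (norm h)\<^sup>2)" .
  qed (use \<delta> \<rho>1 \<rho>2 in auto)
qed

text \<open>The remainder is the sum of that of the plain difference quotient and of the phase error
  times \<open>u y\<close>; replacing the gradient by \<open>m\<close> absorbs exactly the first
  order term of the phase.\<close>

lemma remainder_small:
  assumes e: "0 < e"
  shows "\<exists>\<rho>>0. \<forall>h. norm h < \<rho> \<longrightarrow>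
    (\<integral>\<^sup>+y. indicator (\<Omega> \<inter> {y. y + h \<in> \<Omega>}) y * ennreal ((norm (D h y - dir_deriv m h y))\<^sup>2) \<partial>lborel) \<le> ennreal (e * (norm h)\<^sup>2)"
proof -
  let ?p = "\<lambda>h y. 1 + \<i> * complex_of_real (h \<bullet> A y) - exp (\<i> * complex_of_real (h \<bullet> A (y + (1/2) *\<^sub>R h)))"
  let ?S = "\<lambda>h. \<Omega> \<inter> {y. y + h \<in> \<Omega>}"
  obtain \<rho>1 where \<rho>1: "0 < \<rho>1" "\<And>h. norm h < \<rho>1 \<Longrightarrow>
    (\<integral>\<^sup>+y. indicator (?S h) y * ennreal ((norm (u (y + h) - u y - dir_deriv g h y))\<^sup>2) \<partial>lborel) \<le> ennreal (e / 4 * (norm h)\<^sup>2)"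
    using difference_quotient_small[of "e / 4"] e by auto
  obtain \<rho>2 where \<rho>2: "0 < \<rho>2" "\<And>h. norm h < \<rho>2 \<Longrightarrow>
    (\<integral>\<^sup>+y. indicator \<Omega> y * ennreal ((norm (?p h y * u y))\<^sup>2) \<partial>lborel) \<le> ennreal (e / 4 * (norm h)\<^sup>2)"
    using phase_remainder_small[of "e / 4"] e by auto
  show ?thesis
  proof (intro exI[of _ "min \<rho>1 \<rho>2"] conjI allI impI)
    fix h :: "real^'n" assume "norm h < min \<rho>1 \<rho>2"
    then have h: "norm h < \<rho>1" "norm h < \<rho>2" by auto
    have "(\<integral>\<^sup>+y. indicator (?S h) y * ennreal ((norm (D h y - dir_deriv m h y))\<^sup>2) \<partial>lborel) \<le>
       (\<integral>\<^sup>+y. 2 * (indicator (?S h) y * ennreal ((norm (u (y + h) - u y - dir_deriv g h y))\<^sup>2)) + 2 * (indicator \<Omega> y * ennreal ((norm (?p h y * u y))\<^sup>2)) \<partial>lborel)"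
    proof (rule nn_integral_mono)
      fix y
      let ?a = "u (y + h) - u y - dir_deriv g h y" and ?b = "?p h y * u y"
      have "D h y - dir_deriv m h y = ?a + ?b" by (simp add: D_def dir_deriv_m algebra_simps)
      then have "(norm (D h y - dir_deriv m h y))\<^sup>2 \<le> (norm ?a + norm ?b)\<^sup>2"
        by (simp only:) (intro power_mono norm_triangle_ineq norm_ge_zero)
      also have "\<dots> \<le> 2 * (norm ?a)\<^sup>2 + 2 * (norm ?b)\<^sup>2"
        using zero_le_power2[of "norm ?a - norm ?b"] by (simp add: power2_eq_square algebra_simps)
      finally have "ennreal ((norm (D h y - dir_deriv m h y))\<^sup>2) \<le> ennreal (2 * (norm ?a)\<^sup>2 + 2 * (norm ?b)\<^sup>2)" by (rule ennreal_leI)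
      also have "\<dots> = 2 * ennreal ((norm ?a)\<^sup>2) + 2 * ennreal ((norm ?b)\<^sup>2)" by (simp add: ennreal_plus ennreal_mult')
      finally have "ennreal ((norm (D h y - dir_deriv m h y))\<^sup>2) \<le> 2 * ennreal ((norm ?a)\<^sup>2) + 2 * ennreal ((norm ?b)\<^sup>2)" .
      then show "indicator (?S h) y * ennreal ((norm (D h y - dir_deriv m h y))\<^sup>2) \<le>
         2 * (indicator (?S h) y * ennreal ((norm ?a)\<^sup>2)) + 2 * (indicator \<Omega> y * ennreal ((norm ?b)\<^sup>2))"
        by (cases "y \<in> ?S h") auto
    qed
    also have "\<dots> = 2 * (\<integral>\<^sup>+y. indicator (?S h) y * ennreal ((norm (u (y + h) - u y - dir_deriv g h y))\<^sup>2) \<partial>lborel) + 2 * (\<integral>\<^sup>+y. indicator \<Omega> y * ennreal ((norm (?p h y * u y))\<^sup>2) \<partial>lborel)"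
      by (subst nn_integral_add, measurable, subst nn_integral_cmult, measurable, subst nn_integral_cmult, measurable)
    also have "\<dots> \<le> 2 * ennreal (e / 4 * (norm h)\<^sup>2) + 2 * ennreal (e / 4 * (norm h)\<^sup>2)"
      by (intro add_mono mult_left_mono \<rho>1(2) \<rho>2(2) h) auto
    also have "\<dots> = ennreal (2 * (e / 4 * (norm h)\<^sup>2) + 2 * (e / 4 * (norm h)\<^sup>2))"
    proof -
      have "2 * ennreal x + 2 * ennreal x = ennreal (2 * x + 2 * x)" if "0 \<le> x" for x
        using that ennreal_mult[of 2 x] by (simp only: ennreal_plus mult_nonneg_nonneg ennreal_numeral zero_le_numeral)
      then show ?thesis using e by simp
    qed
    finally show "(\<integral>\<^sup>+y. indicator (?S h) y * ennreal ((norm (D h y - dir_deriv m h y))\<^sup>2) \<partial>lborel) \<le> ennreal (e * (norm h)\<^sup>2)" by simp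
  qed (use \<rho>1 \<rho>2 in auto)
qed

lemma norm_add_sq_le_ennreal:
  fixes a b :: "'c::real_normed_vector"
  assumes "0 < e"
  shows "ennreal ((norm a)\<^sup>2) \<le> ennreal (1 + e) * ennreal ((norm b)\<^sup>2) + ennreal (1 + 1 / e) * ennreal ((norm (a - b))\<^sup>2)"
proof -
  have "ennreal ((norm a)\<^sup>2) \<le> ennreal ((1 + e) * (norm b)\<^sup>2 + (1 + 1 / e) * (norm (a - b))\<^sup>2)"
    by (rule ennreal_leI[OF norm_add_sq_le[OF assms]])
  also have "\<dots> = ennreal (1 + e) * ennreal ((norm b)\<^sup>2) + ennreal (1 + 1 / e) * ennreal ((norm (a - b))\<^sup>2)"
    using assms by (simp add: ennreal_plus ennreal_mult)
  finally show ?thesis .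
qed

text \<open>\<open>G h\<close> sees only the points \<open>y\<close> of \<open>\<Omega>\<close>
  whose translate stays in \<open>\<Omega>\<close>, while \<open>Q h\<close> sees all of
  \<open>\<Omega>\<close>. The missing points lie in a boundary layer, where the energy of
  \<open>m\<close> is small; this is the extra term in the second inequality.\<close>

theorem G_Q_comparison:
  assumes e: "0 < e"
  shows "\<exists>\<delta>>0. \<forall>h. norm h < \<delta> \<longrightarrow> G h \<le> ennreal (1 + e) * Q h + ennreal (e * (norm h)\<^sup>2)
     \<and> Q h \<le> ennreal (1 + e) * G h + ennreal (e * (norm h)\<^sup>2)"
proof -
  let ?S = "\<lambda>h. \<Omega> \<inter> {y. y + h \<in> \<Omega>}"
  let ?Rem = "\<lambda>h. \<integral>\<^sup>+y. indicator (?S h) y * ennreal ((norm (D h y - dir_deriv m h y))\<^sup>2) \<partial>lborel"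
  \<comment> \<open>Compensates the factor \<open>1 + 1 / e\<close> and leaves \<open>e / 2\<close>
    for the remainder.\<close>
  define e1 where "e1 = e / (2 * (1 + 1 / e))"
  have ee: "0 < 1 + 1 / e" using e by (simp add: add_pos_pos)
  have e1: "0 < e1" "(1 + 1 / e) * e1 = e / 2"
  proof -
    show "0 < e1" using e ee unfolding e1_def by (intro divide_pos_pos) auto
    have "X * (e / (2 * X)) = e / 2" if "0 < X" for X using that by simp
    from this[OF ee] show "(1 + 1 / e) * e1 = e / 2" unfolding e1_def .
  qed
  obtain \<rho>1 where \<rho>1: "0 < \<rho>1" "\<And>h. norm h < \<rho>1 \<Longrightarrow> ?Rem h \<le> ennreal (e1 * (norm h)\<^sup>2)"
    using remainder_small[OF e1(1)] by auto
  obtain \<delta> where \<delta>: "0 < \<delta>" "(\<integral>\<^sup>+y. indicator (boundary_layer \<Omega> \<delta>) y * ennreal ((norm (m y))\<^sup>2) \<partial>lborel) \<le> ennreal (e / 2)"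
    using boundary_layer_nn_integral_small[OF \<Omega>(1) _ nn_integral_sq_finite(2)[OF integrable_m_sq], of "e / 2"] e by auto
  show ?thesis
  proof (intro exI[of _ "min \<rho>1 \<delta>"] conjI allI impI)
    show "0 < min \<rho>1 \<delta>" using \<rho>1 \<delta> by simp
  next
    fix h :: "real^'n" assume "norm h < min \<rho>1 \<delta>"
    then have h: "norm h < \<rho>1" "norm h < \<delta>" by auto
    have rem: "ennreal (1 + 1 / e) * ?Rem h \<le> ennreal (e / 2 * (norm h)\<^sup>2)"
    proof -
      have "ennreal (1 + 1 / e) * ?Rem h \<le> ennreal (1 + 1 / e) * ennreal (e1 * (norm h)\<^sup>2)"
        by (intro mult_left_mono \<rho>1(2) h) simp
      also have "\<dots> = ennreal ((1 + 1 / e) * e1 * (norm h)\<^sup>2)"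
        using ee e1(1) by (subst ennreal_mult[symmetric]) (auto simp: mult.assoc)
      finally show ?thesis unfolding e1(2) .
    qed
    have "G h \<le> (\<integral>\<^sup>+y. ennreal (1 + e) * ennreal ((norm (dir_deriv m h y))\<^sup>2) + ennreal (1 + 1 / e) * (indicator (?S h) y * ennreal ((norm (D h y - dir_deriv m h y))\<^sup>2)) \<partial>lborel)"
      unfolding G_def using norm_add_sq_le_ennreal[OF e]
      by (intro nn_integral_mono) (auto simp: indicator_def)
    also have "\<dots> = ennreal (1 + e) * Q h + ennreal (1 + 1 / e) * ?Rem h"
      unfolding Q_def by (subst nn_integral_add, measurable, subst nn_integral_cmult, measurable, subst nn_integral_cmult, measurable)
    also have "\<dots> \<le> ennreal (1 + e) * Q h + ennreal (e * (norm h)\<^sup>2)"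
      using e by (intro add_left_mono order_trans[OF rem] ennreal_leI mult_right_mono) auto
    finally show "G h \<le> ennreal (1 + e) * Q h + ennreal (e * (norm h)\<^sup>2)" .
    have "Q h \<le> (\<integral>\<^sup>+y. (ennreal (1 + e) * (indicator (?S h) y * ennreal ((norm (D h y))\<^sup>2)) + ennreal (1 + 1 / e) * (indicator (?S h) y * ennreal ((norm (D h y - dir_deriv m h y))\<^sup>2)))
        + ennreal ((norm h)\<^sup>2) * (indicator (boundary_layer \<Omega> \<delta>) y * ennreal ((norm (m y))\<^sup>2)) \<partial>lborel)"
      unfolding Q_def
    proof (rule nn_integral_mono)
      fix y
      consider "y \<in> ?S h" | "y \<notin> ?S h" "y \<in> boundary_layer \<Omega> \<delta>" | "y \<notin> \<Omega>"
        using not_in_boundary_layer[of y \<Omega> \<delta> h] h(2) by blast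
      then show "ennreal ((norm (dir_deriv m h y))\<^sup>2) \<le> (ennreal (1 + e) * (indicator (?S h) y * ennreal ((norm (D h y))\<^sup>2)) + ennreal (1 + 1 / e) * (indicator (?S h) y * ennreal ((norm (D h y - dir_deriv m h y))\<^sup>2)))
        + ennreal ((norm h)\<^sup>2) * (indicator (boundary_layer \<Omega> \<delta>) y * ennreal ((norm (m y))\<^sup>2))"
      proof cases
        case 1
        then show ?thesis
          using norm_add_sq_le_ennreal[OF e, of "dir_deriv m h y" "D h y"]
          by (simp add: norm_minus_commute add_increasing2)
      next
        case 2
        have "ennreal ((norm (dir_deriv m h y))\<^sup>2) \<le> ennreal ((norm h * norm (m y))\<^sup>2)"
          by (intro ennreal_leI power_mono norm_dir_deriv_le) simp
        also have "\<dots> = ennreal ((norm h)\<^sup>2) * ennreal ((norm (m y))\<^sup>2)"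
          by (simp add: power_mult_distrib ennreal_mult)
        finally show ?thesis using 2 by (simp add: add_increasing)
      next
        case 3
        then have "m y = 0" by (rule m_outside)
        then have "dir_deriv m h y = 0" by (simp add: dir_deriv_def)
        then show ?thesis by simp
      qed
    qed
    also have "\<dots> = (ennreal (1 + e) * G h + ennreal (1 + 1 / e) * ?Rem h) + ennreal ((norm h)\<^sup>2) * (\<integral>\<^sup>+y. indicator (boundary_layer \<Omega> \<delta>) y * ennreal ((norm (m y))\<^sup>2) \<partial>lborel)"
      unfolding G_def by (subst nn_integral_add, measurable, subst nn_integral_add, measurable, simp add: nn_integral_cmult)
    also have "\<dots> \<le> (ennreal (1 + e) * G h + ennreal (e / 2 * (norm h)\<^sup>2)) + ennreal ((norm h)\<^sup>2) * ennreal (e / 2)"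
      by (intro add_mono mult_left_mono rem \<delta>(2)) auto
    also have "\<dots> = ennreal (1 + e) * G h + ennreal (e * (norm h)\<^sup>2)"
    proof -
      have "ennreal ((norm h)\<^sup>2) * ennreal (e / 2) = ennreal ((norm h)\<^sup>2 * (e / 2))"
        by (rule ennreal_mult[symmetric]) (use e in auto)
      moreover have "ennreal (e / 2 * (norm h)\<^sup>2) + ennreal ((norm h)\<^sup>2 * (e / 2)) = ennreal (e / 2 * (norm h)\<^sup>2 + (norm h)\<^sup>2 * (e / 2))"
        by (rule ennreal_plus[symmetric]) (use e in auto)
      ultimately have "ennreal (e / 2 * (norm h)\<^sup>2) + ennreal ((norm h)\<^sup>2) * ennreal (e / 2) = ennreal (e * (norm h)\<^sup>2)"
        by (simp only:) (simp add: mult.commute)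
      then show ?thesis by (simp only: add.assoc)
    qed
    finally show "Q h \<le> ennreal (1 + e) * G h + ennreal (e * (norm h)\<^sup>2)" .
  qed
qed

end

section \<open>The singular limit\<close>

lemma emeasure_ball_outside:
  fixes \<delta> x :: real
  assumes "0 \<le> x" "x \<le> \<delta>"
  shows "emeasure lborel {h \<in> ball (0::'a::euclidean_space) \<delta>. x < norm h} = ennreal (unit_ball_vol (real DIM('a)) * (\<delta> ^ DIM('a) - x ^ DIM('a)))"
proof (cases "x = \<delta>")
  case True
  then have empty: "{h \<in> ball (0::'a) \<delta>. x < norm h} = {}" by auto
  show ?thesis unfolding empty using True by simp
next
  case False
  have "{h \<in> ball (0::'a) \<delta>. x < norm h} = ball 0 \<delta> - cball 0 x" by auto
  moreover have "emeasure lborel (ball (0::'a) \<delta> - cball 0 x) = emeasure lborel (ball (0::'a) \<delta>) - emeasure lborel (cball (0::'a) x)"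
    using assms False by (intro emeasure_Diff) (auto simp: emeasure_cball)
  moreover have "\<dots> = ennreal (unit_ball_vol (real DIM('a)) * (\<delta> ^ DIM('a) - x ^ DIM('a)))"
    using assms by (simp add: emeasure_cball emeasure_ball ennreal_minus[symmetric] algebra_simps)
  ultimately show ?thesis by simp
qed

text \<open>The image of Lebesgue measure on a ball under the norm has density
  \<open>N \<omega> t ^ (N - 1)\<close>. It is enough to compare both measures on half-lines, whose
  preimages in the ball are shells.\<close>

lemma nn_integral_radial:
  fixes f :: "real \<Rightarrow> ennreal"
  assumes [measurable]: "f \<in> borel_measurable borel" and \<delta>: "0 < \<delta>"
  shows "(\<integral>\<^sup>+h. indicator (ball 0 \<delta>) h * f (norm (h::'a::euclidean_space)) \<partial>lborel)
    = (\<integral>\<^sup>+t. (indicator {0..\<delta>} t * ennreal (real DIM('a) * unit_ball_vol (real DIM('a)) * t ^ (DIM('a) - 1))) * f t \<partial>lborel)"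
proof -
  let ?N = "DIM('a)" and ?w = "unit_ball_vol (real DIM('a))"
  let ?d = "\<lambda>t::real. indicator {0..\<delta>} t * ennreal (real ?N * ?w * t ^ (?N - 1))"
  let ?M1 = "distr (density lborel (indicator (ball (0::'a) \<delta>))) borel norm" and ?M2 = "density lborel ?d"
  have [measurable]: "ball (0::'a) \<delta> \<in> sets borel" by auto
  have seg: "(\<integral>\<^sup>+t. ?d t * indicator {x..\<delta>} t \<partial>lborel) = ennreal (?w * (\<delta> ^ ?N - x ^ ?N))" if "0 \<le> x" "x \<le> \<delta>" for x
  proof -
    have "(\<integral>\<^sup>+t. ?d t * indicator {x..\<delta>} t \<partial>lborel) = (\<integral>\<^sup>+t. ennreal (?w * (real ?N * t ^ (?N - 1))) * indicator {x..\<delta>} t \<partial>lborel)"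
      using that by (intro nn_integral_cong) (auto simp: indicator_def mult_ac)
    also have "\<dots> = ?w * \<delta> ^ ?N - ?w * x ^ ?N"
      using that by (intro nn_integral_FTC_Icc[where F="\<lambda>t. ?w * t ^ ?N"])
        (auto intro!: derivative_eq_intros mult_nonneg_nonneg)
    finally show ?thesis by (simp add: right_diff_distrib)
  qed
  have "?M1 = ?M2"
  proof (rule measure_eqI_lessThan)
    fix x :: real
    have [measurable]: "norm -` {x<..} \<in> sets (borel :: 'a measure)"
      by (rule measurable_sets_borel[OF borel_measurable_norm]) auto
    have m1: "emeasure ?M1 {x<..} = emeasure lborel {h \<in> ball (0::'a) \<delta>. x < norm h}"
    proof -
      have "emeasure ?M1 {x<..} = emeasure (density lborel (indicator (ball (0::'a) \<delta>))) (norm -` {x<..})"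
        by (subst emeasure_distr) auto
      also have "\<dots> = (\<integral>\<^sup>+h. indicator (ball (0::'a) \<delta>) h * indicator (norm -` {x<..}) h \<partial>lborel)"
        by (subst emeasure_density) measurable
      also have "\<dots> = (\<integral>\<^sup>+h. indicator {h \<in> ball (0::'a) \<delta>. x < norm h} h \<partial>lborel)"
        by (intro nn_integral_cong) (auto simp: indicator_def)
      also have "\<dots> = emeasure lborel {h \<in> ball (0::'a) \<delta>. x < norm h}" by (subst nn_integral_indicator) auto
      finally show ?thesis .
    qed
    have m2: "emeasure ?M2 {x<..} = (\<integral>\<^sup>+t. ?d t * indicator {x<..} t \<partial>lborel)"
      by (subst emeasure_density) auto
    consider "x < 0" | "0 \<le> x" "x \<le> \<delta>" | "\<delta> < x" by linarith
    then show "emeasure ?M1 {x<..} = emeasure ?M2 {x<..}"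
    proof cases
      case 1
      then have "{h \<in> ball (0::'a) \<delta>. x < norm h} = ball 0 \<delta>" by (auto intro: less_le_trans[OF _ norm_ge_zero])
      then have "emeasure ?M1 {x<..} = ennreal (?w * (\<delta> ^ ?N - 0 ^ ?N))"
        unfolding m1 using \<delta> by (simp add: emeasure_ball power_0_left)
      also have "\<dots> = (\<integral>\<^sup>+t. ?d t * indicator {0..\<delta>} t \<partial>lborel)" using seg[of 0] \<delta> by simp
      also have "\<dots> = emeasure ?M2 {x<..}"
        unfolding m2 using 1 by (intro nn_integral_cong) (auto simp: indicator_def)
      finally show ?thesis .
    next
      case 2
      have "emeasure ?M1 {x<..} = (\<integral>\<^sup>+t. ?d t * indicator {x..\<delta>} t \<partial>lborel)"
        unfolding m1 seg[OF 2] by (rule emeasure_ball_outside[OF 2])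
      also have "\<dots> = (\<integral>\<^sup>+t. ?d t * indicator {x<..} t \<partial>lborel)"
        using AE_lborel_singleton[of x] by (intro nn_integral_cong_AE) (auto elim!: eventually_mono simp: indicator_def)
      finally show ?thesis unfolding m2 .
    next
      case 3
      then have empty: "{h \<in> ball (0::'a) \<delta>. x < norm h} = {}" by auto
      have "(\<integral>\<^sup>+t. ?d t * indicator {x<..} t \<partial>lborel) = (\<integral>\<^sup>+t. 0 \<partial>(lborel :: real measure))"
        using 3 by (intro nn_integral_cong) (auto simp: indicator_def)
      then show ?thesis unfolding m1 m2 empty by simp
    qed
    show "emeasure ?M1 {x<..} < \<infinity>"
      unfolding m1 by (rule le_less_trans[OF emeasure_mono emeasure_lborel_ball_finite[of 0 \<delta>]]) auto
  qed auto
  have "(\<integral>\<^sup>+h. indicator (ball 0 \<delta>) h * f (norm (h::'a)) \<partial>lborel) = (\<integral>\<^sup>+t. f t \<partial>?M1)"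
    by (subst nn_integral_distr) (auto simp: nn_integral_density)
  also have "\<dots> = (\<integral>\<^sup>+t. ?d t * f t \<partial>lborel)"
    unfolding \<open>?M1 = ?M2\<close> by (subst nn_integral_density) auto
  finally show ?thesis .
qed

text \<open>The radial density cancels the dimension in the exponent and leaves
  \<open>t powr (\<beta> - 1)\<close>, which is integrable at 0 because \<open>\<beta>\<close> is
  positive.\<close>

lemma nn_integral_ball_norm_powr:
  fixes \<beta> \<delta> :: real
  assumes \<beta>: "0 < \<beta>" and \<delta>: "0 < \<delta>"
  shows "(\<integral>\<^sup>+h. indicator (ball 0 \<delta>) h * ennreal (norm (h::'a::euclidean_space) powr (\<beta> - real DIM('a))) \<partial>lborel)
    = ennreal (real DIM('a) * unit_ball_vol (real DIM('a)) * (\<delta> powr \<beta> / \<beta>))"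
proof -
  let ?N = "DIM('a)" and ?c = "real DIM('a) * unit_ball_vol (real DIM('a))"
  have "(\<integral>\<^sup>+h. indicator (ball 0 \<delta>) h * ennreal (norm (h::'a) powr (\<beta> - real ?N)) \<partial>lborel)
    = (\<integral>\<^sup>+t. (indicator {0..\<delta>} t * ennreal (?c * t ^ (?N - 1))) * ennreal (t powr (\<beta> - real ?N)) \<partial>lborel)"
    by (rule nn_integral_radial[OF _ \<delta>]) measurable
  also have "\<dots> = (\<integral>\<^sup>+t. ennreal ?c * ennreal (indicator {0..\<delta>} t * t powr (\<beta> - 1)) \<partial>lborel)"
  proof (rule nn_integral_cong_AE)
    have "ennreal (?c * t ^ (?N - 1)) * ennreal (t powr (\<beta> - real ?N)) = ennreal ?c * ennreal (t powr (\<beta> - 1))" if "0 < t" for t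
    proof -
      have "t ^ (?N - 1) * t powr (\<beta> - real ?N) = t powr (\<beta> - 1)"
        using that by (simp add: powr_realpow[symmetric] powr_add[symmetric] of_nat_diff)
      then show ?thesis using that by (simp add: ennreal_mult[symmetric] mult.assoc)
    qed
    then show "AE t in lborel. (indicator {0..\<delta>} t * ennreal (?c * t ^ (?N - 1))) * ennreal (t powr (\<beta> - real ?N)) = ennreal ?c * ennreal (indicator {0..\<delta>} t * t powr (\<beta> - 1))"
      using AE_lborel_singleton[of "0::real"] by (auto elim!: eventually_mono simp: indicator_def)
  qed
  also have "\<dots> = ennreal ?c * (\<integral>\<^sup>+t. ennreal (indicator {0..\<delta>} t * t powr (\<beta> - 1)) \<partial>lborel)"
    by (rule nn_integral_cmult) measurable
  also have "(\<integral>\<^sup>+t. ennreal (indicator {0..\<delta>} t * t powr (\<beta> - 1)) \<partial>lborel) = ennreal (\<delta> powr \<beta> / \<beta>)"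
  proof -
    have "((\<lambda>t. t powr (\<beta> - 1)) has_integral \<delta> powr \<beta> / \<beta>) {0..\<delta>}"
      using has_integral_powr_from_0[of "\<beta> - 1" \<delta>] \<beta> \<delta> by simp
    from nn_integral_has_integral_lebesgue[OF _ this] show ?thesis by simp
  qed
  finally show ?thesis using \<beta> by (simp add: ennreal_mult'[symmetric])
qed

text \<open>For fixed \<open>e\<close> the bounds confine the limit points of \<open>i\<close>
  between \<open>(a - e b) / (1 + e)\<close> and \<open>(1 + e) a + e b\<close>; then
  \<open>e\<close> tends to 0. The functions \<open>j\<close> and \<open>r\<close> may depend on
  \<open>e\<close>, since the radius of localisation does.\<close>

lemma tendsto_from_approx_bounds:
  fixes i :: "'b \<Rightarrow> real" and a b :: real
  assumes nontriv: "F \<noteq> bot"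
    and bounds: "\<And>e. 0 < e \<Longrightarrow> \<exists>j r. (j \<longlongrightarrow> 1) F \<and> (r \<longlongrightarrow> 0) F \<and>
      (\<forall>\<^sub>F s in F. i s \<le> (1 + e) * a * j s + e * b * j s + r s \<and> a * j s \<le> (1 + e) * i s + e * b * j s)"
  shows "(i \<longlongrightarrow> a) F"
proof (rule order_tendstoI)
  fix c assume c: "c < a"
  have "((\<lambda>e. (a - e * b) / (1 + e)) \<longlongrightarrow> (a - 0 * b) / (1 + 0)) (at_right 0)" by (intro tendsto_intros) auto
  then have "\<forall>\<^sub>F e in at_right 0. c < (a - e * b) / (1 + e)" using c by (intro order_tendstoD(1)) auto
  then have "\<forall>\<^sub>F e in at_right 0. c < (a - e * b) / (1 + e) \<and> 0 < e" using eventually_at_right_less[of 0] by eventually_elim auto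
  then obtain e where e: "c < (a - e * b) / (1 + e)" "0 < e" using eventually_happens'[OF trivial_limit_at_right_real] by blast
  obtain j r where j: "(j \<longlongrightarrow> 1) F" and ev: "\<forall>\<^sub>F s in F. i s \<le> (1 + e) * a * j s + e * b * j s + r s \<and> a * j s \<le> (1 + e) * i s + e * b * j s"
    using bounds[OF e(2)] by blast
  have "((\<lambda>s. (a * j s - e * b * j s) / (1 + e)) \<longlongrightarrow> (a * 1 - e * b * 1) / (1 + e)) F" using e(2) by (intro tendsto_intros j) auto
  then have "\<forall>\<^sub>F s in F. c < (a * j s - e * b * j s) / (1 + e)" using e(1) by (intro order_tendstoD(1)) auto
  with ev show "\<forall>\<^sub>F s in F. c < i s"
  proof eventually_elim
    case (elim s)
    have "(a * j s - e * b * j s) / (1 + e) \<le> i s" using elim(1) e(2) by (simp add: divide_le_eq mult.commute)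
    then show ?case using elim(2) by linarith
  qed
next
  fix c assume c: "a < c"
  have "((\<lambda>e. (1 + e) * a + e * b) \<longlongrightarrow> (1 + 0) * a + 0 * b) (at_right 0)" by (intro tendsto_intros)
  then have "\<forall>\<^sub>F e in at_right 0. (1 + e) * a + e * b < c" using c by (intro order_tendstoD(2)) auto
  then have "\<forall>\<^sub>F e in at_right 0. (1 + e) * a + e * b < c \<and> 0 < e" using eventually_at_right_less[of 0] by eventually_elim auto
  then obtain e where e: "(1 + e) * a + e * b < c" "0 < e" using eventually_happens'[OF trivial_limit_at_right_real] by blast
  obtain j r where j: "(j \<longlongrightarrow> 1) F" "(r \<longlongrightarrow> 0) F" and ev: "\<forall>\<^sub>F s in F. i s \<le> (1 + e) * a * j s + e * b * j s + r s \<and> a * j s \<le> (1 + e) * i s + e * b * j s"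
    using bounds[OF e(2)] by blast
  have "((\<lambda>s. (1 + e) * a * j s + e * b * j s + r s) \<longlongrightarrow> (1 + e) * a * 1 + e * b * 1 + 0) F" by (intro tendsto_intros j)
  then have "\<forall>\<^sub>F s in F. (1 + e) * a * j s + e * b * j s + r s < c" using e(1) by (intro order_tendstoD(2)) auto
  with ev show "\<forall>\<^sub>F s in F. i s < c" by eventually_elim linarith
qed

section \<open>Moments of the kernel and the localised limit\<close>

context magnetic_data
begin

text \<open>At \<open>h = 0\<close> the value is 0, by the conventions for \<open>powr\<close> and
  division; the integrand of the theorem takes the same value on the diagonal.\<close>

definition kernel :: "real \<Rightarrow> real^'n \<Rightarrow> ennreal" where
  "kernel s h = ennreal (1 / norm h powr (real CARD('n) + 2 * s))"

lemma kernel_borel [measurable]: "kernel s \<in> borel_measurable borel"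
  unfolding kernel_def[abs_def] by measurable

text \<open>Joint measurability for Fubini's theorem. The set in the first indicator depends on
  \<open>h\<close>, so the indicator is rewritten as a product of two.\<close>

lemma pair_borel [measurable]:
  "(\<lambda>(h, y). indicator (\<Omega> \<inter> {y. y + h \<in> \<Omega>}) y * ennreal ((norm (D h y))\<^sup>2)) \<in> borel_measurable (lborel \<Otimes>\<^sub>M lborel)"
  "(\<lambda>(h, y). ennreal ((norm (dir_deriv m h y))\<^sup>2)) \<in> borel_measurable (lborel \<Otimes>\<^sub>M lborel)"
proof -
  have "(\<lambda>(h, y). indicator \<Omega> y * indicator \<Omega> (y + h) * ennreal ((norm (D h y))\<^sup>2)) \<in> borel_measurable (lborel \<Otimes>\<^sub>M lborel)"
    unfolding D_def by measurable
  moreover have "(\<lambda>(h, y). indicator (\<Omega> \<inter> {y. y + h \<in> \<Omega>}) y * ennreal ((norm (D h y))\<^sup>2)) = (\<lambda>(h, y). indicator \<Omega> y * indicator \<Omega> (y + h) * ennreal ((norm (D h y))\<^sup>2))"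
    by (auto simp: indicator_def fun_eq_iff)
  ultimately show "(\<lambda>(h, y). indicator (\<Omega> \<inter> {y. y + h \<in> \<Omega>}) y * ennreal ((norm (D h y))\<^sup>2)) \<in> borel_measurable (lborel \<Otimes>\<^sub>M lborel)" by simp
  have [measurable]: "(\<lambda>x. m x $ j) \<in> borel_measurable borel" "(\<lambda>x::real^'n. x $ j) \<in> borel_measurable borel" for j
    by (rule measurable_compose[OF m_borel], simp add: borel_measurable_continuous_onI continuous_on_component)
      (simp add: borel_measurable_continuous_onI continuous_on_component)
  show "(\<lambda>(h, y). ennreal ((norm (dir_deriv m h y))\<^sup>2)) \<in> borel_measurable (lborel \<Otimes>\<^sub>M lborel)"
    unfolding dir_deriv_def by measurable
qed

lemma G_borel [measurable]: "G \<in> borel_measurable borel"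
  unfolding G_def[abs_def] using lborel.borel_measurable_nn_integral_fst[OF pair_borel(1)] by simp

lemma Q_borel [measurable]: "Q \<in> borel_measurable borel"
  unfolding Q_def[abs_def] using lborel.borel_measurable_nn_integral_fst[OF pair_borel(2)] by simp

definition T :: ennreal where "T = (\<integral>\<^sup>+x. ennreal ((norm (m x))\<^sup>2) \<partial>lborel)"

lemma T_finite: "T < \<infinity>"
  unfolding T_def by (rule nn_integral_sq_finite(1)[OF integrable_m_sq])

text \<open>The phase has modulus 1, so the square of \<open>D h y\<close> is at most twice the sum
  of the squares of both values of \<open>u\<close>. Integrated over \<open>h\<close>, each gives
  the volume of \<open>\<Omega>\<close> times the squared norm of \<open>u\<close>. This controls
  the part away from \<open>h = 0\<close>.\<close>

lemma G_integral_finite: "(\<integral>\<^sup>+h. G h \<partial>lborel) < \<infinity>"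
proof -
  let ?U = "\<integral>\<^sup>+x. ennreal ((norm (u x))\<^sup>2) \<partial>lborel"
  have "G h \<le> (\<integral>\<^sup>+y. 2 * (indicator \<Omega> y * ennreal ((norm (u (y + h)))\<^sup>2)) + 2 * (indicator \<Omega> (y + h) * ennreal ((norm (u y))\<^sup>2)) \<partial>lborel)" for h
    unfolding G_def
  proof (rule nn_integral_mono)
    fix y
    have "norm (D h y) \<le> norm (u (y + h)) + norm (u y)"
      unfolding D_def by (rule order_trans[OF norm_triangle_ineq4]) (simp add: norm_mult)
    then have "(norm (D h y))\<^sup>2 \<le> (norm (u (y + h)) + norm (u y))\<^sup>2" by (intro power_mono) auto
    also have "\<dots> \<le> 2 * (norm (u (y + h)))\<^sup>2 + 2 * (norm (u y))\<^sup>2"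
      using zero_le_power2[of "norm (u (y + h)) - norm (u y)"] by (simp add: power2_eq_square algebra_simps)
    finally have "ennreal ((norm (D h y))\<^sup>2) \<le> ennreal (2 * (norm (u (y + h)))\<^sup>2 + 2 * (norm (u y))\<^sup>2)" by (rule ennreal_leI)
    also have "\<dots> = 2 * ennreal ((norm (u (y + h)))\<^sup>2) + 2 * ennreal ((norm (u y))\<^sup>2)" by (simp add: ennreal_plus ennreal_mult')
    finally show "indicator (\<Omega> \<inter> {y. y + h \<in> \<Omega>}) y * ennreal ((norm (D h y))\<^sup>2) \<le>
      2 * (indicator \<Omega> y * ennreal ((norm (u (y + h)))\<^sup>2)) + 2 * (indicator \<Omega> (y + h) * ennreal ((norm (u y))\<^sup>2))"
      by (auto simp: indicator_def)
  qed
  then have "(\<integral>\<^sup>+h. G h \<partial>lborel) \<le> (\<integral>\<^sup>+h. (\<integral>\<^sup>+y. 2 * (indicator \<Omega> y * ennreal ((norm (u (y + h)))\<^sup>2)) + 2 * (indicator \<Omega> (y + h) * ennreal ((norm (u y))\<^sup>2)) \<partial>lborel) \<partial>lborel)"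
    by (rule nn_integral_mono)
  also have "\<dots> = (\<integral>\<^sup>+y. (\<integral>\<^sup>+h. 2 * (indicator \<Omega> y * ennreal ((norm (u (y + h)))\<^sup>2)) + 2 * (indicator \<Omega> (y + h) * ennreal ((norm (u y))\<^sup>2)) \<partial>lborel) \<partial>lborel)"
    by (rule lborel_pair.Fubini') measurable
  also have "\<dots> = (\<integral>\<^sup>+y. 2 * (indicator \<Omega> y * ?U) + 2 * (emeasure lborel \<Omega> * ennreal ((norm (u y))\<^sup>2)) \<partial>lborel)"
  proof (rule nn_integral_cong)
    fix y
    have 1: "(\<integral>\<^sup>+h. ennreal ((norm (u (y + h)))\<^sup>2) \<partial>lborel) = ?U"
      using nn_integral_translate[of "\<lambda>x. ennreal ((norm (u x))\<^sup>2)" y] by (simp add: add.commute)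
    have 2: "(\<integral>\<^sup>+h. indicator \<Omega> (y + h) \<partial>lborel) = emeasure lborel \<Omega>"
      using nn_integral_translate[of "indicator \<Omega>" y] by (simp add: add.commute)
    show "(\<integral>\<^sup>+h. 2 * (indicator \<Omega> y * ennreal ((norm (u (y + h)))\<^sup>2)) + 2 * (indicator \<Omega> (y + h) * ennreal ((norm (u y))\<^sup>2)) \<partial>lborel)
       = 2 * (indicator \<Omega> y * ?U) + 2 * (emeasure lborel \<Omega> * ennreal ((norm (u y))\<^sup>2))"
      by (subst nn_integral_add, measurable) (simp add: nn_integral_cmult nn_integral_multc 1 2)
  qed
  also have "\<dots> = 2 * (emeasure lborel \<Omega> * ?U) + 2 * (emeasure lborel \<Omega> * ?U)"
    by (subst nn_integral_add, measurable) (simp add: nn_integral_cmult nn_integral_multc)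
  also have "\<dots> < \<infinity>"
    using nn_integral_sq_finite(1)[OF integrable_u_sq] emeasure_bounded_finite[OF \<Omega>(2)] by (simp add: ennreal_mult_less_top ennreal_add_less_top)
  finally show ?thesis .
qed

lemma kernel_moment:
  assumes s: "s < 1" and \<delta>: "0 < \<delta>"
  shows "(\<integral>\<^sup>+h. indicator (ball 0 \<delta>) h * (ennreal ((norm h)\<^sup>2) * kernel s h) \<partial>lborel)
    = ennreal (real CARD('n) * unit_ball_vol (real CARD('n)) * (\<delta> powr (2 - 2 * s) / (2 - 2 * s)))"
proof -
  have "ennreal ((norm h)\<^sup>2) * kernel s h = ennreal (norm h powr (2 - 2 * s - real DIM(real^'n)))" for h :: "real^'n"
  proof (cases "h = 0")
    case False
    have "(norm h)\<^sup>2 * (1 / norm h powr (real CARD('n) + 2 * s)) = norm h powr (2 - 2 * s - real CARD('n))"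
      using False by (simp add: powr_diff powr_add powr_numeral field_simps)
    then show ?thesis by (simp add: kernel_def ennreal_mult[symmetric])
  qed (simp add: kernel_def)
  then show ?thesis using nn_integral_ball_norm_powr[of "2 - 2 * s" \<delta>, where 'a="real^'n"] s \<delta> by simp
qed

text \<open>Real and imaginary part of \<open>z y\<close> are real vectors \<open>a\<close> and
  \<open>b\<close>, and the directional derivative has the components \<open>h \<bullet> a\<close>
  and \<open>h \<bullet> b\<close>. The rotational average applies to each of them.\<close>

lemma dir_deriv_sq_moment:
  fixes z :: "real^'n \<Rightarrow> complex^'n"
  assumes k [measurable]: "k \<in> borel_measurable borel"
    and kinv: "\<And>f x. orthogonal_transformation f \<Longrightarrow> k (f x) = k (x :: real^'n)"
  shows "of_nat CARD('n) * (\<integral>\<^sup>+h. ennreal ((norm (dir_deriv z h y))\<^sup>2) * k h \<partial>lborel)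
    = ennreal ((norm (z y))\<^sup>2) * (\<integral>\<^sup>+h. ennreal ((norm h)\<^sup>2) * k h \<partial>lborel)"
proof -
  let ?J = "\<integral>\<^sup>+h. ennreal ((norm h)\<^sup>2) * k h \<partial>lborel"
  have vec: "of_nat CARD('n) * (\<integral>\<^sup>+h. ennreal ((h \<bullet> v)\<^sup>2) * k h \<partial>lborel) = ennreal ((norm v)\<^sup>2) * ?J" for v :: "real^'n"
  proof (cases "v = 0")
    case False
    define e where "e = v /\<^sub>R norm v"
    have e: "norm e = 1" "v = norm v *\<^sub>R e" using False by (auto simp: e_def)
    have "ennreal ((h \<bullet> v)\<^sup>2) * k h = ennreal ((norm v)\<^sup>2) * (ennreal ((h \<bullet> e)\<^sup>2) * k h)" for h
    proof -
      have "(h \<bullet> v)\<^sup>2 = (norm v)\<^sup>2 * (h \<bullet> e)\<^sup>2" by (subst e(2)) (simp add: power_mult_distrib)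
      then show ?thesis by (simp add: ennreal_mult mult.assoc)
    qed
    then have X: "(\<integral>\<^sup>+h. ennreal ((h \<bullet> v)\<^sup>2) * k h \<partial>lborel) = ennreal ((norm v)\<^sup>2) * (\<integral>\<^sup>+h. ennreal ((h \<bullet> e)\<^sup>2) * k h \<partial>lborel)"
      by (simp add: nn_integral_cmult)
    have Y: "of_nat CARD('n) * (\<integral>\<^sup>+h. ennreal ((h \<bullet> e)\<^sup>2) * k h \<partial>lborel) = ?J"
      by (rule nn_integral_inner_sq) (use lborel_distr_orthogonal kinv e(1) in auto)
    show ?thesis unfolding X by (subst mult.left_commute) (simp only: Y)
  qed simp
  define a b where "a = (\<chi> j. Re (z y $ j))" and "b = (\<chi> j. Im (z y $ j))"
  have dd: "(norm (dir_deriv z h y))\<^sup>2 = (h \<bullet> a)\<^sup>2 + (h \<bullet> b)\<^sup>2" for h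
    unfolding cmod_power2 by (simp add: dir_deriv_def a_def b_def inner_vec_def)
  have nz: "(norm (z y))\<^sup>2 = (norm a)\<^sup>2 + (norm b)\<^sup>2"
    unfolding power2_norm_eq_inner by (simp add: inner_vec_def a_def b_def inner_complex_def sum.distrib)
  have "(\<integral>\<^sup>+h. ennreal ((norm (dir_deriv z h y))\<^sup>2) * k h \<partial>lborel) = (\<integral>\<^sup>+h. ennreal ((h \<bullet> a)\<^sup>2) * k h + ennreal ((h \<bullet> b)\<^sup>2) * k h \<partial>lborel)"
    unfolding dd by (simp add: ennreal_plus distrib_right)
  also have "\<dots> = (\<integral>\<^sup>+h. ennreal ((h \<bullet> a)\<^sup>2) * k h \<partial>lborel) + (\<integral>\<^sup>+h. ennreal ((h \<bullet> b)\<^sup>2) * k h \<partial>lborel)"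
    by (rule nn_integral_add) measurable
  finally show ?thesis by (simp add: distrib_left distrib_right vec nz ennreal_plus)
qed

text \<open>Fubini moves the integral over \<open>h\<close> inside, where the rotational average
  replaces \<open>dir_deriv m h y\<close> by \<open>m y\<close> with a factor \<open>1 / N\<close>.
  This factor cancels the \<open>N\<close> in \<open>kernel_moment\<close>.\<close>

lemma Q_moment:
  assumes s: "s < 1" and \<delta>: "0 < \<delta>"
  shows "(\<integral>\<^sup>+h. indicator (ball 0 \<delta>) h * (Q h * kernel s h) \<partial>lborel)
    = ennreal (unit_ball_vol (real CARD('n)) * (\<delta> powr (2 - 2 * s) / (2 - 2 * s))) * T"
proof -
  let ?k = "\<lambda>h. indicator (ball 0 \<delta>) h * kernel s h"
  have kinv: "?k (f x) = ?k x" if "orthogonal_transformation f" for f x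
    using that by (simp add: kernel_def orthogonal_transformation indicator_def)
  have k [measurable]: "?k \<in> borel_measurable borel"
    by (intro borel_measurable_times_ennreal borel_measurable_indicator kernel_borel) auto
  have J: "(\<integral>\<^sup>+h. ennreal ((norm h)\<^sup>2) * ?k h \<partial>lborel) = ennreal (real CARD('n) * unit_ball_vol (real CARD('n)) * (\<delta> powr (2 - 2 * s) / (2 - 2 * s)))"
    using kernel_moment[OF s \<delta>] by (simp add: mult_ac)
  have swapped: "(\<lambda>(y, h). ennreal ((norm (dir_deriv m h y))\<^sup>2) * ?k h) \<in> borel_measurable (lborel \<Otimes>\<^sub>M lborel)"
  proof -
    have "(\<lambda>x. ennreal ((norm (dir_deriv m (snd x) (fst x)))\<^sup>2)) \<in> borel_measurable (lborel \<Otimes>\<^sub>M lborel)"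
      using measurable_pair_swap[OF pair_borel(2)] by (simp only: case_prod_beta' fst_conv snd_conv)
    moreover have "(\<lambda>x. ?k (snd x)) \<in> borel_measurable ((lborel :: (real^'n) measure) \<Otimes>\<^sub>M lborel)"
      using k by measurable
    ultimately show ?thesis by (simp add: case_prod_beta borel_measurable_times_ennreal)
  qed
  have "of_nat CARD('n) * (\<integral>\<^sup>+h. indicator (ball 0 \<delta>) h * (Q h * kernel s h) \<partial>lborel) =
     of_nat CARD('n) * (\<integral>\<^sup>+h. (\<integral>\<^sup>+y. ennreal ((norm (dir_deriv m h y))\<^sup>2) * ?k h \<partial>lborel) \<partial>lborel)"
  proof (rule arg_cong[where f="\<lambda>x. of_nat CARD('n) * x"], rule nn_integral_cong)
    fix h :: "real^'n"
    have "indicator (ball 0 \<delta>) h * (Q h * kernel s h) = Q h * ?k h" by (simp only: mult_ac)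
    also have "\<dots> = (\<integral>\<^sup>+y. ennreal ((norm (dir_deriv m h y))\<^sup>2) * ?k h \<partial>lborel)"
      unfolding Q_def by (rule nn_integral_multc[symmetric]) measurable
    finally show "indicator (ball 0 \<delta>) h * (Q h * kernel s h) = (\<integral>\<^sup>+y. ennreal ((norm (dir_deriv m h y))\<^sup>2) * ?k h \<partial>lborel)" .
  qed
  also have "(\<integral>\<^sup>+h. (\<integral>\<^sup>+y. ennreal ((norm (dir_deriv m h y))\<^sup>2) * ?k h \<partial>lborel) \<partial>lborel) =
      (\<integral>\<^sup>+y. (\<integral>\<^sup>+h. ennreal ((norm (dir_deriv m h y))\<^sup>2) * ?k h \<partial>lborel) \<partial>lborel)"
    by (rule lborel_pair.Fubini'[OF swapped])
  also have "of_nat CARD('n) * \<dots> = (\<integral>\<^sup>+y. of_nat CARD('n) * (\<integral>\<^sup>+h. ennreal ((norm (dir_deriv m h y))\<^sup>2) * ?k h \<partial>lborel) \<partial>lborel)"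
    using lborel.borel_measurable_nn_integral_fst[OF swapped] by (intro nn_integral_cmult[symmetric]) simp
  also have "\<dots> = (\<integral>\<^sup>+y. ennreal ((norm (m y))\<^sup>2) * (\<integral>\<^sup>+h. ennreal ((norm h)\<^sup>2) * ?k h \<partial>lborel) \<partial>lborel)"
    by (rule nn_integral_cong, rule dir_deriv_sq_moment[where k="?k", OF k]) (rule kinv)
  also have "\<dots> = T * ennreal (real CARD('n) * unit_ball_vol (real CARD('n)) * (\<delta> powr (2 - 2 * s) / (2 - 2 * s)))"
    unfolding J T_def by (rule nn_integral_multc) measurable
  also have "\<dots> = of_nat CARD('n) * (ennreal (unit_ball_vol (real CARD('n)) * (\<delta> powr (2 - 2 * s) / (2 - 2 * s))) * T)"
  proof -
    have "ennreal (real CARD('n) * (unit_ball_vol (real CARD('n)) * (\<delta> powr (2 - 2 * s) / (2 - 2 * s)))) =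
       of_nat CARD('n) * ennreal (unit_ball_vol (real CARD('n)) * (\<delta> powr (2 - 2 * s) / (2 - 2 * s)))"
      by (subst ennreal_mult') (simp_all only: of_nat_0_le_iff ennreal_of_nat_eq_real_of_nat)
    then show ?thesis by (simp only: mult.assoc mult.commute mult.left_commute)
  qed
  finally show ?thesis by (simp add: ennreal_mult_cancel_left)
qed

text \<open>The normalised moments \<open>(1 - s) \<integral>\<close> over a ball tend to a limit independent of its radius,
  while the exterior of the ball contributes nothing in the limit; hence only the behaviour of
  \<open>G h\<close> as \<open>h\<close> tends to 0 matters.\<close>

theorem localized_limit:
  "((\<lambda>s. ennreal (1 - s) * (\<integral>\<^sup>+h. G h * kernel s h \<partial>lborel)) \<longlongrightarrow> ennreal (unit_ball_vol (real CARD('n)) / 2) * T) (at_left 1)"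
proof -
  let ?w = "unit_ball_vol (real CARD('n))" and ?N = "real CARD('n)"
  define t where "t = enn2real T"
  have t: "T = ennreal t" "0 \<le> t" using T_finite by (auto simp: t_def)
  define B where "B = enn2real (\<integral>\<^sup>+h. G h \<partial>lborel)"
  have B: "(\<integral>\<^sup>+h. G h \<partial>lborel) = ennreal B" "0 \<le> B" using G_integral_finite by (auto simp: B_def)
  define I where "I s = ennreal (1 - s) * (\<integral>\<^sup>+h. G h * kernel s h \<partial>lborel)" for s
  define a where "a = ?w / 2 * t"
  define b where "b = ?N * ?w / 2"
  have w: "0 \<le> ?w" by simp
  have ab: "0 \<le> a" "0 \<le> b" using t w by (auto simp: a_def b_def)
  have near1: "\<forall>\<^sub>F s in at_left (1::real). 0 < s \<and> s < 1"
    using eventually_at_left_real[of 0 "1::real", OF zero_less_one] by eventually_elim auto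
  have key: "\<exists>j r. (j \<longlongrightarrow> 1) (at_left 1) \<and> (r \<longlongrightarrow> 0) (at_left 1) \<and>
      (\<forall>\<^sub>F s in at_left 1. I s \<le> ennreal ((1 + e) * a * j s + e * b * j s + r s) \<and>
         ennreal (a * j s) \<le> ennreal (1 + e) * I s + ennreal (e * b * j s))" if e: "0 < e" for e
  proof -
    obtain \<delta>1 where \<delta>1: "0 < \<delta>1" "\<And>h. norm h < \<delta>1 \<Longrightarrow> G h \<le> ennreal (1 + e) * Q h + ennreal (e * (norm h)\<^sup>2)
         \<and> Q h \<le> ennreal (1 + e) * G h + ennreal (e * (norm h)\<^sup>2)"
      using G_Q_comparison[OF e] by blast
    \<comment> \<open>With \<open>\<delta>\<close> at most 1, \<open>\<delta> powr (N + 2)\<close>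
      is a lower bound for \<open>\<delta> powr (N + 2 * s)\<close>, so the kernel outside the ball
      is bounded uniformly in \<open>s\<close>.\<close>
    define \<delta> where "\<delta> = min 1 \<delta>1"
    have \<delta>: "0 < \<delta>" "\<delta> \<le> 1" "\<delta> \<le> \<delta>1" using \<delta>1(1) by (auto simp: \<delta>_def)
    have [measurable]: "ball (0::real^'n) \<delta> \<in> sets borel" by auto
    define j where "j s = \<delta> powr (2 - 2 * s)" for s
    define r where "r s = (1 - s) * (B * (1 / \<delta> powr (?N + 2)))" for s
    have "(j \<longlongrightarrow> \<delta> powr (2 - 2 * 1)) (at_left 1)"
      unfolding j_def using \<delta>(1) by (intro tendsto_intros) auto
    then have j1: "(j \<longlongrightarrow> 1) (at_left 1)" using \<delta>(1) by simp
    have "(r \<longlongrightarrow> (1 - 1) * (B * (1 / \<delta> powr (?N + 2)))) (at_left 1)" unfolding r_def by (intro tendsto_intros)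
    then have r0: "(r \<longlongrightarrow> 0) (at_left 1)" by simp
    have main: "I s \<le> ennreal ((1 + e) * a * j s + e * b * j s + r s) \<and>
         ennreal (a * j s) \<le> ennreal (1 + e) * I s + ennreal (e * b * j s)" if s: "0 < s" "s < 1" for s
    proof -
      have j0: "0 \<le> j s" by (simp add: j_def)
      let ?near = "\<lambda>f. \<integral>\<^sup>+h. indicator (ball 0 \<delta>) h * (f h * kernel s h) \<partial>lborel"
      have nearQ: "ennreal (1 - s) * ?near Q = ennreal (a * j s)"
      proof -
        have "ennreal (1 - s) * ?near Q = ennreal (1 - s) * (ennreal (?w * (j s / (2 - 2 * s))) * ennreal t)"
          unfolding Q_moment[OF s(2) \<delta>(1)] j_def t(1) ..
        also have "\<dots> = ennreal ((1 - s) * (?w * (j s / (2 - 2 * s)) * t))"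
        proof -
          have "0 \<le> ?w * (j s / (2 - 2 * s))" using s j0 by (intro mult_nonneg_nonneg divide_nonneg_nonneg) auto
          then show ?thesis using s t(2) by (simp only: ennreal_mult mult_nonneg_nonneg diff_ge_0_iff_ge less_imp_le)
        qed
        also have "(1 - s) * (?w * (j s / (2 - 2 * s)) * t) = a * j s"
        proof -
          have "x * (?w * (j s / (2 * x)) * t) = a * j s" if "0 < x" for x using that by (simp add: a_def)
          from this[of "1 - s"] show ?thesis using s by (simp add: right_diff_distrib)
        qed
        finally show ?thesis .
      qed
      have nearh: "ennreal (1 - s) * (ennreal e * ?near (\<lambda>h. ennreal ((norm h)\<^sup>2))) = ennreal (e * b * j s)"
      proof -
        have "ennreal (1 - s) * (ennreal e * ?near (\<lambda>h. ennreal ((norm h)\<^sup>2))) = ennreal (1 - s) * (ennreal e * ennreal (?N * ?w * (j s / (2 - 2 * s))))"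
          unfolding kernel_moment[OF s(2) \<delta>(1)] j_def ..
        also have "\<dots> = ennreal ((1 - s) * (e * (?N * ?w * (j s / (2 - 2 * s)))))"
        proof -
          have "0 \<le> ?N * ?w * (j s / (2 - 2 * s))" using s j0 by (intro mult_nonneg_nonneg divide_nonneg_nonneg) auto
          then show ?thesis using s e by (simp only: ennreal_mult mult_nonneg_nonneg diff_ge_0_iff_ge less_imp_le)
        qed
        also have "(1 - s) * (e * (?N * ?w * (j s / (2 - 2 * s)))) = e * b * j s"
        proof -
          have "x * (e * (?N * ?w * (j s / (2 * x)))) = e * b * j s" if "0 < x" for x using that by (simp add: b_def)
          from this[of "1 - s"] show ?thesis using s by (simp add: right_diff_distrib)
        qed
        finally show ?thesis .
      qed
      \<comment> \<open>Used in both directions, with \<open>G\<close> and \<open>Q\<close> in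
        either role.\<close>
      have cmp: "?near f \<le> ennreal (1 + e) * ?near f' + ennreal e * ?near (\<lambda>h. ennreal ((norm h)\<^sup>2))"
        if le: "\<And>h. norm h < \<delta>1 \<Longrightarrow> f h \<le> ennreal (1 + e) * f' h + ennreal (e * (norm h)\<^sup>2)"
          and [measurable]: "f \<in> borel_measurable borel" "f' \<in> borel_measurable borel" for f f' :: "real^'n \<Rightarrow> ennreal"
      proof -
        have "?near f \<le> (\<integral>\<^sup>+h. ennreal (1 + e) * (indicator (ball 0 \<delta>) h * (f' h * kernel s h)) + ennreal e * (indicator (ball 0 \<delta>) h * (ennreal ((norm h)\<^sup>2) * kernel s h)) \<partial>lborel)"
        proof (rule nn_integral_mono)
          fix h :: "real^'n"
          show "indicator (ball 0 \<delta>) h * (f h * kernel s h) \<le> ennreal (1 + e) * (indicator (ball 0 \<delta>) h * (f' h * kernel s h)) + ennreal e * (indicator (ball 0 \<delta>) h * (ennreal ((norm h)\<^sup>2) * kernel s h))"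
          proof (cases "h \<in> ball 0 \<delta>")
            case True
            then have "f h \<le> ennreal (1 + e) * f' h + ennreal e * ennreal ((norm h)\<^sup>2)"
              using le[of h] \<delta>(3) e by (simp add: ennreal_mult)
            then have "f h * kernel s h \<le> (ennreal (1 + e) * f' h + ennreal e * ennreal ((norm h)\<^sup>2)) * kernel s h"
              by (rule mult_right_mono) simp
            then show ?thesis using True by (simp add: distrib_right mult.assoc)
          qed simp
        qed
        also have "\<dots> = ennreal (1 + e) * ?near f' + ennreal e * ?near (\<lambda>h. ennreal ((norm h)\<^sup>2))"
          by (subst nn_integral_add, measurable, subst nn_integral_cmult, measurable, subst nn_integral_cmult, measurable)
        finally show ?thesis .
      qed
      have split: "(\<integral>\<^sup>+h. G h * kernel s h \<partial>lborel) = ?near G + (\<integral>\<^sup>+h. indicator (- ball 0 \<delta>) h * (G h * kernel s h) \<partial>lborel)"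
        by (subst nn_integral_add[symmetric], measurable, intro nn_integral_cong) (simp add: indicator_def)
      have far: "ennreal (1 - s) * (\<integral>\<^sup>+h. indicator (- ball 0 \<delta>) h * (G h * kernel s h) \<partial>lborel) \<le> ennreal (r s)"
      proof -
        have "indicator (- ball 0 \<delta>) h * (G h * kernel s h) \<le> G h * ennreal (1 / \<delta> powr (?N + 2))" for h
        proof (cases "h \<in> ball 0 \<delta>")
          case False
          then have h: "\<delta> \<le> norm h" by simp
          have "\<delta> powr (?N + 2) \<le> \<delta> powr (?N + 2 * s)" using \<delta> s by (intro powr_mono') auto
          also have "\<dots> \<le> norm h powr (?N + 2 * s)" using \<delta> s h by (intro powr_mono2) auto
          finally have "1 / norm h powr (?N + 2 * s) \<le> 1 / \<delta> powr (?N + 2)"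
            using \<delta>(1) h by (intro divide_left_mono mult_pos_pos) (auto simp: powr_gt_zero)
          then have "G h * kernel s h \<le> G h * ennreal (1 / \<delta> powr (?N + 2))"
            unfolding kernel_def by (intro mult_left_mono ennreal_leI) auto
          then show ?thesis using False by simp
        qed simp
        then have "(\<integral>\<^sup>+h. indicator (- ball 0 \<delta>) h * (G h * kernel s h) \<partial>lborel) \<le> (\<integral>\<^sup>+h. G h * ennreal (1 / \<delta> powr (?N + 2)) \<partial>lborel)"
          by (rule nn_integral_mono)
        also have "\<dots> = ennreal B * ennreal (1 / \<delta> powr (?N + 2))"
          unfolding B(1)[symmetric] by (rule nn_integral_multc) measurable
        finally have "ennreal (1 - s) * (\<integral>\<^sup>+h. indicator (- ball 0 \<delta>) h * (G h * kernel s h) \<partial>lborel) \<le> ennreal (1 - s) * (ennreal B * ennreal (1 / \<delta> powr (?N + 2)))"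
          by (rule mult_left_mono) simp
        also have "\<dots> = ennreal (r s)"
          unfolding r_def using s B(2)
          by (simp only: ennreal_mult mult_nonneg_nonneg diff_ge_0_iff_ge less_imp_le powr_ge_zero divide_nonneg_nonneg zero_le_one)
        finally show ?thesis .
      qed
      have "I s = ennreal (1 - s) * ?near G + ennreal (1 - s) * (\<integral>\<^sup>+h. indicator (- ball 0 \<delta>) h * (G h * kernel s h) \<partial>lborel)"
        unfolding I_def split by (rule distrib_left)
      also have "\<dots> \<le> ennreal (1 - s) * (ennreal (1 + e) * ?near Q + ennreal e * ?near (\<lambda>h. ennreal ((norm h)\<^sup>2))) + ennreal (r s)"
        using \<delta>1(2) by (intro add_mono far mult_left_mono cmp) auto
      also have "\<dots> = ennreal (1 + e) * (ennreal (1 - s) * ?near Q) + ennreal (1 - s) * (ennreal e * ?near (\<lambda>h. ennreal ((norm h)\<^sup>2))) + ennreal (r s)"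
        by (simp only: distrib_left mult.left_commute)
      also have "\<dots> = ennreal (1 + e) * ennreal (a * j s) + ennreal (e * b * j s) + ennreal (r s)"
        unfolding nearQ nearh ..
      also have "\<dots> = ennreal ((1 + e) * a * j s + e * b * j s + r s)"
      proof -
        have "0 \<le> r s" "0 \<le> a * j s" "0 \<le> e * b * j s" "0 \<le> (1 + e) * a * j s" "0 \<le> 1 + e"
          using s B(2) ab j0 e by (auto simp: r_def intro!: mult_nonneg_nonneg)
        then show ?thesis by (simp only: ennreal_plus ennreal_mult mult.assoc add_nonneg_nonneg)
      qed
      finally have up: "I s \<le> ennreal ((1 + e) * a * j s + e * b * j s + r s)" .
      have "ennreal (a * j s) = ennreal (1 - s) * ?near Q" by (rule nearQ[symmetric])
      also have "\<dots> \<le> ennreal (1 - s) * (ennreal (1 + e) * ?near G + ennreal e * ?near (\<lambda>h. ennreal ((norm h)\<^sup>2)))"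
        using \<delta>1(2) by (intro mult_left_mono cmp) auto
      also have "\<dots> = ennreal (1 + e) * (ennreal (1 - s) * ?near G) + ennreal (1 - s) * (ennreal e * ?near (\<lambda>h. ennreal ((norm h)\<^sup>2)))"
        by (simp only: distrib_left mult.left_commute)
      also have "\<dots> \<le> ennreal (1 + e) * I s + ennreal (e * b * j s)"
        unfolding nearh I_def split by (intro add_right_mono mult_left_mono) auto
      finally show ?thesis using up by blast
    qed
    have "\<forall>\<^sub>F s in at_left 1. I s \<le> ennreal ((1 + e) * a * j s + e * b * j s + r s) \<and>
         ennreal (a * j s) \<le> ennreal (1 + e) * I s + ennreal (e * b * j s)"
      using near1 by eventually_elim (use main in blast)
    then show ?thesis using j1 r0 by blast
  qed
  \<comment> \<open>The upper bound for \<open>e = 1\<close> makes \<open>I s\<close> finite for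
    \<open>s\<close> close to 1, which permits the passage to real numbers.\<close>
  have Ifin: "\<forall>\<^sub>F s in at_left 1. I s = ennreal (enn2real (I s))"
  proof -
    obtain j r where "\<forall>\<^sub>F s in at_left 1. I s \<le> ennreal ((1 + 1) * a * j s + 1 * b * j s + r s) \<and>
         ennreal (a * j s) \<le> ennreal (1 + 1) * I s + ennreal (1 * b * j s)"
      using key[of 1] by auto
    then show ?thesis
      by eventually_elim (auto dest: le_less_trans[OF _ ennreal_less_top])
  qed
  have "((\<lambda>s. enn2real (I s)) \<longlongrightarrow> a) (at_left 1)"
  proof (rule tendsto_from_approx_bounds[where b=b])
    fix e :: real assume e: "0 < e"
    obtain j r where jr: "(j \<longlongrightarrow> 1) (at_left 1)" "(r \<longlongrightarrow> 0) (at_left 1)"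
      and ev: "\<forall>\<^sub>F s in at_left 1. I s \<le> ennreal ((1 + e) * a * j s + e * b * j s + r s) \<and>
         ennreal (a * j s) \<le> ennreal (1 + e) * I s + ennreal (e * b * j s)"
      using key[OF e] by blast
    define r' where "r' s = \<bar>r s\<bar>" for s
    have r': "(r' \<longlongrightarrow> 0) (at_left 1)" unfolding r'_def using tendsto_rabs_zero[OF jr(2)] .
    have jpos: "\<forall>\<^sub>F s in at_left 1. 0 < j s" using jr(1) by (rule order_tendstoD) simp
    have "\<forall>\<^sub>F s in at_left 1. enn2real (I s) \<le> (1 + e) * a * j s + e * b * j s + r' s \<and> a * j s \<le> (1 + e) * enn2real (I s) + e * b * j s"
      using ev Ifin jpos
    proof eventually_elim
      case (elim s)
      have nn: "0 \<le> (1 + e) * a * j s + e * b * j s" "0 \<le> e * b * j s"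
        using e ab elim(3) by (auto intro!: add_nonneg_nonneg mult_nonneg_nonneg)
      have "I s \<le> ennreal ((1 + e) * a * j s + e * b * j s + r' s)"
        by (rule order_trans[OF conjunct1[OF elim(1)] ennreal_leI]) (simp add: r'_def)
      then have 1: "enn2real (I s) \<le> (1 + e) * a * j s + e * b * j s + r' s"
        using nn(1) by (intro enn2real_leI) (auto simp: r'_def)
      have "ennreal (a * j s) \<le> ennreal (1 + e) * ennreal (enn2real (I s)) + ennreal (e * b * j s)"
        using elim(1,2) by simp
      also have "\<dots> = ennreal ((1 + e) * enn2real (I s) + e * b * j s)"
        using e nn(2) by (simp add: ennreal_plus ennreal_mult)
      finally have "a * j s \<le> (1 + e) * enn2real (I s) + e * b * j s"
        using e nn(2) by (subst (asm) ennreal_le_iff) (auto intro!: add_nonneg_nonneg mult_nonneg_nonneg)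
      with 1 show ?case by blast
    qed
    then show "\<exists>j r. (j \<longlongrightarrow> 1) (at_left 1) \<and> (r \<longlongrightarrow> 0) (at_left 1) \<and>
      (\<forall>\<^sub>F s in at_left 1. enn2real (I s) \<le> (1 + e) * a * j s + e * b * j s + r s \<and> a * j s \<le> (1 + e) * enn2real (I s) + e * b * j s)"
      using jr(1) r' by blast
  qed simp
  then have "((\<lambda>s. ennreal (enn2real (I s))) \<longlongrightarrow> ennreal a) (at_left 1)" by (rule tendsto_ennrealI)
  then have "(I \<longlongrightarrow> ennreal a) (at_left 1)"
    by (rule Lim_transform_eventually) (use Ifin in \<open>auto elim: eventually_mono\<close>)
  moreover have "ennreal a = ennreal (?w / 2) * T" unfolding a_def t(1) using w t(2) by (intro ennreal_mult) auto
  ultimately show ?thesis by (simp add: I_def[abs_def])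
qed

end

section \<open>Borel representatives\<close>

lemma lebesgue_measurable_ex_borel:
  fixes f :: "'a::euclidean_space \<Rightarrow> 'b::euclidean_space"
  assumes f: "f \<in> borel_measurable lebesgue"
  obtains f' where "f' \<in> borel_measurable borel" "AE x in lborel. f x = f' x"
proof -
  have "\<exists>c. c \<in> borel_measurable lborel \<and> (AE x in lborel. f x \<bullet> b = c x)" for b
    using completion_ex_borel_measurable_real[of "\<lambda>x. f x \<bullet> b" lborel] f by auto
  then obtain c where c: "\<And>b. c b \<in> borel_measurable lborel" "\<And>b. AE x in lborel. f x \<bullet> b = c b x"
    by metis
  have [measurable]: "c b \<in> borel_measurable borel" for b using c(1)[of b] by simp
  have "AE x in lborel. \<forall>b\<in>Basis. f x \<bullet> b = c b x"
    using c(2) by (intro AE_finite_allI) auto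
  then have "AE x in lborel. f x = (\<Sum>b\<in>Basis. c b x *\<^sub>R b)"
  proof eventually_elim
    case (elim x)
    have "f x = (\<Sum>b\<in>Basis. (f x \<bullet> b) *\<^sub>R b)" by (rule euclidean_representation[symmetric])
    also have "\<dots> = (\<Sum>b\<in>Basis. c b x *\<^sub>R b)" using elim by (intro sum.cong) auto
    finally show ?case .
  qed
  moreover have "(\<lambda>x. \<Sum>b\<in>Basis. c b x *\<^sub>R b) \<in> borel_measurable borel" by measurable
  ultimately show thesis by (intro that)
qed

lemma lebesgue_on_measurable_ex_borel:
  fixes f :: "'a::euclidean_space \<Rightarrow> 'b::euclidean_space"
  assumes f: "f \<in> borel_measurable (lebesgue_on S)" and S [measurable]: "S \<in> sets borel"
  obtains f' where "f' \<in> borel_measurable borel" "AE x in lborel. x \<in> S \<longrightarrow> f x = f' x" "\<And>x. x \<notin> S \<Longrightarrow> f' x = 0"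
proof -
  have "(\<lambda>x. indicator S x *\<^sub>R f x) \<in> borel_measurable lebesgue"
    using f by (subst borel_measurable_restrict_space_iff[symmetric]) auto
  then obtain f1 where f1 [measurable]: "f1 \<in> borel_measurable borel" "AE x in lborel. indicator S x *\<^sub>R f x = f1 x"
    by (rule lebesgue_measurable_ex_borel)
  show thesis
  proof (rule that)
    show "(\<lambda>x. indicator S x *\<^sub>R f1 x) \<in> borel_measurable borel" by measurable
    show "AE x in lborel. x \<in> S \<longrightarrow> f x = indicator S x *\<^sub>R f1 x"
      using f1(2) by eventually_elim (auto simp: indicator_def)
  qed auto
qed

text \<open>An open set is a countable union of closed boxes. These are compact, so \<open>f\<close>
  is integrable, hence measurable, on each of them.\<close>

lemma locally_integrable_measurable:
  fixes f :: "'a::euclidean_space \<Rightarrow> 'b::euclidean_space"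
  assumes S: "open S" and f: "locally_integrable S f"
  shows "f \<in> borel_measurable (lebesgue_on S)"
proof -
  obtain \<D> where D: "countable \<D>" "\<D> \<subseteq> Pow S" "\<And>X. X \<in> \<D> \<Longrightarrow> \<exists>a b. X = cbox a b" "\<Union>\<D> = S"
    using open_countable_Union_open_cbox[OF S] by blast
  show ?thesis
  proof (rule measurable_piecewise_restrict[OF D(1)])
    show "space (lebesgue_on S) \<subseteq> \<Union>\<D>" using D(4) by simp
    fix X assume X: "X \<in> \<D>"
    then obtain a b where ab: "X = cbox a b" using D(3) by blast
    have sub: "X \<subseteq> S" using X D(2) by blast
    have "X \<in> sets lebesgue" "S \<in> sets lebesgue" using S by (auto simp: ab)
    then show "X \<inter> space (lebesgue_on S) \<in> sets (lebesgue_on S)"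
      using sub by (auto simp: sets_restrict_space intro!: image_eqI[of _ _ X])
    have "restrict_space (lebesgue_on S) X = lebesgue_on X"
      using \<open>X \<in> sets lebesgue\<close> \<open>S \<in> sets lebesgue\<close> sub
      by (subst restrict_restrict_space) (auto simp: Int_absorb1)
    moreover have "compact X" by (simp add: ab)
    then have "integrable (lebesgue_on X) f" using f sub unfolding locally_integrable_def by blast
    ultimately show "f \<in> borel_measurable (restrict_space (lebesgue_on S) X)" by simp
  qed
qed

lemma nn_integral_lebesgue_on_borel:
  assumes "S \<in> sets borel"
  shows "(\<integral>\<^sup>+x. f x \<partial>lebesgue_on S) = (\<integral>\<^sup>+x. indicator S x * f x \<partial>lborel)"
proof -
  have "(\<integral>\<^sup>+x. f x \<partial>lebesgue_on S) = (\<integral>\<^sup>+x. f x * indicator S x \<partial>lebesgue)"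
    by (rule nn_integral_restrict_space) (use assms in auto)
  then show ?thesis by (simp add: nn_integral_completion mult.commute)
qed

lemma integral_lebesgue_on_borel:
  fixes f :: "'a::euclidean_space \<Rightarrow> 'b::euclidean_space"
  assumes S: "S \<in> sets borel" and f: "f \<in> borel_measurable (lebesgue_on S)" and f': "f' \<in> borel_measurable borel"
    and ae: "AE x in lborel. x \<in> S \<longrightarrow> f x = f' x" and 0: "\<And>x. x \<notin> S \<Longrightarrow> f' x = 0"
  shows "(LINT x|lebesgue_on S. f x) = (\<integral>x. f' x \<partial>lborel)"
proof -
  have "(LINT x|lebesgue_on S. f x) = (\<integral>x. indicator S x *\<^sub>R f x \<partial>lebesgue)"
    by (rule integral_restrict_space) (use S in auto)
  also have "\<dots> = (\<integral>x. f' x \<partial>lebesgue)"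
  proof (rule integral_cong_AE)
    show "(\<lambda>x. indicator S x *\<^sub>R f x) \<in> borel_measurable lebesgue"
      using f S by (subst borel_measurable_restrict_space_iff[symmetric]) auto
    show "f' \<in> borel_measurable lebesgue" using f' by (intro measurable_completion) simp
    show "AE x in lebesgue. indicator S x *\<^sub>R f x = f' x"
      by (rule AE_completion) (use ae in eventually_elim, auto simp: indicator_def 0)
  qed
  also have "\<dots> = (\<integral>x. f' x \<partial>lborel)" by (rule integral_completion) (use f' in simp)
  finally show ?thesis .
qed

text \<open>Meant for the map from \<open>x\<close> to \<open>(x + y) / 2\<close>: for fixed
  \<open>y\<close>, almost every \<open>x\<close> has its midpoint with \<open>y\<close> outside a
  given null set.\<close>

lemma AE_lborel_affine:
  fixes t :: "'a::euclidean_space"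
  assumes "AE x in lborel. P x" "c \<noteq> 0"
  shows "AE x in lborel. P (t + c *\<^sub>R x)"
proof -
  let ?f = "\<lambda>x. t + c *\<^sub>R x" and ?k = "ennreal (\<bar>c\<bar> ^ DIM('a))"
  obtain N where N: "{x. \<not> P x} \<subseteq> N" "N \<in> null_sets lborel"
    using assms(1) unfolding eventually_ae_filter by auto
  have [measurable]: "N \<in> sets borel" using N(2) by auto
  have "emeasure lborel N = emeasure (density (distr lborel borel ?f) (\<lambda>_. ?k)) N"
    by (rule arg_cong[where f="\<lambda>m. emeasure m N", OF lborel_affine[OF assms(2), of t]])
  also have "\<dots> = ?k * emeasure lborel (?f -` N)"
    by (simp add: emeasure_density nn_integral_cmult emeasure_distr)
  finally have "emeasure lborel (?f -` N) = 0"
    using N(2) assms(2) by (auto simp: null_sets_def)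
  moreover have "?f -` N \<in> sets lborel"
    using measurable_sets[of ?f borel borel N] by simp
  ultimately have "?f -` N \<in> null_sets lborel" by (simp add: null_sets_def)
  then show ?thesis by (rule AE_I') (use N(1) in auto)
qed

text \<open>On \<open>\<Omega>\<close> the representative equals \<open>A\<close> everywhere, since
  uniform continuity does not survive changes on null sets. Elsewhere in \<open>K\<close> agreement
  almost everywhere suffices, and the values of norm above \<open>M\<close> are replaced by 0 to
  obtain a global bound.\<close>

lemma vector_field_borel_representative:
  fixes A :: "'a::euclidean_space \<Rightarrow> 'b::euclidean_space"
  assumes \<Omega>: "bounded \<Omega>" and A: "A \<in> borel_measurable lebesgue" "locally_bounded A" "continuous_on (closure \<Omega>) A"
    and K: "compact K" "closure \<Omega> \<subseteq> K"
  obtains A' M where "A' \<in> borel_measurable borel" "\<And>x. norm (A' x) \<le> M" "uniformly_continuous_on \<Omega> A'"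
    "\<And>x. x \<in> \<Omega> \<Longrightarrow> A' x = A x" "AE x in lborel. x \<in> K \<longrightarrow> A x = A' x"
proof -
  have "bounded (A ` K)" using A(2) K(1) by (simp add: locally_bounded_def)
  then obtain M0 where M0: "\<And>x. x \<in> K \<Longrightarrow> norm (A x) \<le> M0" by (auto simp: bounded_iff)
  define M where "M = max 0 M0"
  have M: "0 \<le> M" "\<And>x. x \<in> K \<Longrightarrow> norm (A x) \<le> M" using M0 by (auto simp: M_def le_max_iff_disj)
  obtain B where [measurable]: "B \<in> borel_measurable borel" and B: "AE x in lborel. A x = B x"
    using lebesgue_measurable_ex_borel[OF A(1)] by blast
  have [measurable]: "closure \<Omega> \<in> sets borel" by auto
  define A' where "A' x = (if x \<in> closure \<Omega> then A x else if norm (B x) \<le> M then B x else 0)" for x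
  have c: "(\<lambda>x. indicator (closure \<Omega>) x *\<^sub>R A x) \<in> borel_measurable borel"
    by (rule borel_measurable_continuous_on_indicator[OF _ A(3)]) auto
  have "A' = (\<lambda>x. if x \<in> closure \<Omega> then indicator (closure \<Omega>) x *\<^sub>R A x else if norm (B x) \<le> M then B x else 0)"
    by (auto simp: A'_def fun_eq_iff)
  also have "\<dots> \<in> borel_measurable borel" using c by measurable
  finally have m: "A' \<in> borel_measurable borel" .
  have "uniformly_continuous_on (closure \<Omega>) A"
    using A(3) \<Omega> by (intro compact_uniformly_continuous) auto
  then have "uniformly_continuous_on \<Omega> A"
    unfolding uniformly_continuous_on_def using closure_subset by (meson subset_iff)
  moreover have eq: "A' x = A x" if "x \<in> \<Omega>" for x using that closure_subset by (auto simp: A'_def)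
  ultimately have unif: "uniformly_continuous_on \<Omega> A'" by (simp add: uniformly_continuous_on_def)
  have bd: "norm (A' x) \<le> M" for x using M K(2) by (auto simp: A'_def)
  have "AE x in lborel. x \<in> K \<longrightarrow> A x = A' x"
    using B
  proof eventually_elim
    case (elim x)
    then show ?case using M(2)[of x] by (auto simp: A'_def)
  qed
  with m bd unif eq show thesis by (rule that)
qed

context magnetic_data
begin

text \<open>The substitution \<open>x = y + h\<close> takes the midpoint to
  \<open>y + (1/2) *\<^sub>R h\<close>. Since \<open>\<Omega>\<close> may fail to be convex,
  midpoints can leave it; hence the convex set \<open>K\<close> on which \<open>A\<close> and
  \<open>B\<close> are compared.\<close>

lemma integral_G_kernel_eq:
  assumes v: "AE x in lborel. x \<in> \<Omega> \<longrightarrow> v x = u x" and B: "AE x in lborel. x \<in> K \<longrightarrow> B x = A x"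
    and K: "convex K" "\<Omega> \<subseteq> K"
  shows "(\<integral>\<^sup>+y. (\<integral>\<^sup>+x. ennreal
      ((norm (v x - exp (\<i> * complex_of_real ((x - y) \<bullet> B ((1/2) *\<^sub>R (x + y)))) * v y))\<^sup>2
        / norm (x - y) powr (real CARD('n) + 2 * s)) \<partial>lebesgue_on \<Omega>) \<partial>lebesgue_on \<Omega>)
    = (\<integral>\<^sup>+h. G h * kernel s h \<partial>lborel)"
proof -
  let ?F = "\<lambda>v B x y. ennreal
      ((norm (v x - exp (\<i> * complex_of_real ((x - y) \<bullet> B ((1/2) *\<^sub>R (x + y)))) * v y))\<^sup>2
        / norm (x - y) powr (real CARD('n) + 2 * s))"
  let ?H = "\<lambda>h y. indicator (\<Omega> \<inter> {y. y + h \<in> \<Omega>}) y * ennreal ((norm (D h y))\<^sup>2) * kernel s h"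
  have "(\<integral>\<^sup>+y. (\<integral>\<^sup>+x. ?F v B x y \<partial>lebesgue_on \<Omega>) \<partial>lebesgue_on \<Omega>)
    = (\<integral>\<^sup>+y. indicator \<Omega> y * (\<integral>\<^sup>+x. indicator \<Omega> x * ?F v B x y \<partial>lborel) \<partial>lborel)"
    by (simp only: nn_integral_lebesgue_on_borel[OF \<Omega>_borel])
  also have "\<dots> = (\<integral>\<^sup>+y. indicator \<Omega> y * (\<integral>\<^sup>+x. indicator \<Omega> x * ?F u A x y \<partial>lborel) \<partial>lborel)"
  proof (rule nn_integral_cong_AE, use v in eventually_elim)
    case (elim y)
    show ?case
    proof (cases "y \<in> \<Omega>")
      case True
      have "AE x in lborel. (1/2) *\<^sub>R (x + y) \<in> K \<longrightarrow> B ((1/2) *\<^sub>R (x + y)) = A ((1/2) *\<^sub>R (x + y))"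
        using AE_lborel_affine[OF B, of "1/2" "(1/2) *\<^sub>R y"] by (simp add: scaleR_add_right add.commute)
      with v have "AE x in lborel. indicator \<Omega> x * ?F v B x y = indicator \<Omega> x * ?F u A x y"
      proof eventually_elim
        case (elim x)
        have "(1/2) *\<^sub>R (x + y) \<in> K" if "x \<in> \<Omega>"
          using convexD[OF K(1), of x y "1/2" "1/2"] that True K(2) by (auto simp: scaleR_add_right)
        then show ?case using elim \<open>y \<in> \<Omega> \<longrightarrow> v y = u y\<close> True by (cases "x \<in> \<Omega>") simp_all
      qed
      then show ?thesis by (intro arg_cong[where f="\<lambda>t. indicator \<Omega> y * t"] nn_integral_cong_AE)
    qed simp
  qed
  also have "\<dots> = (\<integral>\<^sup>+y. (\<integral>\<^sup>+h. ?H h y \<partial>lborel) \<partial>lborel)"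
  proof (rule nn_integral_cong)
    fix y
    have "indicator \<Omega> y * (\<integral>\<^sup>+x. indicator \<Omega> x * ?F u A x y \<partial>lborel) = (\<integral>\<^sup>+x. indicator \<Omega> y * (indicator \<Omega> x * ?F u A x y) \<partial>lborel)"
      by (rule nn_integral_cmult[symmetric]) measurable
    also have "\<dots> = (\<integral>\<^sup>+h. indicator \<Omega> y * (indicator \<Omega> (h + y) * ?F u A (h + y) y) \<partial>lborel)"
      by (rule nn_integral_translate[symmetric]) measurable
    also have "\<dots> = (\<integral>\<^sup>+h. ?H h y \<partial>lborel)"
    proof (rule nn_integral_cong)
      fix h
      have mid: "(1/2) *\<^sub>R (h + y + y) = y + (1/2) *\<^sub>R h" by (simp add: vec_eq_iff field_simps)
      have "?F u A (h + y) y = ennreal ((norm (D h y))\<^sup>2 * (1 / norm h powr (real CARD('n) + 2 * s)))"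
        unfolding D_def mid by (simp add: add.commute)
      also have "\<dots> = ennreal ((norm (D h y))\<^sup>2) * kernel s h"
        unfolding kernel_def by (rule ennreal_mult) auto
      finally show "indicator \<Omega> y * (indicator \<Omega> (h + y) * ?F u A (h + y) y) = ?H h y"
        by (simp add: indicator_def add.commute)
    qed
    finally show "indicator \<Omega> y * (\<integral>\<^sup>+x. indicator \<Omega> x * ?F u A x y \<partial>lborel) = (\<integral>\<^sup>+h. ?H h y \<partial>lborel)" .
  qed
  also have "\<dots> = (\<integral>\<^sup>+h. (\<integral>\<^sup>+y. ?H h y \<partial>lborel) \<partial>lborel)"
  proof (rule lborel_pair.Fubini')
    have "(\<lambda>x. kernel s (fst x)) \<in> borel_measurable ((lborel :: (real^'n) measure) \<Otimes>\<^sub>M lborel)" by measurable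
    from borel_measurable_times_ennreal[OF pair_borel(1) this]
    show "(\<lambda>(h, y). ?H h y) \<in> borel_measurable (lborel \<Otimes>\<^sub>M lborel)" by (simp add: case_prod_beta')
  qed
  also have "\<dots> = (\<integral>\<^sup>+h. G h * kernel s h \<partial>lborel)"
    unfolding G_def by (rule nn_integral_cong, rule nn_integral_multc) measurable
  finally show ?thesis .
qed

end

lemma weak_gradient_on_bumps_if_has_weak_gradient:
  fixes \<Omega> :: "(real^'n::finite) set"
  assumes \<Omega>: "open \<Omega>" and w: "has_weak_gradient \<Omega> v w"
    and u [measurable]: "u \<in> borel_measurable borel" and g [measurable]: "g \<in> borel_measurable borel"
    and uv: "AE x in lborel. x \<in> \<Omega> \<longrightarrow> v x = u x" and gw: "AE x in lborel. x \<in> \<Omega> \<longrightarrow> w x = g x"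
    and u0: "\<And>x. x \<notin> \<Omega> \<Longrightarrow> u x = 0" and g0: "\<And>x. x \<notin> \<Omega> \<Longrightarrow> g x = 0"
  shows "weak_gradient_on_bumps \<Omega> u g"
  unfolding weak_gradient_on_bumps_def
proof (intro allI impI)
  fix a b \<phi> j assume ab: "cbox a b \<subseteq> \<Omega>" and \<phi>: "\<phi> \<in> bump_fun a b"
  have vm: "v \<in> borel_measurable (lebesgue_on \<Omega>)" and wm: "w \<in> borel_measurable (lebesgue_on \<Omega>)"
    using w locally_integrable_measurable[OF \<Omega>] by (auto simp: has_weak_gradient_def)
  have S: "\<Omega> \<in> sets borel" using \<Omega> by auto
  have \<phi>m [measurable]: "\<phi> \<in> borel_measurable borel" "partial_deriv j \<phi> \<in> borel_measurable borel"
    using bump_fun_continuous \<phi> bump_fun_derivative(2)[OF \<phi>] by (auto intro!: borel_measurable_continuous_onI)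
  have \<phi>l: "\<phi> \<in> borel_measurable (lebesgue_on \<Omega>)" "partial_deriv j \<phi> \<in> borel_measurable (lebesgue_on \<Omega>)"
    using \<phi>m by (auto intro!: measurable_restrict_space1 measurable_completion)
  have wj: "(\<lambda>x. w x $ j) \<in> borel_measurable (lebesgue_on \<Omega>)"
    by (rule measurable_compose[OF wm]) (simp add: borel_measurable_continuous_onI continuous_on_component)
  have gj [measurable]: "(\<lambda>x. g x $ j) \<in> borel_measurable borel"
    by (rule measurable_compose[OF g]) (simp add: borel_measurable_continuous_onI continuous_on_component)
  have 1: "(LINT x|lebesgue_on \<Omega>. partial_deriv j \<phi> x *\<^sub>R v x) = (\<integral>x. partial_deriv j \<phi> x *\<^sub>R u x \<partial>lborel)"
  proof (rule integral_lebesgue_on_borel[OF S])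
    show "AE x in lborel. x \<in> \<Omega> \<longrightarrow> partial_deriv j \<phi> x *\<^sub>R v x = partial_deriv j \<phi> x *\<^sub>R u x"
      using uv by eventually_elim simp
  qed (auto intro!: borel_measurable_scaleR \<phi>l vm simp: u0)
  have 2: "(LINT x|lebesgue_on \<Omega>. \<phi> x *\<^sub>R (w x $ j)) = (\<integral>x. \<phi> x *\<^sub>R (g x $ j) \<partial>lborel)"
  proof (rule integral_lebesgue_on_borel[OF S])
    show "AE x in lborel. x \<in> \<Omega> \<longrightarrow> \<phi> x *\<^sub>R (w x $ j) = \<phi> x *\<^sub>R (g x $ j)"
      using gw by eventually_elim simp
  qed (auto intro!: borel_measurable_scaleR \<phi>l wj simp: g0)
  show "(\<integral>x. partial_deriv j \<phi> x *\<^sub>R u x \<partial>lborel) = - (\<integral>x. \<phi> x *\<^sub>R (g x $ j) \<partial>lborel)"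
    using w bump_fun_test_function[OF \<phi> ab] 1 2 by (simp add: has_weak_gradient_def)
qed

theorem theorem1p1:
  fixes \<Omega> :: "(real^'n::finite) set"
    and A :: "real^'n \<Rightarrow> real^'n"
    and u :: "real^'n \<Rightarrow> complex"
    and e :: "real^'n"
  assumes "open \<Omega>" and "bounded \<Omega>" and "lipschitz_boundary \<Omega>"
    and "A \<in> borel_measurable lebesgue" and "locally_bounded A" and "C2_closure \<Omega> A"
    and "u \<in> H1A \<Omega> A"
    and "norm e = 1"
  shows
    "((\<lambda>s::real. ennreal (1 - s) *
        (\<integral>\<^sup>+y. (\<integral>\<^sup>+x. ennreal
            ((norm (u x - exp (\<i> * complex_of_real ((x - y) \<bullet> A ((1/2) *\<^sub>R (x + y)))) * u y))\<^sup>2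
              / norm (x - y) powr (real CARD('n) + 2 * s))
          \<partial>lebesgue_on \<Omega>) \<partial>lebesgue_on \<Omega>))
      \<longlongrightarrow>
      ((1/2) * (\<integral>\<^sup>+\<omega>\<in>sphere 0 1. ennreal (\<bar>\<omega> \<bullet> e\<bar>\<^sup>2) \<partial>hausdorff_measure (CARD('n) - 1)))
        * (\<integral>\<^sup>+x. ennreal ((norm (magnetic_gradient \<Omega> A u x))\<^sup>2) \<partial>lebesgue_on \<Omega>))
     (at_left 1)"
proof -
  have S [measurable]: "\<Omega> \<in> sets borel" using assms(1) by auto
  have um: "u \<in> borel_measurable (lebesgue_on \<Omega>)" and ui: "integrable (lebesgue_on \<Omega>) (\<lambda>x. (norm (u x))\<^sup>2)"
    and ex: "\<exists>w. has_weak_gradient \<Omega> u w"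
    and fin: "(\<integral>\<^sup>+x. ennreal ((norm (magnetic_gradient \<Omega> A u x))\<^sup>2) \<partial>lebesgue_on \<Omega>) < \<infinity>"
    using assms(7) unfolding H1A_def by auto
  \<comment> \<open>\<open>weak_gradient\<close> is a choice; the existence of some weak gradient
    makes the chosen one valid.\<close>
  have w: "has_weak_gradient \<Omega> u (weak_gradient \<Omega> u)"
    unfolding weak_gradient_def using ex by (rule someI_ex)
  then have wm: "weak_gradient \<Omega> u \<in> borel_measurable (lebesgue_on \<Omega>)"
    by (intro locally_integrable_measurable[OF assms(1)]) (simp add: has_weak_gradient_def)
  have "bounded (closure \<Omega>)" using assms(2) by (rule bounded_closure)
  then obtain r where "\<And>x. x \<in> closure \<Omega> \<Longrightarrow> norm x \<le> r" unfolding bounded_iff by metis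
  \<comment> \<open>A closed ball is convex and so contains all midpoints of pairs of points of
    \<open>\<Omega>\<close>.\<close>
  then have r: "closure \<Omega> \<subseteq> cball 0 r" by auto
  have cA: "continuous_on (closure \<Omega>) A" using assms(6) by (simp add: C2_closure_def)
  obtain A' M where A': "A' \<in> borel_measurable borel" "\<And>x. norm (A' x) \<le> M" "uniformly_continuous_on \<Omega> A'"
    "\<And>x. x \<in> \<Omega> \<Longrightarrow> A' x = A x" "AE x in lborel. x \<in> cball 0 r \<longrightarrow> A x = A' x"
  proof (rule vector_field_borel_representative[OF assms(2,4,5) cA compact_cball r])
    fix A' M assume "A' \<in> borel_measurable borel" "\<And>x. norm (A' x) \<le> M" "uniformly_continuous_on \<Omega> A'"
      "\<And>x. x \<in> \<Omega> \<Longrightarrow> A' x = A x" "AE x in lborel. x \<in> cball 0 r \<longrightarrow> A x = A' x"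
    then show thesis by (rule that)
  qed
  obtain u' where u' [measurable]: "u' \<in> borel_measurable borel" and uu': "AE x in lborel. x \<in> \<Omega> \<longrightarrow> u x = u' x"
    and u0: "\<And>x. x \<notin> \<Omega> \<Longrightarrow> u' x = 0"
  proof (rule lebesgue_on_measurable_ex_borel[OF um S])
    fix f assume "f \<in> borel_measurable borel" "AE x in lborel. x \<in> \<Omega> \<longrightarrow> u x = f x" "\<And>x. x \<notin> \<Omega> \<Longrightarrow> f x = 0"
    then show thesis by (rule that)
  qed
  obtain g' where g' [measurable]: "g' \<in> borel_measurable borel" and wg': "AE x in lborel. x \<in> \<Omega> \<longrightarrow> weak_gradient \<Omega> u x = g' x"
    and g0: "\<And>x. x \<notin> \<Omega> \<Longrightarrow> g' x = 0"
  proof (rule lebesgue_on_measurable_ex_borel[OF wm S])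
    fix f assume "f \<in> borel_measurable borel" "AE x in lborel. x \<in> \<Omega> \<longrightarrow> weak_gradient \<Omega> u x = f x" "\<And>x. x \<notin> \<Omega> \<Longrightarrow> f x = 0"
    then show thesis by (rule that)
  qed
  define m' where "m' x = g' x - (\<chi> j. \<i> * complex_of_real (A' x $ j) * u' x)" for x
  have T: "(\<integral>\<^sup>+x. ennreal ((norm (magnetic_gradient \<Omega> A u x))\<^sup>2) \<partial>lebesgue_on \<Omega>) = (\<integral>\<^sup>+x. ennreal ((norm (m' x))\<^sup>2) \<partial>lborel)"
    unfolding nn_integral_lebesgue_on_borel[OF S]
  proof (rule nn_integral_cong_AE, use uu' wg' in eventually_elim)
    case (elim x)
    have "m' x = 0" if "x \<notin> \<Omega>" using that by (simp add: m'_def u0 g0 vec_eq_iff)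
    then show ?case using elim A'(4)[of x] by (cases "x \<in> \<Omega>") (simp_all add: m'_def magnetic_gradient_def)
  qed
  have "(\<integral>\<^sup>+x. ennreal ((norm (u x))\<^sup>2) \<partial>lebesgue_on \<Omega>) = (\<integral>\<^sup>+x. ennreal ((norm (u' x))\<^sup>2) \<partial>lborel)"
    unfolding nn_integral_lebesgue_on_borel[OF S]
  proof (rule nn_integral_cong_AE, use uu' in eventually_elim)
    case (elim x)
    then show ?case using u0[of x] by (cases "x \<in> \<Omega>") simp_all
  qed
  then have u'fin: "(\<integral>\<^sup>+x. ennreal ((norm (u' x))\<^sup>2) \<partial>lborel) < \<infinity>"
    using ui by (simp add: integrable_iff_bounded)
  then have u'2: "integrable lborel (\<lambda>x. (norm (u' x))\<^sup>2)"
    by (intro integrableI_bounded) auto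
  \<comment> \<open>Finiteness is given for the magnetic energy. The plain gradient differs from the
    magnetic one by a term bounded by \<open>M * norm (u' x)\<close>, so it is square integrable as
    well.\<close>
  have g'2: "integrable lborel (\<lambda>x. (norm (g' x))\<^sup>2)"
  proof (intro integrableI_bounded)
    have mm [measurable]: "m' \<in> borel_measurable borel"
      unfolding m'_def[abs_def] by (intro borel_measurable_diff g' borel_measurable_vec_phase A'(1) u')
    have "(\<integral>\<^sup>+x. ennreal (norm ((norm (g' x))\<^sup>2)) \<partial>lborel)
      \<le> (\<integral>\<^sup>+x. 2 * ennreal ((norm (m' x))\<^sup>2) + ennreal (2 * M\<^sup>2) * ennreal ((norm (u' x))\<^sup>2) \<partial>lborel)"
    proof (rule nn_integral_mono)
      fix x
      have "norm (A' x) * norm (u' x) \<le> M * norm (u' x)" by (intro mult_right_mono A'(2)) simp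
      moreover have "norm (g' x) \<le> norm (m' x) + norm (A' x) * norm (u' x)"
        using norm_triangle_ineq[of "m' x" "\<chi> j. \<i> * complex_of_real (A' x $ j) * u' x"]
        by (simp add: m'_def norm_vec_phase)
      ultimately have "norm (g' x) \<le> norm (m' x) + M * norm (u' x)" by linarith
      then have "(norm (g' x))\<^sup>2 \<le> (norm (m' x) + M * norm (u' x))\<^sup>2" by (intro power_mono) auto
      also have "\<dots> \<le> 2 * (norm (m' x))\<^sup>2 + 2 * M\<^sup>2 * (norm (u' x))\<^sup>2"
        using zero_le_power2[of "norm (m' x) - M * norm (u' x)"] by (simp add: power2_eq_square algebra_simps)
      finally have "ennreal ((norm (g' x))\<^sup>2) \<le> ennreal (2 * (norm (m' x))\<^sup>2 + 2 * M\<^sup>2 * (norm (u' x))\<^sup>2)" by (rule ennreal_leI)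
      also have "\<dots> = 2 * ennreal ((norm (m' x))\<^sup>2) + ennreal (2 * M\<^sup>2) * ennreal ((norm (u' x))\<^sup>2)"
        by (subst ennreal_plus) (simp_all add: ennreal_mult')
      finally show "ennreal (norm ((norm (g' x))\<^sup>2)) \<le> 2 * ennreal ((norm (m' x))\<^sup>2) + ennreal (2 * M\<^sup>2) * ennreal ((norm (u' x))\<^sup>2)"
        by simp
    qed
    also have "\<dots> = 2 * (\<integral>\<^sup>+x. ennreal ((norm (m' x))\<^sup>2) \<partial>lborel) + ennreal (2 * M\<^sup>2) * (\<integral>\<^sup>+x. ennreal ((norm (u' x))\<^sup>2) \<partial>lborel)"
      by (subst nn_integral_add, measurable) (simp add: nn_integral_cmult)
    also have "\<dots> < \<infinity>"
      using fin u'fin unfolding T by (simp add: ennreal_mult_less_top ennreal_add_less_top)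
    finally show "(\<integral>\<^sup>+x. ennreal (norm ((norm (g' x))\<^sup>2)) \<partial>lborel) < \<infinity>" .
  qed measurable
  interpret magnetic_data \<Omega> u' g' A' M
  proof
    show "weak_gradient_on_bumps \<Omega> u' g'"
      by (rule weak_gradient_on_bumps_if_has_weak_gradient[OF assms(1) w u' g' uu' wg' u0 g0])
  qed (use assms A' u' g' u0 g0 u'2 g'2 in auto)
  have "T = (\<integral>\<^sup>+x. ennreal ((norm (magnetic_gradient \<Omega> A u x))\<^sup>2) \<partial>lebesgue_on \<Omega>)"
    unfolding T T_def m_def m'_def ..
  moreover have "(1/2) * (\<integral>\<^sup>+\<omega>\<in>sphere 0 1. ennreal (\<bar>\<omega> \<bullet> e\<bar>\<^sup>2) \<partial>hausdorff_measure (CARD('n) - 1)) = ennreal (unit_ball_vol (real CARD('n)) / 2)"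
  proof -
    have "(1/2 :: ennreal) = ennreal (1/2)" using divide_ennreal[of 1 2] by simp
    then show ?thesis
      unfolding nn_integral_sphere_inner_sq[OF assms(8)] by (simp only: ennreal_mult'[symmetric]) simp
  qed
  moreover have "(\<integral>\<^sup>+y. (\<integral>\<^sup>+x. ennreal
      ((norm (u x - exp (\<i> * complex_of_real ((x - y) \<bullet> A ((1/2) *\<^sub>R (x + y)))) * u y))\<^sup>2
        / norm (x - y) powr (real CARD('n) + 2 * s)) \<partial>lebesgue_on \<Omega>) \<partial>lebesgue_on \<Omega>)
    = (\<integral>\<^sup>+h. G h * kernel s h \<partial>lborel)" for s
    by (rule integral_G_kernel_eq[OF uu' A'(5) convex_cball order_trans[OF closure_subset r]])
  ultimately show ?thesis using localized_limit by simp
qed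

end
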